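(* Let $i\ge0$ and $k\ge1$ be integers. Then for all $c\ge0$, $$\mathrm H_k\big((\mathrm Ni\mathrm{EXP})^{\Sigma^p_c}\big)\cup \text{co-}\mathrm H_k\big((\mathrm Ni\mathrm{EXP})^{\Sigma^p_c}\big)\subseteq (i\mathrm{EXP})^{\Sigma^p_{c+1}[k]}_{\|}\subseteq \mathrm H_{k+1}\big((\mathrm Ni\mathrm{EXP})^{\Sigma^p_c}\big)\cap \text{co-}\mathrm H_{k+1}\big((\mathrm Ni\mathrm{EXP})^{\Sigma^p_c}\big).$$
   Context: $\Sigma=\{0,1\}$. $\exp_0(x)=x$, $\exp_i(x)=2^{\exp_{i-1}(x)}$ for $i>0$. For $i\ge0$, $i\mathrm{EXP}=\bigcup_{k\ge1}\mathrm{DTIME}(\exp_i(n^k))$ and $\mathrm{N}i\mathrm{EXP}=\bigcup_{k\ge1}\mathrm{NTIME}(\exp_i(n^k))$. $\Sigma^p_c$ is the $c$-th level of the polynomial hierarchy ($\Sigma^p_0=\mathrm P$, $\Sigma^p_{c+1}=\mathrm{NP}^{\Sigma^p_c}$). For complexity classes $\mathcal C,\mathcal D$, $\mathcal C^{\mathcal D}$ is the class of languages decided by oracle machines of the kind and resource bound of $\mathcal C$ with an oracle for some language in $\mathcal D$ (each query costs one step); $\mathcal C^{\mathcal D[k]}_{\|}$ restricts to a single round of at most $k$ parallel (nonadaptive) queries. A Hausdorff predicate is a relation $D\subseteq\Sigma^*\times\mathbb N$ with $D(w,z)\ge D(w,z+1)$ for all strings $w$ and all integers $z\ge1$. For a strictly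 positive nondecreasing computable $g:\mathbb N\to\mathbb N$ (in particular a positive constant), a language $L$ is $g(n)$-Hausdorff reducible to $D$ if for every string $w$: $w\in L$ iff $|\{z:1\le z\le g(|w|),\ D(w,z)=1\}|$ is odd. A Hausdorff predicate $D$ belongs to a complexity class $\mathcal C$ if the pairs $(w,z)$, with $z$ written in binary most significant bit first, can be decided by a machine of the kind defining $\mathcal C$ within the resource bound of $\mathcal C$ measured as a function of $|w|$ only. $\mathrm H_{g(n)}(\mathcal C)$ denotes the class of languages that are $g(n)$-Hausdorff reducible to some Hausdorff predicate in $\mathcal C$, and $\text{co-}\mathrm H_{g(n)}(\mathcal C)$ the class of complements of such languages. ($\mathrm H_k(\mathcal C)$ for constant $k$ is the $k$-th level of the Boolean hierarchy over $\mathcal C$.) *)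

theory Defs
  imports Main
begin

type_synonym lang = "bool list set"   (* languages over Sigma = {0,1}; False = 0, True = 1 *)

fun expi :: "nat \<Rightarrow> nat \<Rightarrow> nat" where
  "expi 0 x = x"
| "expi (Suc i) x = 2 ^ expi i x"

fun bin :: "nat \<Rightarrow> bool list" where
  "bin z = (if z < 2 then [z = 1] else bin (z div 2) @ [odd z])"

(* Tape symbols: 0 = blank, 1 = bit 0, 2 = bit 1, 3 = pair separator.
   The machine has one two-way infinite work tape and a write-only query
   buffer holding a list of query strings. *)

datatype qact = QNone | QWrite bool | QNext

record otm =
  delta :: "(nat \<times> nat \<times> nat \<times> nat \<times> int \<times> qact) set"
    (* (state, read symbol, new state, written symbol, head move, query action) *)
  start :: nat
  acc :: nat
  rej :: nat
  ask :: nat   (* query state: all buffered queries are answered in one step *)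
  ret :: nat   (* state entered after the oracle answers *)

type_synonym cfg = "nat \<times> (int \<Rightarrow> nat) \<times> int \<times> bool list list"

definition sym_of_bit :: "bool \<Rightarrow> nat" where
  "sym_of_bit b = (if b then 2 else 1)"

definition enc :: "bool list \<Rightarrow> nat list" where
  "enc w = map sym_of_bit w"

definition enc_pair :: "bool list \<Rightarrow> nat \<Rightarrow> nat list" where
  "enc_pair w z = enc w @ [3] @ enc (bin z)"

definition init_tape :: "nat list \<Rightarrow> int \<Rightarrow> nat" where
  "init_tape xs = (\<lambda>p. if 0 \<le> p \<and> p < int (length xs) then xs ! nat p else 0)"

definition init_cfg :: "otm \<Rightarrow> nat list \<Rightarrow> cfg" where
  "init_cfg M xs = (start M, init_tape xs, 0, [[]])"

fun qupd :: "qact \<Rightarrow> bool list list \<Rightarrow> bool list list" where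
  "qupd QNone qs = qs"
| "qupd (QWrite b) qs = butlast qs @ [last qs @ [b]]"
| "qupd QNext qs = qs @ [[]]"

definition write_answers :: "(int \<Rightarrow> nat) \<Rightarrow> int \<Rightarrow> bool list \<Rightarrow> int \<Rightarrow> nat" where
  "write_answers t h ans = (\<lambda>p. if h \<le> p \<and> p < h + int (length ans)
                                 then sym_of_bit (ans ! nat (p - h)) else t p)"

definition wf_otm :: "otm \<Rightarrow> bool" where
  "wf_otm M \<longleftrightarrow> finite (delta M) \<and> acc M \<noteq> rej M \<and> ask M \<noteq> acc M \<and> ask M \<noteq> rej M
     \<and> ret M \<noteq> ask M
     \<and> (\<forall>(q, a, q', b, d, x) \<in> delta M. d \<in> {-1, 0, 1} \<and> q \<noteq> acc M \<and> q \<noteq> rej M \<and> q \<noteq> ask M)"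

definition deterministic :: "otm \<Rightarrow> bool" where
  "deterministic M \<longleftrightarrow> (\<forall>tr1 \<in> delta M. \<forall>tr2 \<in> delta M.
      fst tr1 = fst tr2 \<and> fst (snd tr1) = fst (snd tr2) \<longrightarrow> tr1 = tr2)"

definition oracle_free :: "otm \<Rightarrow> bool" where
  "oracle_free M \<longleftrightarrow> start M \<noteq> ask M \<and> (\<forall>(q, a, q', b, d, x) \<in> delta M. q' \<noteq> ask M)"

definition step :: "otm \<Rightarrow> lang \<Rightarrow> cfg \<Rightarrow> cfg \<Rightarrow> bool" where
  "step M Or c c' \<longleftrightarrow> (case c of (q, t, h, qs) \<Rightarrow> case c' of (q', t', h', qs') \<Rightarrow>
      (q = ask M \<and> q' = ret M \<and> h' = h \<and> qs' = [[]]
         \<and> t' = write_answers t h (map (\<lambda>x. x \<in> Or) qs))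
    \<or> (q \<noteq> acc M \<and> q \<noteq> rej M \<and> q \<noteq> ask M \<and>
         (\<exists>b d a. (q, t h, q', b, d, a) \<in> delta M \<and> t' = t(h := b) \<and> h' = h + d
                  \<and> qs' = qupd a qs)))"

definition halts_within :: "otm \<Rightarrow> lang \<Rightarrow> nat \<Rightarrow> nat list \<Rightarrow> bool" where
  "halts_within M Or T xs \<longleftrightarrow> \<not> (\<exists>c. (step M Or ^^ Suc T) (init_cfg M xs) c)"

definition accepts :: "otm \<Rightarrow> lang \<Rightarrow> nat list \<Rightarrow> bool" where
  "accepts M Or xs \<longleftrightarrow> (\<exists>n c. (step M Or ^^ n) (init_cfg M xs) c \<and> fst c = acc M)"

definition one_round :: "otm \<Rightarrow> lang \<Rightarrow> nat \<Rightarrow> nat list \<Rightarrow> bool" where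
  "one_round M Or k xs \<longleftrightarrow>
     (\<forall>n c. (step M Or ^^ n) (init_cfg M xs) c \<and> fst c = ask M
        \<longrightarrow> length (snd (snd (snd c))) \<le> k
          \<and> (\<forall>m c'. m > 0 \<and> (step M Or ^^ m) c c' \<longrightarrow> fst c' \<noteq> ask M))"

definition decides_lang :: "otm \<Rightarrow> lang \<Rightarrow> (nat \<Rightarrow> nat) \<Rightarrow> lang \<Rightarrow> bool" where
  "decides_lang M Or T L \<longleftrightarrow>
     (\<forall>w. halts_within M Or (T (length w)) (enc w) \<and> (w \<in> L \<longleftrightarrow> accepts M Or (enc w)))"

definition decides_pred :: "otm \<Rightarrow> lang \<Rightarrow> (nat \<Rightarrow> nat) \<Rightarrow> (bool list \<Rightarrow> nat \<Rightarrow> bool) \<Rightarrow> bool" where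
  "decides_pred M Or T D \<longleftrightarrow>
     (\<forall>w z. halts_within M Or (T (length w)) (enc_pair w z)
            \<and> (D w z \<longleftrightarrow> accepts M Or (enc_pair w z)))"

primrec SigmaP :: "nat \<Rightarrow> lang set" where
  "SigmaP 0 = {L. \<exists>M kk a. kk \<ge> 1 \<and> wf_otm M \<and> deterministic M \<and> oracle_free M
                    \<and> decides_lang M {} (\<lambda>n. a * n ^ kk + a) L}"
| "SigmaP (Suc c) = {L. \<exists>Or \<in> SigmaP c. \<exists>M kk a. kk \<ge> 1 \<and> wf_otm M
                    \<and> decides_lang M Or (\<lambda>n. a * n ^ kk + a) L}"

definition ExpPar :: "nat \<Rightarrow> nat \<Rightarrow> nat \<Rightarrow> lang set" where
  "ExpPar i c k = {L. \<exists>Or \<in> SigmaP (Suc c). \<exists>M kk a. kk \<ge> 1 \<and> wf_otm M \<and> deterministic M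
        \<and> (\<forall>w. one_round M Or k (enc w))
        \<and> decides_lang M Or (\<lambda>n. a * expi i (n ^ kk) + a) L}"

definition NExpPredClass :: "nat \<Rightarrow> nat \<Rightarrow> (bool list \<Rightarrow> nat \<Rightarrow> bool) set" where
  "NExpPredClass i c = {D. \<exists>Or \<in> SigmaP c. \<exists>M kk a. kk \<ge> 1 \<and> wf_otm M
        \<and> decides_pred M Or (\<lambda>n. a * expi i (n ^ kk) + a) D}"

definition hausdorff_pred :: "(bool list \<Rightarrow> nat \<Rightarrow> bool) \<Rightarrow> bool" where
  "hausdorff_pred D \<longleftrightarrow> (\<forall>w z. z \<ge> 1 \<longrightarrow> D w (Suc z) \<longrightarrow> D w z)"

definition HausdorffH :: "(nat \<Rightarrow> nat) \<Rightarrow> (bool list \<Rightarrow> nat \<Rightarrow> bool) set \<Rightarrow> lang set" where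
  "HausdorffH g C = {L. \<exists>D \<in> C. hausdorff_pred D \<and>
        (\<forall>w. w \<in> L \<longleftrightarrow> odd (card {z. 1 \<le> z \<and> z \<le> g (length w) \<and> D w z}))}"

definition coHausdorffH :: "(nat \<Rightarrow> nat) \<Rightarrow> (bool list \<Rightarrow> nat \<Rightarrow> bool) set \<Rightarrow> lang set" where
  "coHausdorffH g C = {L. - L \<in> HausdorffH g C}"

end

theory Submission
  imports Defs
begin

text \<open>
  The answers to one round of queries form a vector \<open>Y\<close>, and a machine that uses them computes a fixed
  function \<open>f\<close> of that vector.  The longest chain \<open>S\<^sub>1 \<le> \<dots> \<le> S\<^sub>z \<le> Y\<close> along which \<open>f\<close> alternates, starting with
  \<open>f S\<^sub>1 = True\<close>, has odd length iff \<open>f Y\<close> holds, and \<open>z \<le> k + 1\<close>.  Its existence is a Hausdorff predicate: guess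
  the chain, verify \<open>S\<^sub>z \<le> Y\<close> by simulating the nondeterministic machine of the oracle on the positive
  queries, and evaluate \<open>f\<close> by simulation.  Conversely, \<open>D w z\<close> for \<open>z \<le> k\<close> becomes one query padded to the
  running time, so that the oracle machine runs in polynomial time.  In both directions simulations are
  cut off by a unary clock, since with wrong answers or short padding they need not halt.

  The machines are obtained from structured programs over finitely many stacks: the states of the
  compiled machine are the finitely many continuations of the program, and the stacks are tracks of its tape.
\<close>

text \<open>The proof is shaped by an asymmetry: a nondeterministic machine can certify a positive
  oracle answer but not a negative one. Hence only lower bounds on the answer vector are checked,
  and alternation along a chain recovers the value at the true vector from lower bounds alone. The
  function \<open>f\<close> can be evaluated at every vector because the deterministic machine fixes
  all its queries before it sees an answer, so guessed answers can be written on its tape. Negating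
  \<open>f\<close> treats the co-class at the same level. As \<open>k\<close> is a constant, chains
  and answer vectors are constants of the program, not data. The bounds fit because iterated
  exponentials of polynomials are closed under polynomials: a query can be as long as the time
  bound, and polynomial time in its length stays within the class. This is also why padding turns an
  iterated-exponential computation into a polynomial one. One more obstacle is that the time for a
  pair may depend on \<open>w\<close> only, although \<open>z\<close> can be arbitrarily long; the
  machine therefore gives up on long codes of \<open>z\<close> while loading its input.\<close>

subsection \<open>Runs of transition systems\<close>

text \<open>All runs reach \<open>P\<close> within \<open>n\<close> steps; reaching \<open>P\<close> counts even if the run could go on.\<close>

primrec af :: "('c \<Rightarrow> 'c \<Rightarrow> bool) \<Rightarrow> ('c \<Rightarrow> bool) \<Rightarrow> nat \<Rightarrow> 'c \<Rightarrow> bool" where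
  "af R P 0 c = P c"
| "af R P (Suc n) c = (P c \<or> ((\<exists>d. R c d) \<and> (\<forall>d. R c d \<longrightarrow> af R P n d)))"

abbreviation go :: "('c \<Rightarrow> 'c \<Rightarrow> bool) \<Rightarrow> nat \<Rightarrow> 'c \<Rightarrow> 'c \<Rightarrow> bool" where
  "go R n c d \<equiv> af R ((=) d) n c"

lemma af_now: "P c \<Longrightarrow> af R P n c"
  by (cases n) auto

lemma af_SucI: "R c d \<Longrightarrow> (\<And>e. R c e \<Longrightarrow> af R P n e) \<Longrightarrow> af R P (Suc n) c"
  by auto

lemma af_SucE: "af R P (Suc n) c \<Longrightarrow> \<not> P c \<Longrightarrow> \<exists>d. R c d \<and> (\<forall>e. R c e \<longrightarrow> af R P n e)"
  by simp

lemma af_mono: "af R P n c \<Longrightarrow> n \<le> m \<Longrightarrow> af R P m c"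
proof (induction n arbitrary: c m)
  case 0 then show ?case by (simp add: af_now)
next
  case (Suc n)
  obtain k where k: "m = Suc k" "n \<le> k" using Suc.prems(2) by (cases m) simp_all
  show ?case
  proof (cases "P c")
    case False
    obtain d where d: "R c d" "\<And>e. R c e \<Longrightarrow> af R P n e"
      using af_SucE[OF Suc.prems(1) False] by metis
    show ?thesis unfolding k(1)
    proof (rule af_SucI)
      show "R c d" by (rule d(1))
      show "af R P k e" if "R c e" for e by (rule Suc.IH[OF d(2)[OF that] k(2)])
    qed
  qed (rule af_now)
qed

lemma af_trans: "af R P n c \<Longrightarrow> (\<And>d. P d \<Longrightarrow> af R Q m d) \<Longrightarrow> af R Q (n + m) c"
proof (induction n arbitrary: c)
  case (Suc n)
  show ?case
  proof (cases "P c")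
    case True
    then have "af R Q m c" by (rule Suc.prems)
    then show ?thesis by (rule af_mono) simp
  next
    case False
    obtain d where d: "R c d" "\<And>e. R c e \<Longrightarrow> af R P n e"
      using af_SucE[OF Suc.prems(1) False] by metis
    have "af R Q (Suc (n + m)) c"
    proof (rule af_SucI)
      show "R c d" by (rule d(1))
      show "af R Q (n + m) e" if "R c e" for e
        by (rule Suc.IH[OF d(2)[OF that]]) (rule Suc.prems(2))
    qed
    then show ?thesis by simp
  qed
qed simp

lemma af_weaken: "af R P n c \<Longrightarrow> (\<And>d. P d \<Longrightarrow> Q d) \<Longrightarrow> af R Q n c"
  using af_trans[of R P n c Q 0] by simp

lemma go_af: "go R n c d \<Longrightarrow> af R P m d \<Longrightarrow> af R P (n + m) c"
  by (erule af_trans) (erule subst)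

lemma go_step: "R c d \<Longrightarrow> (\<And>e. R c e \<Longrightarrow> e = d) \<Longrightarrow> af R P n d \<Longrightarrow> af R P (Suc n) c"
  by (rule af_SucI) blast+

lemma af_reach: "af R P n c \<Longrightarrow> \<exists>d. R\<^sup>*\<^sup>* c d \<and> P d"
proof (induction n arbitrary: c)
  case (Suc n)
  show ?case
  proof (cases "P c")
    case False
    obtain d where d: "R c d" "\<And>e. R c e \<Longrightarrow> af R P n e"
      using af_SucE[OF Suc.prems False] by metis
    then show ?thesis using Suc.IH[of d] by (meson converse_rtranclp_into_rtranclp)
  qed (meson rtranclp.rtrancl_refl)
qed (simp, meson rtranclp.rtrancl_refl)

lemma rtranclp_cases_first: "R\<^sup>*\<^sup>* c d \<Longrightarrow> c = d \<or> (\<exists>e. R c e \<and> R\<^sup>*\<^sup>* e d)"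
  by (erule converse_rtranclpE) auto

text \<open>A run has nowhere else to stop: \<open>af\<close> grants a successor to every
  configuration met before \<open>P\<close>.\<close>

lemma af_stuck_reach:
  assumes "af R P n c" "R\<^sup>*\<^sup>* c d" "\<And>e. \<not> R d e" "\<And>x y. P x \<Longrightarrow> \<not> R x y"
  shows "P d"
  using assms(1,2)
proof (induction n arbitrary: c)
  case 0
  then have "P c" by simp
  then show ?case using rtranclp_cases_first[OF 0(2)] assms(4) by metis
next
  case (Suc n)
  show ?case
  proof (cases "P c")
    case True
    then show ?thesis using rtranclp_cases_first[OF Suc.prems(2)] assms(4) by metis
  next
    case False
    obtain e where e: "R c e" "\<And>e. R c e \<Longrightarrow> af R P n e"
      using af_SucE[OF Suc.prems(1) False] by metis
    have "c \<noteq> d" using e(1) assms(3) by metis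
    then obtain c' where "R c c'" "R\<^sup>*\<^sup>* c' d" using rtranclp_cases_first[OF Suc.prems(2)] by metis
    then show ?thesis using Suc.IH e(2) by metis
  qed
qed

text \<open>Keeps the information that the target was reached from \<open>c0\<close>. The acceptance
  clause of \<open>dec\<close> speaks of reachable configurations, and this makes it applicable to
  the target.\<close>

lemma af_reach_inv: "af R P n c \<Longrightarrow> R\<^sup>*\<^sup>* c0 c \<Longrightarrow> af R (\<lambda>d. P d \<and> R\<^sup>*\<^sup>* c0 d) n c"
proof (induction n arbitrary: c)
  case (Suc n)
  show ?case
  proof (cases "P c")
    case True
    then show ?thesis using Suc.prems(2) by simp
  next
    case False
    obtain d where d: "R c d" "\<And>e. R c e \<Longrightarrow> af R P n e"
      using af_SucE[OF Suc.prems(1) False] by metis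
    show ?thesis
    proof (rule af_SucI)
      show "R c d" by (rule d(1))
      show "af R (\<lambda>d. P d \<and> R\<^sup>*\<^sup>* c0 d) n e" if "R c e" for e
        by (rule Suc.IH[OF d(2)[OF that] rtranclp.rtrancl_into_rtrancl[OF Suc.prems(2) that]])
    qed
  qed
qed simp

text \<open>Each step before \<open>P\<close> uses up one unit of the budget. This is how
  \<open>af\<close> is turned into \<open>halts_within\<close>.\<close>

lemma af_length:
  assumes "af R P n c" "(R ^^ m) c d" "\<And>x y. P x \<Longrightarrow> \<not> R x y"
  shows "m \<le> n"
  using assms(1,2)
proof (induction n arbitrary: c m)
  case 0
  show ?case
  proof (cases m)
    case (Suc m')
    then obtain c' where "R c c'" using 0 by (metis relpowp_Suc_E2)
    then show ?thesis using 0 assms(3) by (metis af.simps(1))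
  qed simp
next
  case (Suc n)
  show ?case
  proof (cases m)
    case (Suc m')
    then obtain c' where c': "R c c'" "(R ^^ m') c' d" using Suc.prems(2) by (metis relpowp_Suc_E2)
    then have "\<not> P c" using assms(3) by metis
    obtain e where e: "R c e" "\<And>e. R c e \<Longrightarrow> af R P n e"
      using af_SucE[OF Suc.prems(1) \<open>\<not> P c\<close>] by metis
    then have "m' \<le> n" using Suc.IH c' by metis
    then show ?thesis using Suc by simp
  qed simp
qed

declare af.simps(2) [simp del]

subsection \<open>Iterated-exponential bounds\<close>

text \<open>The factor \<open>a\<close> of the class definitions is absorbed into the exponent for
  \<open>n \<ge> 2\<close>; the additive \<open>C\<close> takes care of \<open>n \<le> 1\<close>,
  where \<open>n ^ m\<close> does not grow with \<open>m\<close>.\<close>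

definition bnd :: "nat \<Rightarrow> (nat \<Rightarrow> nat) \<Rightarrow> bool" where
  "bnd i f \<longleftrightarrow> (\<exists>m \<ge> 1. \<exists>C. \<forall>n. f n \<le> expi i (n ^ m) + C)"

lemma expi_mono: "x \<le> y \<Longrightarrow> expi i x \<le> expi i y"
  by (induction i) auto

lemma expi_ge: "x \<le> expi i x"
proof (induction i)
  case (Suc i)
  have "expi i x < 2 ^ expi i x" by simp
  with Suc show ?case unfolding expi.simps by linarith
qed simp

lemma expi_Suc_ge: "expi i x \<le> expi (Suc i) x"
proof -
  have "expi i x < 2 ^ expi i x" by simp
  then show ?thesis unfolding expi.simps by linarith
qed

lemma affine_le_pow2: "a * 2 ^ e + a \<le> (2::nat) ^ (2 * a + e)"
proof -
  have "2 * a \<le> 2 ^ (2 * a)" using less_exp[of "2 * a"] by (rule less_imp_le)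
  then have "2 * a * 2 ^ e \<le> (2::nat) ^ (2 * a) * 2 ^ e" by simp
  moreover have "a * 2 ^ e + a \<le> 2 * a * (2::nat) ^ e" by simp
  ultimately show ?thesis unfolding power_add by linarith
qed

lemma expi_affine: "m \<ge> 1 \<Longrightarrow> \<exists>m' \<ge> 1. \<forall>n \<ge> 2. a * expi i (n ^ m) + a \<le> expi i (n ^ m')"
proof (induction i arbitrary: a)
  case 0
  have "a * n ^ m + a \<le> n ^ (2 * a + m)" if "n \<ge> 2" for n :: nat
  proof -
    have "2 * a \<le> 2 ^ (2 * a)" using less_exp[of "2 * a"] by (rule less_imp_le)
    also have "\<dots> \<le> n ^ (2 * a)" using that by (simp add: power_mono)
    finally have "2 * a * n ^ m \<le> n ^ (2 * a) * n ^ m" by simp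
    moreover have "a * n ^ m + a \<le> 2 * a * n ^ m" using that by simp
    ultimately show ?thesis unfolding power_add by linarith
  qed
  with 0 show ?case by (intro exI[of _ "2 * a + m"]) auto
next
  case (Suc i)
  \<comment> \<open>The factor is changed to \<open>2*a+1\<close> so that the exponent
    \<open>2 * a + expi i (n ^ m)\<close>, which \<open>affine_le_pow2\<close> produces below, falls
    under the induction hypothesis.\<close>
  then obtain m' where m': "m' \<ge> 1" "\<forall>n \<ge> 2. (2*a+1) * expi i (n ^ m) + (2*a+1) \<le> expi i (n ^ m')" by blast
  have "a * expi (Suc i) (n ^ m) + a \<le> expi (Suc i) (n ^ m')" if "n \<ge> 2" for n
  proof -
    have "a * 2 ^ expi i (n ^ m) + a \<le> (2::nat) ^ (2 * a + expi i (n ^ m))" by (rule affine_le_pow2)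
    also have "2 * a + expi i (n ^ m) \<le> (2*a+1) * expi i (n ^ m) + (2*a+1)"
      by simp
    also have "\<dots> \<le> expi i (n ^ m')" using m' that by blast
    finally show ?thesis by simp
  qed
  with m' show ?case by blast
qed

lemma bndI:
  assumes "m \<ge> 1" "\<And>n. n \<ge> 2 \<Longrightarrow> f n \<le> a * expi i (n ^ m) + a"
  shows "bnd i f"
proof -
  obtain m' where m': "m' \<ge> 1" "\<forall>n \<ge> 2. a * expi i (n ^ m) + a \<le> expi i (n ^ m')"
    using expi_affine[OF assms(1)] by blast
  have "f n \<le> expi i (n ^ m') + (f 0 + f 1)" for n
  proof (cases "n \<ge> 2")
    case True
    with m' assms(2)[of n] have "f n \<le> expi i (n ^ m')" by (meson le_trans)
    then show ?thesis by simp
  next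
    case False
    then have "n = 0 \<or> n = 1" by linarith
    then show ?thesis by auto
  qed
  with m' show ?thesis unfolding bnd_def by blast
qed

lemma bnd_mono: "bnd i g \<Longrightarrow> (\<And>n. f n \<le> g n) \<Longrightarrow> bnd i f"
  unfolding bnd_def by (meson le_trans)

lemma bnd_const: "bnd i (\<lambda>_. C)"
  unfolding bnd_def by (intro exI[of _ 1] conjI exI[of _ C]) auto

lemma bnd_id: "bnd i (\<lambda>n. n)"
  unfolding bnd_def by (intro exI[of _ 1] conjI exI[of _ 0]) (auto simp: expi_ge)

lemma bnd_expi: "m \<ge> 1 \<Longrightarrow> bnd i (\<lambda>n. expi i (n ^ m))"
  unfolding bnd_def by (intro exI[of _ m] conjI exI[of _ 0]) auto

lemma bnd_Suc: "bnd i f \<Longrightarrow> bnd (Suc i) f"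
  unfolding bnd_def using expi_Suc_ge[of i] by (meson add_le_mono1 le_trans)

text \<open>For \<open>i > 0\<close> a product of powers of 2 is a sum one level down, and a sum of
  two such terms is an affine bound covered by \<open>expi_affine\<close>.\<close>

lemma expi_times: "m \<ge> 1 \<Longrightarrow> m' \<ge> 1 \<Longrightarrow>
   \<exists>l \<ge> 1. \<forall>n \<ge> 2. expi i (n ^ m) * expi i (n ^ m') \<le> expi i (n ^ l)"
proof (cases i)
  case 0
  assume "m \<ge> 1" "m' \<ge> 1"
  then show ?thesis using 0 by (intro exI[of _ "m + m'"]) (simp add: power_add)
next
  case (Suc j)
  assume m: "m \<ge> 1" "m' \<ge> 1"
  then obtain l where l: "l \<ge> 1" "\<forall>n \<ge> 2. 2 * expi j (n ^ (max m m')) + 2 \<le> expi j (n ^ l)"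
    using expi_affine[of "max m m'" 2 j] by (meson max.coboundedI1)
  have "expi i (n ^ m) * expi i (n ^ m') \<le> expi i (n ^ l)" if n: "n \<ge> 2" for n
  proof -
    have a: "expi j (n ^ m) \<le> expi j (n ^ max m m')" "expi j (n ^ m') \<le> expi j (n ^ max m m')"
      using n by (auto intro!: expi_mono power_increasing)
    have "expi j (n ^ m) + expi j (n ^ m') \<le> expi j (n ^ l)" using l(2)[rule_format, OF n] a
      by linarith
    then show ?thesis by (simp add: Suc power_add [symmetric])
  qed
  with l(1) show ?thesis by blast
qed

lemma bnd_mult:
  assumes "bnd i f" "bnd i g"
  shows "bnd i (\<lambda>n. f n * g n)"
proof -
  obtain m C where f: "m \<ge> 1" "\<And>n. f n \<le> expi i (n ^ m) + C" using assms(1) unfolding bnd_def by blast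
  obtain m' C' where g: "m' \<ge> 1" "\<And>n. g n \<le> expi i (n ^ m') + C'" using assms(2) unfolding bnd_def by blast
  obtain l where l: "l \<ge> 1" "\<forall>n \<ge> 2. expi i (n ^ m) * expi i (n ^ m') \<le> expi i (n ^ l)"
    using expi_times[OF f(1) g(1)] by blast
  show ?thesis
  proof (rule bndI[OF l(1)])
    fix n :: nat assume n: "n \<ge> 2"
    have pos: "expi i (n ^ m) \<ge> 1" "expi i (n ^ m') \<ge> 1"
      using expi_ge[of "n ^ m" i] expi_ge[of "n ^ m'" i] n by (meson le_trans one_le_power one_le_numeral)+
    have "f n \<le> (C + 1) * expi i (n ^ m)"
    proof -
      have "C \<le> C * expi i (n ^ m)" using pos(1) by (metis mult.right_neutral mult_le_mono2)
      then show ?thesis using f(2)[of n] unfolding distrib_right mult_1 by linarith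
    qed
    moreover have "g n \<le> (C' + 1) * expi i (n ^ m')"
    proof -
      have "C' \<le> C' * expi i (n ^ m')" using pos(2) by (metis mult.right_neutral mult_le_mono2)
      then show ?thesis using g(2)[of n] unfolding distrib_right mult_1 by linarith
    qed
    ultimately have "f n * g n \<le> ((C + 1) * expi i (n ^ m)) * ((C' + 1) * expi i (n ^ m'))"
      by (rule mult_le_mono)
    also have "\<dots> = ((C + 1) * (C' + 1)) * (expi i (n ^ m) * expi i (n ^ m'))" by (simp only: ac_simps)
    also have "\<dots> \<le> ((C + 1) * (C' + 1)) * expi i (n ^ l)" using l(2) n by (intro mult_le_mono2) blast
    finally show "f n * g n \<le> ((C + 1) * (C' + 1)) * expi i (n ^ l) + (C + 1) * (C' + 1)" by simp
  qed
qed

lemma bnd_add: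
  assumes "bnd i f" "bnd i g"
  shows "bnd i (\<lambda>n. f n + g n)"
proof -
  have "bnd i (\<lambda>n. Suc (f n))" if "bnd i f" for f
  proof -
    from that obtain m C where "m \<ge> 1" "\<And>n. f n \<le> expi i (n ^ m) + C" unfolding bnd_def by blast
    then have "m \<ge> 1 \<and> (\<forall>n. Suc (f n) \<le> expi i (n ^ m) + Suc C)" by simp
    then show ?thesis unfolding bnd_def by blast
  qed
  \<comment> \<open>A sum is at most the product of the successors, so closure under products
    suffices.\<close>
  then have "bnd i (\<lambda>n. Suc (f n) * Suc (g n))" using assms bnd_mult by blast
  then show ?thesis by (rule bnd_mono) simp
qed

lemma bnd_Sucf: "bnd i f \<Longrightarrow> bnd i (\<lambda>n. Suc (f n))"
  using bnd_add[OF _ bnd_const[of i 1]] by simp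

lemma bnd_pow: "bnd i f \<Longrightarrow> bnd i (\<lambda>n. f n ^ k)"
  by (induction k) (auto intro: bnd_mult bnd_const[of i 1, simplified])

lemmas bnd_intros = bnd_add bnd_mult bnd_const bnd_id bnd_Sucf bnd_pow

lemma bnd_official: "bnd i f \<Longrightarrow> \<exists>kk \<ge> 1. \<exists>a. \<forall>n. f n \<le> a * expi i (n ^ kk) + a"
proof -
  assume "bnd i f"
  then obtain m C where f: "m \<ge> 1" "\<And>n. f n \<le> expi i (n ^ m) + C" unfolding bnd_def by blast
  have "f n \<le> (C + 1) * expi i (n ^ m) + (C + 1)" for n
    using f(2)[of n] by simp
  with f(1) show ?thesis by blast
qed

lemma bnd_class: "kk \<ge> 1 \<Longrightarrow> bnd i (\<lambda>n. a * expi i (n ^ kk) + a)"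
  by (rule bndI[of kk]) auto

subsection \<open>Stack programs and their steps\<close>

text \<open>\<open>Pop\<close> passes the popped symbol (\<open>None\<close> for an empty stack) to its continuation; the test of \<open>While\<close> also pops,
  so leaving a loop consumes the symbol that ended it.\<close>

datatype com =
    Skip
  | Push nat nat
  | Pop nat "nat option \<Rightarrow> com"
  | While nat "nat option \<Rightarrow> bool" "nat option \<Rightarrow> com"
  | Seq com com
  | QW bool
  | QN
  | Ask nat "bool list \<Rightarrow> com"
  | Or com com
  | Halt bool

type_synonym store = "nat \<Rightarrow> nat list"
type_synonym acfg = "com list \<times> store \<times> bool list list"

definition hdo :: "nat list \<Rightarrow> nat option" where
  "hdo xs = (case xs of [] \<Rightarrow> None | x # _ \<Rightarrow> Some x)"

lemma hdo_simps [simp]: "hdo [] = None" "hdo (x # xs) = Some x"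
  by (simp_all add: hdo_def)

text \<open>Gathers what happens after a pop, so that \<open>Pop\<close> and \<open>While\<close>
  share one treatment in the micro-machine.\<close>

fun contk :: "com \<Rightarrow> com list \<Rightarrow> nat option \<Rightarrow> com list" where
  "contk (Pop s f) ks x = f x # ks"
| "contk (While s P f) ks x = (if P x then f x # While s P f # ks else ks)"
| "contk c ks x = ks"

text \<open>A query round with a buffer of the wrong size is stuck. The size \<open>m\<close> is
  fixed in the program so that only finitely many answer vectors, hence finitely many continuations,
  can follow.\<close>

fun succs :: "lang \<Rightarrow> acfg \<Rightarrow> acfg set" where
  "succs X ([], S, q) = {}"
| "succs X (Skip # ks, S, q) = {(ks, S, q)}"
| "succs X (Push s a # ks, S, q) = {(ks, S(s := a # S s), q)}"
| "succs X (Pop s f # ks, S, q) = {(f (hdo (S s)) # ks, S(s := tl (S s)), q)}"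
| "succs X (While s P f # ks, S, q) = {(contk (While s P f) ks (hdo (S s)), S(s := tl (S s)), q)}"
| "succs X (Seq c d # ks, S, q) = {(c # d # ks, S, q)}"
| "succs X (QW b # ks, S, q) = {(ks, S, qupd (QWrite b) q)}"
| "succs X (QN # ks, S, q) = {(ks, S, qupd QNext q)}"
| "succs X (Ask m f # ks, S, q) = (if length q = m then {(f (map (\<lambda>x. x \<in> X) q) # ks, S, [[]])} else {})"
| "succs X (Or c d # ks, S, q) = {(c # ks, S, q), (d # ks, S, q)}"
| "succs X (Halt b # ks, S, q) = {}"

definition astep :: "lang \<Rightarrow> acfg \<Rightarrow> acfg \<Rightarrow> bool" where
  "astep X c d \<longleftrightarrow> d \<in> succs X c"

text \<open>Running off the end of the program counts as halting without acceptance, in agreement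
  with \<open>run [] = Rej\<close> below.\<close>

fun fin :: "acfg \<Rightarrow> bool" where
  "fin ([], S, q) = True"
| "fin (Halt b # ks, S, q) = True"
| "fin (c # ks, S, q) = False"

fun accf :: "acfg \<Rightarrow> bool" where
  "accf (Halt True # ks, S, q) = True"
| "accf (ks, S, q) = False"

lemma fin_stuck: "fin c \<Longrightarrow> \<not> astep X c d"
  by (cases c rule: fin.cases) (auto simp: astep_def)

lemma accf_fin: "accf c \<Longrightarrow> fin c"
  by (cases c rule: accf.cases) auto

lemma accf_stuck: "accf c \<Longrightarrow> \<not> astep X c d"
  using fin_stuck accf_fin by blast

text \<open>The verdict \<open>b\<close> is determined by the configuration
  (\<open>dec_unique\<close>). Carrying it as an argument lets running time and acceptance be
  derived in a single pass over a program.\<close>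

definition dec :: "lang \<Rightarrow> nat \<Rightarrow> acfg \<Rightarrow> bool \<Rightarrow> bool" where
  "dec X n c b \<longleftrightarrow> af (astep X) fin n c \<and> (b \<longleftrightarrow> (\<exists>d. (astep X)\<^sup>*\<^sup>* c d \<and> accf d))"

lemma dec_mono: "dec X n c b \<Longrightarrow> n \<le> m \<Longrightarrow> dec X m c b"
  unfolding dec_def by (elim conjE) (intro conjI, erule (1) af_mono)

lemma dec_Halt: "dec X n (Halt b # ks, S, q) b"
  unfolding dec_def
proof
  show "af (astep X) fin n (Halt b # ks, S, q)" by (rule af_now) simp
  show "b \<longleftrightarrow> (\<exists>d. (astep X)\<^sup>*\<^sup>* (Halt b # ks, S, q) d \<and> accf d)"
  proof
    assume b
    then show "\<exists>d. (astep X)\<^sup>*\<^sup>* (Halt b # ks, S, q) d \<and> accf d"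
      by (intro exI[of _ "(Halt b # ks, S, q)"]) simp
  next
    assume "\<exists>d. (astep X)\<^sup>*\<^sup>* (Halt b # ks, S, q) d \<and> accf d"
    then obtain d where d: "(astep X)\<^sup>*\<^sup>* (Halt b # ks, S, q) d" "accf d" by blast
    have "d = (Halt b # ks, S, q)"
      using rtranclp_cases_first[OF d(1)] fin_stuck[of "(Halt b # ks, S, q)" X] by auto
    with d(2) show b by (cases b) auto
  qed
qed

lemma dec_step:
  assumes "astep X c d0" "\<And>d. astep X c d \<Longrightarrow> dec X n d (B d)"
  shows "dec X (Suc n) c (\<exists>d. astep X c d \<and> B d)"
  unfolding dec_def
proof
  show "af (astep X) fin (Suc n) c"
    by (rule af_SucI) (use assms in \<open>auto simp: dec_def\<close>)
  have na: "\<not> accf c" using assms(1) accf_stuck by metis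
  show "(\<exists>d. astep X c d \<and> B d) \<longleftrightarrow> (\<exists>d. (astep X)\<^sup>*\<^sup>* c d \<and> accf d)"
  proof
    assume "\<exists>d. astep X c d \<and> B d"
    then obtain d where d: "astep X c d" "B d" by (elim exE conjE)
    then obtain e where e: "(astep X)\<^sup>*\<^sup>* d e" "accf e" using assms(2)[OF d(1)] unfolding dec_def by metis
    have "(astep X)\<^sup>*\<^sup>* c e" using d(1) e(1) by (rule converse_rtranclp_into_rtranclp)
    with e(2) show "\<exists>d. (astep X)\<^sup>*\<^sup>* c d \<and> accf d" by metis
  next
    assume "\<exists>d. (astep X)\<^sup>*\<^sup>* c d \<and> accf d"
    then obtain e where e: "(astep X)\<^sup>*\<^sup>* c e" "accf e" by (elim exE conjE)
    then have "c \<noteq> e" using na by metis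
    then obtain d where d: "astep X c d" "(astep X)\<^sup>*\<^sup>* d e" using rtranclp_cases_first[OF e(1)] by metis
    then have "B d" using assms(2)[OF d(1)] e(2) unfolding dec_def by metis
    with d(1) show "\<exists>d. astep X c d \<and> B d" by metis
  qed
qed

lemma dec_go: "go (astep X) n c d \<Longrightarrow> dec X m d b \<Longrightarrow> dec X (n + m) c b"
proof (induction n arbitrary: c)
  case (Suc n)
  show ?case
  proof (cases "c = d")
    case True
    then have "dec X m c b" using Suc.prems(2) by simp
    then show ?thesis by (rule dec_mono) simp
  next
    case False
    obtain e where e: "astep X c e" "\<And>e. astep X c e \<Longrightarrow> go (astep X) n e d"
      using af_SucE[OF Suc.prems(1)] False by metis
    have "dec X (Suc (n + m)) c (\<exists>d. astep X c d \<and> b)"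
      by (rule dec_step[OF e(1)]) (rule Suc.IH[OF e(2) Suc.prems(2)])
    moreover have "(\<exists>d. astep X c d \<and> b) = b" using e(1) by blast
    ultimately show ?thesis by simp
  qed
qed simp

lemma dec_unique: "dec X n c b \<Longrightarrow> dec X m c b' \<Longrightarrow> b = b'"
  unfolding dec_def by metis

lemma dec_Or:
  assumes "dec X n (c # ks, S, q) b1" "dec X n (d # ks, S, q) b2"
  shows "dec X (Suc n) (Or c d # ks, S, q) (b1 \<or> b2)"
proof -
  define B where "B = (\<lambda>e. if e = (c # ks, S, q) then b1 else b2)"
  \<comment> \<open>The two branches may be the same configuration, in which case \<open>B\<close>
    forgets \<open>b2\<close>; uniqueness of verdicts then makes both values equal.\<close>
  have eq: "b1 = b2" if "(d # ks, S, q) = (c # ks, S, q)" using that assms dec_unique by metis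
  have "dec X (Suc n) (Or c d # ks, S, q) (\<exists>e. astep X (Or c d # ks, S, q) e \<and> B e)"
    by (rule dec_step[of _ _ "(c # ks, S, q)"]) (use assms in \<open>auto simp: B_def astep_def\<close>)
  moreover have "(\<exists>e. astep X (Or c d # ks, S, q) e \<and> B e) = (b1 \<or> b2)"
    using eq unfolding astep_def succs.simps B_def
    by (simp del: split_paired_Ex, metis insert_iff)
  ultimately show ?thesis by simp
qed

primrec Ors :: "com list \<Rightarrow> com" where
  "Ors [] = Halt False"
| "Ors (c # cs) = Or c (Ors cs)"

lemma dec_Ors:
  assumes "\<And>c. c \<in> set cs \<Longrightarrow> dec X n (c # ks, S, q) (B c)"
  shows "dec X (n + length cs) (Ors cs # ks, S, q) (\<exists>c \<in> set cs. B c)"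
  using assms
proof (induction cs)
  case Nil
  then show ?case using dec_Halt[of X "n" False] by simp
next
  case (Cons c cs)
  have "dec X (Suc (n + length cs)) (Or c (Ors cs) # ks, S, q) (B c \<or> (\<exists>c \<in> set cs. B c))"
    using Cons by (intro dec_Or) (auto intro: dec_mono[of X n])
  then show ?case by simp
qed

text \<open>Deterministic execution: \<open>af\<close> with a singleton target serves both the time bound and reachability.\<close>

lemma go_Skip [intro]: "af (astep X) P n (ks, S, q) \<Longrightarrow> af (astep X) P (Suc n) (Skip # ks, S, q)"
  by (rule go_step) (auto simp: astep_def)

lemma go_Push: "af (astep X) P n (ks, S(s := a # S s), q) \<Longrightarrow> af (astep X) P (Suc n) (Push s a # ks, S, q)"
  by (rule go_step) (auto simp: astep_def)

lemma go_Pop: "af (astep X) P n (f (hdo (S s)) # ks, S(s := tl (S s)), q) \<Longrightarrow> af (astep X) P (Suc n) (Pop s f # ks, S, q)"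
  by (rule go_step) (auto simp: astep_def)

lemma go_While: "af (astep X) P n (contk (While s Q f) ks (hdo (S s)), S(s := tl (S s)), q)
   \<Longrightarrow> af (astep X) P (Suc n) (While s Q f # ks, S, q)"
  by (rule go_step) (auto simp: astep_def)

lemma go_Seq: "af (astep X) P n (c # d # ks, S, q) \<Longrightarrow> af (astep X) P (Suc n) (Seq c d # ks, S, q)"
  by (rule go_step) (auto simp: astep_def)

lemma go_QW: "af (astep X) P n (ks, S, qupd (QWrite b) q) \<Longrightarrow> af (astep X) P (Suc n) (QW b # ks, S, q)"
  by (rule go_step) (auto simp: astep_def)

lemma go_QN: "af (astep X) P n (ks, S, qupd QNext q) \<Longrightarrow> af (astep X) P (Suc n) (QN # ks, S, q)"
  by (rule go_step) (auto simp: astep_def)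

lemma go_Ask: "length q = m \<Longrightarrow> af (astep X) P n (f (map (\<lambda>x. x \<in> X) q) # ks, S, [[]])
   \<Longrightarrow> af (astep X) P (Suc n) (Ask m f # ks, S, q)"
  by (rule go_step) (auto simp: astep_def)

lemma go_refl: "go R n c c"
  by (rule af_now) simp

definition opts :: "nat \<Rightarrow> nat option set" where
  "opts A = insert None (Some ` {..<A})"

subsection \<open>Continuations\<close>

text \<open>Stack symbols are below \<open>A\<close> and stacks below \<open>K\<close>; the flag \<open>d\<close> asks for a deterministic program whose only
  query round, of size at most \<open>k\<close>, comes immediately before it halts.\<close>

primrec wfc :: "nat \<Rightarrow> nat \<Rightarrow> nat \<Rightarrow> bool \<Rightarrow> com \<Rightarrow> bool" where
  "wfc A K k d Skip = True"
| "wfc A K k d (Push s a) = (s < K \<and> a < A)"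
| "wfc A K k d (Pop s f) = (s < K \<and> (\<forall>x \<in> opts A. wfc A K k d (f x)))"
| "wfc A K k d (While s P f) = (s < K \<and> (\<forall>x \<in> opts A. wfc A K k d (f x)))"
| "wfc A K k d (Seq c e) = (wfc A K k d c \<and> wfc A K k d e)"
| "wfc A K k d (QW b) = True"
| "wfc A K k d QN = True"
| "wfc A K k d (Ask m f) = (1 \<le> m \<and> (\<forall>bs. length bs = m \<longrightarrow> wfc A K k d (f bs))
      \<and> (d \<longrightarrow> m \<le> k \<and> (\<forall>bs. length bs = m \<longrightarrow> (\<exists>b. f bs = Halt b))))"
| "wfc A K k d (Or c e) = (\<not> d \<and> wfc A K k d c \<and> wfc A K k d e)"
| "wfc A K k d (Halt b) = True"

text \<open>Contains every continuation list that can arise from \<open>[c]\<close>. It is finite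
  because a loop only ever puts itself below its body, and because branching is restricted to
  symbols below \<open>A\<close> and to answer vectors of the prescribed length.\<close>

primrec conts :: "nat \<Rightarrow> com \<Rightarrow> com list set" where
  "conts A Skip = {[Skip], []}"
| "conts A (Push s a) = {[Push s a], []}"
| "conts A (Pop s f) = insert [Pop s f] (\<Union>x \<in> opts A. conts A (f x))"
| "conts A (While s P f) = {[While s P f], []} \<union> (\<Union>x \<in> opts A. (\<lambda>xs. xs @ [While s P f]) ` conts A (f x))"
| "conts A (Seq c e) = insert [Seq c e] ((\<lambda>xs. xs @ [e]) ` conts A c \<union> conts A e)"
| "conts A (QW b) = {[QW b], []}"
| "conts A QN = {[QN], []}"
| "conts A (Ask m f) = insert [Ask m f] (\<Union>bs \<in> {bs. length bs = m}. conts A (f bs))"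
| "conts A (Or c e) = insert [Or c e] (conts A c \<union> conts A e)"
| "conts A (Halt b) = {[Halt b]}"

fun nx :: "nat \<Rightarrow> com \<Rightarrow> com list set" where
  "nx A (Pop s f) = (\<lambda>x. [f x]) ` opts A"
| "nx A (While s P f) = insert [] ((\<lambda>x. [f x, While s P f]) ` opts A)"
| "nx A (Seq c e) = {[c, e]}"
| "nx A (Ask m f) = (\<lambda>bs. [f bs]) ` {bs. length bs = m}"
| "nx A (Or c e) = {[c], [e]}"
| "nx A (Halt b) = {}"
| "nx A c = {[]}"

lemma finite_opts: "finite (opts A)"
  by (simp add: opts_def)

lemma finite_bools: "finite {bs :: bool list. length bs = m}"
  using finite_lists_length_eq[of "UNIV :: bool set" m] by simp

lemma finite_conts: "finite (conts A c)"
  by (induction c) (auto simp: finite_opts finite_bools)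

lemma conts_self: "[c] \<in> conts A c"
  by (cases c) auto

lemma conts_wfc: "ks \<in> conts A c \<Longrightarrow> wfc A K k d c \<Longrightarrow> e \<in> set ks \<Longrightarrow> wfc A K k d e"
proof (induction c arbitrary: ks)
  case (Pop s f)
  have "wfc A K k d e" if "x \<in> opts A" "ks \<in> conts A (f x)" for x
    using Pop.IH[OF rangeI that(2)] Pop.prems(2,3) that(1) by simp
  then show ?case using Pop.prems by auto
next
  case (While s P f)
  have "wfc A K k d e" if "x \<in> opts A" "xs \<in> conts A (f x)" "e \<in> set xs" for x xs
    using While.IH[OF rangeI that(2)] While.prems(2) that by simp
  then show ?case using While.prems by auto
next
  case (Ask m f)
  have "wfc A K k d e" if "length bs = m" "ks \<in> conts A (f bs)" for bs
    using Ask.IH[OF rangeI that(2)] Ask.prems(2,3) that(1) by simp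
  then show ?case using Ask.prems by auto
next
  case (Seq c1 c2)
  then show ?case by (auto simp del: split_paired_Ex)
qed auto

text \<open>The common step for loops and sequences, whose continuation lists end in a fixed program
  \<open>w\<close>: either only \<open>w\<close> is left, or the step takes place above it.\<close>

lemma conts_closed_app:
  assumes "c # ks = xs @ [w]" "xs \<in> C" "e \<in> nx A c"
    "\<And>c ks e. c # ks \<in> C \<Longrightarrow> e \<in> nx A c \<Longrightarrow> e @ ks \<in> C"
    "\<And>e. e \<in> nx A w \<Longrightarrow> e \<in> D"
    "(\<lambda>xs. xs @ [w]) ` C \<subseteq> D"
  shows "e @ ks \<in> D"
proof (cases xs)
  case Nil
  then show ?thesis using assms(1,3,5) by simp
next
  case (Cons c' xs')
  then have "c' = c" "ks = xs' @ [w]" using assms(1) by auto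
  then have "e @ xs' \<in> C" using Cons assms(2,3,4) by blast
  then have "(e @ xs') @ [w] \<in> D" using assms(6) by blast
  then show ?thesis using \<open>ks = xs' @ [w]\<close> by simp
qed

text \<open>This closure is what allows the finite set \<open>conts A c0\<close> to serve as the
  control of the compiled machine.\<close>

lemma conts_closed: "c # ks \<in> conts A c0 \<Longrightarrow> e \<in> nx A c \<Longrightarrow> e @ ks \<in> conts A c0"
proof (induction c0 arbitrary: c ks e)
  case (Pop s f)
  from Pop.prems(1) consider "c = Pop s f" "ks = []" | x where "x \<in> opts A" "c # ks \<in> conts A (f x)" by auto
  then show ?case
  proof cases
    case 1
    then show ?thesis using Pop.prems(2) conts_self by auto
  next
    case 2
    then have "e @ ks \<in> conts A (f x)" using Pop.IH[of "f x"] Pop.prems(2) by blast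
    then show ?thesis using 2 by auto
  qed
next
  case (While s P f)
  let ?w = "While s P f"
  have self: "e \<in> conts A ?w" if "e \<in> nx A ?w" for e
  proof -
    from that consider "e = []" | x where "x \<in> opts A" "e = [f x] @ [?w]" by auto
    then show ?thesis
    proof cases
      case 2
      then have "e \<in> (\<lambda>xs. xs @ [?w]) ` conts A (f x)" using conts_self by (intro image_eqI) auto
      then show ?thesis using 2(1) by auto
    qed simp
  qed
  from While.prems(1) consider "c = ?w" "ks = []"
    | x xs where "x \<in> opts A" "c # ks = xs @ [?w]" "xs \<in> conts A (f x)" by auto
  then show ?case
  proof cases
    case 1
    then show ?thesis using While.prems(2) self by simp
  next
    case 2
    show ?thesis
    proof (rule conts_closed_app[OF 2(2,3) While.prems(2)])
      show "\<And>c ks e. c # ks \<in> conts A (f x) \<Longrightarrow> e \<in> nx A c \<Longrightarrow> e @ ks \<in> conts A (f x)"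
        using While.IH[of "f x"] by blast
      show "(\<lambda>xs. xs @ [?w]) ` conts A (f x) \<subseteq> conts A ?w" using 2(1) by auto
    qed (rule self)
  qed
next
  case (Seq c1 c2)
  from Seq.prems(1) consider "c = Seq c1 c2" "ks = []"
    | xs where "c # ks = xs @ [c2]" "xs \<in> conts A c1" | "c # ks \<in> conts A c2" by auto
  then show ?case
  proof cases
    case 1
    then show ?thesis using Seq.prems(2) by (auto intro!: image_eqI[where x = "[c1]"] conts_self)
  next
    case 2
    show ?thesis
    proof (rule conts_closed_app[OF 2 Seq.prems(2) Seq.IH(1)])
      show "e \<in> conts A (Seq c1 c2)" if "e \<in> nx A c2" for e
        using Seq.IH(2)[OF conts_self that] by simp
    qed auto
  next
    case 3
    then show ?thesis using Seq.IH(2) Seq.prems(2) by simp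
  qed
next
  case (Ask m f)
  from Ask.prems(1) consider "c = Ask m f" "ks = []" | x where "length x = m" "c # ks \<in> conts A (f x)" by auto
  then show ?case
  proof cases
    case 1
    then show ?thesis using Ask.prems(2) conts_self by auto
  next
    case 2
    then have "e @ ks \<in> conts A (f x)" using Ask.IH[of "f x"] Ask.prems(2) by blast
    then show ?thesis using 2 by auto
  qed
next
  case (Or c1 c2)
  then show ?case using conts_self by auto
qed auto

subsection \<open>Micro-machine\<close>

text \<open>Cell \<open>p\<close> holds entry \<open>p\<close> of every stack, counted from the bottom (0 for none, otherwise the symbol plus 1).
  The head rests on cell -1, which stays blank.  Queries are asked to the left of it: since all queries
  return to the same state, the continuation is first saved as a \<open>Sav\<close> symbol just left of the cells that
  receive the answers.\<close>

datatype tsym = Raw nat | Cell "nat \<Rightarrow> nat" | Sav com "com list"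

text \<open>\<open>Psh\<close> and \<open>Pp\<close> walk right to the first cell without an entry
  of one stack, \<open>Pq\<close> then stands on its top entry or on cell -1, and
  \<open>Home\<close> walks back to cell -1. \<open>AskL\<close> walks left to the place of the
  saved continuation, \<open>AskS\<close> and \<open>RetS\<close> are the query and return states,
  \<open>Ret2\<close> fetches the continuation, and \<open>Rd\<close> collects the answers.\<close>

datatype ms = Init0 | Init1 nat | Acc | Rej | Run "com list" | Home "com list"
  | Psh nat nat "com list" | Pp com "com list" | Pq com "com list"
  | AskL nat com "com list" | AskS | RetS | Ret2 | Rd nat com "com list" "bool list"

type_synonym mcfg = "ms \<times> (int \<Rightarrow> tsym) \<times> int \<times> bool list list"

text \<open>Halting is decided on entry, so a final program configuration is represented directly by
  a final machine state.\<close>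

fun run :: "com list \<Rightarrow> ms" where
  "run [] = Rej"
| "run (Halt b # ks) = (if b then Acc else Rej)"
| "run (c # ks) = Run (c # ks)"

fun trun :: "com \<Rightarrow> com list \<Rightarrow> (ms \<times> tsym \<times> int \<times> qact) set" where
  "trun Skip ks = {(run ks, Raw 0, 0, QNone)}"
| "trun (Push s a) ks = {(Psh s a ks, Raw 0, 1, QNone)}"
| "trun (Pop s f) ks = {(Pp (Pop s f) ks, Raw 0, 1, QNone)}"
| "trun (While s P f) ks = {(Pp (While s P f) ks, Raw 0, 1, QNone)}"
| "trun (Seq c e) ks = {(run (c # e # ks), Raw 0, 0, QNone)}"
| "trun (QW b) ks = {(run ks, Raw 0, 0, QWrite b)}"
| "trun QN ks = {(run ks, Raw 0, 0, QNext)}"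
| "trun (Ask m f) ks = {(AskL m (Ask m f) ks, Raw 0, -1, QNone)}"
| "trun (Or c e) ks = {(run (c # ks), Raw 0, 0, QNone), (run (e # ks), Raw 0, 0, QNone)}"
| "trun (Halt b) ks = {}"

fun pst :: "com \<Rightarrow> nat" where
  "pst (Pop s f) = s" | "pst (While s P f) = s" | "pst c = 0"

fun askm :: "com \<Rightarrow> nat" where
  "askm (Ask m f) = m" | "askm c = 0"

fun askf :: "com \<Rightarrow> bool list \<Rightarrow> com" where
  "askf (Ask m f) = f" | "askf c = (\<lambda>_. c)"

definition v0 :: "nat \<Rightarrow> nat \<Rightarrow> nat \<Rightarrow> nat" where
  "v0 s a = (\<lambda>_. 0)(s := Suc a)"

text \<open>\<open>Init0\<close> and \<open>Init1\<close> turn the raw input into stack 0.  After the separator at most \<open>B\<close> symbols are accepted,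
  because the running time may depend on \<open>w\<close> only, not on the length of \<open>z\<close>.\<close>

fun tr :: "nat \<Rightarrow> com \<Rightarrow> ms \<Rightarrow> tsym \<Rightarrow> (ms \<times> tsym \<times> int \<times> qact) set" where
  "tr B c0 Init0 (Raw r) = (if r = 0 then {(Home [c0], Raw 0, -1, QNone)}
      else if r = 3 then {(Init1 B, Cell (v0 0 r), 1, QNone)} else {(Init0, Cell (v0 0 r), 1, QNone)})"
| "tr B c0 (Init1 j) (Raw r) = (if r = 0 then {(Home [c0], Raw 0, -1, QNone)}
      else if j = 0 then {(Rej, Raw r, 0, QNone)} else {(Init1 (j - 1), Cell (v0 0 r), 1, QNone)})"
| "tr B c0 (Run (c # ks)) (Raw r) = (if r = 0 then trun c ks else {})"
| "tr B c0 (Home ks) (Cell v) = {(Home ks, Cell v, -1, QNone)}"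
| "tr B c0 (Home ks) (Raw r) = (if r = 0 then {(run ks, Raw 0, 0, QNone)} else {})"
| "tr B c0 (Psh s a ks) (Cell v) = (if v s = 0 then {(Home ks, Cell (v(s := Suc a)), -1, QNone)}
      else {(Psh s a ks, Cell v, 1, QNone)})"
| "tr B c0 (Psh s a ks) (Raw r) = (if r = 0 then {(Home ks, Cell (v0 s a), -1, QNone)} else {})"
| "tr B c0 (Pp c ks) (Cell v) = (if v (pst c) = 0 then {(Pq c ks, Cell v, -1, QNone)}
      else {(Pp c ks, Cell v, 1, QNone)})"
| "tr B c0 (Pp c ks) (Raw r) = (if r = 0 then {(Pq c ks, Raw 0, -1, QNone)} else {})"
| "tr B c0 (Pq c ks) (Cell v) = (if v (pst c) = 0 then {}
      else {(Home (contk c ks (Some (v (pst c) - 1))), Cell (v(pst c := 0)), -1, QNone)})"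
| "tr B c0 (Pq c ks) (Raw r) = (if r = 0 then {(run (contk c ks None), Raw 0, 0, QNone)} else {})"
| "tr B c0 (AskL j c ks) (Raw r) = (if r \<noteq> 0 then {}
      else if j = 0 then {(AskS, Sav c ks, 1, QNone)} else {(AskL (j - 1) c ks, Raw 0, -1, QNone)})"
| "tr B c0 RetS (Raw r) = {(Ret2, Raw r, -1, QNone)}"
| "tr B c0 Ret2 (Sav c ks) = {(Rd (askm c) c ks [], Raw 0, 1, QNone)}"
| "tr B c0 (Rd j c ks bs) (Raw r) = (if j = 0
      then (if r = 0 then {(run (askf c bs # ks), Raw 0, 0, QNone)} else {})
      else {(Rd (j - 1) c ks (bs @ [r = 2]), Raw 0, 1, QNone)})"
| "tr B c0 q a = {}"

lemma finite_trun: "finite (trun c ks)"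
  by (cases c) auto

lemma finite_tr: "finite (tr B c0 q a)"
  by (cases "(B, c0, q, a)" rule: tr.cases) (simp_all add: finite_trun)

definition write_raw :: "(int \<Rightarrow> tsym) \<Rightarrow> int \<Rightarrow> bool list \<Rightarrow> int \<Rightarrow> tsym" where
  "write_raw t h ans = (\<lambda>p. if h \<le> p \<and> p < h + int (length ans)
                             then Raw (sym_of_bit (ans ! nat (p - h))) else t p)"

text \<open>The query step demands a saved continuation and the matching number of buffered queries.
  The compiled machine does not test this, but the bound on the size of a query round in
  \<open>machine_dec\<close> is read off from here.\<close>

definition cstep :: "nat \<Rightarrow> com \<Rightarrow> lang \<Rightarrow> mcfg \<Rightarrow> mcfg \<Rightarrow> bool" where
  "cstep B c0 X C D \<longleftrightarrow> (case C of (q, t, h, qs) \<Rightarrow> case D of (q', t', h', qs') \<Rightarrow>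
     (q = AskS \<and> (\<exists>c ks. t (h - 1) = Sav c ks \<and> length qs = askm c) \<and> q' = RetS \<and> h' = h \<and> qs' = [[]]
       \<and> t' = write_raw t h (map (\<lambda>x. x \<in> X) qs))
   \<or> (\<exists>b dd x. (q', b, dd, x) \<in> tr B c0 q (t h) \<and> t' = t(h := b) \<and> h' = h + dd \<and> qs' = qupd x qs))"

lemma cs1:
  assumes "tr B c0 q (t h) = {(q', b, dd, x)}" "af (cstep B c0 X) P n (q', t(h := b), h + dd, qupd x qs)"
  shows "af (cstep B c0 X) P (Suc n) (q, t, h, qs)"
proof -
  have "q \<noteq> AskS" using assms(1) by auto
  then show ?thesis using assms(1)
    by (intro go_step[OF _ _ assms(2)]) (auto simp: cstep_def)
qed

definition at :: "nat list \<Rightarrow> nat \<Rightarrow> nat" where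
  "at xs p = (if p < length xs then Suc (rev xs ! p) else 0)"

text \<open>\<open>H\<close> is a high-water mark: emptied cells remain \<open>Cell\<close> symbols,
  so one store is represented by several tapes.\<close>

definition tape :: "nat \<Rightarrow> store \<Rightarrow> int \<Rightarrow> tsym" where
  "tape H S = (\<lambda>p. if 0 \<le> p \<and> p < int H then Cell (\<lambda>s. at (S s) (nat p)) else Raw 0)"

fun repc :: "nat \<Rightarrow> acfg \<Rightarrow> mcfg" where
  "repc H (ks, S, q) = (run ks, tape H S, -1, q)"

text \<open>\<open>N\<close> controls the cost of the next program step on the micro-machine and
  grows by at most one per step.\<close>

fun okb :: "nat \<Rightarrow> nat \<Rightarrow> acfg \<Rightarrow> bool" where
  "okb H N (ks, S, q) = ((\<forall>s. length (S s) \<le> H) \<and> H \<le> N \<and> length q \<le> N \<and> 1 \<le> N)"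

lemma at_Cons: "at (a # xs) p = (if p = length xs then Suc a else at xs p)"
  by (auto simp: at_def nth_append)

lemma at_length: "at xs p = 0 \<longleftrightarrow> length xs \<le> p"
  by (simp add: at_def)

lemma tape_in: "j < H \<Longrightarrow> tape H S (int j) = Cell (\<lambda>s. at (S s) j)"
  by (simp add: tape_def)

lemma tape_out: "p < 0 \<or> int H \<le> p \<Longrightarrow> tape H S p = Raw 0"
  by (auto simp: tape_def)

lemma tape_same: "j < H \<Longrightarrow> (tape H S)(int j := Cell (\<lambda>s. at (S s) j)) = tape H S"
  using tape_in[of j H S] by (metis fun_upd_triv)

lemma tape_same_out: "p < 0 \<or> int H \<le> p \<Longrightarrow> (tape H S)(p := Raw 0) = tape H S"
  using tape_out[of p H S] by (metis fun_upd_triv)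

lemma home: "j \<le> H \<Longrightarrow> go (cstep B c0 X) (j + 1) (Home ks, tape H S, int j - 1, qs) (run ks, tape H S, -1, qs)"
proof (induction j)
  case 0
  have "go (cstep B c0 X) (Suc 0) (Home ks, tape H S, -1, qs) (run ks, tape H S, -1, qs)"
    by (rule cs1[where q' = "run ks" and b = "Raw 0" and dd = 0 and x = QNone])
       (simp_all add: tape_out fun_upd_idem)
  then show ?case by simp
next
  case (Suc j)
  have "go (cstep B c0 X) (Suc (j + 1)) (Home ks, tape H S, int j, qs) (run ks, tape H S, -1, qs)"
    by (rule cs1[where q' = "Home ks" and b = "tape H S (int j)" and dd = "-1" and x = QNone])
       (use Suc in \<open>simp_all add: tape_in tape_same\<close>)
  then show ?case by simp
qed

text \<open>Stated for an arbitrary state that passes over the entries of stack \<open>s\<close>, to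
  serve both \<open>Psh\<close> and \<open>Pp\<close>.\<close>

lemma sweep:
  assumes "\<And>v. v s \<noteq> 0 \<Longrightarrow> tr B c0 q (Cell v) = {(q, Cell v, 1, QNone)}" "length (S s) \<le> H"
  shows "j \<le> length (S s) \<Longrightarrow>
    go (cstep B c0 X) j (q, tape H S, int (length (S s) - j), qs) (q, tape H S, int (length (S s)), qs)"
proof (induction j)
  case 0
  then show ?case by simp
next
  case (Suc j)
  let ?p = "length (S s) - Suc j"
  have p: "?p < H" "?p < length (S s)" "int ?p + 1 = int (length (S s) - j)" using Suc.prems assms(2) by auto
  show ?case
  proof (rule cs1)
    show "tr B c0 q (tape H S (int ?p)) = {(q, Cell (\<lambda>s. at (S s) ?p), 1, QNone)}"
      unfolding tape_in[OF p(1)] by (rule assms(1)) (use p(2) in \<open>simp add: at_length\<close>)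
    show "go (cstep B c0 X) j (q, (tape H S)(int ?p := Cell (\<lambda>s. at (S s) ?p)), int ?p + 1, qupd QNone qs)
       (q, tape H S, int (length (S s)), qs)"
      using Suc p(3) tape_same[OF p(1), of S] by simp
  qed
qed


lemma tape_push:
  assumes "length (S s) < H"
  shows "(tape H S)(int (length (S s)) := Cell ((\<lambda>s'. at (S s') (length (S s)))(s := Suc a))) = tape H (S(s := a # S s))"
  using assms by (auto simp: tape_def fun_eq_iff at_Cons at_length)

lemma tape_push_new:
  assumes "\<And>s. length (S s) \<le> H" "length (S s) = H"
  shows "(tape H S)(int H := Cell (v0 s a)) = tape (Suc H) (S(s := a # S s))"
  using assms by (auto simp: tape_def fun_eq_iff at_Cons at_length v0_def)

lemma tape_pop:
  assumes "S s = a # xs" "length (S s) \<le> H"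
  shows "(tape H S)(int (length xs) := Cell ((\<lambda>s'. at (S s') (length xs))(s := 0))) = tape H (S(s := xs))"
proof
  fix p
  show "((tape H S)(int (length xs) := Cell ((\<lambda>s'. at (S s') (length xs))(s := 0)))) p = tape H (S(s := xs)) p"
    using assms by (auto simp: tape_def fun_eq_iff at_Cons at_length)
qed

lemma micro_push:
  assumes "okb H N (ks, S, q)"
  shows "\<exists>H'. okb H' (Suc N) (ks, S(s := a # S s), q)
    \<and> go (cstep B c0 X) (2 * N + 10) (repc H (Push s a # ks, S, q)) (repc H' (ks, S(s := a # S s), q))"
proof -
  let ?l = "length (S s)"
  \<comment> \<open>A new cell is needed only when the pushed stack is already as high as the
    tape.\<close>
  let ?H = "if ?l < H then H else Suc H"
  let ?G = "repc ?H (ks, S(s := a # S s), q)"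
  have lH: "\<And>s. length (S s) \<le> H" using assms by auto
  have HN: "H \<le> N" using assms by simp
  have ok: "okb ?H (Suc N) (ks, S(s := a # S s), q)" using assms by (auto intro: le_antisym simp: le_Suc_eq)
  have g3: "go (cstep B c0 X) (?l + 1) (Home ks, tape ?H (S(s := a # S s)), int ?l - 1, q) ?G"
    unfolding repc.simps by (rule home) (use lH[of s] in auto)
  have g2: "go (cstep B c0 X) (Suc (?l + 1)) (Psh s a ks, tape H S, int ?l, q) ?G"
  proof (cases "?l < H")
    case True
    show ?thesis
    proof (rule cs1)
      show "tr B c0 (Psh s a ks) (tape H S (int ?l)) =
        {(Home ks, Cell ((\<lambda>s'. at (S s') ?l)(s := Suc a)), -1, QNone)}"
        unfolding tape_in[OF True] by (simp add: at_length)
      show "go (cstep B c0 X) (?l + 1) (Home ks, (tape H S)(int ?l := Cell ((\<lambda>s'. at (S s') ?l)(s := Suc a))),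
          int ?l + - 1, qupd QNone q) ?G"
        using g3 True by (simp add: tape_push del: fun_upd_apply)
    qed
  next
    case False
    then have l: "?l = H" using lH[of s] by (meson le_neq_implies_less)
    show ?thesis
    proof (rule cs1)
      show "tr B c0 (Psh s a ks) (tape H S (int ?l)) = {(Home ks, Cell (v0 s a), -1, QNone)}"
        using l by (simp add: tape_out)
      show "go (cstep B c0 X) (?l + 1) (Home ks, (tape H S)(int ?l := Cell (v0 s a)),
          int ?l + - 1, qupd QNone q) ?G"
        using g3 l tape_push_new[where S = S and s = s and H = H and a = a] lH by (simp del: fun_upd_apply)
    qed
  qed
  have g1: "go (cstep B c0 X) ?l (Psh s a ks, tape H S, 0, q) (Psh s a ks, tape H S, int ?l, q)"
    using sweep[where q = "Psh s a ks" and s = s and S = S and j = ?l and H = H and qs = q and B = B and X = X and ?c0.0 = c0] lH by simp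
  have "go (cstep B c0 X) (Suc (?l + Suc (?l + 1))) (repc H (Push s a # ks, S, q)) ?G"
    unfolding repc.simps(1)[of H]
    by (rule cs1[where q' = "Psh s a ks" and b = "Raw 0" and dd = 1 and x = QNone])
       (use go_af[OF g1 g2] in \<open>simp_all add: tape_out tape_same_out\<close>)
  then have "go (cstep B c0 X) (2 * N + 10) (repc H (Push s a # ks, S, q)) ?G"
    by (rule af_mono) (use lH[of s] HN in simp)
  then show ?thesis using ok by (intro exI[of _ ?H]) simp
qed

lemma micro_pop:
  assumes "okb H N (ks, S, q)" "c = Pop s f \<or> c = While s P f"
  shows "okb H N (contk c ks (hdo (S s)), S(s := tl (S s)), q)
    \<and> go (cstep B c0 X) (2 * N + 10) (repc H (c # ks, S, q)) (repc H (contk c ks (hdo (S s)), S(s := tl (S s)), q))"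
proof -
  let ?l = "length (S s)"
  let ?G = "repc H (contk c ks (hdo (S s)), S(s := tl (S s)), q)"
  have lH: "\<And>s. length (S s) \<le> H" using assms by auto
  have ok: "okb H N (contk c ks (hdo (S s)), S(s := tl (S s)), q)"
    using assms(1) by (auto intro: order_trans[OF diff_le_self])
  have HN: "H \<le> N" using assms(1) by simp
  have ps: "pst c = s" using assms(2) by auto
  have g3: "go (cstep B c0 X) (Suc ?l) (Pq c ks, tape H S, int ?l - 1, q) ?G"
  proof (cases "S s")
    case Nil
    have "S(s := []) = S" using Nil by (metis fun_upd_triv)
    then show ?thesis
      by (intro cs1[where q' = "run (contk c ks None)" and b = "Raw 0" and dd = 0 and x = QNone])
         (use Nil ps in \<open>simp_all add: tape_out tape_same_out go_refl del: fun_upd_apply\<close>)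
  next
    case (Cons a xs)
    have xs: "length xs < H" using lH[of s] Cons by simp
    show ?thesis
    proof (rule cs1)
      show "tr B c0 (Pq c ks) (tape H S (int ?l - 1)) =
         {(Home (contk c ks (Some a)), Cell ((\<lambda>s'. at (S s') (length xs))(s := 0)), -1, QNone)}"
        using Cons ps by (simp add: tape_in[OF xs] at_Cons)
      show "go (cstep B c0 X) ?l (Home (contk c ks (Some a)),
         (tape H S)(int ?l - 1 := Cell ((\<lambda>s'. at (S s') (length xs))(s := 0))), int ?l - 1 + - 1, qupd QNone q) ?G"
        using home[where j = "length xs" and H = H and ks = "contk c ks (Some a)" and S = "S(s := xs)" and qs = q
            and B = B and X = X and ?c0.0 = c0] xs Cons tape_pop[where S = S and s = s and a = a and xs = xs and H = H] Cons lH[of s]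
        by (simp del: fun_upd_apply)
    qed
  qed
  have g2: "go (cstep B c0 X) (Suc (Suc ?l)) (Pp c ks, tape H S, int ?l, q) ?G"
  proof (cases "?l < H")
    case True
    show ?thesis
      by (rule cs1[where q' = "Pq c ks" and b = "Cell (\<lambda>s. at (S s) ?l)" and dd = "-1" and x = QNone])
         (use True g3 ps in \<open>simp_all add: tape_in at_length tape_same del: fun_upd_apply\<close>)
  next
    case False
    show ?thesis
      by (rule cs1[where q' = "Pq c ks" and b = "Raw 0" and dd = "-1" and x = QNone])
         (use False g3 in \<open>simp_all add: tape_out tape_same_out del: fun_upd_apply\<close>)
  qed
  have g1: "go (cstep B c0 X) ?l (Pp c ks, tape H S, 0, q) (Pp c ks, tape H S, int ?l, q)"
    using sweep[where q = "Pp c ks" and s = s and S = S and j = ?l and H = H and qs = q and B = B and X = X and ?c0.0 = c0]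
      lH ps by simp
  have rc: "run (c # ks) = Run (c # ks)" "trun c ks = {(Pp c ks, Raw 0, 1, QNone)}" using assms(2) by auto
  have "go (cstep B c0 X) (Suc (?l + Suc (Suc ?l))) (repc H (c # ks, S, q)) ?G"
    unfolding repc.simps(1)[of H "c # ks"] rc
    by (rule cs1[where q' = "Pp c ks" and b = "Raw 0" and dd = 1 and x = QNone])
       (use go_af[OF g1 g2] in \<open>simp_all add: tape_out tape_same_out rc\<close>)
  then have "go (cstep B c0 X) (2 * N + 10) (repc H (c # ks, S, q)) ?G"
    by (rule af_mono) (use lH[of s] HN in simp)
  then show ?thesis using ok by simp
qed


text \<open>Each answer is erased when it is read, so the tape left of cell 0 is blank again and the
  next round finds it as the first one did.\<close>

lemma rd:
  "(\<And>p. p < 0 \<Longrightarrow> T p = Raw 0) \<Longrightarrow>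
   go (cstep B c0 X) (length ans + 1) (Rd (length ans) c ks bs, write_raw T (- int (length ans) - 1) ans, - int (length ans) - 1, qs)
     (run (askf c (bs @ ans) # ks), T, -1, qs)"
proof (induction ans arbitrary: bs)
  case Nil
  have w: "write_raw T h [] = T" for h by (auto simp: write_raw_def fun_eq_iff)
  have "T(- 1 := Raw 0) = T" using Nil by (metis fun_upd_triv neg_less_0_iff_less zero_less_one)
  then have "go (cstep B c0 X) (Suc 0) (Rd 0 c ks bs, T, -1, qs) (run (askf c bs # ks), T, -1, qs)"
    by (intro cs1[where q' = "run (askf c bs # ks)" and b = "Raw 0" and dd = 0 and x = QNone])
       (simp_all add: Nil go_refl)
  then show ?case by (simp only: list.size(3) of_nat_0 minus_zero diff_0 w append_Nil2) simp
next
  case (Cons a ans)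
  let ?h = "- int (length (a # ans)) - 1" and ?W = "write_raw T (- int (length (a # ans)) - 1) (a # ans)"
  have r: "?W ?h = Raw (sym_of_bit a)" by (simp add: write_raw_def)
  have u: "?W(?h := Raw 0) = write_raw T (- int (length ans) - 1) ans"
  proof
    fix p
    show "(?W(?h := Raw 0)) p = write_raw T (- int (length ans) - 1) ans p"
      using Cons.prems[of ?h]
      by (auto simp: write_raw_def nth_Cons' intro!: arg_cong[where f = "\<lambda>i. sym_of_bit (ans ! i)"])
  qed
  have "go (cstep B c0 X) (Suc (length ans + 1)) (Rd (Suc (length ans)) c ks bs, ?W, ?h, qs) (run (askf c (bs @ a # ans) # ks), T, -1, qs)"
  proof (rule cs1)
    show "tr B c0 (Rd (Suc (length ans)) c ks bs) (?W ?h) = {(Rd (length ans) c ks (bs @ [a]), Raw 0, 1, QNone)}"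
      unfolding r by (simp add: sym_of_bit_def)
    have h: "?h + 1 = - int (length ans) - 1" by simp
    show "go (cstep B c0 X) (length ans + 1) (Rd (length ans) c ks (bs @ [a]), ?W(?h := Raw 0), ?h + 1, qupd QNone qs)
       (run (askf c (bs @ a # ans) # ks), T, -1, qs)"
      unfolding u h using Cons.IH[of "bs @ [a]"] Cons.prems by simp
  qed
  then show ?case by simp
qed

lemma askl:
  "(\<And>p. p < 0 \<Longrightarrow> T p = Raw 0) \<Longrightarrow> j \<le> m \<Longrightarrow>
   go (cstep B c0 X) j (AskL j c ks, T, int j - int m - 2, qs) (AskL 0 c ks, T, - int m - 2, qs)"
proof (induction j)
  case (Suc j)
  let ?p = "int (Suc j) - int m - 2"
  have p: "T ?p = Raw 0" using Suc.prems by simp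
  show ?case
    by (rule cs1[where q' = "AskL j c ks" and b = "Raw 0" and dd = "-1" and x = QNone])
       (use Suc p fun_upd_idem[where f = T and x = ?p and y = "Raw 0"] in \<open>simp_all add: algebra_simps\<close>)
qed simp

lemma micro_ask:
  assumes "okb H N (ks, S, q)" "length q = m"
  shows "go (cstep B c0 X) (2 * N + 10) (repc H (Ask m f # ks, S, q)) (repc H (f (map (\<lambda>x. x \<in> X) q) # ks, S, [[]]))"
proof -
  let ?T = "tape H S" and ?c = "Ask m f" and ?ans = "map (\<lambda>x. x \<in> X) q"
  \<comment> \<open>With the continuation saved in cell \<open>s\<close>, the \<open>m\<close>
    answers fill the cells from \<open>s + 1\<close> to -2, and reading them from left to right ends
    on the resting cell -1.\<close>
  define s where s: "s = - int m - 2"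
  let ?G = "repc H (f ?ans # ks, S, [[]])"
  let ?T1 = "?T(s := Sav ?c ks)"
  let ?T2 = "write_raw ?T1 (s + 1) ?ans"
  have neg: "?T p = Raw 0" if "p < 0" for p using that by (simp add: tape_out)
  have T3: "?T2(s := Raw 0) = write_raw ?T (s + 1) ?ans"
    using neg[of s] s by (auto simp: write_raw_def fun_eq_iff)
  have eq: "s + 1 = - int m - 1" by (simp add: s)
  have ns: "s < 0" by (simp add: s)
  have g5: "go (cstep B c0 X) (m + 1) (Rd m ?c ks [], ?T2(s := Raw 0), s + 1, [[]]) ?G"
    using rd[where T = ?T and ans = ?ans and c = ?c and ks = ks and bs = "[]" and qs = "[[]]" and B = B and X = X and ?c0.0 = c0] neg assms(2)
    unfolding eq T3[unfolded eq] by simp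
  have g4: "go (cstep B c0 X) (Suc (m + 1)) (Ret2, ?T2, s, [[]]) ?G"
    by (rule cs1[where q' = "Rd m ?c ks []" and b = "Raw 0" and dd = 1 and x = QNone])
       (use g5 in \<open>simp_all add: write_raw_def\<close>)
  obtain r where r: "?T2 (s + 1) = Raw r"
  proof (cases "m = 0")
    case True
    then have "?T2 (s + 1) = Raw 0" using neg[of "-1"] assms(2) s by (simp add: write_raw_def)
    then show ?thesis using that by simp
  next
    case False
    then have "?T2 (s + 1) = Raw (sym_of_bit (?ans ! 0))" using assms(2) s by (simp add: write_raw_def)
    then show ?thesis using that by simp
  qed
  have g3: "go (cstep B c0 X) (Suc (Suc (m + 1))) (RetS, ?T2, s + 1, [[]]) ?G"
    by (rule cs1[where q' = Ret2 and b = "Raw r" and dd = "-1" and x = QNone])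
       (use g4 r fun_upd_idem[where f = ?T2 and x = "s + 1" and y = "Raw r"] in simp_all)
  have g2: "go (cstep B c0 X) (Suc (Suc (Suc (m + 1)))) (AskS, ?T1, s + 1, q) ?G"
    by (rule go_step[OF _ _ g3]) (use assms(2) in \<open>auto simp: cstep_def\<close>)
  have g1: "go (cstep B c0 X) (Suc (Suc (Suc (Suc (m + 1))))) (AskL 0 ?c ks, ?T, s, q) ?G"
    by (rule cs1[where q' = AskS and b = "Sav ?c ks" and dd = 1 and x = QNone])
       (use g2 neg[OF ns] in simp_all)
  have g0: "go (cstep B c0 X) m (AskL m ?c ks, ?T, -2, q) (AskL 0 ?c ks, ?T, s, q)"
    using askl[where T = ?T and j = m and m = m and c = ?c and ks = ks and qs = q and B = B and X = X and ?c0.0 = c0] neg s by simp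
  have "go (cstep B c0 X) (Suc (m + Suc (Suc (Suc (Suc (m + 1)))))) (repc H (Ask m f # ks, S, q)) ?G"
    unfolding repc.simps(1)[of H "Ask m f # ks"] run.simps
    by (rule cs1[where q' = "AskL m ?c ks" and b = "Raw 0" and dd = "-1" and x = QNone])
       (use go_af[OF g0 g1] in \<open>simp_all add: neg tape_same_out\<close>)
  then show ?thesis by (rule af_mono) (use assms in simp)
qed

lemma micro_simple:
  assumes "trun c ks = {(run ks', Raw 0, 0, x)}" "\<And>b. c \<noteq> Halt b"
  shows "go (cstep B c0 X) (2 * N + 10) (repc H (c # ks, S, q)) (repc H (ks', S, qupd x q))"
proof -
  have rc: "run (c # ks) = Run (c # ks)" using assms(2) by (cases c) auto
  have "go (cstep B c0 X) (Suc 0) (repc H (c # ks, S, q)) (repc H (ks', S, qupd x q))"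
    unfolding repc.simps rc
    by (rule cs1[where q' = "run ks'" and b = "Raw 0" and dd = 0 and x = x])
       (simp_all add: assms(1) tape_out tape_same_out)
  then show ?thesis by (rule af_mono) simp
qed

lemma length_qupd: "length (qupd x q) \<le> Suc (length q)"
  by (cases x) auto

lemma micro:
  assumes "okb H N (c # ks, S, q)" "astep X (c # ks, S, q) d" "\<And>c1 c2. c \<noteq> Or c1 c2"
  shows "\<exists>H'. okb H' (Suc N) d \<and> go (cstep B c0 X) (2 * N + 10) (repc H (c # ks, S, q)) (repc H' d)"
proof -
  have same: ?thesis if "d = (ks', S, qupd x q)" "trun c ks = {(run ks', Raw 0, 0, x)}" "\<And>b. c \<noteq> Halt b" for ks' x
    using micro_simple[OF that(2,3), where B = B and X = X and N = N and H = H and S = S and q = q and ?c0.0 = c0] that(1) assms(1) length_qupd[of x q]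
    by (intro exI[of _ H]) (auto simp del: qupd.simps)
  have okS: "okb H (Suc N) e" if "okb H N e" for e using that by (cases e) auto
  show ?thesis
  proof (cases c)
    case Skip
    show ?thesis by (rule same[of ks QNone]) (use assms(2) Skip in \<open>auto simp: astep_def\<close>)
  next
    case (Push s a)
    have "d = (ks, S(s := a # S s), q)" using assms(2) Push by (simp add: astep_def)
    then show ?thesis using micro_push[where H = H and N = N and ks = ks and S = S and q = q and s = s and a = a] assms(1) Push by simp
  next
    case (Pop s f)
    have "d = (contk c ks (hdo (S s)), S(s := tl (S s)), q)" using assms(2) Pop by (simp add: astep_def)
    then show ?thesis using micro_pop[where H = H and N = N and ks = ks and S = S and q = q and c = c and s = s and f = f] assms(1) okS Pop
      by (intro exI[of _ H]) (simp del: contk.simps)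
  next
    case (While s P f)
    have "d = (contk c ks (hdo (S s)), S(s := tl (S s)), q)" using assms(2) While
      by (simp add: astep_def del: contk.simps)
    then show ?thesis using micro_pop[where H = H and N = N and ks = ks and S = S and q = q and c = c and s = s and f = f and P = P] assms(1) okS While
      by (intro exI[of _ H]) (simp del: contk.simps)
  next
    case (Seq c1 c2)
    show ?thesis by (rule same[of "c1 # c2 # ks" QNone]) (use assms(2) Seq in \<open>auto simp: astep_def\<close>)
  next
    case (QW b)
    show ?thesis by (rule same[of ks "QWrite b"]) (use assms(2) QW in \<open>auto simp: astep_def\<close>)
  next
    case QN
    show ?thesis by (rule same[of ks "QNext"]) (use assms(2) QN in \<open>auto simp: astep_def\<close>)
  next
    case (Ask m f)
    have d: "length q = m" "d = (f (map (\<lambda>x. x \<in> X) q) # ks, S, [[]])"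
      using assms(2) Ask by (auto simp: astep_def split: if_splits)
    then show ?thesis using micro_ask[where H = H and N = N and ks = ks and S = S and q = q and m = m and f = f] assms(1) Ask by (intro exI[of _ H]) simp
  next
    case (Or c1 c2)
    then show ?thesis using assms(3) by simp
  next
    case (Halt b)
    then show ?thesis using assms(2) by (simp add: astep_def)
  qed
qed


lemma sim_step:
  assumes "okb H N c" "astep X c d"
  shows "\<exists>H'. okb H' (Suc N) d \<and> (cstep B c0 X)\<^sup>*\<^sup>* (repc H c) (repc H' d)"
proof -
  obtain k S q where c: "c = (k, S, q)" by (cases c)
  then obtain c1 ks where k: "k = c1 # ks" using assms(2) by (cases k) (auto simp: astep_def)
  show ?thesis
  proof (cases "\<exists>a b. c1 = Or a b")
    case True
    then obtain a b where o: "c1 = Or a b" by blast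
    have t: "tape H S = (tape H S)(- 1 := Raw 0)" by (simp add: tape_same_out)
    have "cstep B c0 X (repc H c) (repc H d)"
      using assms(2) t unfolding c k o
      by (auto simp: astep_def cstep_def tape_out intro!: exI[of _ "Raw 0"] exI[of _ QNone])
    moreover have "okb H (Suc N) d" using assms unfolding c k o by (auto simp: astep_def)
    ultimately show ?thesis by (intro exI[of _ H]) (auto intro: r_into_rtranclp)
  next
    case False
    then obtain H' where H': "okb H' (Suc N) d" "go (cstep B c0 X) (2 * N + 10) (repc H c) (repc H' d)"
      using micro[of H N c1 ks S q X d B c0] assms unfolding c k by auto
    then show ?thesis using af_reach[OF H'(2)] by auto
  qed
qed

text \<open>One program step costs at most \<open>2 * N + 10\<close> and raises \<open>N\<close> by
  at most one, so \<open>n\<close> steps cost a quadratic amount.\<close>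

lemma sim_af:
  "af (astep X) P n c \<Longrightarrow> okb H N c \<Longrightarrow>
    af (cstep B c0 X) (\<lambda>C. \<exists>H' c'. C = repc H' c' \<and> P c') (n * (2 * (N + n) + 10)) (repc H c)"
proof (induction n arbitrary: c H N)
  case 0
  then have "P c" by simp
  then have "\<exists>H' c'. repc H c = repc H' c' \<and> P c'" by blast
  then show ?case by (rule af_now)
next
  case (Suc n)
  let ?Q = "\<lambda>C. \<exists>H' c'. C = repc H' c' \<and> P c'"
  show ?case
  proof (cases "P c")
    case True
    then have "?Q (repc H c)" by blast
    then show ?thesis by (rule af_now)
  next
    case False
    obtain d where d: "astep X c d" "\<And>e. astep X c e \<Longrightarrow> af (astep X) P n e"
      using af_SucE[OF Suc.prems(1) False] by metis
    obtain k S q where c: "c = (k, S, q)" by (cases c)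
    then obtain c1 ks where k: "k = c1 # ks" using d(1) by (cases k) (auto simp: astep_def)
    let ?n = "n * (2 * (Suc N + n) + 10)"
    have bound: "(2 * N + 10) + ?n \<le> Suc n * (2 * (N + Suc n) + 10)" by (simp add: algebra_simps)
    have "af (cstep B c0 X) ?Q ((2 * N + 10) + ?n) (repc H c)"
    proof (cases "\<exists>a b. c1 = Or a b")
      case True
      then obtain a b where o: "c1 = Or a b" by blast
      have ok: "okb H (Suc N) (ks', S, q)" for ks' using Suc.prems(2) c by auto
      have s: "C = repc H (a # ks, S, q) \<or> C = repc H (b # ks, S, q)" if "cstep B c0 X (repc H c) C" for C
        using that unfolding c k o by (auto simp: cstep_def tape_out tape_same_out)
      have c1: "cstep B c0 X (repc H c) (repc H (a # ks, S, q))"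
        using tape_same_out[of "-1" H S, symmetric] unfolding c k o
        by (auto simp: cstep_def tape_out intro!: exI[of _ "Raw 0"] exI[of _ QNone])
      have "af (cstep B c0 X) ?Q (Suc ?n) (repc H c)"
      proof (rule af_SucI)
        show "cstep B c0 X (repc H c) (repc H (a # ks, S, q))" by (rule c1)
      next
        fix e assume e: "cstep B c0 X (repc H c) e"
        have st: "astep X c (a # ks, S, q)" "astep X c (b # ks, S, q)" unfolding c k o by (auto simp: astep_def)
        have "af (cstep B c0 X) ?Q ?n (repc H (a # ks, S, q))" "af (cstep B c0 X) ?Q ?n (repc H (b # ks, S, q))"
          by (rule Suc.IH[OF d(2)[OF st(1)] ok], rule Suc.IH[OF d(2)[OF st(2)] ok])
        with s[OF e] show "af (cstep B c0 X) ?Q ?n e" by (elim disjE) simp_all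
      qed
      then show ?thesis by (rule af_mono) simp
    next
      case False
      then obtain H' where H': "okb H' (Suc N) d" "go (cstep B c0 X) (2 * N + 10) (repc H c) (repc H' d)"
        using micro[of H N c1 ks S q X d B c0] d(1) Suc.prems(2) unfolding c k by auto
      show ?thesis by (rule go_af[OF H'(2)]) (rule Suc.IH[OF d(2)[OF d(1)] H'(1)])
    qed
    then show ?thesis using bound by (rule af_mono)
  qed
qed

lemma sim_reach:
  "(astep X)\<^sup>*\<^sup>* c d \<Longrightarrow> okb H N c \<Longrightarrow> \<exists>H' N'. okb H' N' d \<and> (cstep B c0 X)\<^sup>*\<^sup>* (repc H c) (repc H' d)"
proof (induction rule: rtranclp_induct)
  case base
  then show ?case by blast
next
  case (step y z)
  then obtain H' N' where "okb H' N' y" "(cstep B c0 X)\<^sup>*\<^sup>* (repc H c) (repc H' y)" by blast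
  with sim_step[OF this(1) step(2), of B c0] show ?case by (meson rtranclp_trans)
qed

subsection \<open>Encoding the micro-machine\<close>

text \<open>The last input symbol is on top, so cell \<open>p\<close> corresponds to input symbol
  \<open>p\<close> and loading converts the symbols in place.\<close>

definition S0 :: "nat list \<Rightarrow> store" where
  "S0 xs = (\<lambda>_. [])(0 := rev xs)"

definition itape :: "nat \<Rightarrow> nat list \<Rightarrow> int \<Rightarrow> tsym" where
  "itape j xs = (\<lambda>p. if 0 \<le> p \<and> p < int (length xs)
      then (if p < int j then Cell (v0 0 (xs ! nat p)) else Raw (xs ! nat p)) else Raw 0)"

lemma itape_0: "itape 0 xs = Raw \<circ> init_tape xs"
  by (auto simp: itape_def init_tape_def fun_eq_iff)

lemma itape_full: "itape (length xs) xs = tape (length xs) (S0 xs)"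
  by (auto simp: itape_def tape_def S0_def at_def v0_def fun_eq_iff)

lemma itape_at: "j < length xs \<Longrightarrow> itape j xs (int j) = Raw (xs ! j)"
  by (simp add: itape_def)

lemma itape_upd: "j < length xs \<Longrightarrow> (itape j xs)(int j := Cell (v0 0 (xs ! j))) = itape (Suc j) xs"
  by (auto simp: itape_def fun_eq_iff)

lemma itape_out: "itape j xs (int (length xs)) = Raw 0"
  by (simp add: itape_def)

lemma load_step:
  assumes "j < length xs" "tr B c0 q (Raw (xs ! j)) = {(q', Cell (v0 0 (xs ! j)), 1, QNone)}"
    "af (cstep B c0 X) P n (q', itape (Suc j) xs, int (Suc j), qs)"
  shows "af (cstep B c0 X) P (Suc n) (q, itape j xs, int j, qs)"
  by (rule cs1[where q' = q' and b = "Cell (v0 0 (xs ! j))" and dd = 1 and x = QNone])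
     (use assms in \<open>simp_all add: itape_at itape_upd add.commute\<close>)

lemma load_word:
  assumes "\<And>i. i < length u \<Longrightarrow> u ! i \<noteq> 0 \<and> u ! i \<noteq> 3"
  shows "n \<le> length u \<Longrightarrow> go (cstep B c0 X) n (Init0, itape (length u - n) (u @ v), int (length u - n), qs)
     (Init0, itape (length u) (u @ v), int (length u), qs)"
proof (induction n)
  case (Suc n)
  then have lt: "length u - Suc n < length u" by simp
  show ?case
    by (rule load_step[where q' = Init0])
       (use Suc lt assms[OF lt] in \<open>simp_all add: nth_append Suc_diff_Suc\<close>)
qed simp

lemma load_tail:
  "(\<And>i. i < length xs \<Longrightarrow> xs ! i \<noteq> 0) \<Longrightarrow> n \<le> b \<Longrightarrow> j + n \<le> length xs \<Longrightarrow>
    go (cstep B c0 X) n (Init1 b, itape j xs, int j, qs) (Init1 (b - n), itape (j + n) xs, int (j + n), qs)"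
proof (induction n arbitrary: b j)
  case (Suc n)
  show ?case
  proof (rule load_step[where q' = "Init1 (b - 1)"])
    show "go (cstep B c0 X) n (Init1 (b - 1), itape (Suc j) xs, int (Suc j), qs)
      (Init1 (b - Suc n), itape (j + Suc n) xs, int (j + Suc n), qs)"
      using Suc.IH[of "b - 1" "Suc j"] Suc.prems by simp
  qed (use Suc.prems(1)[of j] Suc.prems(2,3) in auto)
qed simp

lemma load_end:
  assumes "q = Init0 \<or> q = Init1 b"
  shows "go (cstep B c0 X) (length xs + 3) (q, itape (length xs) xs, int (length xs), qs)
      (repc (length xs) ([c0], S0 xs, qs))"
proof -
  let ?l = "length xs"
  have "go (cstep B c0 X) (?l + 1) (Home [c0], tape ?l (S0 xs), int ?l - 1, qs) (run [c0], tape ?l (S0 xs), -1, qs)"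
    by (rule home) simp
  then have "go (cstep B c0 X) (Suc (?l + 1)) (q, itape ?l xs, int ?l, qs) (repc ?l ([c0], S0 xs, qs))"
    by (intro cs1[where q' = "Home [c0]" and b = "Raw 0" and dd = "-1" and x = QNone])
       (use assms in \<open>auto simp: itape_out fun_upd_idem itape_full tape_out tape_same_out\<close>)
  then show ?thesis by (rule af_mono) simp
qed

lemma load_enc:
  assumes "\<And>i. i < length u \<Longrightarrow> u ! i \<noteq> 0 \<and> u ! i \<noteq> 3" "\<And>i. i < length v \<Longrightarrow> v ! i \<noteq> 0"
    "xs = u \<or> (xs = u @ 3 # v \<and> length v \<le> B)"
  shows "go (cstep B c0 X) (2 * length xs + 3) (Init0, Raw \<circ> init_tape xs, 0, qs)
      (repc (length xs) ([c0], S0 xs, qs))"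
  using assms(3)
proof
  assume "xs = u"
  then have "go (cstep B c0 X) (length xs) (Init0, itape 0 xs, 0, qs) (Init0, itape (length xs) xs, int (length xs), qs)"
    using load_word[OF assms(1), of "length u" B c0 X "[]" qs] by simp
  note g1 = this
  have g2: "go (cstep B c0 X) (length xs + 3) (Init0, itape (length xs) xs, int (length xs), qs)
      (repc (length xs) ([c0], S0 xs, qs))" by (rule load_end) simp
  have "length xs + (length xs + 3) = 2 * length xs + 3" by simp
  then show ?thesis using go_af[OF g1 g2] by (simp only: itape_0)
next
  assume x: "xs = u @ 3 # v \<and> length v \<le> B"
  then have l: "length xs = length u + Suc (length v)" by simp
  have nz: "xs ! i \<noteq> 0" if "i < length xs" for i
    using assms(1)[of i] assms(2)[of "i - Suc (length u)"] that x by (auto simp: nth_append nth_Cons')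
  have g1: "go (cstep B c0 X) (length u) (Init0, itape 0 xs, 0, qs) (Init0, itape (length u) xs, int (length u), qs)"
    using load_word[OF assms(1), of "length u" B c0 X "3 # v" qs] x by simp
  have g2: "go (cstep B c0 X) (length v) (Init1 B, itape (Suc (length u)) xs, int (Suc (length u)), qs)
      (Init1 (B - length v), itape (length xs) xs, int (length xs), qs)"
    using load_tail[OF nz, of "length v" B "Suc (length u)" B c0 X qs] x by simp
  have g3: "go (cstep B c0 X) (length xs + 3) (Init1 (B - length v), itape (length xs) xs, int (length xs), qs)
      (repc (length xs) ([c0], S0 xs, qs))" by (rule load_end) simp
  have g4: "go (cstep B c0 X) (Suc (length v + (length xs + 3))) (Init0, itape (length u) xs, int (length u), qs)
      (repc (length xs) ([c0], S0 xs, qs))"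
    by (rule load_step[where q' = "Init1 B", OF _ _ go_af[OF g2 g3]]) (use x in auto)
  have "length u + Suc (length v + (length xs + 3)) = 2 * length xs + 3" using l by simp
  then show ?thesis using go_af[OF g1 g4] by (simp only: itape_0)
qed

text \<open>The machine stops at the first symbol beyond the \<open>B\<close> allowed ones, which is
  why the bound does not mention \<open>length v\<close>.\<close>

lemma load_long:
  assumes "\<And>i. i < length u \<Longrightarrow> u ! i \<noteq> 0 \<and> u ! i \<noteq> 3" "\<And>i. i < length v \<Longrightarrow> v ! i \<noteq> 0" "B < length v"
  shows "af (cstep B c0 X) (\<lambda>C. fst C = Rej) (length u + B + 2) (Init0, Raw \<circ> init_tape (u @ 3 # v), 0, qs)"
proof -
  let ?xs = "u @ 3 # v"
  have nz: "?xs ! i \<noteq> 0" if "i < length ?xs" for i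
    using assms(1)[of i] assms(2)[of "i - Suc (length u)"] that by (auto simp: nth_append nth_Cons')
  have g1: "go (cstep B c0 X) (length u) (Init0, itape 0 ?xs, 0, qs) (Init0, itape (length u) ?xs, int (length u), qs)"
    using load_word[OF assms(1), of "length u" B c0 X "3 # v" qs] by simp
  have g2: "go (cstep B c0 X) B (Init1 B, itape (Suc (length u)) ?xs, int (Suc (length u)), qs)
      (Init1 0, itape (Suc (length u) + B) ?xs, int (Suc (length u) + B), qs)"
    using load_tail[OF nz, of B B "Suc (length u)" B c0 X qs] assms(3) by simp
  let ?j = "Suc (length u) + B"
  have j: "?j < length ?xs" using assms(3) by simp
  have g3: "af (cstep B c0 X) (\<lambda>C. fst C = Rej) (Suc 0) (Init1 0, itape ?j ?xs, int ?j, qs)"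
    by (rule cs1[where q' = Rej and b = "Raw (?xs ! ?j)" and dd = 0 and x = QNone])
       (use j nz[OF j] in \<open>simp_all only: itape_at\<close>, simp_all)
  have "af (cstep B c0 X) (\<lambda>C. fst C = Rej) (Suc (B + Suc 0)) (Init0, itape (length u) ?xs, int (length u), qs)"
    by (rule load_step[where q' = "Init1 B", OF _ _ go_af[OF g2 g3]]) auto
  from go_af[OF g1 this] show ?thesis by (simp add: itape_0 del: repc.simps)
qed

section \<open>The finitely many states and symbols in use, and what can follow a query
  round\<close>

fun isask :: "com \<Rightarrow> bool" where
  "isask (Ask m f) = True" | "isask c = False"

fun ispop :: "com \<Rightarrow> bool" where
  "ispop (Pop s f) = True" | "ispop (While s P f) = True" | "ispop c = False"

locale compiled =
  fixes A K k :: nat and d :: bool and c0 :: com and B :: nat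
  assumes A4: "4 \<le> A" and K1: "1 \<le> K" and wf: "wfc A K k d c0"
begin

abbreviation "CK \<equiv> conts A c0"

text \<open>Together with \<open>oksym\<close> an invariant of \<open>tr\<close> that cuts the
  infinite types of states and symbols down to finite sets.\<close>

fun okst :: "ms \<Rightarrow> bool" where
  "okst (Init1 j) = (j \<le> B)"
| "okst (Run ks) = (ks \<in> CK)"
| "okst (Home ks) = (ks \<in> CK)"
| "okst (Psh s a ks) = (Push s a # ks \<in> CK)"
| "okst (Pp c ks) = (c # ks \<in> CK \<and> ispop c)"
| "okst (Pq c ks) = (c # ks \<in> CK \<and> ispop c)"
| "okst (AskL j c ks) = (c # ks \<in> CK \<and> isask c \<and> j \<le> askm c)"
| "okst (Rd j c ks bs) = (c # ks \<in> CK \<and> isask c \<and> j + length bs = askm c)"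
| "okst q = True"

fun oksym :: "tsym \<Rightarrow> bool" where
  "oksym (Raw r) = (r < 4)"
| "oksym (Cell v) = (\<forall>s. v s \<le> A \<and> (s \<ge> K \<longrightarrow> v s = 0))"
| "oksym (Sav c ks) = (c # ks \<in> CK \<and> isask c)"

lemma okst_run: "ks \<in> CK \<Longrightarrow> okst (run ks)"
  by (cases ks rule: run.cases) auto

lemma ck_wf: "c # ks \<in> CK \<Longrightarrow> wfc A K k d c"
  using conts_wfc[OF _ wf] by fastforce

lemma ck_nx: "c # ks \<in> CK \<Longrightarrow> e \<in> nx A c \<Longrightarrow> ks' = e @ ks \<Longrightarrow> ks' \<in> CK"
  using conts_closed by blast

lemma ck0: "c # ks \<in> CK \<Longrightarrow> [] \<in> nx A c \<Longrightarrow> ks \<in> CK"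
  using ck_nx[of c ks "[]"] by simp

lemma ck1: "c # ks \<in> CK \<Longrightarrow> [e] \<in> nx A c \<Longrightarrow> e # ks \<in> CK"
  using ck_nx[of c ks "[e]"] by simp

lemma ck2: "c # ks \<in> CK \<Longrightarrow> [e, e'] \<in> nx A c \<Longrightarrow> e # e' # ks \<in> CK"
  using ck_nx[of c ks "[e, e']"] by simp

lemma contk_CK: "c # ks \<in> CK \<Longrightarrow> ispop c \<Longrightarrow> x \<in> opts A \<Longrightarrow> contk c ks x \<in> CK"
  by (cases c) (auto intro: ck0 ck1 ck2)

lemma trun_ok: "c # ks \<in> CK \<Longrightarrow> (q', b, dd, x) \<in> trun c ks \<Longrightarrow> okst q' \<and> oksym b \<and> dd \<in> {-1, 0, 1}"
  by (cases c) (auto intro!: okst_run intro: ck0 ck1 ck2)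

lemma v0_ok: "r < 4 \<Longrightarrow> oksym (Cell (v0 0 r))"
  using A4 K1 by (auto simp: v0_def)

lemma tr_ok:
  assumes "okst q" "oksym a" "(q', b, dd, x) \<in> tr B c0 q a"
  shows "okst q' \<and> oksym b \<and> dd \<in> {-1, 0, 1}"
proof -
  have c0: "[c0] \<in> CK" by (rule conts_self)
  note d = if_splits
  show ?thesis
  proof (cases q)
    case Init0
    then show ?thesis using assms c0 v0_ok by (cases a) (auto split: d simp del: oksym.simps(2))
  next
    case (Init1 j)
    then show ?thesis using assms c0 v0_ok by (cases a) (auto split: d simp del: oksym.simps(2))
  next
    case (Run ks)
    then show ?thesis using assms trun_ok by (cases a; cases ks) (auto split: d)
  next
    case (Home ks)
    then show ?thesis using assms okst_run by (cases a) (auto split: d)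
  next
    case (Psh s a' ks)
    then have "s < K" "a' < A" "ks \<in> CK"
      using assms(1) ck_wf[of "Push s a'" ks] ck0[of "Push s a'" ks] by auto
    then show ?thesis using Psh assms by (cases a) (auto split: d simp: v0_def)
  next
    case (Pp c ks)
    then show ?thesis using assms by (cases a) (auto split: d)
  next
    case (Pq c ks)
    show ?thesis
    proof (cases a)
      case (Raw r)
      have "None \<in> opts A" by (simp add: opts_def)
      then show ?thesis using Pq Raw assms contk_CK[of c ks None] by (auto split: d intro!: okst_run)
    next
      case (Cell v)
      have "Some (v (pst c) - 1) \<in> opts A" if "v (pst c) \<noteq> 0"
      proof -
        have "v (pst c) \<le> A" using Cell assms(2) by simp
        then show ?thesis using that by (auto simp: opts_def)
      qed
      then show ?thesis using Pq Cell assms contk_CK[of c ks "Some (v (pst c) - 1)"] by (auto split: d)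
    qed (use Pq assms in simp)
  next
    case (AskL j c ks)
    then show ?thesis using assms by (cases a) (auto split: d)
  next
    case RetS
    then show ?thesis using assms by (cases a) auto
  next
    case Ret2
    then show ?thesis using assms by (cases a) auto
  next
    case (Rd j c ks bs)
    then have c: "c # ks \<in> CK" "isask c" "j + length bs = askm c" using assms(1) by auto
    have "askf c bs # ks \<in> CK" if "j = 0"
    proof (cases c)
      case (Ask m f)
      show ?thesis using c that Ask by (auto intro: ck1)
    qed (use c(2) in simp_all)
    then show ?thesis using Rd assms by (cases a) (auto split: d intro!: okst_run)
  qed (use assms in \<open>cases a; simp\<close>)+
qed

lemma finite_CK: "finite CK"
  by (rule finite_conts)

lemma finite_okst: "finite {q. okst q}"
proof -
  let ?L = "\<Union>l \<in> CK. (\<lambda>j. AskL j (hd l) (tl l)) ` {..askm (hd l)}"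
  let ?R = "\<Union>l \<in> CK. \<Union>j \<in> {..askm (hd l)}. (\<lambda>bs. Rd j (hd l) (tl l) bs) ` {bs. length bs = askm (hd l) - j}"
  let ?P = "(\<lambda>l. case l of Push s a # ks \<Rightarrow> Psh s a ks | _ \<Rightarrow> Acc) ` CK"
  have "{q. okst q} \<subseteq> {Init0, Acc, Rej, AskS, RetS, Ret2} \<union> Init1 ` {..B} \<union> Run ` CK \<union> Home ` CK \<union> ?P
      \<union> (\<lambda>l. Pp (hd l) (tl l)) ` CK \<union> (\<lambda>l. Pq (hd l) (tl l)) ` CK \<union> ?L \<union> ?R"
  proof
    fix q assume "q \<in> {q. okst q}"
    then have q: "okst q" by simp
    show "q \<in> {Init0, Acc, Rej, AskS, RetS, Ret2} \<union> Init1 ` {..B} \<union> Run ` CK \<union> Home ` CK \<union> ?P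
      \<union> (\<lambda>l. Pp (hd l) (tl l)) ` CK \<union> (\<lambda>l. Pq (hd l) (tl l)) ` CK \<union> ?L \<union> ?R"
    proof (cases q)
      case (Psh s a ks)
      then have "q \<in> ?P" using q by (intro image_eqI[where x = "Push s a # ks"]) auto
      then show ?thesis by blast
    next
      case (Pp c ks)
      then have "q \<in> (\<lambda>l. Pp (hd l) (tl l)) ` CK" using q by (intro image_eqI[where x = "c # ks"]) auto
      then show ?thesis by blast
    next
      case (Pq c ks)
      then have "q \<in> (\<lambda>l. Pq (hd l) (tl l)) ` CK" using q by (intro image_eqI[where x = "c # ks"]) auto
      then show ?thesis by blast
    next
      case (AskL j c ks)
      then have "q \<in> ?L" using q by (intro UN_I[where a = "c # ks"]) auto
      then show ?thesis by blast
    next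
      case (Rd j c ks bs)
      then have "q \<in> ?R" using q by (intro UN_I[where a = "c # ks"] UN_I[where a = j]) auto
      then show ?thesis by blast
    qed (use q in auto)
  qed
  then show ?thesis
    by (rule finite_subset) (auto simp: finite_CK finite_bools)
qed

lemma finite_oksym: "finite {a. oksym a}"
proof -
  have sub: "{a. oksym a} \<subseteq> Raw ` {..<4} \<union> Cell ` {v. \<forall>s. (s \<in> {..<K} \<longrightarrow> v s \<in> {..A}) \<and> (s \<notin> {..<K} \<longrightarrow> v s = 0)}
     \<union> (\<lambda>l. Sav (hd l) (tl l)) ` CK"
  proof
    fix a assume "a \<in> {a. oksym a}"
    then have a: "oksym a" by simp
    show "a \<in> Raw ` {..<4} \<union> Cell ` {v. \<forall>s. (s \<in> {..<K} \<longrightarrow> v s \<in> {..A}) \<and> (s \<notin> {..<K} \<longrightarrow> v s = 0)}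
     \<union> (\<lambda>l. Sav (hd l) (tl l)) ` CK"
    proof (cases a)
      case (Sav c ks)
      then have "a \<in> (\<lambda>l. Sav (hd l) (tl l)) ` CK" using a by (intro image_eqI[where x = "c # ks"]) auto
      then show ?thesis by blast
    qed (use a in auto)
  qed
  have fin: "finite {v :: nat \<Rightarrow> nat. \<forall>s. (s \<in> {..<K} \<longrightarrow> v s \<in> {..A}) \<and> (s \<notin> {..<K} \<longrightarrow> v s = 0)}"
    by (rule finite_set_of_finite_funs) auto
  show ?thesis
    by (rule finite_subset[OF sub]) (use fin finite_CK in auto)
qed


text \<open>Only \<open>Or\<close> offers two transitions, and the flag \<open>d\<close> excludes
  it.\<close>

lemma tr_det:
  assumes d "okst q" "t1 \<in> tr B c0 q a" "t2 \<in> tr B c0 q a"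
  shows "t1 = t2"
proof (cases q)
  case (Run ks)
  show ?thesis
  proof (cases ks)
    case (Cons c ks')
    then have "wfc A K k d c" using assms(2) Run ck_wf by simp
    then have "\<And>c1 c2. c \<noteq> Or c1 c2" using assms(1) by auto
    then show ?thesis using assms(3,4) Run Cons by (cases a; cases c) (auto split: if_splits)
  qed (use Run assms in \<open>cases a; simp\<close>)
qed (use assms in \<open>cases a; auto split: if_splits\<close>)+

fun okc :: "mcfg \<Rightarrow> bool" where
  "okc (q, t, h, qs) = (okst q \<and> (\<forall>p. oksym (t p)))"

lemma cstep_ok: "okc C \<Longrightarrow> cstep B c0 X C D \<Longrightarrow> okc D"
proof -
  assume a: "okc C" "cstep B c0 X C D"
  obtain q t h qs q' t' h' qs' where C: "C = (q, t, h, qs)" and D: "D = (q', t', h', qs')"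
    by (cases C, cases D)
  have ok: "okst q" "\<And>p. oksym (t p)" using a(1) C by auto
  show ?thesis
  proof (cases "q = AskS")
    case True
    then have "q' = RetS" "t' = write_raw t h (map (\<lambda>x. x \<in> X) qs)" using a(2) unfolding C D cstep_def by auto
    then show ?thesis using ok unfolding D by (auto simp: write_raw_def sym_of_bit_def)
  next
    case False
    then obtain b dd x where b: "(q', b, dd, x) \<in> tr B c0 q (t h)" "t' = t(h := b)"
      using a(2) unfolding C D cstep_def by auto
    have "okst q' \<and> oksym b" using tr_ok[OF ok(1) ok(2)[of h] b(1)] by simp
    then show ?thesis using ok(2) b(2) unfolding D by simp
  qed
qed

text \<open>The states that can follow a query round when \<open>d\<close> holds: by
  \<open>wfc\<close>, every continuation of an \<open>Ask\<close> is then a \<open>Halt\<close>, so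
  the control never returns to a \<open>Run\<close> state.\<close>

fun good :: "ms \<Rightarrow> bool" where
  "good RetS = True" | "good Ret2 = True" | "good Acc = True" | "good Rej = True"
| "good (Rd j c ks bs) = True" | "good q = False"

lemma good_step:
  assumes d "okc C" "good (fst C)" "cstep B c0 X C D"
  shows "good (fst D)"
proof -
  obtain q t h qs q' t' h' qs' where C: "C = (q, t, h, qs)" and D: "D = (q', t', h', qs')"
    by (cases C, cases D)
  have "q \<noteq> AskS" using assms(3) C by auto
  then obtain b dd x where b: "(q', b, dd, x) \<in> tr B c0 q (t h)"
    using assms(4) unfolding C D cstep_def by auto
  have "good q'"
  proof (cases q)
    case (Rd j c ks bs)
    have q: "c # ks \<in> CK" "isask c" "j + length bs = askm c" using assms(2) unfolding C Rd by auto
    have r: "\<exists>b. askf c bs = Halt b" if "j = 0"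
      using ck_wf[OF q(1)] q that assms(1) by (cases c) auto
    show ?thesis
    proof (cases "j = 0")
      case True
      then obtain b' where "askf c bs = Halt b'" using r by blast
      then show ?thesis using b Rd True by (cases "t h"; cases b') (auto split: if_splits)
    next
      case False
      then show ?thesis using b Rd by (cases "t h") auto
    qed
  qed (use b assms(3) C in \<open>cases "t h"; auto\<close>)+
  then show ?thesis using D by simp
qed

lemma good_reach:
  assumes "(cstep B c0 X)\<^sup>*\<^sup>* C D" d "okc C" "good (fst C)"
  shows "okc D \<and> good (fst D)"
  using assms(1)
proof (induction rule: rtranclp_induct)
  case base
  then show ?case using assms by simp
next
  case (step y z)
  then show ?case using cstep_ok good_step assms(2) by blast
qed

end

section \<open>Transfer to a machine whose states and symbols are numbers\<close>

locale coded = compiled +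
  fixes e :: "ms \<Rightarrow> nat" and g :: "tsym \<Rightarrow> nat"
  assumes einj: "inj_on e {q. okst q}" and ginj: "inj_on g {a. oksym a}"
    and graw: "\<And>r. r < 4 \<Longrightarrow> g (Raw r) = r"
begin

lemma eD: "e q = e q' \<Longrightarrow> okst q \<Longrightarrow> okst q' \<Longrightarrow> q = q'"
  using einj by (auto simp: inj_on_def)

lemma gD: "g a = g b \<Longrightarrow> oksym a \<Longrightarrow> oksym b \<Longrightarrow> a = b"
  using ginj by (auto simp: inj_on_def)

definition M0 :: otm where
  "M0 = \<lparr>delta = (\<lambda>((q, a), (q', b, dd, x)). (e q, g a, e q', g b, dd, x)) `
            (SIGMA p : {q. okst q} \<times> {a. oksym a}. tr B c0 (fst p) (snd p)),
         start = e Init0, acc = e Acc, rej = e Rej, ask = e AskS, ret = e RetS\<rparr>"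

lemma in_delta: "tt \<in> delta M0 \<longleftrightarrow> (\<exists>q a q' b dd x. okst q \<and> oksym a \<and> (q', b, dd, x) \<in> tr B c0 q a
     \<and> tt = (e q, g a, e q', g b, dd, x))"
  unfolding M0_def by (force simp: image_iff)

lemma spec_states [simp]:
  "start M0 = e Init0" "acc M0 = e Acc" "rej M0 = e Rej" "ask M0 = e AskS" "ret M0 = e RetS"
  by (simp_all add: M0_def)

lemma finite_delta: "finite (delta M0)"
proof -
  have "finite (SIGMA p : {q. okst q} \<times> {a. oksym a}. tr B c0 (fst p) (snd p))"
    using finite_okst finite_oksym finite_tr by (intro finite_SigmaI) auto
  then show ?thesis unfolding M0_def by simp
qed

lemma wf_M0: "wf_otm M0"
proof -
  have ne: "e Acc \<noteq> e Rej" "e AskS \<noteq> e Acc" "e AskS \<noteq> e Rej" "e RetS \<noteq> e AskS"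
    using eD[of Acc Rej] eD[of AskS Acc] eD[of AskS Rej] eD[of RetS AskS] by auto
  have "dd \<in> {-1, 0, 1} \<and> u \<noteq> e Acc \<and> u \<noteq> e Rej \<and> u \<noteq> e AskS"
    if tt: "(u, a, u', b, dd, x) \<in> delta M0" for u a u' b dd x
  proof -
    obtain q a' q' b' where q: "okst q" "oksym a'" "(q', b', dd, x) \<in> tr B c0 q a'" "u = e q"
      using tt unfolding in_delta by auto
    have "q \<noteq> Acc" "q \<noteq> Rej" "q \<noteq> AskS" using q(3) by auto
    then have "u \<noteq> e Acc \<and> u \<noteq> e Rej \<and> u \<noteq> e AskS"
      using eD[of q Acc] eD[of q Rej] eD[of q AskS] q(1,4) by auto
    then show ?thesis using tr_ok[OF q(1-3)] by blast
  qed
  then have "\<forall>(u, a, u', b, dd, x) \<in> delta M0. dd \<in> {-1, 0, 1} \<and> u \<noteq> e Acc \<and> u \<noteq> e Rej \<and> u \<noteq> e AskS"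
    by (intro ballI, clarify) blast
  then show ?thesis unfolding wf_otm_def using ne finite_delta by simp
qed

lemma det_M0: "d \<Longrightarrow> deterministic M0"
  unfolding deterministic_def
proof (intro ballI impI)
  fix t1 t2 assume d and t: "t1 \<in> delta M0" "t2 \<in> delta M0" "fst t1 = fst t2 \<and> fst (snd t1) = fst (snd t2)"
  obtain q1 a1 q1' b1 d1 x1 where 1: "okst q1" "oksym a1" "(q1', b1, d1, x1) \<in> tr B c0 q1 a1"
     "t1 = (e q1, g a1, e q1', g b1, d1, x1)" using t(1) unfolding in_delta by blast
  obtain q2 a2 q2' b2 d2 x2 where 2: "okst q2" "oksym a2" "(q2', b2, d2, x2) \<in> tr B c0 q2 a2"
     "t2 = (e q2, g a2, e q2', g b2, d2, x2)" using t(2) unfolding in_delta by blast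
  have "q1 = q2" "a1 = a2" using 1 2 t(3) eD[of q1 q2] gD[of a1 a2] by auto
  then have "(q1', b1, d1, x1) = (q2', b2, d2, x2)" using tr_det[OF \<open>d\<close> 1(1,3)] 2(3) by auto
  then show "t1 = t2" using 1(4) 2(4) \<open>q1 = q2\<close> \<open>a1 = a2\<close> by simp
qed

fun phi :: "mcfg \<Rightarrow> cfg" where
  "phi (q, t, h, qs) = (e q, g \<circ> t, h, qs)"

lemma fst_phi: "fst (phi C) = e (fst C)"
  by (cases C) simp

text \<open>Relies on \<open>graw\<close>: the oracle step of the machine model writes answers in
  its own coding, which the numbering of raw symbols has to respect.\<close>

lemma g_write: "g \<circ> write_raw t h ans = write_answers (g \<circ> t) h ans"
  by (auto simp: write_raw_def write_answers_def fun_eq_iff graw sym_of_bit_def)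

lemma step_fwd:
  assumes "okc C" "cstep B c0 X C D"
  shows "step M0 X (phi C) (phi D)"
proof -
  obtain q t h qs q' t' h' qs' where C: "C = (q, t, h, qs)" and D: "D = (q', t', h', qs')"
    by (cases C, cases D)
  have ok: "okst q" "\<And>p. oksym (t p)" using assms(1) C by auto
  show ?thesis
  proof (cases "q = AskS")
    case True
    then show ?thesis using assms(2) unfolding C D cstep_def step_def by (auto simp: g_write)
  next
    case False
    then obtain b dd x where b: "(q', b, dd, x) \<in> tr B c0 q (t h)" "t' = t(h := b)" "h' = h + dd" "qs' = qupd x qs"
      using assms(2) unfolding C D cstep_def by auto
    have "q \<noteq> Acc" "q \<noteq> Rej" using b(1) by auto
    then have ne: "e q \<noteq> e Acc" "e q \<noteq> e Rej" "e q \<noteq> e AskS" using eD[of q Acc] eD[of q Rej] eD[of q AskS] ok(1) False by auto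
    have "(e q, g (t h), e q', g b, dd, x) \<in> delta M0" unfolding in_delta using ok b(1) by blast
    moreover have "g \<circ> t' = (g \<circ> t)(h := g b)" using b(2) by (auto simp: fun_eq_iff)
    ultimately show ?thesis using ne b(3,4) unfolding C D step_def by auto
  qed
qed

text \<open>The existing micro step \<open>D0\<close> carries the side condition on the saved
  continuation and the number of queries; at the query state the real machine moves without
  it.\<close>

lemma step_bwd:
  assumes "okc C" "cstep B c0 X C D0" "step M0 X (phi C) Y"
  shows "\<exists>D. cstep B c0 X C D \<and> Y = phi D"
proof -
  obtain q t h qs where C: "C = (q, t, h, qs)" by (cases C)
  obtain y t' h' qs' where Y: "Y = (y, t', h', qs')" by (cases Y)
  have ok: "okst q" "\<And>p. oksym (t p)" using assms(1) C by auto
  show ?thesis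
  proof (cases "q = AskS")
    case True
    let ?D = "(RetS, write_raw t h (map (\<lambda>x. x \<in> X) qs), h, [[]])"
    have "cstep B c0 X C ?D" using assms(2) True unfolding C cstep_def by auto
    moreover have "Y = phi ?D" using assms(3) True unfolding C Y step_def by (auto simp: g_write)
    ultimately show ?thesis by blast
  next
    case False
    then have "e q \<noteq> e AskS" using eD[of q AskS] ok(1) by auto
    then obtain b dd x where b: "(e q, g (t h), y, b, dd, x) \<in> delta M0" "t' = (g \<circ> t)(h := b)" "h' = h + dd" "qs' = qupd x qs"
      using assms(3) unfolding C Y step_def by auto
    then obtain q1 a1 q' b' where 1: "okst q1" "oksym a1" "(q', b', dd, x) \<in> tr B c0 q1 a1"
      "e q1 = e q" "g a1 = g (t h)" "y = e q'" "b = g b'" unfolding in_delta by auto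
    then have "q1 = q" "a1 = t h" using eD[of q1 q] gD[of a1 "t h"] ok by auto
    then have "cstep B c0 X C (q', t(h := b'), h + dd, qupd x qs)" using 1(3) unfolding C cstep_def by auto
    moreover have "Y = phi (q', t(h := b'), h + dd, qupd x qs)"
      using b 1 unfolding Y by (auto simp: fun_eq_iff)
    ultimately show ?thesis by blast
  qed
qed

lemma halt_stuck: "fst D \<in> {Acc, Rej} \<Longrightarrow> \<not> step M0 X (phi D) Y"
  using eD[of Acc AskS] eD[of Rej AskS] by (cases D, cases Y) (auto simp: step_def)

lemma cstep_halt_stuck: "fst D \<in> {Acc, Rej} \<Longrightarrow> \<not> cstep B c0 X D Y"
  by (cases D, cases Y) (auto simp: cstep_def)

lemma real_af: "af (cstep B c0 X) P n C \<Longrightarrow> okc C \<Longrightarrow> af (step M0 X) (\<lambda>Y. \<exists>D. Y = phi D \<and> P D) n (phi C)"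
proof (induction n arbitrary: C)
  case 0
  then have "P C" by simp
  then have "\<exists>D. phi C = phi D \<and> P D" by blast
  then show ?case by (rule af_now)
next
  case (Suc n)
  show ?case
  proof (cases "P C")
    case True
    then have "\<exists>D. phi C = phi D \<and> P D" by blast
    then show ?thesis by (rule af_now)
  next
    case False
    obtain D where D: "cstep B c0 X C D" "\<And>e. cstep B c0 X C e \<Longrightarrow> af (cstep B c0 X) P n e"
      using af_SucE[OF Suc.prems(1) False] by metis
    show ?thesis
    proof (rule af_SucI)
      show "step M0 X (phi C) (phi D)" by (rule step_fwd[OF Suc.prems(2) D(1)])
      fix Y assume "step M0 X (phi C) Y"
      then obtain D' where D': "cstep B c0 X C D'" "Y = phi D'" using step_bwd[OF Suc.prems(2) D(1)] by blast
      show "af (step M0 X) (\<lambda>Y. \<exists>D. Y = phi D \<and> P D) n Y"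
        unfolding D'(2) by (rule Suc.IH[OF D(2)[OF D'(1)] cstep_ok[OF Suc.prems(2) D'(1)]])
    qed
  qed
qed

lemma real_fwd: "(cstep B c0 X)\<^sup>*\<^sup>* C D \<Longrightarrow> okc C \<Longrightarrow> (step M0 X)\<^sup>*\<^sup>* (phi C) (phi D) \<and> okc D"
proof (induction rule: rtranclp_induct)
  case (step y z)
  then have "step M0 X (phi y) (phi z)" using step_fwd by blast
  then show ?case using step cstep_ok by (meson rtranclp.rtrancl_into_rtrancl)
qed simp

text \<open>The remaining budget of \<open>af\<close> is carried along because it provides, before
  every halting configuration, the micro step that \<open>step_bwd\<close> asks for.\<close>

lemma real_bwd:
  assumes "(step M0 X)\<^sup>*\<^sup>* (phi C) Y" "af (cstep B c0 X) P n C" "okc C" "\<And>D. P D \<Longrightarrow> fst D \<in> {Acc, Rej}"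
  shows "\<exists>D n. Y = phi D \<and> okc D \<and> (cstep B c0 X)\<^sup>*\<^sup>* C D \<and> af (cstep B c0 X) P n D"
  using assms(1)
proof (induction rule: rtranclp_induct)
  case base
  then show ?case using assms(2,3) by blast
next
  case (step y z)
  then obtain D n where D: "y = phi D" "okc D" "(cstep B c0 X)\<^sup>*\<^sup>* C D" "af (cstep B c0 X) P n D" by blast
  have nP: "\<not> P D" using halt_stuck[OF assms(4)] step(2) D(1) by blast
  then obtain m where n: "n = Suc m" using D(4) by (cases n) auto
  obtain D0 where D0: "cstep B c0 X D D0" "\<And>e. cstep B c0 X D e \<Longrightarrow> af (cstep B c0 X) P m e"
    using af_SucE[OF D(4)[unfolded n] nP] by metis
  obtain D' where D': "cstep B c0 X D D'" "z = phi D'" using step_bwd[OF D(2) D0(1)] step(2) D(1) by blast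
  have "(cstep B c0 X)\<^sup>*\<^sup>* C D'" using D(3) D'(1) by (rule rtranclp.rtrancl_into_rtrancl)
  then show ?case using D0(2)[OF D'(1)] cstep_ok[OF D(2) D'(1)] D'(2) by blast
qed


lemma final_state: "C = repc H c \<Longrightarrow> fin c \<Longrightarrow> fst C \<in> {Acc, Rej} \<and> (fst C = Acc \<longleftrightarrow> accf c)"
  by (cases c rule: fin.cases) (auto simp: fun_eq_iff split: if_splits)

lemma init_phi: "set xs \<subseteq> {..<4} \<Longrightarrow> init_cfg M0 xs = phi (Init0, Raw \<circ> init_tape xs, 0, [[]])"
  by (auto simp: init_cfg_def init_tape_def fun_eq_iff graw subset_iff)

lemma init_okc: "set xs \<subseteq> {..<4} \<Longrightarrow> okc (Init0, Raw \<circ> init_tape xs, 0, [[]])"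
  by (auto simp: init_tape_def subset_iff)

lemma accepts_reach: "accepts M X xs \<longleftrightarrow> (\<exists>Y. (step M X)\<^sup>*\<^sup>* (init_cfg M xs) Y \<and> fst Y = acc M)"
  unfolding accepts_def by (metis rtranclp_power)

lemma machine_dec:
  assumes u: "\<And>i. i < length u \<Longrightarrow> u ! i \<noteq> 0 \<and> u ! i \<noteq> 3" and v: "\<And>i. i < length v \<Longrightarrow> v ! i \<noteq> 0"
    and xs: "xs = u \<or> (xs = u @ 3 # v \<and> length v \<le> B)" "set xs \<subseteq> {..<4}"
    and dec: "dec X n ([c0], S0 xs, [[]]) b"
  defines "T \<equiv> 2 * length xs + 3 + n * (2 * (Suc (length xs) + n) + 10)"
  shows "halts_within M0 X T xs \<and> (accepts M0 X xs \<longleftrightarrow> b) \<and> (d \<longrightarrow> one_round M0 X k xs)"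
proof -
  \<comment> \<open>Only this direction of the verdict can be attached to every halting
    configuration: when \<open>b\<close> holds, some run accepts, but others may reject.\<close>
  let ?P = "\<lambda>c. fin c \<and> (accf c \<longrightarrow> b)"
  let ?C0 = "(Init0, Raw \<circ> init_tape xs, 0, [[]]) :: mcfg"
  let ?a0 = "([c0], S0 xs, [[]]) :: acfg"
  let ?Q = "\<lambda>C. \<exists>H' c'. C = repc H' c' \<and> ?P c'"
  note ok0 = init_okc[OF xs(2)] and ip = init_phi[OF xs(2)]
  have okb: "okb (length xs) (Suc (length xs)) ?a0" by (auto simp: S0_def)
  have "af (astep X) (\<lambda>c. fin c \<and> (astep X)\<^sup>*\<^sup>* ?a0 c) n ?a0"
    using dec unfolding dec_def by (intro af_reach_inv) auto
  then have "af (astep X) ?P n ?a0"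
    by (rule af_weaken) (use dec in \<open>unfold dec_def, metis\<close>)
  then have g2: "af (cstep B c0 X) ?Q (n * (2 * (Suc (length xs) + n) + 10)) (repc (length xs) ?a0)"
    using okb by (rule sim_af)
  have g1: "go (cstep B c0 X) (2 * length xs + 3) ?C0 (repc (length xs) ?a0)"
    by (rule load_enc[OF u v xs(1)])
  have afQ0: "af (cstep B c0 X) ?Q T ?C0"
    unfolding T_def by (rule go_af[OF g1 g2])
  have Qfin0: "fst C \<in> {Acc, Rej} \<and> (fst C = Acc \<longrightarrow> b)" if QC: "?Q C" for C
  proof -
    obtain H' c' where "C = repc H' c'" "?P c'" using QC by metis
    then show ?thesis using final_state[of C H' c'] by blast
  qed
  define Q where "Q = ?Q"
  have afQ: "af (cstep B c0 X) Q T ?C0" unfolding Q_def by (rule afQ0)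
  have Qfin: "fst C \<in> {Acc, Rej} \<and> (fst C = Acc \<longrightarrow> b)" if "Q C" for C
    by (rule Qfin0) (use that in \<open>simp only: Q_def\<close>)
  have Qh: "\<And>C. Q C \<Longrightarrow> fst C \<in> {Acc, Rej}" using Qfin by blast
  have halts: "halts_within M0 X T xs"
    unfolding halts_within_def
  proof
    assume "\<exists>c. (step M0 X ^^ Suc T) (init_cfg M0 xs) c"
    then obtain c where c: "(step M0 X ^^ Suc T) (init_cfg M0 xs) c" by blast
    have "Suc T \<le> T"
      by (rule af_length[OF real_af[OF afQ ok0] c[unfolded ip]]) (use halt_stuck Qh in metis)
    then show False by simp
  qed
  have acc1: b if ac: "accepts M0 X xs"
  proof -
    obtain Y where Y: "(step M0 X)\<^sup>*\<^sup>* (phi ?C0) Y" "fst Y = e Acc"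
      using ac unfolding accepts_reach ip by auto
    obtain D where D: "Y = phi D" "okc D" "(cstep B c0 X)\<^sup>*\<^sup>* ?C0 D"
      using real_bwd[OF Y(1) afQ ok0 Qh] by blast
    have "okst (fst D)" using D(2) by (cases D) auto
    then have fD: "fst D = Acc" using Y(2) eD[of "fst D" Acc] by (simp add: D(1) fst_phi)
    have st: "\<not> cstep B c0 X D E" for E by (rule cstep_halt_stuck) (simp add: fD)
    have "Q D"
      by (rule af_stuck_reach[OF afQ D(3) st]) (use cstep_halt_stuck Qh in metis)
    then show b using Qfin fD by blast
  qed
  have acc2: "accepts M0 X xs" if hb: b
  proof -
    obtain f where f: "(astep X)\<^sup>*\<^sup>* ?a0 f" "accf f" using dec hb unfolding dec_def by blast
    obtain H' where H': "(cstep B c0 X)\<^sup>*\<^sup>* (repc (length xs) ?a0) (repc H' f)"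
      using sim_reach[OF f(1) okb] by blast
    have "(cstep B c0 X)\<^sup>*\<^sup>* ?C0 (repc (length xs) ?a0)"
      using af_reach[OF g1] by blast
    then have "(step M0 X)\<^sup>*\<^sup>* (phi ?C0) (phi (repc H' f))"
      using real_fwd[OF rtranclp_trans[OF _ H'] ok0] by blast
    moreover have "fst (phi (repc H' f)) = e Acc"
      using final_state[of "repc H' f" H' f] f(2) accf_fin[OF f(2)] by (simp add: fst_phi)
    ultimately show ?thesis unfolding accepts_reach ip spec_states by blast
  qed
  have oner: "one_round M0 X k xs" if d
    unfolding one_round_def
  proof (intro allI impI)
    fix m Y assume Y: "(step M0 X ^^ m) (init_cfg M0 xs) Y \<and> fst Y = ask M0"
    then have Y1: "(step M0 X)\<^sup>*\<^sup>* (phi ?C0) Y" unfolding ip by (metis rtranclp_power)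
    obtain D j where D: "Y = phi D" "okc D" "(cstep B c0 X)\<^sup>*\<^sup>* ?C0 D" "af (cstep B c0 X) Q j D"
      using real_bwd[OF Y1 afQ ok0 Qh] by blast
    obtain q t h qs where Dq: "D = (q, t, h, qs)" by (cases D)
    have q: "q = AskS" using Y D(1,2) eD[of q AskS] unfolding Dq by simp
    have nQ: "\<not> Q D" using Qh[of D] q Dq by auto
    have "j \<noteq> 0"
    proof
      assume "j = 0"
      with D(4) have "af (cstep B c0 X) Q 0 D" by simp
      then have "Q D" by (rule af.simps(1)[THEN iffD1])
      with nQ show False by (rule notE)
    qed
    then obtain j' where j: "j = Suc j'" using not0_implies_Suc by metis
    obtain E where E: "cstep B c0 X D E" "\<And>e. cstep B c0 X D e \<Longrightarrow> af (cstep B c0 X) Q j' e"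
      using af_SucE[OF D(4)[unfolded j] nQ] by metis
    \<comment> \<open>The buffer has the size of the saved \<open>Ask\<close>, and
      \<open>wfc\<close> bounds that size by \<open>k\<close>.\<close>
    obtain c ks where c: "t (h - 1) = Sav c ks" "length qs = askm c"
      using E(1) unfolding Dq q cstep_def by auto
    have "oksym (t (h - 1))" using D(2) unfolding Dq by auto
    then have "c # ks \<in> CK" "isask c" using c(1) by auto
    then have len: "length qs \<le> k" using ck_wf[of c ks] c(2) that by (cases c) auto
    have "fst Z \<noteq> ask M0" if m: "m' > 0" "(step M0 X ^^ m') Y Z" for m' Z
    proof
      assume Z: "fst Z = ask M0"
      obtain m'' where "m' = Suc m''" using m(1) by (cases m') auto
      then obtain Y' where Y': "step M0 X Y Y'" "(step M0 X ^^ m'') Y' Z" using m(2) by (metis relpowp_Suc_E2)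
      obtain D' where D': "cstep B c0 X D D'" "Y' = phi D'" using step_bwd[OF D(2) E(1)] Y'(1) D(1) by blast
      have fD': "good (fst D')" using D'(1) unfolding Dq q cstep_def by auto
      have okD': "okc D'" by (rule cstep_ok[OF D(2) D'(1)])
      have "(step M0 X)\<^sup>*\<^sup>* (phi D') Z" using Y'(2) D'(2) by (metis rtranclp_power)
      then obtain F where F: "Z = phi F" "okc F" "(cstep B c0 X)\<^sup>*\<^sup>* D' F"
        using real_bwd[OF _ E(2)[OF D'(1)] okD' Qh] by blast
      \<comment> \<open>Only \<open>good\<close> states occur after the query, and
        \<open>AskS\<close> is not among them.\<close>
      have "good (fst F)" using good_reach[OF F(3) \<open>d\<close> okD' fD'] by simp
      moreover have "fst F = AskS" using Z F(1,2) eD[of "fst F" AskS] by (cases F) auto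
      ultimately show False by simp
    qed
    moreover have "length (snd (snd (snd Y))) \<le> k" using len unfolding D(1) Dq by simp
    ultimately show "length (snd (snd (snd Y))) \<le> k \<and> (\<forall>m' c'. m' > 0 \<and> (step M0 X ^^ m') Y c' \<longrightarrow> fst c' \<noteq> ask M0)"
      by blast
  qed
  show ?thesis using halts acc1 acc2 oner by blast
qed

lemma machine_long:
  assumes u: "\<And>i. i < length u \<Longrightarrow> u ! i \<noteq> 0 \<and> u ! i \<noteq> 3" and v: "\<And>i. i < length v \<Longrightarrow> v ! i \<noteq> 0"
    and xs: "B < length v" "set (u @ 3 # v) \<subseteq> {..<4}"
  shows "halts_within M0 X (length u + B + 2) (u @ 3 # v) \<and> \<not> accepts M0 X (u @ 3 # v)"
proof -
  let ?C0 = "(Init0, Raw \<circ> init_tape (u @ 3 # v), 0, [[]]) :: mcfg"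
  define Q where "Q = (\<lambda>C :: mcfg. fst C = Rej)"
  note ok0 = init_okc[OF xs(2)] and ip = init_phi[OF xs(2)]
  have afQ: "af (cstep B c0 X) Q (length u + B + 2) ?C0" unfolding Q_def by (rule load_long[OF u v xs(1)])
  have Qh: "\<And>C. Q C \<Longrightarrow> fst C \<in> {Acc, Rej}" unfolding Q_def by blast
  have "halts_within M0 X (length u + B + 2) (u @ 3 # v)"
    unfolding halts_within_def
  proof
    assume "\<exists>c. (step M0 X ^^ Suc (length u + B + 2)) (init_cfg M0 (u @ 3 # v)) c"
    then obtain c where c: "(step M0 X ^^ Suc (length u + B + 2)) (init_cfg M0 (u @ 3 # v)) c" by blast
    have "Suc (length u + B + 2) \<le> length u + B + 2"
      by (rule af_length[OF real_af[OF afQ ok0] c[unfolded ip]]) (use halt_stuck Qh in metis)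
    then show False by simp
  qed
  moreover have "\<not> accepts M0 X (u @ 3 # v)"
  proof
    assume "accepts M0 X (u @ 3 # v)"
    then obtain Y where Y: "(step M0 X)\<^sup>*\<^sup>* (phi ?C0) Y" "fst Y = e Acc"
      unfolding accepts_reach ip by auto
    obtain D where D: "Y = phi D" "okc D" "(cstep B c0 X)\<^sup>*\<^sup>* ?C0 D"
      using real_bwd[OF Y(1) afQ ok0 Qh] by blast
    have "okst (fst D)" using D(2) by (cases D) auto
    then have fD: "fst D = Acc" using Y(2) eD[of "fst D" Acc] by (simp add: D(1) fst_phi)
    have st: "\<not> cstep B c0 X D E" for E by (rule cstep_halt_stuck) (simp add: fD)
    have "Q D"
      by (rule af_stuck_reach[OF afQ D(3) st]) (use cstep_halt_stuck Qh in metis)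
    then show False using fD unfolding Q_def by simp
  qed
  ultimately show ?thesis by blast
qed

end

lemma set_enc: "set (enc w) \<subseteq> {1, 2}"
  by (auto simp: enc_def sym_of_bit_def)

text \<open>The interface between programs and machines. Pairs are split according to the length of
  \<open>bin z\<close>, and short codes are charged with \<open>B\<close> instead of their actual
  length, so that both time bounds depend on \<open>length w\<close> only.\<close>

lemma compile:
  assumes "4 \<le> A" "1 \<le> K" "wfc A K k d c0"
  shows "\<exists>M. wf_otm M \<and> (d \<longrightarrow> deterministic M)
    \<and> (\<forall>X w n b. dec X n ([c0], S0 (enc w), [[]]) b \<longrightarrow>
          halts_within M X (2 * length w + 3 + n * (2 * (Suc (length w) + n) + 10)) (enc w)
          \<and> (accepts M X (enc w) \<longleftrightarrow> b) \<and> (d \<longrightarrow> one_round M X k (enc w)))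
    \<and> (\<forall>X w z n b. length (bin z) \<le> B \<longrightarrow> dec X n ([c0], S0 (enc_pair w z), [[]]) b \<longrightarrow>
          halts_within M X (2 * (length w + B + 1) + 3 + n * (2 * (Suc (length w + B + 1) + n) + 10)) (enc_pair w z)
          \<and> (accepts M X (enc_pair w z) \<longleftrightarrow> b))
    \<and> (\<forall>X w z. B < length (bin z) \<longrightarrow>
          halts_within M X (length w + B + 2) (enc_pair w z) \<and> \<not> accepts M X (enc_pair w z))"
proof -
  interpret compiled A K k d c0 B by standard (use assms in auto)
  obtain e :: "ms \<Rightarrow> nat" where e: "inj_on e {q. okst q}"
    using finite_imp_inj_to_nat_seg[OF finite_okst] by blast
  obtain g0 :: "tsym \<Rightarrow> nat" where g0: "inj_on g0 {a. oksym a}"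
    using finite_imp_inj_to_nat_seg[OF finite_oksym] by blast
  \<comment> \<open>The raw symbols in use are below 4, so shifting all other codes by 4 keeps them
    apart.\<close>
  define g where "g = (\<lambda>a. case a of Raw r \<Rightarrow> r | _ \<Rightarrow> 4 + g0 a)"
  have g: "inj_on g {a. oksym a}"
  proof (rule inj_onI)
    fix a b assume ab: "a \<in> {a. oksym a}" "b \<in> {a. oksym a}" "g a = g b"
    have "g0 a = g0 b \<Longrightarrow> a = b" using ab(1,2) inj_onD[OF g0] by blast
    then show "a = b" using ab by (cases a; cases b) (simp_all add: g_def)
  qed
  interpret coded A K k d c0 B e g
    by standard (use e g in \<open>auto simp: g_def\<close>)
  have nz: "enc w ! i \<noteq> 0 \<and> enc w ! i \<noteq> 3" if "i < length (enc w)" for w i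
  proof -
    have "enc w ! i \<in> {1, 2}" using set_enc[of w] nth_mem[OF that] by blast
    then show ?thesis by auto
  qed
  have lt: "set (enc w) \<subseteq> {..<4}" for w using set_enc[of w] by auto
  have len: "length (enc w) = length w" for w by (simp add: enc_def)
  have hm: "halts_within M X T xs \<Longrightarrow> T \<le> T' \<Longrightarrow> halts_within M X T' xs" for M X T T' xs
  proof -
    assume h: "halts_within M X T xs" "T \<le> T'"
    have "\<not> (step M X ^^ Suc T') (init_cfg M xs) c" for c
    proof
      assume c: "(step M X ^^ Suc T') (init_cfg M xs) c"
      have "Suc T' = Suc T + (T' - T)" using h(2) by simp
      then have "\<exists>c'. (step M X ^^ Suc T) (init_cfg M xs) c'" using c by (metis relcomppE relpowp_add)
      then show False using h(1) unfolding halts_within_def by blast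
    qed
    then show ?thesis unfolding halts_within_def by blast
  qed
  show ?thesis
  proof (intro exI[of _ M0] conjI allI impI)
    fix X w n b assume a: "dec X n ([c0], S0 (enc w), [[]]) b"
    note m = machine_dec[OF nz[of _ w] conjunct1[OF nz[of _ "[]"]] disjI1[OF refl] lt a]
    show "halts_within M0 X (2 * length w + 3 + n * (2 * (Suc (length w) + n) + 10)) (enc w)"
      using m by (simp add: len)
    show "accepts M0 X (enc w) \<longleftrightarrow> b" using m by simp
    show "one_round M0 X k (enc w)" if d using m that by simp
  next
    fix X w z n b assume a: "length (bin z) \<le> B" "dec X n ([c0], S0 (enc_pair w z), [[]]) b"
    have ep: "enc_pair w z = enc w @ 3 # enc (bin z)" by (simp add: enc_pair_def)
    have "set (enc_pair w z) \<subseteq> {..<4}" using lt unfolding ep by auto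
    then have m: "halts_within M0 X (2 * length (enc_pair w z) + 3 + n * (2 * (Suc (length (enc_pair w z)) + n) + 10)) (enc_pair w z)
        \<and> (accepts M0 X (enc_pair w z) \<longleftrightarrow> b) \<and> (d \<longrightarrow> one_round M0 X k (enc_pair w z))"
      by (intro machine_dec[where u = "enc w" and v = "enc (bin z)"]) (use a nz ep len in auto)
    have l: "length (enc_pair w z) \<le> length w + B + 1" using a(1) unfolding ep by (simp add: len)
    show "halts_within M0 X (2 * (length w + B + 1) + 3 + n * (2 * (Suc (length w + B + 1) + n) + 10)) (enc_pair w z)"
      by (rule hm[OF conjunct1[OF m]]) (use l in \<open>intro add_mono mult_le_mono; simp\<close>)
    show "accepts M0 X (enc_pair w z) \<longleftrightarrow> b" using m by simp
  next
    fix X w z assume a: "B < length (bin z)"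
    have ep: "enc_pair w z = enc w @ 3 # enc (bin z)" by (simp add: enc_pair_def)
    have "halts_within M0 X (length (enc w) + B + 2) (enc w @ 3 # enc (bin z)) \<and> \<not> accepts M0 X (enc w @ 3 # enc (bin z))"
      by (rule machine_long) (use a nz lt len in auto)
    then show "halts_within M0 X (length w + B + 2) (enc_pair w z)" "\<not> accepts M0 X (enc_pair w z)"
      unfolding ep len by simp_all
  qed (use wf_M0 det_M0 in auto)
qed

subsection \<open>Stack programs\<close>

declare fun_upd_apply [simp del] fun_upd_same [simp] fun_upd_other [simp]

abbreviation Gs :: "lang \<Rightarrow> nat \<Rightarrow> acfg \<Rightarrow> acfg \<Rightarrow> bool" where
  "Gs X n c d \<equiv> go (astep X) n c d"

lemma go_add: "Gs X n c d \<Longrightarrow> Gs X m d e \<Longrightarrow> Gs X (n + m) c e"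
  by (rule go_af)

definition clear :: "nat \<Rightarrow> com" where
  "clear a = While a (\<lambda>x. x \<noteq> None) (\<lambda>_. Skip)"

definition mv :: "nat \<Rightarrow> nat \<Rightarrow> com" where
  "mv a b = While a (\<lambda>x. x \<noteq> None) (\<lambda>x. if x = None then Skip else Push b (the x))"

definition copyloop :: "nat \<Rightarrow> nat \<Rightarrow> nat \<Rightarrow> (nat \<Rightarrow> nat) \<Rightarrow> com" where
  "copyloop a b c h = While a (\<lambda>x. x \<noteq> None) (\<lambda>x. if x = None then Skip else Seq (Push b (the x)) (Push c (h (the x))))"

lemma go_clear: "S a = l \<Longrightarrow> Gs X (2 * length l + 1) (clear a # ks, S, q) (ks, S(a := []), q)"
proof (induction l arbitrary: S)
  case Nil
  then have "S(a := []) = S" by (metis fun_upd_triv)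
  then have "Gs X (Suc 0) (clear a # ks, S, q) (ks, S(a := []), q)"
    unfolding clear_def by (intro go_While) (simp add: Nil)
  then show ?case by simp
next
  case (Cons x l)
  have "Gs X (2 * length l + 1) (clear a # ks, S(a := l), q) (ks, S(a := []), q)"
    using Cons.IH[of "S(a := l)"] by simp
  then have "Gs X (Suc (Suc (2 * length l + 1))) (clear a # ks, S, q) (ks, S(a := []), q)"
    unfolding clear_def by (intro go_While) (simp add: Cons.prems go_Skip)
  then show ?case by simp
qed

lemma go_mv: "S a = l \<Longrightarrow> a \<noteq> b \<Longrightarrow> Gs X (2 * length l + 1) (mv a b # ks, S, q) (ks, S(a := [], b := rev l @ S b), q)"
proof (induction l arbitrary: S)
  case Nil
  then have "S(a := []) = S" "S(a := [], b := S b) = S" by (auto simp: fun_eq_iff fun_upd_apply)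
  then have "Gs X (Suc 0) (mv a b # ks, S, q) (ks, S(a := [], b := S b), q)"
    unfolding mv_def by (intro go_While) (simp add: Nil)
  then show ?case by simp
next
  case (Cons x l)
  let ?S = "S(a := l, b := x # S b)"
  have "Gs X (2 * length l + 1) (mv a b # ks, ?S, q) (ks, ?S(a := [], b := rev l @ ?S b), q)"
    by (rule Cons.IH) (use Cons.prems in auto)
  moreover have "?S(a := [], b := rev l @ ?S b) = S(a := [], b := rev (x # l) @ S b)"
    using Cons.prems(2) by (auto simp: fun_eq_iff fun_upd_apply)
  ultimately have "Gs X (Suc (Suc (2 * length l + 1))) (mv a b # ks, S, q) (ks, S(a := [], b := rev (x # l) @ S b), q)"
    unfolding mv_def using Cons.prems by (intro go_While) (auto intro!: go_Push)
  then show ?case by simp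
qed

lemma go_copyloop:
  "S a = l \<Longrightarrow> a \<noteq> b \<Longrightarrow> a \<noteq> c \<Longrightarrow> b \<noteq> c \<Longrightarrow>
   Gs X (4 * length l + 1) (copyloop a b c h # ks, S, q) (ks, S(a := [], b := rev l @ S b, c := rev (map h l) @ S c), q)"
proof (induction l arbitrary: S)
  case Nil
  then have "S(a := [], b := rev [] @ S b, c := rev (map h []) @ S c) = S" by (auto simp: fun_eq_iff fun_upd_apply)
  then have "Gs X (Suc 0) (copyloop a b c h # ks, S, q) (ks, S(a := [], b := rev [] @ S b, c := rev (map h []) @ S c), q)"
    unfolding copyloop_def by (intro go_While) (use Nil fun_upd_triv[of S a] in simp)
  then show ?case by simp
next
  case (Cons x l)
  let ?S = "S(a := l, b := x # S b, c := h x # S c)"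
  have "Gs X (4 * length l + 1) (copyloop a b c h # ks, ?S, q) (ks, ?S(a := [], b := rev l @ ?S b, c := rev (map h l) @ ?S c), q)"
    by (rule Cons.IH) (use Cons.prems in auto)
  moreover have "?S(a := [], b := rev l @ ?S b, c := rev (map h l) @ ?S c)
     = S(a := [], b := rev (x # l) @ S b, c := rev (map h (x # l)) @ S c)"
    using Cons.prems by (auto simp: fun_eq_iff fun_upd_apply)
  ultimately have "Gs X (Suc (Suc (Suc (Suc (4 * length l + 1))))) (copyloop a b c h # ks, S, q)
      (ks, S(a := [], b := rev (x # l) @ S b, c := rev (map h (x # l)) @ S c), q)"
    unfolding copyloop_def using Cons.prems by (intro go_While) (auto intro!: go_Push go_Seq)
  then show ?case by (rule af_mono) simp
qed

subsection \<open>Unary arithmetic\<close>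

text \<open>Numbers are kept in unary, as stacks of zeros; a stack that is listed several times
  gains that many.\<close>

primrec push0s :: "nat list \<Rightarrow> com" where
  "push0s [] = Skip"
| "push0s (b # bs) = Seq (Push b 0) (push0s bs)"

definition addz :: "nat list \<Rightarrow> store \<Rightarrow> store" where
  "addz bs S = (\<lambda>b. replicate (count_list bs b) 0 @ S b)"

lemma go_push0s: "Gs X (2 * length bs + 1) (push0s bs # ks, S, q) (ks, addz bs S, q)"
proof (induction bs arbitrary: S)
  case Nil
  have "Gs X (Suc 0) (Skip # ks, S, q) (ks, S, q)" by (rule go_Skip) simp
  then show ?case by (simp add: addz_def)
next
  case (Cons b bs)
  have e: "addz bs (S(b := 0 # S b)) = addz (b # bs) S"
    by (auto simp: addz_def fun_eq_iff fun_upd_apply replicate_app_Cons_same)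
  have "Gs X (Suc (Suc (2 * length bs + 1))) (push0s (b # bs) # ks, S, q) (ks, addz (b # bs) S, q)"
    unfolding push0s.simps by (rule go_Seq, rule go_Push) (rule Cons.IH[of "S(b := 0 # S b)", unfolded e])
  then show ?case by simp
qed

text \<open>The one arithmetic primitive: repetitions in \<open>bs\<close> act as factors, so
  moving, copying and doubling a number are all instances.\<close>

definition xfer :: "nat \<Rightarrow> nat list \<Rightarrow> com" where
  "xfer a bs = While a (\<lambda>x. x \<noteq> None) (\<lambda>_. push0s bs)"

lemma go_xfer:
  "S a = l \<Longrightarrow> a \<notin> set bs \<Longrightarrow>
   Gs X (length l * (2 * length bs + 2) + 1) (xfer a bs # ks, S, q)
     (ks, (\<lambda>b. replicate (length l * count_list bs b) 0 @ S b)(a := []), q)"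
proof (induction l arbitrary: S)
  case Nil
  then have "(\<lambda>b. replicate (0 * count_list bs b) 0 @ S b)(a := []) = S" by (auto simp: fun_eq_iff fun_upd_apply)
  then have "Gs X (Suc 0) (xfer a bs # ks, S, q) (ks, (\<lambda>b. replicate (0 * count_list bs b) 0 @ S b)(a := []), q)"
    unfolding xfer_def by (intro go_While) (use Nil fun_upd_triv[of S a] in simp)
  then show ?case by simp
next
  case (Cons x l)
  let ?S = "addz bs (S(a := l))"
  let ?G = "(ks, (\<lambda>b. replicate (length (x # l) * count_list bs b) 0 @ S b)(a := []), q)"
  have c0: "count_list bs a = 0" using Cons.prems(2) by (simp add: count_list_0_iff)
  have "Gs X (length l * (2 * length bs + 2) + 1) (xfer a bs # ks, ?S, q)
     (ks, (\<lambda>b. replicate (length l * count_list bs b) 0 @ ?S b)(a := []), q)"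
    by (rule Cons.IH) (use Cons.prems c0 in \<open>auto simp: addz_def\<close>)
  moreover have "(\<lambda>b. replicate (length l * count_list bs b) 0 @ ?S b)(a := [])
      = (\<lambda>b. replicate (length (x # l) * count_list bs b) 0 @ S b)(a := [])"
    by (auto simp: fun_eq_iff fun_upd_apply addz_def replicate_add [symmetric] add.commute)
  ultimately have g: "Gs X (length l * (2 * length bs + 2) + 1) (xfer a bs # ks, ?S, q) ?G" by simp
  have g': "Gs X (2 * length bs + 1 + (length l * (2 * length bs + 2) + 1)) (push0s bs # xfer a bs # ks, S(a := l), q) ?G"
    by (rule go_add[OF go_push0s g])
  have "Gs X (Suc (2 * length bs + 1 + (length l * (2 * length bs + 2) + 1))) (xfer a bs # ks, S, q) ?G"
    unfolding xfer_def by (rule go_While) (use g' Cons.prems in \<open>simp add: xfer_def\<close>)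
  then show ?case by (rule af_mono) simp
qed

text \<open>A clock component works on stack 1 with scratch stacks 2 and 3 and leaves the other
  stacks alone. It has to be well-formed for both values of \<open>d\<close>, since the
  deterministic machine and the nondeterministic one both compute clocks.\<close>

definition unary :: "com \<Rightarrow> (nat \<Rightarrow> nat) \<Rightarrow> (nat \<Rightarrow> nat) \<Rightarrow> bool" where
  "unary c F G \<longleftrightarrow> (\<forall>A K k d. 4 \<le> A \<longrightarrow> 10 \<le> K \<longrightarrow> wfc A K k d c) \<and>
     (\<forall>X ks S q n. S 1 = replicate n 0 \<longrightarrow> S 2 = [] \<longrightarrow> S 3 = [] \<longrightarrow>
        Gs X (G n) (c # ks, S, q) (ks, S(1 := replicate (F n) 0), q))"

lemma unary_go: "unary c F G \<Longrightarrow> S 1 = replicate n 0 \<Longrightarrow> S 2 = [] \<Longrightarrow> S 3 = [] \<Longrightarrow>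
    Gs X (G n) (c # ks, S, q) (ks, S(1 := replicate (F n) 0), q)"
  unfolding unary_def by blast

lemma unary_comp:
  assumes "unary c1 F1 G1" "unary c2 F2 G2"
  shows "unary (Seq c1 c2) (\<lambda>n. F2 (F1 n)) (\<lambda>n. Suc (G1 n + G2 (F1 n)))"
  unfolding unary_def
proof (intro conjI allI impI)
  fix A K k d assume "4 \<le> (A::nat)" "10 \<le> (K::nat)"
  then show "wfc A K k d (Seq c1 c2)" using assms unfolding unary_def by simp
next
  fix X ks S q n assume S: "S (1::nat) = replicate n (0::nat)" "S 2 = []" "S 3 = []"
  let ?S = "S(1 := replicate (F1 n) 0)"
  have "Gs X (G1 n) (c1 # c2 # ks, S, q) (c2 # ks, ?S, q)" by (rule unary_go[OF assms(1) S])
  moreover have "Gs X (G2 (F1 n)) (c2 # ks, ?S, q) (ks, ?S(1 := replicate (F2 (F1 n)) 0), q)"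
    by (rule unary_go[OF assms(2)]) (use S in auto)
  ultimately have "Gs X (G1 n + G2 (F1 n)) (c1 # c2 # ks, S, q) (ks, ?S(1 := replicate (F2 (F1 n)) 0), q)"
    by (rule go_add)
  then show "Gs X (Suc (G1 n + G2 (F1 n))) (Seq c1 c2 # ks, S, q) (ks, S(1 := replicate (F2 (F1 n)) 0), q)"
    by (intro go_Seq) simp
qed

lemma wfc_push0s: "0 < A \<Longrightarrow> \<forall>b \<in> set bs. b < K \<Longrightarrow> wfc A K k d (push0s bs)"
  by (induction bs) auto

lemma wfc_xfer: "0 < A \<Longrightarrow> a < K \<Longrightarrow> \<forall>b \<in> set bs. b < K \<Longrightarrow> wfc A K k d (xfer a bs)"
  by (simp add: xfer_def wfc_push0s)

lemma unary_addc: "unary (push0s (replicate C (1::nat))) (\<lambda>n. n + C) (\<lambda>_. 2 * C + 1)"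
  unfolding unary_def
proof (intro conjI allI impI)
  fix A K k d assume "4 \<le> (A::nat)" "10 \<le> (K::nat)"
  then show "wfc A K k d (push0s (replicate C (1::nat)))" by (intro wfc_push0s) auto
next
  fix X ks S q n assume S: "S (1::nat) = replicate n (0::nat)" "S 2 = []" "S 3 = []"
  have "addz (replicate C (1::nat)) S = S(1 := replicate (n + C) 0)"
  proof -
    have "count_list (replicate C (1::nat)) b = (if b = 1 then C else 0)" for b :: nat
      by (induction C) auto
    then show ?thesis using S(1) by (auto simp: addz_def fun_eq_iff fun_upd_apply replicate_add [symmetric] add.commute)
  qed
  then show "Gs X (2 * C + 1) (push0s (replicate C (1::nat)) # ks, S, q) (ks, S(1 := replicate (n + C) 0), q)"
    using go_push0s[where bs = "replicate C 1" and S = S and X = X and ks = ks and q = q] by simp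
qed

text \<open>A square as a sum of odd numbers: the pass that leaves \<open>j\<close> zeros on stack 1
  adds \<open>2 * j + 1\<close> to stack 2.\<close>

definition sqloop :: com where
  "sqloop = While 1 (\<lambda>x. x \<noteq> None) (\<lambda>_. Seq (Push 2 0) (Seq (xfer 1 [3, 2, 2]) (xfer 3 [1])))"

definition sqc :: com where
  "sqc = Seq sqloop (xfer 2 [1])"

lemma go_sqloop:
  "S 1 = replicate j 0 \<Longrightarrow> S 2 = replicate m 0 \<Longrightarrow> S 3 = [] \<Longrightarrow>
   Gs X (j * (12 * j + 20) + 1) (sqloop # ks, S, q) (ks, S(1 := [], 2 := replicate (m + j * j) 0), q)"
proof (induction j arbitrary: S m)
  case 0
  then have "S(1 := [], 2 := replicate (m + 0 * 0) 0) = S" by (auto simp: fun_eq_iff fun_upd_apply)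
  then have "Gs X (Suc 0) (sqloop # ks, S, q) (ks, S(1 := [], 2 := replicate (m + 0 * 0) 0), q)"
    unfolding sqloop_def by (intro go_While) (use 0 fun_upd_triv[of S 1] in simp)
  then show ?case by simp
next
  case (Suc j)
  let ?G = "(ks, S(1 := [], 2 := replicate (m + Suc j * Suc j) 0), q)"
  let ?S1 = "S(1 := replicate j 0, 2 := replicate (Suc m) 0)"
  let ?S2 = "S(1 := [], 2 := replicate (Suc m + 2 * j) 0, 3 := replicate j 0)"
  let ?S3 = "S(1 := replicate j 0, 2 := replicate (Suc m + 2 * j) 0)"
  have "Gs X (j * (12 * j + 20) + 1) (sqloop # ks, ?S3, q) (ks, ?S3(1 := [], 2 := replicate (Suc m + 2 * j + j * j) 0), q)"
    by (rule Suc.IH) (use Suc.prems in auto)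
  moreover have "?S3(1 := [], 2 := replicate (Suc m + 2 * j + j * j) 0) = S(1 := [], 2 := replicate (m + Suc j * Suc j) 0)"
    by (auto simp: fun_eq_iff fun_upd_apply)
  ultimately have g3: "Gs X (j * (12 * j + 20) + 1) (sqloop # ks, ?S3, q) ?G" by simp
  have "Gs X (length (?S2 3) * (2 * length [1::nat] + 2) + 1) (xfer 3 [1] # sqloop # ks, ?S2, q)
     (sqloop # ks, (\<lambda>b. replicate (length (?S2 3) * count_list [1] b) 0 @ ?S2 b)(3 := []), q)"
    by (rule go_xfer) auto
  moreover have "(\<lambda>b. replicate (length (?S2 3) * count_list [1] b) 0 @ ?S2 b)(3 := []) = ?S3"
    using Suc.prems by (auto simp: fun_eq_iff fun_upd_apply)
  ultimately have g2: "Gs X (4 * j + 1) (xfer 3 [1] # sqloop # ks, ?S2, q) (sqloop # ks, ?S3, q)" by (simp add: mult.commute)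
  have "Gs X (length (?S1 1) * (2 * length [3, 2, 2::nat] + 2) + 1) (xfer 1 [3, 2, 2] # xfer 3 [1] # sqloop # ks, ?S1, q)
     (xfer 3 [1] # sqloop # ks, (\<lambda>b. replicate (length (?S1 1) * count_list [3, 2, 2] b) 0 @ ?S1 b)(1 := []), q)"
    by (rule go_xfer) auto
  moreover have "(\<lambda>b. replicate (length (?S1 1) * count_list [3, 2, 2] b) 0 @ ?S1 b)(1 := []) = ?S2"
    using Suc.prems by (auto simp: fun_eq_iff fun_upd_apply replicate_app_Cons_same replicate_add [symmetric] ac_simps)
  ultimately have g1: "Gs X (8 * j + 1) (xfer 1 [3, 2, 2] # xfer 3 [1] # sqloop # ks, ?S1, q) (xfer 3 [1] # sqloop # ks, ?S2, q)"
    by (simp add: mult.commute)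
  let ?n = "8 * j + 1 + (4 * j + 1 + (j * (12 * j + 20) + 1))"
  have g: "Gs X ?n (xfer 1 [3, 2, 2] # xfer 3 [1] # sqloop # ks, ?S1, q) ?G"
    by (rule go_add[OF g1 go_add[OF g2 g3]])
  have s1: "(S(1 := replicate j 0))(2 := 0 # (S(1 := replicate j 0)) 2) = ?S1" using Suc.prems by simp
  have "Gs X (Suc (Suc (Suc (Suc ?n)))) (sqloop # ks, S, q) ?G"
    unfolding sqloop_def
    by (rule go_While) (use g s1 Suc.prems in \<open>auto simp: sqloop_def intro!: go_Seq go_Push\<close>)
  then show ?case by (rule af_mono) (simp add: algebra_simps)
qed

lemma unary_sq: "unary sqc (\<lambda>n. n * n) (\<lambda>n. n * (12 * n + 20) + 4 * (n * n) + 3)"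
  unfolding unary_def
proof (intro conjI allI impI)
  fix A K k d assume "4 \<le> (A::nat)" "10 \<le> (K::nat)"
  then show "wfc A K k d sqc" by (simp add: sqc_def sqloop_def wfc_xfer)
next
  fix X ks S q n assume S: "S (1::nat) = replicate n (0::nat)" "S 2 = []" "S 3 = []"
  let ?S1 = "S(1 := [], 2 := replicate (n * n) 0)"
  have g1: "Gs X (n * (12 * n + 20) + 1) (sqloop # xfer 2 [1] # ks, S, q) (xfer 2 [1] # ks, ?S1, q)"
    using go_sqloop[of S n 0 X "xfer 2 [1] # ks" q] S by simp
  have "Gs X (length (?S1 2) * (2 * length [1::nat] + 2) + 1) (xfer 2 [1] # ks, ?S1, q)
     (ks, (\<lambda>b. replicate (length (?S1 2) * count_list [1] b) 0 @ ?S1 b)(2 := []), q)"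
    by (rule go_xfer) auto
  moreover have "(\<lambda>b. replicate (length (?S1 2) * count_list [1] b) 0 @ ?S1 b)(2 := []) = S(1 := replicate (n * n) 0)"
    using S by (auto simp: fun_eq_iff fun_upd_apply)
  ultimately have g2: "Gs X (4 * (n * n) + 1) (xfer 2 [1] # ks, ?S1, q) (ks, S(1 := replicate (n * n) 0), q)"
    by (simp add: mult.commute)
  have "Gs X (Suc (n * (12 * n + 20) + 1 + (4 * (n * n) + 1))) (sqc # ks, S, q) (ks, S(1 := replicate (n * n) 0), q)"
    unfolding sqc_def by (rule go_Seq) (rule go_add[OF g1 g2])
  then show "Gs X (n * (12 * n + 20) + 4 * (n * n) + 3) (sqc # ks, S, q) (ks, S(1 := replicate (n * n) 0), q)"
    by (rule af_mono) simp
qed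

definition exploop :: com where
  "exploop = While 1 (\<lambda>x. x \<noteq> None) (\<lambda>_. Seq (xfer 2 [3, 3]) (xfer 3 [2]))"

definition expc :: com where
  "expc = Seq (Push 2 0) (Seq exploop (xfer 2 [1]))"

lemma go_exploop:
  "S 1 = replicate j 0 \<Longrightarrow> S 2 = replicate m 0 \<Longrightarrow> S 3 = [] \<Longrightarrow>
   Gs X (j * (14 * (m * 2 ^ j) + 20) + 1) (exploop # ks, S, q) (ks, S(1 := [], 2 := replicate (m * 2 ^ j) 0), q)"
proof (induction j arbitrary: S m)
  case 0
  then have "S(1 := [], 2 := replicate (m * 2 ^ 0) 0) = S" by (auto simp: fun_eq_iff fun_upd_apply)
  then have "Gs X (Suc 0) (exploop # ks, S, q) (ks, S(1 := [], 2 := replicate (m * 2 ^ 0) 0), q)"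
    unfolding exploop_def by (intro go_While) (use 0 fun_upd_triv[of S 1] in simp)
  then show ?case by simp
next
  case (Suc j)
  let ?G = "(ks, S(1 := [], 2 := replicate (m * 2 ^ Suc j) 0), q)"
  let ?S1 = "S(1 := replicate j 0)"
  let ?S2 = "S(1 := replicate j 0, 2 := [], 3 := replicate (2 * m) 0)"
  let ?S3 = "S(1 := replicate j 0, 2 := replicate (2 * m) 0)"
  have "Gs X (j * (14 * (2 * m * 2 ^ j) + 20) + 1) (exploop # ks, ?S3, q) (ks, ?S3(1 := [], 2 := replicate (2 * m * 2 ^ j) 0), q)"
    by (rule Suc.IH) (use Suc.prems in auto)
  moreover have "?S3(1 := [], 2 := replicate (2 * m * 2 ^ j) 0) = S(1 := [], 2 := replicate (m * 2 ^ Suc j) 0)"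
    by (auto simp: fun_eq_iff fun_upd_apply)
  ultimately have g3: "Gs X (j * (14 * (m * 2 ^ Suc j) + 20) + 1) (exploop # ks, ?S3, q) ?G" by (simp add: ac_simps)
  have "Gs X (length (?S2 3) * (2 * length [2::nat] + 2) + 1) (xfer 3 [2] # exploop # ks, ?S2, q)
     (exploop # ks, (\<lambda>b. replicate (length (?S2 3) * count_list [2] b) 0 @ ?S2 b)(3 := []), q)"
    by (rule go_xfer) auto
  moreover have "(\<lambda>b. replicate (length (?S2 3) * count_list [2] b) 0 @ ?S2 b)(3 := []) = ?S3"
    using Suc.prems by (auto simp: fun_eq_iff fun_upd_apply)
  ultimately have g2: "Gs X (8 * m + 1) (xfer 3 [2] # exploop # ks, ?S2, q) (exploop # ks, ?S3, q)"
    by (simp add: mult.commute mult.left_commute)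
  have "Gs X (length (?S1 2) * (2 * length [3, 3::nat] + 2) + 1) (xfer 2 [3, 3] # xfer 3 [2] # exploop # ks, ?S1, q)
     (xfer 3 [2] # exploop # ks, (\<lambda>b. replicate (length (?S1 2) * count_list [3, 3] b) 0 @ ?S1 b)(2 := []), q)"
    by (rule go_xfer) auto
  moreover have "(\<lambda>b. replicate (length (?S1 2) * count_list [3, 3] b) 0 @ ?S1 b)(2 := []) = ?S2"
    using Suc.prems by (auto simp: fun_eq_iff fun_upd_apply mult.commute)
  ultimately have g1: "Gs X (6 * m + 1) (xfer 2 [3, 3] # xfer 3 [2] # exploop # ks, ?S1, q) (xfer 3 [2] # exploop # ks, ?S2, q)"
    using Suc.prems by (simp add: mult.commute)
  let ?n = "6 * m + 1 + (8 * m + 1 + (j * (14 * (m * 2 ^ Suc j) + 20) + 1))"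
  have g: "Gs X ?n (xfer 2 [3, 3] # xfer 3 [2] # exploop # ks, ?S1, q) ?G"
    by (rule go_add[OF g1 go_add[OF g2 g3]])
  have "Gs X (Suc (Suc ?n)) (exploop # ks, S, q) ?G"
    unfolding exploop_def
    by (rule go_While) (use g Suc.prems in \<open>auto simp: exploop_def intro!: go_Seq\<close>)
  moreover have "m \<le> m * 2 ^ Suc j" using one_le_power[of "2::nat" "Suc j"] by simp
  then have "Suc (Suc ?n) \<le> Suc j * (14 * (m * 2 ^ Suc j) + 20) + 1"
    unfolding mult_Suc by linarith
  ultimately show ?case by (rule af_mono)
qed

lemma unary_exp: "unary expc (\<lambda>n. 2 ^ n) (\<lambda>n. n * (14 * 2 ^ n + 20) + 4 * 2 ^ n + 5)"
  unfolding unary_def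
proof (intro conjI allI impI)
  fix A K k d assume "4 \<le> (A::nat)" "10 \<le> (K::nat)"
  then show "wfc A K k d expc" by (simp add: expc_def exploop_def wfc_xfer)
next
  fix X ks S q n assume S: "S (1::nat) = replicate n (0::nat)" "S 2 = []" "S 3 = []"
  let ?S0 = "S(2 := [0])"
  let ?S1 = "S(1 := [], 2 := replicate (2 ^ n) 0)"
  have g1: "Gs X (n * (14 * 2 ^ n + 20) + 1) (exploop # xfer 2 [1] # ks, ?S0, q) (xfer 2 [1] # ks, ?S1, q)"
    using go_exploop[of ?S0 n 1 X "xfer 2 [1] # ks" q] S by (simp add: fun_upd_twist)
  have "Gs X (length (?S1 2) * (2 * length [1::nat] + 2) + 1) (xfer 2 [1] # ks, ?S1, q)
     (ks, (\<lambda>b. replicate (length (?S1 2) * count_list [1] b) 0 @ ?S1 b)(2 := []), q)"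
    by (rule go_xfer) auto
  moreover have "(\<lambda>b. replicate (length (?S1 2) * count_list [1] b) 0 @ ?S1 b)(2 := []) = S(1 := replicate (2 ^ n) 0)"
    using S by (auto simp: fun_eq_iff fun_upd_apply)
  ultimately have g2: "Gs X (4 * 2 ^ n + 1) (xfer 2 [1] # ks, ?S1, q) (ks, S(1 := replicate (2 ^ n) 0), q)"
    by (simp add: mult.commute)
  have "Gs X (Suc (Suc (Suc (n * (14 * 2 ^ n + 20) + 1 + (4 * 2 ^ n + 1))))) (expc # ks, S, q) (ks, S(1 := replicate (2 ^ n) 0), q)"
    unfolding expc_def by (rule go_Seq, rule go_Push, rule go_Seq) (use go_add[OF g1 g2] S in simp)
  then show "Gs X (n * (14 * 2 ^ n + 20) + 4 * 2 ^ n + 5) (expc # ks, S, q) (ks, S(1 := replicate (2 ^ n) 0), q)"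
    by (rule af_mono) simp
qed

text \<open>Iterated squaring produces only exponents that are powers of two;
  \<open>clock_exists\<close> dominates an exponent \<open>m\<close> by
  \<open>2 ^ m\<close>.\<close>

lemma unary_power: "\<exists>c G. unary c (\<lambda>n. n ^ (2 ^ j)) G \<and> bnd 0 G"
proof (induction j)
  case 0
  have "unary Skip (\<lambda>n. n ^ (2 ^ 0)) (\<lambda>_. 1)"
    unfolding unary_def
  proof (intro conjI allI impI)
    fix X ks S q n assume S: "S (1::nat) = replicate n (0::nat)" "S 2 = []" "S 3 = []"
    have e: "S(1 := replicate (n ^ 2 ^ 0) 0) = S" using S by (auto simp: fun_eq_iff fun_upd_apply)
    have "Gs X (Suc 0) (Skip # ks, S, q) (ks, S, q)" by (rule go_Skip) simp
    then show "Gs X 1 (Skip # ks, S, q) (ks, S(1 := replicate (n ^ 2 ^ 0) 0), q)" unfolding e by simp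
  qed simp
  then show ?case using bnd_const by blast
next
  case (Suc j)
  then obtain c G where c: "unary c (\<lambda>n. n ^ (2 ^ j)) G" "bnd 0 G" by blast
  have "n ^ 2 ^ j * n ^ 2 ^ j = n ^ (2 ^ Suc j)" for n :: nat
    by (simp add: power_add [symmetric] mult_2)
  then show ?case using unary_comp[OF c(1) unary_sq]
    by (intro exI conjI) (simp, intro bnd_intros c(2))
qed

lemma unary_expi:
  assumes "unary c (\<lambda>n. n ^ M) G" "bnd 0 G" "M \<ge> 1"
  shows "\<exists>c G. unary c (\<lambda>n. expi i (n ^ M)) G \<and> bnd i G"
proof (induction i)
  case 0
  then show ?case using assms by auto
next
  case (Suc i)
  then obtain c G where c: "unary c (\<lambda>n. expi i (n ^ M)) G" "bnd i G" by blast
  have b1: "bnd (Suc i) (\<lambda>n. expi i (n ^ M))" by (intro bnd_Suc bnd_expi assms(3))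
  have b2: "bnd (Suc i) (\<lambda>n. 2 ^ expi i (n ^ M))" using bnd_expi[OF assms(3), of "Suc i"] by simp
  show ?case using unary_comp[OF c(1) unary_exp]
    by (intro exI conjI) (simp, intro bnd_intros b1 b2 bnd_Suc[OF c(2)])
qed

text \<open>Takes the place of time-constructibility: instead of \<open>f\<close> itself, a majorant
  of the same kind of growth is computed by squaring, exponentiating and adding a constant.\<close>

lemma clock_exists:
  assumes "bnd i f"
  shows "\<exists>c F G. unary c F G \<and> (\<forall>n. f n \<le> F n) \<and> bnd i F \<and> bnd i G"
proof -
  obtain m C where m: "m \<ge> 1" "\<And>n. f n \<le> expi i (n ^ m) + C" using assms unfolding bnd_def by blast
  obtain c0 G0 where c0: "unary c0 (\<lambda>n. n ^ (2 ^ m)) G0" "bnd 0 G0" using unary_power by blast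
  obtain c G where c: "unary c (\<lambda>n. expi i (n ^ (2 ^ m))) G" "bnd i G"
    using unary_expi[OF c0] by (metis one_le_numeral one_le_power)
  have "n ^ m \<le> n ^ (2 ^ m)" for n :: nat
  proof (cases "n = 0")
    case False
    have "m \<le> 2 ^ m" using less_exp[of m] by simp
    then show ?thesis using False by (intro power_increasing) auto
  qed (use m(1) in \<open>simp add: power_0_left\<close>)
  then have "f n \<le> expi i (n ^ (2 ^ m)) + C" for n using m(2)[of n] expi_mono[of "n ^ m" "n ^ 2 ^ m" i]
    by (meson add_le_mono1 le_trans)
  then show ?thesis using unary_comp[OF c(1) unary_addc[of C]] c(2)
    by (intro exI conjI allI) (assumption | simp | intro bnd_intros bnd_expi)+
qed

text \<open>The input on stack 0 is restored, because some programs start several clocks from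
  it.\<close>

definition mkclock :: "com \<Rightarrow> com" where
  "mkclock c = Seq (copyloop 0 3 1 (\<lambda>_. 0)) (Seq (mv 3 0) c)"

lemma go_mkclock:
  assumes "unary c F G" "S 0 = l" "S 1 = []" "S 2 = []" "S 3 = []"
  shows "Gs X (6 * length l + G (length l) + 4) (mkclock c # ks, S, q) (ks, S(1 := replicate (F (length l)) 0), q)"
proof -
  let ?S1 = "S(0 := [], 3 := rev l, 1 := replicate (length l) 0)"
  let ?S2 = "S(1 := replicate (length l) 0)"
  have g1: "Gs X (4 * length l + 1) (copyloop 0 3 1 (\<lambda>_. 0) # Seq (mv 3 0) c # ks, S, q) (Seq (mv 3 0) c # ks, ?S1, q)"
    using go_copyloop[where S = S and a = 0 and b = 3 and c = 1 and l = l and h = "\<lambda>_. 0"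
        and ks = "Seq (mv 3 0) c # ks" and q = q and X = X] assms by (simp add: map_replicate_const)
  have e: "?S1(3 := [], 0 := l) = ?S2" using assms by (auto simp: fun_eq_iff fun_upd_apply)
  have g2: "Gs X (2 * length l + 1) (mv 3 0 # c # ks, ?S1, q) (c # ks, ?S2, q)"
    using go_mv[where S = ?S1 and a = 3 and b = 0 and l = "rev l" and ks = "c # ks" and q = q and X = X] e by simp
  have g3: "Gs X (G (length l)) (c # ks, ?S2, q) (ks, ?S2(1 := replicate (F (length l)) 0), q)"
    by (rule unary_go[OF assms(1)]) (use assms in auto)
  have g3': "Gs X (G (length l)) (c # ks, ?S2, q) (ks, S(1 := replicate (F (length l)) 0), q)" using g3 by simp
  have "Gs X (Suc (4 * length l + 1 + Suc (2 * length l + 1 + G (length l)))) (mkclock c # ks, S, q)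
     (ks, S(1 := replicate (F (length l)) 0), q)"
    unfolding mkclock_def by (rule go_Seq, rule go_add[OF g1], rule go_Seq, rule go_add[OF g2 g3'])
  then show ?thesis by (rule af_mono) simp
qed

lemma wfc_clear: "a < K \<Longrightarrow> wfc A K k d (clear a)"
  by (simp add: clear_def)

lemma wfc_mv: "0 < A \<Longrightarrow> a < K \<Longrightarrow> b < K \<Longrightarrow> wfc A K k d (mv a b)"
  by (auto simp: mv_def opts_def)

lemma wfc_copyloop: "a < K \<Longrightarrow> b < K \<Longrightarrow> c < K \<Longrightarrow> (\<And>x. x < A \<Longrightarrow> h x < A) \<Longrightarrow> wfc A K k d (copyloop a b c h)"
  by (auto simp: copyloop_def opts_def)

lemma wfc_mkclock: "unary c F G \<Longrightarrow> 4 \<le> A \<Longrightarrow> 10 \<le> K \<Longrightarrow> wfc A K k d (mkclock c)"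
  unfolding mkclock_def unary_def by (auto intro!: wfc_copyloop wfc_mv)

subsection \<open>Clocked simulation\<close>

text \<open>Stacks: 0 input, 1 clock, 2 and 3 scratch, 4 and 5 the simulated tape left of the head and from the head on,
  6 the simulated state, 7 the query buffer (each query preceded by a 3, last symbol on top), 8 answers, 9 saved queries.\<close>

type_synonym zcfg = "nat \<times> nat list \<times> nat list \<times> bool list list"

definition hd0 :: "nat list \<Rightarrow> nat" where
  "hd0 xs = (case xs of [] \<Rightarrow> 0 | x # _ \<Rightarrow> x)"

definition nth0 :: "nat list \<Rightarrow> nat \<Rightarrow> nat" where
  "nth0 xs j = (if j < length xs then xs ! j else 0)"

definition or0 :: "nat option \<Rightarrow> nat" where
  "or0 x = (case x of None \<Rightarrow> 0 | Some y \<Rightarrow> y)"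

lemma or0_hdo: "or0 (hdo xs) = hd0 xs"
  by (cases xs) (simp_all add: or0_def hd0_def)

definition zmove :: "int \<Rightarrow> nat \<Rightarrow> nat list \<Rightarrow> nat list \<Rightarrow> nat list \<times> nat list" where
  "zmove dd b L R = (if dd = 1 then (b # L, R) else if dd = -1 then (tl L, hd0 L # b # R) else (L, b # R))"

definition trans_of :: "otm \<Rightarrow> nat \<Rightarrow> nat \<Rightarrow> (nat \<times> nat \<times> nat \<times> nat \<times> int \<times> qact) set" where
  "trans_of M q a = {t \<in> delta M. fst t = q \<and> fst (snd t) = a}"

fun ztr :: "zcfg \<Rightarrow> nat \<times> nat \<times> nat \<times> nat \<times> int \<times> qact \<Rightarrow> zcfg" where
  "ztr (q, L, R, qs) (q0, a, q', b, dd, x) = (q', fst (zmove dd b L (tl R)), snd (zmove dd b L (tl R)), qupd x qs)"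

text \<open>One clock tick: stuck configurations stay put, and with \<open>md = False\<close> so do those in the query state.\<close>

fun zx :: "otm \<Rightarrow> bool \<Rightarrow> lang \<Rightarrow> zcfg \<Rightarrow> zcfg \<Rightarrow> bool" where
  "zx M md X (q, L, R, qs) z' =
    (if md \<and> q = ask M then z' = (ret M, L, map (\<lambda>x. sym_of_bit (x \<in> X)) qs @ drop (length qs) R, [[]])
     else if trans_of M q (hd0 R) = {} then z' = (q, L, hd0 R # tl R, qs)
     else \<exists>t \<in> trans_of M q (hd0 R). z' = ztr (q, L, R, qs) t)"

definition qf :: "bool list list \<Rightarrow> nat list" where
  "qf qs = concat (map (\<lambda>u. 3 # enc u) qs)"

fun sto :: "store \<Rightarrow> zcfg \<Rightarrow> store" where
  "sto S (q, L, R, qs) = S(4 := L, 5 := R, 6 := [q], 7 := rev (qf qs))"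

fun qc :: "qact \<Rightarrow> com" where
  "qc QNone = Skip"
| "qc (QWrite b) = Push 7 (sym_of_bit b)"
| "qc QNext = Push 7 3"

definition mvc :: "int \<Rightarrow> nat \<Rightarrow> com" where
  "mvc dd b = (if dd = 1 then Push 4 b else if dd = -1 then Seq (Push 5 b) (Pop 4 (\<lambda>y. Push 5 (or0 y))) else Push 5 b)"

fun trc :: "nat \<times> nat \<times> nat \<times> nat \<times> int \<times> qact \<Rightarrow> com" where
  "trc (q, a, q', b, dd, x) = Seq (qc x) (Seq (mvc dd b) (Push 6 q'))"

definition tlist :: "otm \<Rightarrow> nat \<Rightarrow> nat \<Rightarrow> (nat \<times> nat \<times> nat \<times> nat \<times> int \<times> qact) list" where
  "tlist M q a = (SOME ts. set ts = trans_of M q a \<and> distinct ts)"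

definition stepc :: "otm \<Rightarrow> nat \<Rightarrow> nat \<Rightarrow> com" where
  "stepc M q a = (if trans_of M q a = {} then Seq (Push 5 a) (Push 6 q) else Ors (map trc (tlist M q a)))"

definition flush :: com where
  "flush = While 2 (\<lambda>x. x \<noteq> None) (\<lambda>x. QW (x = Some 2))"

text \<open>The buffered queries are asked one at a time, the last one first: the size of a
  simulated round is not known in advance, whereas \<open>Ask\<close> has a fixed one. Passing
  through stack 2 restores the order of the symbols. Each answer overwrites one tape cell, hence the
  pop from stack 5.\<close>

definition asklp :: com where
  "asklp = While 7 (\<lambda>x. x \<noteq> None) (\<lambda>x. if x = Some 3
      then Seq flush (Ask 1 (\<lambda>bs. Seq (Push 8 (sym_of_bit (hd bs))) (Pop 5 (\<lambda>_. Skip)))) else Push 2 (or0 x))"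

text \<open>Moving the answers twice preserves their order. The final 3 on stack 7 represents the
  buffer \<open>[[]]\<close> that a query round leaves.\<close>

definition askc :: "otm \<Rightarrow> com" where
  "askc M = Seq asklp (Seq (mv 8 2) (Seq (mv 2 5) (Seq (Push 7 3) (Push 6 (ret M)))))"

definition simstep :: "otm \<Rightarrow> bool \<Rightarrow> com" where
  "simstep M md = Pop 6 (\<lambda>q. if q = None then Halt False else if md \<and> q = Some (ask M) then askc M
      else Pop 5 (\<lambda>a. stepc M (or0 q) (or0 a)))"

definition sim :: "otm \<Rightarrow> bool \<Rightarrow> com" where
  "sim M md = While 1 (\<lambda>x. x \<noteq> None) (\<lambda>_. simstep M md)"

lemma finite_trans_of: "wf_otm M \<Longrightarrow> finite (trans_of M q a)"
  unfolding trans_of_def wf_otm_def by simp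

lemma tlist: "wf_otm M \<Longrightarrow> set (tlist M q a) = trans_of M q a \<and> distinct (tlist M q a)"
  unfolding tlist_def by (rule someI_ex) (use finite_distinct_list[OF finite_trans_of] in blast)

lemma length_tlist: "wf_otm M \<Longrightarrow> length (tlist M q a) \<le> card (delta M)"
proof -
  assume wf: "wf_otm M"
  have "length (tlist M q a) = card (trans_of M q a)" using tlist[OF wf] distinct_card by metis
  also have "\<dots> \<le> card (delta M)" using wf by (intro card_mono) (auto simp: wf_otm_def trans_of_def)
  finally show ?thesis .
qed

lemma qf_snoc: "qf (qs @ [u]) = qf qs @ 3 # enc u"
  by (simp add: qf_def)

lemma length_qf: "length qs \<le> length (qf qs)"
  by (induction qs) (auto simp: qf_def)

lemma qf_qupd: "qs \<noteq> [] \<Longrightarrow> rev (qf (qupd x qs)) = (case x of QNone \<Rightarrow> [] | QWrite b \<Rightarrow> [sym_of_bit b] | QNext \<Rightarrow> [3]) @ rev (qf qs)"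
proof (cases x)
  case (QWrite b)
  assume "qs \<noteq> []"
  then have e: "qf qs = qf (butlast qs) @ 3 # enc (last qs)" using qf_snoc[of "butlast qs" "last qs"] by simp
  show ?thesis using QWrite e by (simp add: qf_snoc enc_def)
next
  case QNext
  then show ?thesis using qf_snoc[of qs "[]"] by (simp add: enc_def)
qed simp

lemma qupd_ne: "qs \<noteq> [] \<Longrightarrow> qupd x qs \<noteq> []"
  by (cases x) auto

definition askbody :: com where
  "askbody = Seq flush (Ask 1 (\<lambda>bs. Seq (Push 8 (sym_of_bit (hd bs))) (Pop 5 (\<lambda>_. Skip))))"

lemma asklp_in:
  "S 7 = x # r \<Longrightarrow> af (astep X) P n ((if x = 3 then askbody else Push 2 x) # asklp # ks, S(7 := r), q)
    \<Longrightarrow> af (astep X) P (Suc n) (asklp # ks, S, q)"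
  unfolding asklp_def askbody_def by (rule go_While) (simp add: or0_def split: if_splits)

lemma flush_in:
  "S 2 = sym_of_bit b # r \<Longrightarrow> af (astep X) P n (QW b # flush # ks, S(2 := r), q)
    \<Longrightarrow> af (astep X) P (Suc n) (flush # ks, S, q)"
  unfolding flush_def by (rule go_While) (cases b; simp add: sym_of_bit_def)

lemma go_flush: "S 2 = enc u \<Longrightarrow> Gs X (2 * length u + 1) (flush # ks, S, [v]) (ks, S(2 := []), [v @ u])"
proof (induction u arbitrary: S v)
  case Nil
  then have "S(2 := []) = S" by (auto simp: fun_eq_iff fun_upd_apply enc_def)
  then have "Gs X (Suc 0) (flush # ks, S, [v]) (ks, S(2 := []), [v @ []])"
    unfolding flush_def by (intro go_While) (simp add: Nil enc_def)
  then show ?case by (rule af_mono) simp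
next
  case (Cons b u)
  have S2: "S 2 = sym_of_bit b # enc u" using Cons.prems by (simp add: enc_def)
  have b: "(Some (sym_of_bit b) = Some 2) = b" by (simp add: sym_of_bit_def)
  have "Gs X (2 * length u + 1) (flush # ks, S(2 := enc u), [v @ [b]]) (ks, S(2 := enc u, 2 := []), [(v @ [b]) @ u])"
    by (rule Cons.IH) simp
  then have g: "Gs X (2 * length u + 1) (flush # ks, S(2 := enc u), [v @ [b]]) (ks, S(2 := []), [v @ b # u])"
    by simp
  have "Gs X (Suc (Suc (2 * length u + 1))) (flush # ks, S, [v]) (ks, S(2 := []), [v @ b # u])"
    by (rule flush_in[where b = b and r = "enc u"]) (use g S2 in \<open>simp_all add: go_QW\<close>)
  then show ?case by (rule af_mono) simp
qed

lemma go_asklp_bits: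
  "S 7 = l @ r \<Longrightarrow> 3 \<notin> set l \<Longrightarrow> Gs X (2 * length l) (asklp # ks, S, q) (asklp # ks, S(7 := r, 2 := rev l @ S 2), q)"
proof (induction l arbitrary: S)
  case Nil
  then have "S(7 := r, 2 := rev [] @ S 2) = S" by (auto simp: fun_eq_iff fun_upd_apply)
  then show ?case by simp
next
  case (Cons x l)
  let ?S = "S(7 := l @ r, 2 := x # S 2)"
  have "Gs X (2 * length l) (asklp # ks, ?S, q) (asklp # ks, ?S(7 := r, 2 := rev l @ ?S 2), q)"
    by (rule Cons.IH) (use Cons.prems in auto)
  moreover have "?S(7 := r, 2 := rev l @ ?S 2) = S(7 := r, 2 := rev (x # l) @ S 2)"
    by (auto simp: fun_eq_iff fun_upd_apply)
  ultimately have g: "Gs X (2 * length l) (asklp # ks, ?S, q) (asklp # ks, S(7 := r, 2 := rev (x # l) @ S 2), q)" by simp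
  have x3: "x \<noteq> 3" using Cons.prems(2) by auto
  have "Gs X (Suc (Suc (2 * length l))) (asklp # ks, S, q) (asklp # ks, S(7 := r, 2 := rev (x # l) @ S 2), q)"
    by (rule asklp_in[where x = x and r = "l @ r"]) (use g x3 Cons.prems in \<open>simp_all add: go_Push\<close>)
  then show ?case by (rule af_mono) simp
qed

lemma go_asklp:
  "S 7 = rev (qf qs) \<Longrightarrow> S 2 = [] \<Longrightarrow>
   Gs X (10 * length (qf qs) + 1) (asklp # ks, S, [[]])
     (ks, S(7 := [], 8 := map (\<lambda>x. sym_of_bit (x \<in> X)) qs @ S 8, 5 := drop (length qs) (S 5)), [[]])"
proof (induction qs arbitrary: S rule: rev_induct)
  case Nil
  then have "S(7 := [], 8 := map (\<lambda>x. sym_of_bit (x \<in> X)) [] @ S 8, 5 := drop (length []) (S 5)) = S"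
    by (auto simp: fun_eq_iff fun_upd_apply qf_def)
  moreover have "S(7 := []) = S" using Nil by (auto simp: fun_eq_iff fun_upd_apply qf_def)
  ultimately have "Gs X (Suc 0) (asklp # ks, S, [[]]) (ks, S(7 := [], 8 := map (\<lambda>x. sym_of_bit (x \<in> X)) [] @ S 8, 5 := drop (length []) (S 5)), [[]])"
    unfolding asklp_def by (intro go_While) (simp add: Nil qf_def)
  then show ?case by (rule af_mono) simp
next
  case (snoc u qs)
  let ?G = "(ks, S(7 := [], 8 := map (\<lambda>x. sym_of_bit (x \<in> X)) (qs @ [u]) @ S 8, 5 := drop (length (qs @ [u])) (S 5)), [[]])"
  let ?r = "3 # rev (qf qs)"
  let ?S1 = "S(7 := ?r, 2 := enc u)"
  let ?S2 = "S(7 := rev (qf qs), 2 := enc u)"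
  let ?S3 = "S(7 := rev (qf qs), 8 := sym_of_bit (u \<in> X) # S 8, 5 := tl (S 5))"
  let ?w = "Ask 1 (\<lambda>bs. Seq (Push 8 (sym_of_bit (hd bs))) (Pop 5 (\<lambda>_. Skip)))"
  have S7: "S 7 = rev (enc u) @ ?r" using snoc.prems(1) by (simp add: qf_snoc)
  have n3: "3 \<notin> set (rev (enc u))" using set_enc[of u] by auto
  have g1: "Gs X (2 * length (rev (enc u))) (asklp # ks, S, [[]]) (asklp # ks, ?S1, [[]])"
    using go_asklp_bits[where S = S and l = "rev (enc u)" and r = ?r and X = X and ks = ks and q = "[[]]"] S7 snoc.prems(2) n3 by simp
  have "Gs X (10 * length (qf qs) + 1) (asklp # ks, ?S3, [[]]) (ks, ?S3(7 := [], 8 := map (\<lambda>x. sym_of_bit (x \<in> X)) qs @ ?S3 8, 5 := drop (length qs) (?S3 5)), [[]])"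
    by (rule snoc.IH) (use snoc.prems in auto)
  moreover have "?S3(7 := [], 8 := map (\<lambda>x. sym_of_bit (x \<in> X)) qs @ ?S3 8, 5 := drop (length qs) (?S3 5))
     = S(7 := [], 8 := map (\<lambda>x. sym_of_bit (x \<in> X)) (qs @ [u]) @ S 8, 5 := drop (length (qs @ [u])) (S 5))"
    by (auto simp: fun_eq_iff fun_upd_apply drop_Suc)
  ultimately have g4: "Gs X (10 * length (qf qs) + 1) (asklp # ks, ?S3, [[]]) ?G" by simp
  have S3: "S(7 := rev (qf qs), 2 := []) = S(7 := rev (qf qs))" using snoc.prems(2) by (auto simp: fun_eq_iff fun_upd_apply)
  have g3: "Gs X (Suc (Suc (Suc (Suc (Suc (10 * length (qf qs) + 1)))))) (?w # asklp # ks, S(7 := rev (qf qs), 2 := []), [[] @ u]) ?G"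
    unfolding S3
    by (rule go_Ask) (simp, simp, intro go_Seq go_Push go_Pop go_Skip, use g4 in \<open>simp add: fun_upd_twist\<close>)
  have g2: "Gs X (2 * length u + 1) (flush # ?w # asklp # ks, ?S2, [[]]) (?w # asklp # ks, ?S2(2 := []), [[] @ u])"
    by (rule go_flush) simp
  then have g2': "Gs X (2 * length u + 1) (flush # ?w # asklp # ks, ?S2, [[]]) (?w # asklp # ks, S(7 := rev (qf qs), 2 := []), [[] @ u])" by simp
  let ?n = "2 * length u + 1 + Suc (Suc (Suc (Suc (Suc (10 * length (qf qs) + 1)))))"
  have g23: "Gs X ?n (flush # ?w # asklp # ks, ?S2, [[]]) ?G" by (rule go_add[OF g2' g3])
  have S1: "?S1(7 := rev (qf qs)) = ?S2" by (auto simp: fun_eq_iff fun_upd_apply)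
  have g5: "Gs X (Suc (Suc ?n)) (asklp # ks, ?S1, [[]]) ?G"
    by (rule asklp_in[where x = 3 and r = "rev (qf qs)"]) (use g23 S1 in \<open>simp_all add: askbody_def go_Seq\<close>)
  have "Gs X (2 * length (rev (enc u)) + Suc (Suc ?n)) (asklp # ks, S, [[]]) ?G" by (rule go_add[OF g1 g5])
  then show ?case by (rule af_mono) (simp add: qf_snoc enc_def)
qed

lemma go_askc:
  assumes "S 7 = rev (qf qs)" "S 2 = []" "S 8 = []"
  shows "Gs X (14 * length (qf qs) + 10) (askc M # ks, S, [[]])
     (ks, S(7 := [3], 6 := ret M # S 6, 5 := map (\<lambda>x. sym_of_bit (x \<in> X)) qs @ drop (length qs) (S 5)), [[]])"
proof -
  let ?a = "map (\<lambda>x. sym_of_bit (x \<in> X)) qs"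
  let ?R = "drop (length qs) (S 5)"
  let ?G = "(ks, S(7 := [3], 6 := ret M # S 6, 5 := ?a @ ?R), [[]])"
  let ?S1 = "S(7 := [], 8 := ?a, 5 := ?R)"
  let ?S2 = "S(7 := [], 8 := [], 5 := ?R, 2 := rev ?a)"
  let ?S3 = "S(7 := [], 5 := ?a @ ?R)"
  let ?k2 = "Seq (mv 2 5) (Seq (Push 7 3) (Push 6 (ret M))) # ks"
  have g1: "Gs X (10 * length (qf qs) + 1) (asklp # Seq (mv 8 2) (Seq (mv 2 5) (Seq (Push 7 3) (Push 6 (ret M)))) # ks, S, [[]])
      (Seq (mv 8 2) (Seq (mv 2 5) (Seq (Push 7 3) (Push 6 (ret M)))) # ks, ?S1, [[]])"
    using go_asklp[OF assms(1,2), of X] assms(3) by simp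
  have "Gs X (2 * length ?a + 1) (mv 8 2 # ?k2, ?S1, [[]]) (?k2, ?S1(8 := [], 2 := rev ?a @ ?S1 2), [[]])"
    by (rule go_mv) auto
  moreover have "?S1(8 := [], 2 := rev ?a @ ?S1 2) = ?S2" using assms(2) by (auto simp: fun_eq_iff fun_upd_apply)
  ultimately have g2: "Gs X (2 * length qs + 1) (mv 8 2 # ?k2, ?S1, [[]]) (?k2, ?S2, [[]])" by simp
  have "Gs X (2 * length (rev ?a) + 1) (mv 2 5 # Seq (Push 7 3) (Push 6 (ret M)) # ks, ?S2, [[]])
      (Seq (Push 7 3) (Push 6 (ret M)) # ks, ?S2(2 := [], 5 := rev (rev ?a) @ ?S2 5), [[]])"
    by (rule go_mv) auto
  moreover have "?S2(2 := [], 5 := rev (rev ?a) @ ?S2 5) = ?S3" using assms(2,3) by (auto simp: fun_eq_iff fun_upd_apply)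
  ultimately have g3: "Gs X (2 * length qs + 1) (mv 2 5 # Seq (Push 7 3) (Push 6 (ret M)) # ks, ?S2, [[]])
      (Seq (Push 7 3) (Push 6 (ret M)) # ks, ?S3, [[]])" by simp
  have e: "?S3(7 := 3 # ?S3 7, 6 := ret M # (?S3(7 := 3 # ?S3 7)) 6) = S(7 := [3], 6 := ret M # S 6, 5 := ?a @ ?R)"
    by (auto simp: fun_eq_iff fun_upd_apply)
  have g4: "Gs X (Suc (Suc (Suc 0))) (Seq (Push 7 3) (Push 6 (ret M)) # ks, ?S3, [[]]) ?G"
    by (rule go_Seq, rule go_Push, rule go_Push, unfold e) (rule af_now, simp)
  have "Gs X (Suc (10 * length (qf qs) + 1 + Suc (2 * length qs + 1 + Suc (2 * length qs + 1 + Suc (Suc (Suc 0)))))) (askc M # ks, S, [[]]) ?G"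
    unfolding askc_def
    by (rule go_Seq, rule go_add[OF g1], rule go_Seq, rule go_add[OF g2], rule go_Seq, rule go_add[OF g3 g4])
  then show ?thesis by (rule af_mono) (use length_qf[of qs] in simp)
qed

lemma go_trc:
  assumes "qs \<noteq> []"
  shows "Gs X 8 (trc t # ks, S(4 := L, 5 := tl R, 6 := [], 7 := rev (qf qs)), q) (ks, sto S (ztr (p, L, R, qs) t), q)"
proof -
  obtain q0 a q' b dd x where t: "t = (q0, a, q', b, dd, x)" by (cases t)
  let ?S0 = "S(4 := L, 5 := tl R, 6 := [], 7 := rev (qf qs))"
  let ?S1 = "S(4 := L, 5 := tl R, 6 := [], 7 := rev (qf (qupd x qs)))"
  let ?S2 = "S(4 := fst (zmove dd b L (tl R)), 5 := snd (zmove dd b L (tl R)), 6 := [], 7 := rev (qf (qupd x qs)))"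
  have g1: "Gs X 1 (qc x # ks', ?S0, q) (ks', ?S1, q)" for ks'
  proof (cases x)
    case QNone
    have "Gs X (Suc 0) (Skip # ks', ?S0, q) (ks', ?S0, q)" by (rule go_Skip) simp
    then show ?thesis using QNone by simp
  next
    case (QWrite b')
    have "?S0(7 := sym_of_bit b' # ?S0 7) = ?S1" using qf_qupd[OF assms, of x] QWrite by simp
    then have "Gs X (Suc 0) (Push 7 (sym_of_bit b') # ks', ?S0, q) (ks', ?S1, q)" by (intro go_Push af_now) simp
    then show ?thesis using QWrite by simp
  next
    case QNext
    have "?S0(7 := 3 # ?S0 7) = ?S1" using qf_qupd[OF assms, of x] QNext by simp
    then have "Gs X (Suc 0) (Push 7 3 # ks', ?S0, q) (ks', ?S1, q)" by (intro go_Push af_now) simp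
    then show ?thesis using QNext by simp
  qed
  have g2: "Gs X 4 (mvc dd b # ks', ?S1, q) (ks', ?S2, q)" for ks'
  proof -
    have a: "Gs X (Suc 0) (Push 4 b # ks', ?S1, q) (ks', ?S2, q)" if "dd = 1"
    proof -
      have "?S1(4 := b # ?S1 4) = ?S2" using that by (auto simp: zmove_def fun_eq_iff fun_upd_apply)
      then show ?thesis by (intro go_Push af_now) simp
    qed
    have b: "Gs X (Suc (Suc (Suc (Suc 0)))) (Seq (Push 5 b) (Pop 4 (\<lambda>y. Push 5 (or0 y))) # ks', ?S1, q) (ks', ?S2, q)" if "dd = -1"
    proof -
      have "?S1(5 := b # tl R, 4 := tl L, 5 := hd0 L # b # tl R) = ?S2" using that by (auto simp: zmove_def fun_eq_iff fun_upd_apply)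
      then show ?thesis
        by (intro go_Seq go_Push go_Pop) (rule af_now, auto simp: or0_hdo fun_eq_iff fun_upd_apply)
    qed
    have c: "Gs X (Suc 0) (Push 5 b # ks', ?S1, q) (ks', ?S2, q)" if "dd \<noteq> 1" "dd \<noteq> -1"
    proof -
      have "?S1(5 := b # ?S1 5) = ?S2" using that by (auto simp: zmove_def fun_eq_iff fun_upd_apply)
      then show ?thesis by (intro go_Push af_now) simp
    qed
    show ?thesis unfolding mvc_def using af_mono[OF a, of 4] af_mono[OF b, of 4] af_mono[OF c, of 4] by simp
  qed
  have e: "?S2(6 := q' # ?S2 6) = sto S (ztr (p, L, R, qs) t)" unfolding t by (auto simp: fun_eq_iff fun_upd_apply)
  have g3: "Gs X (Suc 0) (Push 6 q' # ks, ?S2, q) (ks, sto S (ztr (p, L, R, qs) t), q)"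
    by (rule go_Push, unfold e) (rule af_now, simp)
  have "Gs X (Suc (1 + Suc (4 + Suc 0))) (trc t # ks, ?S0, q) (ks, sto S (ztr (p, L, R, qs) t), q)"
    unfolding t trc.simps by (rule go_Seq, rule go_add[OF g1], rule go_Seq, rule go_add[OF g2]) (use g3 t in simp)
  then show ?thesis by (rule af_mono) simp
qed

fun zsz :: "zcfg \<Rightarrow> nat" where
  "zsz (q, L, R, qs) = length L + length R + length (qf qs)"

fun zne :: "zcfg \<Rightarrow> bool" where
  "zne (q, L, R, qs) = (qs \<noteq> [])"

text \<open>In a query step the answers lengthen the tape by at most the number of queries, and the
  buffer that disappears held at least one symbol per query.\<close>

lemma zx_sz: "zne z \<Longrightarrow> zx M md X z z' \<Longrightarrow> zne z' \<and> zsz z' \<le> zsz z + 3"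
proof -
  assume a: "zne z" "zx M md X z z'"
  obtain q L R qs where z: "z = (q, L, R, qs)" by (cases z)
  have ne: "qs \<noteq> []" using a z by simp
  have lq: "length (qf (qupd x qs)) \<le> Suc (length (qf qs))" for x
    using arg_cong[OF qf_qupd[OF ne, of x], of length] by (cases x) auto
  have tr: "zne (ztr z t) \<and> zsz (ztr z t) \<le> zsz z + 3" for t
  proof -
    obtain q0 a q' b dd x where t: "t = (q0, a, q', b, dd, x)" by (cases t)
    show ?thesis using lq[of x] qupd_ne[OF ne, of x] unfolding z t by (auto simp: zmove_def)
  qed
  have one: "length (qf [[]]) = 1" by (simp add: qf_def enc_def)
  show ?thesis using a(2) tr ne length_qf[of qs] one unfolding z by (auto split: if_splits)
qed

lemma dec_simstep:
  assumes wf: "wf_otm M" and S: "S 2 = []" "S 8 = []" and ne: "zne z"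
    and k: "\<And>z'. zx M md X z z' \<Longrightarrow> dec X m (ks, sto S z', [[]]) (P z')"
  shows "dec X (m + (card (delta M) + 14 * zsz z + 20)) (simstep M md # ks, sto S z, [[]]) (\<exists>z'. zx M md X z z' \<and> P z')"
proof -
  obtain q L R qs where z: "z = (q, L, R, qs)" by (cases z)
  have qs: "qs \<noteq> []" using ne z by simp
  let ?S1 = "S(4 := L, 5 := R, 6 := [], 7 := rev (qf qs))"
  let ?S2 = "S(4 := L, 5 := tl R, 6 := [], 7 := rev (qf qs))"
  have e1: "(sto S z)(6 := []) = ?S1" unfolding z by (auto simp: fun_eq_iff fun_upd_apply)
  have e2: "?S1(5 := tl R) = ?S2" by (auto simp: fun_eq_iff fun_upd_apply)
  have s6: "sto S z 6 = [q]" unfolding z by simp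
  consider (ask) "md \<and> q = ask M" | (stuck) "\<not> (md \<and> q = ask M)" "trans_of M q (hd0 R) = {}"
    | (step) "\<not> (md \<and> q = ask M)" "trans_of M q (hd0 R) \<noteq> {}" by blast
  then show ?thesis
  proof cases
    case ask
    let ?z = "(ret M, L, map (\<lambda>x. sym_of_bit (x \<in> X)) qs @ drop (length qs) R, [[]])"
    have zx: "zx M md X z z' \<longleftrightarrow> z' = ?z" for z' using ask z by simp
    have "Gs X (14 * length (qf qs) + 10) (askc M # ks, ?S1, [[]])
       (ks, ?S1(7 := [3], 6 := ret M # ?S1 6, 5 := map (\<lambda>x. sym_of_bit (x \<in> X)) qs @ drop (length qs) (?S1 5)), [[]])"
      by (rule go_askc) (use S in auto)
    moreover have "?S1(7 := [3], 6 := ret M # ?S1 6, 5 := map (\<lambda>x. sym_of_bit (x \<in> X)) qs @ drop (length qs) (?S1 5)) = sto S ?z"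
      by (auto simp: fun_eq_iff fun_upd_apply qf_def enc_def)
    ultimately have g: "Gs X (14 * length (qf qs) + 10) (askc M # ks, ?S1, [[]]) (ks, sto S ?z, [[]])" by simp
    have g1: "Gs X (Suc (14 * length (qf qs) + 10)) (simstep M md # ks, sto S z, [[]]) (ks, sto S ?z, [[]])"
      unfolding simstep_def by (rule go_Pop) (use g ask s6 e1 in simp)
    have "dec X (Suc (14 * length (qf qs) + 10) + m) (simstep M md # ks, sto S z, [[]]) (P ?z)"
      by (rule dec_go[OF g1 k]) (simp add: zx)
    then have "dec X (m + (card (delta M) + 14 * zsz z + 20)) (simstep M md # ks, sto S z, [[]]) (P ?z)"
      by (rule dec_mono) (simp add: z)
    then show ?thesis by (simp add: zx del: sto.simps)
  next
    case stuck
    let ?z = "(q, L, hd0 R # tl R, qs)"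
    have zx: "zx M md X z z' \<longleftrightarrow> z' = ?z" for z' unfolding z zx.simps using stuck by presburger
    have e: "?S2(5 := hd0 R # ?S2 5, 6 := [q]) = sto S ?z" by (auto simp: fun_eq_iff fun_upd_apply)
    have "Gs X (Suc (Suc (Suc (Suc (Suc 0))))) (simstep M md # ks, sto S z, [[]]) (ks, sto S ?z, [[]])"
      unfolding simstep_def
    proof (rule go_Pop, unfold s6)
      have "Gs X (Suc (Suc (Suc (Suc 0)))) (Pop 5 (\<lambda>a. stepc M (or0 (Some q)) (or0 a)) # ks, ?S1, [[]]) (ks, sto S ?z, [[]])"
        by (rule go_Pop) (use stuck e e2 in \<open>simp add: or0_hdo stepc_def or0_def[of "Some _"] del: sto.simps, intro go_Seq go_Push af_now, simp del: sto.simps\<close>)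
      then show "Gs X (Suc (Suc (Suc (Suc 0)))) ((if hdo [q] = None then Halt False else if md \<and> hdo [q] = Some (ask M) then askc M
         else Pop 5 (\<lambda>a. stepc M (or0 (hdo [q])) (or0 a))) # ks, (sto S z)(6 := tl [q]), [[]]) (ks, sto S ?z, [[]])"
        using stuck(1) e1 by (cases "md \<and> q = ask M") (auto simp del: sto.simps)
    qed
    from dec_go[OF this k] have "dec X (Suc (Suc (Suc (Suc (Suc 0)))) + m) (simstep M md # ks, sto S z, [[]]) (P ?z)"
      by (simp add: zx del: sto.simps)
    then have "dec X (m + (card (delta M) + 14 * zsz z + 20)) (simstep M md # ks, sto S z, [[]]) (P ?z)"
      by (rule dec_mono) simp
    then show ?thesis by (simp add: zx del: sto.simps)
  next
    case step
    let ?ts = "tlist M q (hd0 R)"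
    have ts: "set ?ts = trans_of M q (hd0 R)" using tlist[OF wf] by blast
    have zx: "zx M md X z z' \<longleftrightarrow> (\<exists>t \<in> set ?ts. z' = ztr z t)" for z' unfolding z zx.simps ts using step by presburger
    have d1: "dec X (8 + m) (trc t # ks, ?S2, [[]]) (P (ztr z t))" if t: "t \<in> set ?ts" for t
    proof -
      have "dec X m (ks, sto S (ztr z t), [[]]) (P (ztr z t))" by (rule k) (use zx t in blast)
      then show ?thesis
        using dec_go[OF go_trc[where t = t and qs = qs and X = X and ks = ks and S = S and L = L and R = R and q = "[[]]" and p = q, OF qs]]
        unfolding z by blast
    qed
    \<comment> \<open>The verdict of a branch is phrased by reachability because
      \<open>dec_Ors\<close> expects a predicate on programs, while \<open>P\<close> refers to the
      transition from which the program was made.\<close>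
    have "dec X (8 + m + length (map trc ?ts)) (Ors (map trc ?ts) # ks, ?S2, [[]]) (\<exists>c \<in> set (map trc ?ts). \<exists>d. (astep X)\<^sup>*\<^sup>* (c # ks, ?S2, [[]]) d \<and> accf d)"
      by (rule dec_Ors) (use d1 in \<open>auto simp: dec_def simp del: split_paired_Ex\<close>)
    moreover have "(\<exists>c \<in> set (map trc ?ts). \<exists>d. (astep X)\<^sup>*\<^sup>* (c # ks, ?S2, [[]]) d \<and> accf d) \<longleftrightarrow> (\<exists>z'. zx M md X z z' \<and> P z')"
    proof -
      have "(\<exists>d. (astep X)\<^sup>*\<^sup>* (trc t # ks, ?S2, [[]]) d \<and> accf d) \<longleftrightarrow> P (ztr z t)" if "t \<in> set ?ts" for t
        using d1[OF that] unfolding dec_def by blast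
      then show ?thesis unfolding zx by (simp del: split_paired_Ex trc.simps ztr.simps) blast
    qed
    ultimately have d: "dec X (8 + m + length ?ts) (Ors (map trc ?ts) # ks, ?S2, [[]]) (\<exists>z'. zx M md X z z' \<and> P z')" by simp
    have "Gs X (Suc (Suc 0)) (simstep M md # ks, sto S z, [[]]) (Ors (map trc ?ts) # ks, ?S2, [[]])"
      unfolding simstep_def
    proof (rule go_Pop, unfold s6)
      have "Gs X (Suc 0) (Pop 5 (\<lambda>a. stepc M (or0 (Some q)) (or0 a)) # ks, ?S1, [[]]) (Ors (map trc ?ts) # ks, ?S2, [[]])"
        by (rule go_Pop) (use step e2 in \<open>simp add: or0_hdo stepc_def or0_def[of "Some _"]\<close>)
      then show "Gs X (Suc 0) ((if hdo [q] = None then Halt False else if md \<and> hdo [q] = Some (ask M) then askc M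
         else Pop 5 (\<lambda>a. stepc M (or0 (hdo [q])) (or0 a))) # ks, (sto S z)(6 := tl [q]), [[]]) (Ors (map trc ?ts) # ks, ?S2, [[]])"
        using step(1) e1 by (cases "md \<and> q = ask M") (auto simp del: sto.simps)
    qed
    from dec_go[OF this d] show ?thesis
      by (rule dec_mono) (use length_tlist[OF wf, of q "hd0 R"] in simp)
  qed
qed


lemma ex_relpow_Suc:
  "(\<exists>z'. (R ^^ Suc n) z z' \<and> P z') \<longleftrightarrow> (\<exists>z1. R z z1 \<and> (\<exists>z'. (R ^^ n) z1 z' \<and> P z'))"
proof
  assume "\<exists>z'. (R ^^ Suc n) z z' \<and> P z'"
  then obtain z' where "(R ^^ Suc n) z z'" "P z'" by blast
  moreover obtain z1 where "R z z1" "(R ^^ n) z1 z'" using relpowp_Suc_D2[OF calculation(1)] by blast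
  ultimately show "\<exists>z1. R z z1 \<and> (\<exists>z'. (R ^^ n) z1 z' \<and> P z')" by blast
next
  assume "\<exists>z1. R z z1 \<and> (\<exists>z'. (R ^^ n) z1 z' \<and> P z')"
  then obtain z1 z' where "R z z1" "(R ^^ n) z1 z'" "P z'" by blast
  then show "\<exists>z'. (R ^^ Suc n) z z' \<and> P z'" using relpowp_Suc_I2[of R z z1 n z'] by blast
qed

text \<open>Choices of the simulated machine become choices of the program, so the verdict is
  existential over runs of exactly as many ticks as the clock has symbols; \<open>P\<close> is the
  verdict of the rest of the program.\<close>

lemma dec_sim:
  assumes wf: "wf_otm M"
  shows "S 1 = l \<Longrightarrow> S 2 = [] \<Longrightarrow> S 8 = [] \<Longrightarrow> zne z \<Longrightarrow>
    (\<And>z'. (zx M md X ^^ length l) z z' \<Longrightarrow> dec X m (ks, sto (S(1 := [])) z', [[]]) (P z')) \<Longrightarrow>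
    dec X (m + length l * (card (delta M) + 14 * (zsz z + 3 * length l) + 21) + 1) (sim M md # ks, sto S z, [[]])
      (\<exists>z'. (zx M md X ^^ length l) z z' \<and> P z')"
proof (induction l arbitrary: S z)
  case Nil
  have s1: "sto S z 1 = []" using Nil by (cases z) simp
  have e: "(sto S z)(1 := tl []) = sto (S(1 := [])) z" using Nil by (cases z) (auto simp: fun_eq_iff fun_upd_apply)
  have "Gs X (Suc 0) (sim M md # ks, sto S z, [[]]) (ks, sto (S(1 := [])) z, [[]])"
    unfolding sim_def by (rule go_While, unfold s1 e) simp
  moreover have "dec X m (ks, sto (S(1 := [])) z, [[]]) (P z)" by (rule Nil.prems) simp
  ultimately have "dec X (Suc 0 + m) (sim M md # ks, sto S z, [[]]) (P z)" by (rule dec_go)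
  then have "dec X (m + length [] * (card (delta M) + 14 * (zsz z + 3 * length []) + 21) + 1) (sim M md # ks, sto S z, [[]]) (P z)"
    by (rule dec_mono) simp
  then show ?case by (simp del: split_paired_Ex)
next
  case (Cons a l)
  let ?S = "S(1 := l)"
  let ?t = "length l * (card (delta M) + 14 * (zsz z + 3 * Suc (length l)) + 21) + 1"
  let ?c = "card (delta M) + 14 * zsz z + 20"
  have s1: "sto S z 1 = a # l" using Cons.prems by (cases z) simp
  have e: "(sto S z)(1 := l) = sto ?S z" by (cases z) (auto simp: fun_eq_iff fun_upd_apply)
  have "Gs X (Suc 0) (sim M md # ks, sto S z, [[]]) (simstep M md # sim M md # ks, sto ?S z, [[]])"
    unfolding sim_def by (rule go_While, unfold s1 list.sel(3) e) simp
  moreover have "dec X (m + ?t + ?c) (simstep M md # sim M md # ks, sto ?S z, [[]])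
      (\<exists>z1. zx M md X z z1 \<and> (\<exists>z'. (zx M md X ^^ length l) z1 z' \<and> P z'))"
  proof (rule dec_simstep[OF wf])
    fix z1 assume z1: "zx M md X z z1"
    have "dec X (m + length l * (card (delta M) + 14 * (zsz z1 + 3 * length l) + 21) + 1) (sim M md # ks, sto ?S z1, [[]])
      (\<exists>z'. (zx M md X ^^ length l) z1 z' \<and> P z')"
    proof (rule Cons.IH)
      fix z' assume "(zx M md X ^^ length l) z1 z'"
      then have "(zx M md X ^^ length (a # l)) z z'" using z1 relpowp_Suc_I2 by fastforce
      then show "dec X m (ks, sto (?S(1 := [])) z', [[]]) (P z')" using Cons.prems(5) by simp
    qed (use Cons.prems zx_sz[OF _ z1] in auto)
    then show "dec X (m + ?t) (sim M md # ks, sto ?S z1, [[]]) (\<exists>z'. (zx M md X ^^ length l) z1 z' \<and> P z')"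
      by (rule dec_mono) (use zx_sz[OF Cons.prems(4) z1] in \<open>simp add: mult_le_mono\<close>)
  qed (use Cons.prems in auto)
  ultimately have d: "dec X (Suc 0 + (m + ?t + ?c)) (sim M md # ks, sto S z, [[]])
      (\<exists>z1. zx M md X z z1 \<and> (\<exists>z'. (zx M md X ^^ length l) z1 z' \<and> P z'))" by (rule dec_go)
  have eq: "(\<exists>z1. zx M md X z z1 \<and> (\<exists>z'. (zx M md X ^^ length l) z1 z' \<and> P z')) = (\<exists>z'. (zx M md X ^^ length (a # l)) z z' \<and> P z')"
    unfolding list.size(4) add_Suc_right add_0_right One_nat_def ex_relpow_Suc ..
  have "dec X (Suc 0 + (m + ?t + ?c)) (sim M md # ks, sto S z, [[]]) (\<exists>z'. (zx M md X ^^ length (a # l)) z z' \<and> P z')"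
    using d unfolding eq .
  then show ?case by (rule dec_mono) (simp add: algebra_simps)
qed

subsection \<open>Zippers and tapes\<close>

fun zrel :: "zcfg \<Rightarrow> cfg \<Rightarrow> bool" where
  "zrel (q, L, R, qs) (q', t, h, qs') = (q' = q \<and> qs' = qs \<and> qs \<noteq> []
     \<and> (\<forall>j. t (h + int j) = nth0 R j) \<and> (\<forall>j. t (h - 1 - int j) = nth0 L j))"

definition stepm :: "otm \<Rightarrow> bool \<Rightarrow> lang \<Rightarrow> cfg \<Rightarrow> cfg \<Rightarrow> bool" where
  "stepm M md X c c' \<longleftrightarrow> step M X c c' \<and> (md \<or> fst c \<noteq> ask M)"

text \<open>Stuck configurations repeat, so a run of exactly \<open>t\<close> ticks always exists
  and represents any shorter run that has halted.\<close>

definition tot :: "('c \<Rightarrow> 'c \<Rightarrow> bool) \<Rightarrow> 'c \<Rightarrow> 'c \<Rightarrow> bool" where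
  "tot R c c' \<longleftrightarrow> R c c' \<or> ((\<forall>d. \<not> R c d) \<and> c' = c)"

lemma nth0_tl: "nth0 (tl xs) j = nth0 xs (Suc j)"
  by (cases xs) (auto simp: nth0_def)

lemma nth0_Cons: "nth0 (x # xs) j = (case j of 0 \<Rightarrow> x | Suc i \<Rightarrow> nth0 xs i)"
  by (cases j) (auto simp: nth0_def)

lemma hd0_nth0: "hd0 xs = nth0 xs 0"
  by (cases xs) (auto simp: nth0_def hd0_def)

lemma zrel_move:
  assumes "zrel (q, L, R, qs) (q, t, h, qs)" "dd \<in> {-1, 0, 1}"
  shows "zrel (q', fst (zmove dd b L (tl R)), snd (zmove dd b L (tl R)), qupd x qs) (q', t(h := b), h + dd, qupd x qs)"
proof -
  have R: "t (h + int j) = nth0 R j" and L: "t (h - 1 - int j) = nth0 L j" for j using assms(1) by auto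
  have ne: "qupd x qs \<noteq> []" using assms(1) qupd_ne by auto
  consider "dd = 1" | "dd = 0" | "dd = -1" using assms(2) by auto
  then show ?thesis
  proof cases
    case 1
    have a: "(t(h := b)) (h + 1 + int j) = nth0 (tl R) j" for j
      using R[of "Suc j"] by (simp add: nth0_tl add.assoc)
    have b: "(t(h := b)) (h + 1 - 1 - int j) = nth0 (b # L) j" for j
    proof (cases j)
      case (Suc i)
      have "h + 1 - 1 - int j = h - 1 - int i" using Suc by simp
      then show ?thesis using L[of i] Suc by (simp add: nth0_Cons algebra_simps)
    qed (simp add: nth0_Cons)
    show ?thesis using 1 a b ne by (simp add: zmove_def)
  next
    case 2
    have a: "(t(h := b)) (h + int j) = nth0 (b # tl R) j" for j
      using R[of j] by (cases j) (auto simp: nth0_tl nth0_Cons fun_upd_apply)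
    have b: "(t(h := b)) (h - 1 - int j) = nth0 L j" for j
      using L[of j] by (simp add: fun_upd_apply)
    show ?thesis using 2 a b ne by (simp add: zmove_def)
  next
    case 3
    have a: "(t(h := b)) (h + -1 + int j) = nth0 (hd0 L # b # tl R) j" for j
    proof -
      consider "j = 0" | "j = 1" | i where "j = Suc (Suc i)" by (metis One_nat_def not0_implies_Suc)
      then show ?thesis
      proof cases
        case 1
        then show ?thesis using L[of 0] by (simp add: nth0_Cons hd0_nth0 fun_upd_apply)
      next
        case 2
        then show ?thesis by (simp add: nth0_Cons)
      next
        case (3 i)
        then have "h + -1 + int j = h + int (Suc i)" by simp
        then show ?thesis using R[of "Suc i"] 3 by (simp add: nth0_Cons nth0_tl fun_upd_apply algebra_simps)
      qed
    qed
    have b: "(t(h := b)) (h + -1 - 1 - int j) = nth0 (tl L) j" for j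
    proof -
      have "h + -1 - 1 - int j = h - 1 - int (Suc j)" by simp
      then show ?thesis using L[of "Suc j"] by (simp add: nth0_tl fun_upd_apply algebra_simps)
    qed
    show ?thesis using 3 a b ne by (simp add: zmove_def)
  qed
qed

lemma zrel_write:
  assumes "zrel (q, L, R, qs) (q, t, h, qs)"
  shows "zrel (q', L, map sym_of_bit ans @ drop (length ans) R, [[]]) (q', write_answers t h ans, h, [[]])"
proof -
  have R: "t (h + int j) = nth0 R j" and L: "t (h - 1 - int j) = nth0 L j" for j using assms(1) by auto
  have "write_answers t h ans (h + int j) = nth0 (map sym_of_bit ans @ drop (length ans) R) j" for j
    using R[of j] by (auto simp: write_answers_def nth0_def nth_append)
  moreover have "write_answers t h ans (h - 1 - int j) = nth0 L j" for j
    using L[of j] by (simp add: write_answers_def)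
  ultimately show ?thesis by simp
qed

lemma delta_ok:
  assumes "wf_otm M" "(q1, a, q2, b, dd, x) \<in> delta M"
  shows "q1 \<noteq> acc M \<and> q1 \<noteq> rej M \<and> q1 \<noteq> ask M \<and> dd \<in> {-1, 0, 1}"
proof -
  have "\<forall>(q, a, q', b, d, x) \<in> delta M. d \<in> {-1, 0, 1} \<and> q \<noteq> acc M \<and> q \<noteq> rej M \<and> q \<noteq> ask M"
    using assms(1) unfolding wf_otm_def by (elim conjE)
  from bspec[OF this assms(2)] show ?thesis by simp
qed

text \<open>Both directions are needed: \<open>zsim_iff\<close> must also rule out program runs to
  which no machine run corresponds.\<close>

lemma zx_bisim:
  assumes wf: "wf_otm M" and rel: "zrel z c"
  shows "zx M md X z z' \<Longrightarrow> \<exists>c'. tot (stepm M md X) c c' \<and> zrel z' c'"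
    and "tot (stepm M md X) c c' \<Longrightarrow> \<exists>z'. zx M md X z z' \<and> zrel z' c'"
proof -
  obtain q L R qs where z: "z = (q, L, R, qs)" by (cases z)
  obtain t h where c: "c = (q, t, h, qs)" using rel unfolding z by (cases c) auto
  have rel': "zrel (q, L, R, qs) (q, t, h, qs)" using rel z c by simp
  have th: "t h = hd0 R" using rel'[simplified] by (metis add_0_right hd0_nth0 of_nat_0)
  have halting: "q1 \<noteq> acc M \<and> q1 \<noteq> rej M \<and> q1 \<noteq> ask M \<and> dd \<in> {-1, 0, 1}" if "(q1, a, q2, b, dd, x) \<in> delta M" for q1 a q2 b dd x
    using wf that delta_ok by metis
  show "\<exists>c'. tot (stepm M md X) c c' \<and> zrel z' c'" if zz: "zx M md X z z'"
  proof -
    consider (ask) "md \<and> q = ask M" | (stuck) "\<not> (md \<and> q = ask M)" "trans_of M q (hd0 R) = {}"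
      | (step) "\<not> (md \<and> q = ask M)" "trans_of M q (hd0 R) \<noteq> {}" by blast
    then show ?thesis
    proof cases
      case ask
      let ?ans = "map (\<lambda>x. x \<in> X) qs"
      have "stepm M md X c (ret M, write_answers t h ?ans, h, [[]])" using ask unfolding c stepm_def step_def by simp
      moreover have "z' = (ret M, L, map sym_of_bit ?ans @ drop (length ?ans) R, [[]])" using zz ask unfolding z by (simp add: comp_def)
      ultimately show ?thesis using zrel_write[OF rel', of "ret M" ?ans] unfolding tot_def by blast
    next
      case stuck
      have "\<not> stepm M md X c d" for d
      proof
        assume d: "stepm M md X c d"
        then have "q \<noteq> ask M" using stuck(1) unfolding c stepm_def by auto
        then obtain q' b dd x where "(q, t h, q', b, dd, x) \<in> delta M" using d unfolding c stepm_def step_def by (cases d) auto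
        then have "(q, t h, q', b, dd, x) \<in> trans_of M q (hd0 R)" unfolding trans_of_def th by simp
        then show False using stuck(2) by simp
      qed
      moreover have "z' = (q, L, hd0 R # tl R, qs)" using zz stuck unfolding z zx.simps by presburger
      \<comment> \<open>Popping and pushing back may turn an implicit blank into an explicit one,
        which changes the list \<open>R\<close> but not the tape it denotes.\<close>
      moreover have "nth0 (hd0 R # tl R) j = nth0 R j" for j by (cases j) (simp_all add: nth0_Cons nth0_tl hd0_nth0)
      ultimately show ?thesis using rel' unfolding tot_def c by (intro exI[of _ "(q, t, h, qs)"]) simp
    next
      case step
      then have "\<exists>t \<in> trans_of M q (hd0 R). z' = ztr z t" using zz unfolding z zx.simps by presburger
      then obtain tt where tt: "tt \<in> trans_of M q (hd0 R)" "z' = ztr z tt" by (elim bexE)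
      obtain q' b dd x where t': "tt = (q, hd0 R, q', b, dd, x)" "(q, t h, q', b, dd, x) \<in> delta M"
        using tt(1) unfolding trans_of_def th by (cases tt) auto
      have "stepm M md X c (q', t(h := b), h + dd, qupd x qs)"
        using halting[OF t'(2)] t'(2) unfolding c stepm_def step_def by auto
      moreover have "zrel z' (q', t(h := b), h + dd, qupd x qs)"
        unfolding tt(2) t'(1) z ztr.simps by (rule zrel_move[OF rel']) (use halting[OF t'(2)] in blast)
      ultimately show ?thesis unfolding tot_def by blast
    qed
  qed
  show "\<exists>z'. zx M md X z z' \<and> zrel z' c'" if tt: "tot (stepm M md X) c c'"
  proof (cases "stepm M md X c c'")
    case True
    obtain q' t' h' qs' where c': "c' = (q', t', h', qs')" by (cases c')
    show ?thesis
    proof (cases "q = ask M")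
      case q: True
      then have md: "md" using True unfolding c stepm_def by simp
      let ?ans = "map (\<lambda>x. x \<in> X) qs"
      have "c' = (ret M, write_answers t h ?ans, h, [[]])" using True q unfolding c c' stepm_def step_def by simp
      moreover have "zx M md X z (ret M, L, map sym_of_bit ?ans @ drop (length ?ans) R, [[]])" using md q unfolding z by (simp add: comp_def)
      ultimately show ?thesis using zrel_write[OF rel', of "ret M" ?ans] by blast
    next
      case False
      then obtain b dd x where t': "(q, t h, q', b, dd, x) \<in> delta M" "c' = (q', t(h := b), h + dd, qupd x qs)"
        using True unfolding c c' stepm_def step_def by auto
      then have "(q, hd0 R, q', b, dd, x) \<in> trans_of M q (hd0 R)" unfolding trans_of_def th by simp
      then have "zx M md X z (ztr z (q, hd0 R, q', b, dd, x))" using False unfolding z zx.simps by (metis empty_iff)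
      moreover have "zrel (ztr z (q, hd0 R, q', b, dd, x)) c'"
        unfolding t'(2) z ztr.simps by (rule zrel_move[OF rel']) (use halting[OF t'(1)] in blast)
      ultimately show ?thesis by blast
    qed
  next
    case False
    then have c': "c' = c" "\<And>d. \<not> stepm M md X c d" using tt unfolding tot_def by auto
    have nask: "\<not> (md \<and> q = ask M)"
    proof
      assume a: "md \<and> q = ask M"
      have "stepm M md X c (ret M, write_answers t h (map (\<lambda>x. x \<in> X) qs), h, [[]])" using a unfolding c stepm_def step_def by simp
      then show False using c'(2) by blast
    qed
    have emp: "trans_of M q (hd0 R) = {}"
    proof (rule ccontr)
      assume "trans_of M q (hd0 R) \<noteq> {}"
      then obtain q' b dd x where t': "(q, t h, q', b, dd, x) \<in> delta M" unfolding trans_of_def th by force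
      have "stepm M md X c (q', t(h := b), h + dd, qupd x qs)"
        using halting[OF t'] t' unfolding c stepm_def step_def by auto
      then show False using c'(2) by blast
    qed
    have "zx M md X z (q, L, hd0 R # tl R, qs)" unfolding z zx.simps using nask emp by presburger
    moreover have "nth0 (hd0 R # tl R) j = nth0 R j" for j by (cases j) (simp_all add: nth0_Cons nth0_tl hd0_nth0)
    ultimately show ?thesis using rel' unfolding c'(1) c by (intro exI[of _ "(q, L, hd0 R # tl R, qs)"]) simp
  qed
qed

lemma zsim_iff:
  assumes wf: "wf_otm M" and rel: "zrel z c" and PQ: "\<And>z' c'. zrel z' c' \<Longrightarrow> P z' \<longleftrightarrow> Q c'"
  shows "(\<exists>z'. (zx M md X ^^ t) z z' \<and> P z') \<longleftrightarrow> (\<exists>c'. (tot (stepm M md X) ^^ t) c c' \<and> Q c')"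
  using rel
proof (induction t arbitrary: z c)
  case 0
  then show ?case using PQ by simp
next
  case (Suc t)
  have "(\<exists>z'. (zx M md X ^^ Suc t) z z' \<and> P z') \<longleftrightarrow> (\<exists>z1. zx M md X z z1 \<and> (\<exists>z'. (zx M md X ^^ t) z1 z' \<and> P z'))"
    by (rule ex_relpow_Suc)
  also have "\<dots> \<longleftrightarrow> (\<exists>c1. tot (stepm M md X) c c1 \<and> (\<exists>c'. (tot (stepm M md X) ^^ t) c1 c' \<and> Q c'))"
  proof
    assume "\<exists>z1. zx M md X z z1 \<and> (\<exists>z'. (zx M md X ^^ t) z1 z' \<and> P z')"
    then obtain z1 where z1: "zx M md X z z1" "\<exists>z'. (zx M md X ^^ t) z1 z' \<and> P z'" by metis
    obtain c1 where c1: "tot (stepm M md X) c c1" "zrel z1 c1" using zx_bisim(1)[OF wf Suc.prems z1(1)] by metis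
    have "\<exists>c'. (tot (stepm M md X) ^^ t) c1 c' \<and> Q c'" by (rule iffD1[OF Suc.IH[OF c1(2)] z1(2)])
    with c1(1) show "\<exists>c1. tot (stepm M md X) c c1 \<and> (\<exists>c'. (tot (stepm M md X) ^^ t) c1 c' \<and> Q c')" by metis
  next
    assume "\<exists>c1. tot (stepm M md X) c c1 \<and> (\<exists>c'. (tot (stepm M md X) ^^ t) c1 c' \<and> Q c')"
    then obtain c1 where c1: "tot (stepm M md X) c c1" "\<exists>c'. (tot (stepm M md X) ^^ t) c1 c' \<and> Q c'" by metis
    obtain z1 where z1: "zx M md X z z1" "zrel z1 c1" using zx_bisim(2)[OF wf Suc.prems c1(1)] by metis
    have "\<exists>z'. (zx M md X ^^ t) z1 z' \<and> P z'" by (rule iffD2[OF Suc.IH[OF z1(2)] c1(2)])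
    with z1(1) show "\<exists>z1. zx M md X z z1 \<and> (\<exists>z'. (zx M md X ^^ t) z1 z' \<and> P z')" by metis
  qed
  also have "\<dots> \<longleftrightarrow> (\<exists>c'. (tot (stepm M md X) ^^ Suc t) c c' \<and> Q c')"
    by (rule ex_relpow_Suc[symmetric])
  finally show ?case .
qed

lemma zrel_init: "zrel (start M, [], xs, [[]]) (init_cfg M xs)"
  by (auto simp: init_cfg_def init_tape_def nth0_def)

lemma tot_relpow:
  assumes "(tot R ^^ t) c c'"
  shows "\<exists>n \<le> t. (R ^^ n) c c' \<and> (n = t \<or> (\<forall>d. \<not> R c' d))"
  using assms
proof (induction t arbitrary: c')
  case (Suc t)
  then obtain c1 where c1: "(tot R ^^ t) c c1" "tot R c1 c'" by auto
  obtain n where n: "n \<le> t" "(R ^^ n) c c1" "n = t \<or> (\<forall>d. \<not> R c1 d)" using Suc.IH[OF c1(1)] by blast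
  show ?case
  proof (cases "R c1 c'")
    case True
    then have "n = t" using n(3) by blast
    then have "(R ^^ Suc t) c c'" using n(2) True by auto
    then show ?thesis by blast
  next
    case False
    then have "c' = c1" "\<forall>d. \<not> R c1 d" using c1(2) unfolding tot_def by auto
    then show ?thesis using n by (intro exI[of _ n]) auto
  qed
qed auto

lemma relpow_tot:
  assumes "(R ^^ n) c c'" "n \<le> t" "\<And>d. \<not> R c' d"
  shows "(tot R ^^ t) c c'"
proof -
  have a: "(tot R ^^ n) c c'" using assms(1)
  proof (induction n arbitrary: c')
    case (Suc n)
    obtain b where b: "(R ^^ n) c b" "R b c'" using relpowp_Suc_E[OF Suc.prems] by blast
    have "tot R b c'" using b(2) unfolding tot_def by blast
    with Suc.IH[OF b(1)] show ?case by (rule relpowp_Suc_I)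
  qed simp
  have self: "tot R c' c'" using assms(3) unfolding tot_def by blast
  have "(tot R ^^ j) c' c'" for j
  proof (induction j)
    case (Suc j)
    then show ?case using self by (rule relpowp_Suc_I)
  qed simp
  then have "(tot R ^^ (n + (t - n))) c c'" using a unfolding relpowp_add by blast
  then show ?thesis using assms(2) by simp
qed

lemma acc_stuck: "wf_otm M \<Longrightarrow> fst c = acc M \<Longrightarrow> \<not> step M X c d"
  by (cases c, cases d) (auto simp: step_def wf_otm_def)

lemma halts_length:
  assumes "halts_within M X T xs" "(step M X ^^ n) (init_cfg M xs) c"
  shows "n \<le> T"
proof (rule ccontr)
  assume "\<not> n \<le> T"
  then have "n = Suc T + (n - Suc T)" by simp
  then have "\<exists>c'. (step M X ^^ Suc T) (init_cfg M xs) c'" using assms(2) by (metis relcomppE relpowp_add)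
  then show False using assms(1) unfolding halts_within_def by blast
qed

text \<open>Waiting longer than the halting time changes nothing, since an accepting configuration
  is stuck and therefore repeats.\<close>

lemma accepts_tot:
  assumes wf: "wf_otm M" and h: "halts_within M X T xs" and t: "T \<le> t"
  shows "accepts M X xs \<longleftrightarrow> (\<exists>c'. (tot (stepm M True X) ^^ t) (init_cfg M xs) c' \<and> fst c' = acc M)"
proof -
  have R: "stepm M True X = step M X" by (intro ext) (simp add: stepm_def)
  show ?thesis unfolding R
  proof
    assume "accepts M X xs"
    then obtain n c where c: "(step M X ^^ n) (init_cfg M xs) c" "fst c = acc M" unfolding accepts_def by metis
    have "(tot (step M X) ^^ t) (init_cfg M xs) c"
      by (rule relpow_tot[OF c(1)]) (use halts_length[OF h c(1)] t acc_stuck[OF wf c(2)] in auto)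
    then show "\<exists>c'. (tot (step M X) ^^ t) (init_cfg M xs) c' \<and> fst c' = acc M" using c(2) by metis
  next
    assume "\<exists>c'. (tot (step M X) ^^ t) (init_cfg M xs) c' \<and> fst c' = acc M"
    then obtain c' where c': "(tot (step M X) ^^ t) (init_cfg M xs) c'" "fst c' = acc M" by metis
    obtain n where "(step M X ^^ n) (init_cfg M xs) c'" using tot_relpow[OF c'(1)] by metis
    with c'(2) show "accepts M X xs" unfolding accepts_def by metis
  qed
qed

lemma zx_accepts:
  assumes wf: "wf_otm M" and h: "halts_within M X T xs" and t: "T \<le> t"
  shows "(\<exists>z'. (zx M True X ^^ t) (start M, [], xs, [[]]) z' \<and> fst z' = acc M) \<longleftrightarrow> accepts M X xs"
  unfolding accepts_tot[OF assms]
proof (rule zsim_iff[OF wf zrel_init])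
  show "fst z' = acc M \<longleftrightarrow> fst c' = acc M" if "zrel z' c'" for z' c'
    using that by (cases z'; cases c') auto
qed

text \<open>States are bounded together with symbols because stack 6 stores the simulated state as a
  stack symbol.\<close>

definition symbound :: "otm \<Rightarrow> nat \<Rightarrow> bool" where
  "symbound M A \<longleftrightarrow> 4 \<le> A \<and> start M < A \<and> acc M < A \<and> rej M < A \<and> ask M < A \<and> ret M < A
     \<and> (\<forall>(q, a, q', b, dd, x) \<in> delta M. q < A \<and> a < A \<and> q' < A \<and> b < A)"

lemma symbound_mono: "symbound M A \<Longrightarrow> A \<le> A' \<Longrightarrow> symbound M A'"
  unfolding symbound_def by fastforce

lemma symbound_ex: "wf_otm M \<Longrightarrow> \<exists>A. symbound M A"
proof -
  assume wf: "wf_otm M"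
  let ?f = "\<lambda>(q, a, q', b, dd :: int, x :: qact). q + a + q' + (b :: nat)"
  let ?A = "5 + start M + acc M + rej M + ask M + ret M + Max (insert 0 (?f ` delta M))"
  have fin: "finite (insert 0 (?f ` delta M))" using wf unfolding wf_otm_def by simp
  have "q < ?A \<and> a < ?A \<and> q' < ?A \<and> b < ?A" if "(q, a, q', b, dd, x) \<in> delta M" for q a q' b dd x
  proof -
    have "?f (q, a, q', b, dd, x) \<in> insert 0 (?f ` delta M)" using that by blast
    then have "?f (q, a, q', b, dd, x) \<le> Max (insert 0 (?f ` delta M))" using fin by (rule Max_ge[rotated])
    then show ?thesis by simp
  qed
  then have "symbound M ?A" unfolding symbound_def by auto
  then show ?thesis by blast
qed

lemma wfc_Ors: "\<forall>c \<in> set cs. wfc A K k False c \<Longrightarrow> wfc A K k False (Ors cs)"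
  by (induction cs) auto

lemma wfc_sim:
  assumes "symbound M A" "10 \<le> K" "wf_otm M"
  shows "wfc A K k False (sim M md)"
proof -
  have A: "4 \<le> A" "ask M < A" "ret M < A" using assms(1) unfolding symbound_def by auto
  have opt: "or0 x < A" if "x \<in> opts A" for x using that A(1) unfolding opts_def or0_def by auto
  have tr: "wfc A K k False (trc t)" if t: "t \<in> delta M" for t
  proof -
    obtain q a q' b dd x where tt: "t = (q, a, q', b, dd, x)" by (cases t)
    have "q' < A" "b < A" using assms(1) t unfolding symbound_def tt by auto
    moreover have "wfc A K k False (qc x)" using A(1) assms(2) by (cases x) (auto simp: sym_of_bit_def)
    ultimately show ?thesis using opt assms(2) unfolding tt by (simp add: mvc_def)
  qed
  have st: "wfc A K k False (stepc M q a)" if "q < A" "a < A" for q a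
  proof (cases "trans_of M q a = {}")
    case False
    have "\<forall>c \<in> set (map trc (tlist M q a)). wfc A K k False c"
      using tr tlist[OF assms(3)] unfolding trans_of_def by auto
    then show ?thesis using False wfc_Ors by (simp add: stepc_def del: trc.simps)
  qed (use that assms(2) in \<open>simp add: stepc_def\<close>)
  have fl: "wfc A K k False flush" using assms(2) by (simp add: flush_def)
  have "wfc A K k False asklp" using assms(2) A opt fl by (auto simp: asklp_def sym_of_bit_def)
  then have "wfc A K k False (askc M)" using assms(2) A by (auto simp: askc_def intro!: wfc_mv)
  then have "wfc A K k False (simstep M md)" using st opt assms(2) by (auto simp: simstep_def)
  then show ?thesis using assms(2) by (simp add: sim_def)
qed

declare bin.simps [simp del]

subsection \<open>Padded queries\<close>

text \<open>Every symbol code ends in \<open>True\<close>: the query is read from its end, and the first \<open>False\<close> in that place marks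
  the padding, whose remaining length serves as the clock.\<close>

definition qcode :: "nat list \<Rightarrow> bool list" where
  "qcode xs = concat (map (\<lambda>s. [s = 3, s = 2, True]) xs)"

definition query :: "bool list \<Rightarrow> nat \<Rightarrow> nat \<Rightarrow> bool list" where
  "query w z p = replicate p True @ [False] @ qcode (enc_pair w z)"

definition decsym :: "nat option \<Rightarrow> nat option \<Rightarrow> nat" where
  "decsym x1 x2 = (if x1 = Some 2 then 3 else if x2 = Some 2 then 2 else 1)"

text \<open>Defined for malformed words as well, with \<open>tl\<close> and the defaults of
  \<open>decsym\<close> filling the gaps: the oracle machine has to respect its time bound on every
  word.\<close>

function pr :: "nat list \<Rightarrow> nat list \<Rightarrow> nat list \<times> nat list" where
  "pr [] R = ([], R)"
| "pr (x # l) R = (if x = 2 then pr (tl (tl l)) (decsym (hdo (tl l)) (hdo l) # R) else (l, R))"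
  by pat_completeness auto
termination by (relation "measure (\<lambda>(l, R). length l)") auto

lemma pr_length: "length (fst (pr l R)) \<le> length l \<and> length (snd (pr l R)) \<le> length l + length R"
  by (induction l R rule: pr.induct) auto

lemma qcode_snoc: "qcode (xs @ [s]) = qcode xs @ [s = 3, s = 2, True]"
  by (simp add: qcode_def)

lemma pr_query: "set xs \<subseteq> {1, 2, 3} \<Longrightarrow> pr (rev (enc (p @ [False] @ qcode xs))) R = (rev (enc p), xs @ R)"
proof (induction xs arbitrary: R rule: rev_induct)
  case Nil
  then show ?case by (simp add: enc_def qcode_def sym_of_bit_def)
next
  case (snoc s xs)
  have s: "s \<in> {1, 2, 3}" using snoc.prems by simp
  have e: "rev (enc (p @ [False] @ qcode (xs @ [s]))) = 2 # sym_of_bit (s = 2) # sym_of_bit (s = 3) # rev (enc (p @ [False] @ qcode xs))"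
    by (simp add: qcode_snoc enc_def sym_of_bit_def)
  have d: "decsym (Some (sym_of_bit (s = 3))) (Some (sym_of_bit (s = 2))) = s"
    using s by (auto simp: decsym_def sym_of_bit_def)
  show ?case unfolding e using snoc by (simp add: d)
qed

definition parse :: com where
  "parse = While 0 (\<lambda>x. x = Some 2) (\<lambda>_. Pop 0 (\<lambda>x2. Pop 0 (\<lambda>x1. Push 5 (decsym x1 x2))))"

lemma go_parse: "S 0 = l \<Longrightarrow> S 5 = R \<Longrightarrow>
   Gs X (4 * length l + 1) (parse # ks, S, q) (ks, S(0 := fst (pr l R), 5 := snd (pr l R)), q)"
proof (induction l R arbitrary: S rule: pr.induct)
  case (1 R)
  have "S(0 := []) = S" "S(0 := [], 5 := R) = S" using 1 by (auto simp: fun_eq_iff fun_upd_apply)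
  then have "Gs X (Suc 0) (parse # ks, S, q) (ks, S(0 := [], 5 := R), q)"
    unfolding parse_def by (intro go_While) (simp add: 1)
  then show ?case by simp
next
  case (2 x l R)
  show ?case
  proof (cases "x = 2")
    case False
    have "S(0 := l, 5 := R) = S(0 := l)" using 2 by (auto simp: fun_eq_iff fun_upd_apply)
    then have "Gs X (Suc 0) (parse # ks, S, q) (ks, S(0 := l, 5 := R), q)"
      unfolding parse_def by (intro go_While) (simp add: 2 False)
    then have "Gs X (4 * length (x # l) + 1) (parse # ks, S, q) (ks, S(0 := l, 5 := R), q)"
      by (rule af_mono) simp
    then show ?thesis using False by simp
  next
    case True
    let ?R = "decsym (hdo (tl l)) (hdo l) # R"
    let ?S = "S(0 := tl (tl l), 5 := ?R)"
    have "Gs X (4 * length (tl (tl l)) + 1) (parse # ks, ?S, q)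
        (ks, ?S(0 := fst (pr (tl (tl l)) ?R), 5 := snd (pr (tl (tl l)) ?R)), q)"
      by (rule 2(1)[OF True]) auto
    moreover have "?S(0 := fst (pr (tl (tl l)) ?R), 5 := snd (pr (tl (tl l)) ?R)) = S(0 := fst (pr (x # l) R), 5 := snd (pr (x # l) R))"
      using True by (auto simp: fun_eq_iff fun_upd_apply)
    ultimately have g: "Gs X (4 * length (tl (tl l)) + 1) (parse # ks, ?S, q) (ks, S(0 := fst (pr (x # l) R), 5 := snd (pr (x # l) R)), q)"
      by simp
    have e: "S(0 := l, 0 := tl l, 0 := tl (tl l), 5 := ?R) = ?S" by (auto simp: fun_eq_iff fun_upd_apply)
    have "Gs X (Suc (Suc (Suc (Suc (4 * length (tl (tl l)) + 1))))) (parse # ks, S, q)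
       (ks, S(0 := fst (pr (x # l) R), 5 := snd (pr (x # l) R)), q)"
      unfolding parse_def
      apply (rule go_While)
      apply (simp add: 2(2) True del: pr.simps)
      apply (rule go_Pop, rule go_Pop, rule go_Push)
      using g 2(3) True by (simp add: parse_def del: pr.simps)
    then show ?thesis by (rule af_mono) simp
  qed
qed

text \<open>What \<open>parse\<close> leaves on stack 0 is the padding. Moving it to stack 1 gives a
  clock without any arithmetic, and its length is at most that of the query.\<close>

definition prog1 :: "otm \<Rightarrow> com" where
  "prog1 M = Seq parse (Seq (mv 0 1) (Seq (Push 6 (start M)) (Seq (Push 7 3) (Seq (sim M True) (Pop 6 (\<lambda>q. Halt (q = Some (acc M))))))))"

lemma qf_init: "rev (qf [[]]) = [3]"
  by (simp add: qf_def enc_def)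

lemma dec_prog1:
  assumes wf: "wf_otm M" and r: "pr (rev (enc q)) [] = (r, R)"
  shows "dec X (6 * length q + length q * (card (delta M) + 14 * (4 * length q + 1) + 21) + 13) ([prog1 M], S0 (enc q), [[]])
    (\<exists>z'. (zx M True X ^^ length r) (start M, [], R, [[]]) z' \<and> fst z' = acc M)"
proof -
  let ?S = "S0 (enc q)"
  let ?n = "length q"
  let ?fin = "Pop 6 (\<lambda>q. Halt (q = Some (acc M)))"
  let ?k3 = "Seq (Push 7 3) (Seq (sim M True) ?fin)"
  let ?S1 = "(\<lambda>_. [])(0 := r, 5 := R) :: store"
  let ?S2 = "(\<lambda>_. [])(1 := rev r, 5 := R) :: store"
  let ?S3 = "(\<lambda>_. [])(1 := rev r) :: store"
  let ?z = "(start M, [], R, [[]]) :: zcfg"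
  have len: "length r \<le> ?n" "length R \<le> ?n" using pr_length[of "rev (enc q)" "[]"] r by (simp_all add: enc_def)
  have le: "length (enc q) = ?n" by (simp add: enc_def)
  have "Gs X (4 * length (rev (enc q)) + 1) (parse # Seq (mv 0 1) (Seq (Push 6 (start M)) ?k3) # [], ?S, [[]])
     (Seq (mv 0 1) (Seq (Push 6 (start M)) ?k3) # [], ?S(0 := fst (pr (rev (enc q)) []), 5 := snd (pr (rev (enc q)) [])), [[]])"
    by (rule go_parse) (auto simp: S0_def)
  moreover have "?S(0 := fst (pr (rev (enc q)) []), 5 := snd (pr (rev (enc q)) [])) = ?S1"
    unfolding r by (auto simp: S0_def fun_eq_iff fun_upd_apply)
  ultimately have g1: "Gs X (4 * ?n + 1) (parse # Seq (mv 0 1) (Seq (Push 6 (start M)) ?k3) # [], ?S, [[]])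
     (Seq (mv 0 1) (Seq (Push 6 (start M)) ?k3) # [], ?S1, [[]])" using le by simp
  have "Gs X (2 * length r + 1) (mv 0 1 # Seq (Push 6 (start M)) ?k3 # [], ?S1, [[]])
      (Seq (Push 6 (start M)) ?k3 # [], ?S1(0 := [], 1 := rev r @ ?S1 1), [[]])"
    by (rule go_mv) auto
  moreover have "?S1(0 := [], 1 := rev r @ ?S1 1) = ?S2" by (auto simp: fun_eq_iff fun_upd_apply)
  ultimately have g2: "Gs X (2 * length r + 1) (mv 0 1 # Seq (Push 6 (start M)) ?k3 # [], ?S1, [[]])
      (Seq (Push 6 (start M)) ?k3 # [], ?S2, [[]])" by simp
  have e: "?S2(6 := start M # ?S2 6, 7 := 3 # (?S2(6 := start M # ?S2 6)) 7) = sto ?S3 ?z"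
    by (auto simp: fun_eq_iff fun_upd_apply qf_init)
  have g3: "Gs X (Suc (Suc (Suc (Suc (Suc 0))))) (Seq (Push 6 (start M)) ?k3 # [], ?S2, [[]]) (sim M True # ?fin # [], sto ?S3 ?z, [[]])"
    by (rule go_Seq, rule go_Push, rule go_Seq, rule go_Push, rule go_Seq, unfold e) (rule af_now, rule refl)
  have d: "dec X (1 + length (rev r) * (card (delta M) + 14 * (zsz ?z + 3 * length (rev r)) + 21) + 1) (sim M True # ?fin # [], sto ?S3 ?z, [[]])
      (\<exists>z'. (zx M True X ^^ length (rev r)) ?z z' \<and> fst z' = acc M)"
  proof (rule dec_sim[OF wf])
    fix z' :: zcfg
    obtain q' L' R' qs' where z': "z' = (q', L', R', qs')" by (cases z')
    let ?T = "sto (?S3(1 := [])) z'"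
    have g: "Gs X (Suc 0) (?fin # [], ?T, [[]]) (Halt (q' = acc M) # [], ?T(6 := []), [[]])"
      by (rule go_Pop) (simp add: z')
    from dec_go[OF this dec_Halt, of 0] show "dec X 1 (?fin # [], ?T, [[]]) (fst z' = acc M)"
      using z' by simp
  qed auto
  have g12: "Gs X (Suc (4 * ?n + 1 + Suc (2 * length r + 1 + Suc (Suc (Suc (Suc (Suc 0))))))) ([prog1 M], ?S, [[]]) (sim M True # ?fin # [], sto ?S3 ?z, [[]])"
    unfolding prog1_def by (rule go_Seq, rule go_add[OF g1], rule go_Seq, rule go_add[OF g2 g3])
  have z1: "zsz ?z = length R + 1" using arg_cong[OF qf_init, of length] by simp
  have "length r * (card (delta M) + 14 * (length R + 1 + 3 * length r) + 21) \<le> ?n * (card (delta M) + 14 * (4 * ?n + 1) + 21)"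
    using len by (intro mult_le_mono) auto
  then show ?thesis using dec_mono[OF dec_go[OF g12 d]] len unfolding z1 by simp
qed

lemma wfc_prog1: "symbound M A \<Longrightarrow> 10 \<le> K \<Longrightarrow> wf_otm M \<Longrightarrow> wfc A K k False (prog1 M)"
  unfolding prog1_def using wfc_sim[of M A K k True]
  by (auto simp: parse_def decsym_def symbound_def intro!: wfc_mv)

lemma halts_mono:
  assumes "halts_within M X T xs" "T \<le> T'"
  shows "halts_within M X T' xs"
  unfolding halts_within_def
proof
  assume "\<exists>c. (step M X ^^ Suc T') (init_cfg M xs) c"
  then obtain c where "(step M X ^^ Suc T') (init_cfg M xs) c" by (elim exE)
  from halts_length[OF assms(1) this] show False using assms(2) by simp
qed

text \<open>\<open>M\<close> may run for iterated-exponential time, but a query with padding of that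
  length makes the clocked simulation polynomial in the length of its own input. If the padding is
  too short, the clock cuts the simulation off and nothing is claimed.\<close>

lemma padded_oracle:
  assumes wf: "wf_otm M" and Or0: "Or0 \<in> SigmaP c"
  shows "\<exists>Y \<in> SigmaP (Suc c). \<forall>w z p T. halts_within M Or0 T (enc_pair w z) \<longrightarrow> T \<le> p \<longrightarrow>
      (query w z p \<in> Y \<longleftrightarrow> accepts M Or0 (enc_pair w z))"
proof -
  obtain A where A: "symbound M A" using symbound_ex[OF wf] by blast
  have A4: "4 \<le> A" using A unfolding symbound_def by blast
  obtain N where N: "wf_otm N"
    "\<And>X w n b. dec X n ([prog1 M], S0 (enc w), [[]]) b \<Longrightarrow>
        halts_within N X (2 * length w + 3 + n * (2 * (Suc (length w) + n) + 10)) (enc w) \<and> (accepts N X (enc w) \<longleftrightarrow> b)"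
    using compile[OF A4, of 10 0 False "prog1 M" 0] wfc_prog1[OF A _ wf, of 10 0] by auto
  \<comment> \<open>The oracle is whatever \<open>N\<close> accepts, so its membership in the
    polynomial-time class needs only the time bound; its meaning is established for sufficiently
    padded queries alone.\<close>
  let ?Y = "{q. accepts N Or0 (enc q)}"
  let ?t = "\<lambda>n. 6 * n + n * (card (delta M) + 14 * (4 * n + 1) + 21) + 13"
  let ?T = "\<lambda>n. 2 * n + 3 + ?t n * (2 * (Suc n + ?t n) + 10)"
  have "bnd 0 ?T" by (intro bnd_intros)
  then obtain kk a where ka: "kk \<ge> 1" "\<And>n. ?T n \<le> a * expi 0 (n ^ kk) + a"
    using bnd_official by blast
  have NN: "halts_within N Or0 (?T (length q)) (enc q) \<and> (accepts N Or0 (enc q) \<longleftrightarrow>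
      (\<exists>z'. (zx M True Or0 ^^ length (fst (pr (rev (enc q)) []))) (start M, [], snd (pr (rev (enc q)) []), [[]]) z' \<and> fst z' = acc M))" for q
    by (rule N(2)) (rule dec_prog1[OF wf], simp)
  have "decides_lang N Or0 (\<lambda>n. a * n ^ kk + a) ?Y"
    unfolding decides_lang_def
  proof (intro allI conjI)
    fix w
    show "halts_within N Or0 (a * length w ^ kk + a) (enc w)"
      by (rule halts_mono[OF conjunct1[OF NN]]) (use ka(2)[of "length w"] in simp)
  qed simp
  then have Y: "?Y \<in> SigmaP (Suc c)"
    using Or0 ka(1) N(1) unfolding SigmaP.simps by blast
  have main: "query w z p \<in> ?Y \<longleftrightarrow> accepts M Or0 (enc_pair w z)"
    if h: "halts_within M Or0 T (enc_pair w z)" "T \<le> p" for w z p T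
  proof -
    have sub: "set (enc_pair w z) \<subseteq> {1, 2, 3}" using set_enc[of w] set_enc[of "bin z"] unfolding enc_pair_def by auto
    have pq: "pr (rev (enc (query w z p))) [] = (rev (enc (replicate p True)), enc_pair w z)"
      unfolding query_def using pr_query[OF sub, of "replicate p True" "[]"] by simp
    have lp: "length (rev (enc (replicate p True))) = p" by (simp add: enc_def)
    have "query w z p \<in> ?Y \<longleftrightarrow> (\<exists>z'. (zx M True Or0 ^^ p) (start M, [], enc_pair w z, [[]]) z' \<and> fst z' = acc M)"
      using conjunct2[OF NN[of "query w z p"]] unfolding pq fst_conv snd_conv mem_Collect_eq lp .
    then show ?thesis unfolding zx_accepts[OF wf h] .
  qed
  show ?thesis
    by (intro bexI[OF _ Y] allI impI) (rule main)
qed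

subsection \<open>Parallel queries\<close>

primrec emits :: "nat list \<Rightarrow> com" where
  "emits [] = Skip"
| "emits (s # xs) = Seq (QW (s = 3)) (Seq (QW (s = 2)) (Seq (QW True) (emits xs)))"

definition padl :: com where
  "padl = While 1 (\<lambda>x. x \<noteq> None) (\<lambda>_. Seq (QW True) (Push 2 0))"

definition wl :: com where
  "wl = While 4 (\<lambda>x. x \<noteq> None) (\<lambda>x. Seq (emits [or0 x]) (Push 5 (or0 x)))"

text \<open>The number \<open>z\<close> is a parameter of the program, so \<open>bin z\<close> is
  written from the finite control. Clock and word are saved while they are written, since every
  further query needs them again.\<close>

definition emit :: "nat \<Rightarrow> com" where
  "emit z = Seq padl (Seq (mv 2 1) (Seq (QW False) (Seq wl (Seq (mv 5 4) (emits (3 # enc (bin z)))))))"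

text \<open>The buffer initially holds one empty query, so the first query is emitted without
  \<open>QN\<close> and only the later ones pass through here.\<close>

primrec emitall :: "nat list \<Rightarrow> com" where
  "emitall [] = Skip"
| "emitall (z # zs) = Seq QN (Seq (emit z) (emitall zs))"

lemma go_emits: "Gs X (6 * length xs + 1) (emits xs # ks, S, qs @ [v]) (ks, S, qs @ [v @ qcode xs])"
proof (induction xs arbitrary: v)
  case Nil
  have "Gs X (Suc 0) (Skip # ks, S, qs @ [v]) (ks, S, qs @ [v])" by (rule go_Skip) simp
  then show ?case by (simp add: qcode_def)
next
  case (Cons s xs)
  have e: "((v @ [s = 3]) @ [s = 2]) @ [True] = v @ [s = 3, s = 2, True]" by simp
  have q: "(v @ [s = 3, s = 2, True]) @ qcode xs = v @ qcode (s # xs)" by (simp add: qcode_def)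
  have g: "Gs X (6 * length xs + 1) (emits xs # ks, S, qs @ [v @ [s = 3, s = 2, True]]) (ks, S, qs @ [v @ qcode (s # xs)])"
    using Cons.IH[of "v @ [s = 3, s = 2, True]"] unfolding q .
  have "Gs X (Suc (Suc (Suc (Suc (Suc (Suc (6 * length xs + 1))))))) (emits (s # xs) # ks, S, qs @ [v]) (ks, S, qs @ [v @ qcode (s # xs)])"
    unfolding emits.simps by (rule go_Seq, rule go_QW, rule go_Seq, rule go_QW, rule go_Seq, rule go_QW) (use g in simp)
  then show ?case by (rule af_mono) simp
qed

lemma go_padl: "S 1 = replicate p 0 \<Longrightarrow>
   Gs X (4 * p + 1) (padl # ks, S, qs @ [v]) (ks, S(1 := [], 2 := replicate p 0 @ S 2), qs @ [v @ replicate p True])"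
proof (induction p arbitrary: S v)
  case 0
  then have "S(1 := [], 2 := replicate 0 0 @ S 2) = S" "S(1 := []) = S" by (auto simp: fun_eq_iff fun_upd_apply)
  then have "Gs X (Suc 0) (padl # ks, S, qs @ [v]) (ks, S(1 := [], 2 := replicate 0 0 @ S 2), qs @ [v @ replicate 0 True])"
    unfolding padl_def by (intro go_While) (use 0 in simp)
  then show ?case by (rule af_mono) simp
next
  case (Suc p)
  let ?S = "S(1 := replicate p 0, 2 := 0 # S 2)"
  have "Gs X (4 * p + 1) (padl # ks, ?S, qs @ [v @ [True]])
     (ks, ?S(1 := [], 2 := replicate p 0 @ ?S 2), qs @ [(v @ [True]) @ replicate p True])"
    by (rule Suc.IH) simp
  moreover have "?S(1 := [], 2 := replicate p 0 @ ?S 2) = S(1 := [], 2 := replicate (Suc p) 0 @ S 2)"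
    by (auto simp: fun_eq_iff fun_upd_apply replicate_app_Cons_same)
  ultimately have g: "Gs X (4 * p + 1) (padl # ks, ?S, qs @ [v @ [True]])
     (ks, S(1 := [], 2 := replicate (Suc p) 0 @ S 2), qs @ [v @ replicate (Suc p) True])" by simp
  have "Gs X (Suc (Suc (Suc (Suc (4 * p + 1))))) (padl # ks, S, qs @ [v])
     (ks, S(1 := [], 2 := replicate (Suc p) 0 @ S 2), qs @ [v @ replicate (Suc p) True])"
    unfolding padl_def
    apply (rule go_While)
    apply (simp add: Suc.prems[unfolded One_nat_def])
    apply (rule go_Seq, rule go_QW, rule go_Push)
    using g by (simp add: padl_def)
  then show ?case by (rule af_mono) simp
qed

lemma go_wl: "S 4 = l \<Longrightarrow>
   Gs X (10 * length l + 1) (wl # ks, S, qs @ [v]) (ks, S(4 := [], 5 := rev l @ S 5), qs @ [v @ qcode l])"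
proof (induction l arbitrary: S v)
  case Nil
  then have "S(4 := [], 5 := rev [] @ S 5) = S" "S(4 := []) = S" by (auto simp: fun_eq_iff fun_upd_apply)
  then have "Gs X (Suc 0) (wl # ks, S, qs @ [v]) (ks, S(4 := [], 5 := rev [] @ S 5), qs @ [v @ qcode []])"
    unfolding wl_def by (intro go_While) (use Nil in \<open>simp add: qcode_def\<close>)
  then show ?case by (rule af_mono) simp
next
  case (Cons x l)
  let ?S = "S(4 := l, 5 := x # S 5)"
  have "Gs X (10 * length l + 1) (wl # ks, ?S, qs @ [v @ qcode [x]])
     (ks, ?S(4 := [], 5 := rev l @ ?S 5), qs @ [(v @ qcode [x]) @ qcode l])"
    by (rule Cons.IH) simp
  moreover have "?S(4 := [], 5 := rev l @ ?S 5) = S(4 := [], 5 := rev (x # l) @ S 5)"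
    by (auto simp: fun_eq_iff fun_upd_apply)
  moreover have "(v @ qcode [x]) @ qcode l = v @ qcode (x # l)" by (simp add: qcode_def)
  ultimately have g: "Gs X (10 * length l + 1) (wl # ks, ?S, qs @ [v @ qcode [x]])
     (ks, S(4 := [], 5 := rev (x # l) @ S 5), qs @ [v @ qcode (x # l)])" by simp
  have e: "(S(4 := l))(5 := x # (S(4 := l)) 5) = ?S" by simp
  have g1: "Gs X (Suc (10 * length l + 1)) (Push 5 x # wl # ks, S(4 := l), qs @ [v @ qcode [x]])
     (ks, S(4 := [], 5 := rev (x # l) @ S 5), qs @ [v @ qcode (x # l)])"
    by (rule go_Push, unfold e) (rule g)
  have g2: "Gs X (6 * length [x] + 1) (emits [x] # Push 5 x # wl # ks, S(4 := l), qs @ [v]) (Push 5 x # wl # ks, S(4 := l), qs @ [v @ qcode [x]])"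
    by (rule go_emits)
  have g3: "Gs X (Suc (6 * length [x] + 1 + Suc (10 * length l + 1))) (Seq (emits [x]) (Push 5 x) # wl # ks, S(4 := l), qs @ [v])
     (ks, S(4 := [], 5 := rev (x # l) @ S 5), qs @ [v @ qcode (x # l)])"
    by (rule go_Seq, rule go_add[OF g2 g1])
  have "Gs X (Suc (Suc (6 * length [x] + 1 + Suc (10 * length l + 1)))) (wl # ks, S, qs @ [v])
     (ks, S(4 := [], 5 := rev (x # l) @ S 5), qs @ [v @ qcode (x # l)])"
    unfolding wl_def
    by (rule go_While) (use g3 in \<open>simp add: Cons.prems wl_def or0_def\<close>)
  then show ?case by (rule af_mono) simp
qed

lemma length_bin: "length (bin z) \<le> Suc z"
proof (induction z rule: bin.induct)
  case (1 z)
  then show ?case by (cases "z < 2") (auto simp: bin.simps[of z])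
qed

lemma go_emit:
  assumes "S 1 = replicate p 0" "S 2 = []" "S 5 = []" "S 4 = enc w"
  shows "Gs X (6 * p + 12 * length w + 6 * z + 40) (emit z # ks, S, qs @ [v]) (ks, S, qs @ [v @ query w z p])"
proof -
  let ?e = "emits (3 # enc (bin z))"
  let ?S1 = "S(1 := [], 2 := replicate p 0)"
  let ?S2 = "S(4 := [], 5 := rev (enc w))"
  have "Gs X (4 * p + 1) (padl # Seq (mv 2 1) (Seq (QW False) (Seq wl (Seq (mv 5 4) ?e))) # ks, S, qs @ [v])
     (Seq (mv 2 1) (Seq (QW False) (Seq wl (Seq (mv 5 4) ?e))) # ks, S(1 := [], 2 := replicate p 0 @ S 2), qs @ [v @ replicate p True])"
    by (rule go_padl) (rule assms(1))
  then have g1: "Gs X (4 * p + 1) (padl # Seq (mv 2 1) (Seq (QW False) (Seq wl (Seq (mv 5 4) ?e))) # ks, S, qs @ [v])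
     (Seq (mv 2 1) (Seq (QW False) (Seq wl (Seq (mv 5 4) ?e))) # ks, ?S1, qs @ [v @ replicate p True])"
    using assms(2) by simp
  have "Gs X (2 * length (replicate p (0::nat)) + 1) (mv 2 1 # Seq (QW False) (Seq wl (Seq (mv 5 4) ?e)) # ks, ?S1, qs @ [v @ replicate p True])
     (Seq (QW False) (Seq wl (Seq (mv 5 4) ?e)) # ks, ?S1(2 := [], 1 := rev (replicate p 0) @ ?S1 1), qs @ [v @ replicate p True])"
    by (rule go_mv) auto
  moreover have "?S1(2 := [], 1 := rev (replicate p 0) @ ?S1 1) = S" using assms by (auto simp: fun_eq_iff fun_upd_apply)
  ultimately have g2: "Gs X (2 * p + 1) (mv 2 1 # Seq (QW False) (Seq wl (Seq (mv 5 4) ?e)) # ks, ?S1, qs @ [v @ replicate p True])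
     (Seq (QW False) (Seq wl (Seq (mv 5 4) ?e)) # ks, S, qs @ [v @ replicate p True])" by simp
  let ?v = "(v @ replicate p True) @ [False]"
  have "Gs X (10 * length (enc w) + 1) (wl # Seq (mv 5 4) ?e # ks, S, qs @ [?v])
     (Seq (mv 5 4) ?e # ks, S(4 := [], 5 := rev (enc w) @ S 5), qs @ [?v @ qcode (enc w)])"
    by (rule go_wl) (rule assms(4))
  then have g3: "Gs X (10 * length w + 1) (wl # Seq (mv 5 4) ?e # ks, S, qs @ [?v])
     (Seq (mv 5 4) ?e # ks, ?S2, qs @ [?v @ qcode (enc w)])"
    using assms(3) by (simp add: enc_def)
  have "Gs X (2 * length (rev (enc w)) + 1) (mv 5 4 # ?e # ks, ?S2, qs @ [?v @ qcode (enc w)])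
     (?e # ks, ?S2(5 := [], 4 := rev (rev (enc w)) @ ?S2 4), qs @ [?v @ qcode (enc w)])"
    by (rule go_mv) auto
  moreover have "?S2(5 := [], 4 := rev (rev (enc w)) @ ?S2 4) = S" using assms by (auto simp: fun_eq_iff fun_upd_apply)
  ultimately have g4: "Gs X (2 * length w + 1) (mv 5 4 # ?e # ks, ?S2, qs @ [?v @ qcode (enc w)]) (?e # ks, S, qs @ [?v @ qcode (enc w)])"
    by (simp add: enc_def)
  have q: "(?v @ qcode (enc w)) @ qcode (3 # enc (bin z)) = v @ query w z p"
    by (simp add: query_def enc_pair_def qcode_def)
  have g5: "Gs X (6 * length (3 # enc (bin z)) + 1) (?e # ks, S, qs @ [?v @ qcode (enc w)]) (ks, S, qs @ [v @ query w z p])"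
    using go_emits[where xs = "3 # enc (bin z)" and v = "?v @ qcode (enc w)" and X = X and ks = ks and S = S and qs = qs] unfolding q .
  have g35: "Gs X (10 * length w + 1 + Suc (2 * length w + 1 + (6 * length (3 # enc (bin z)) + 1)))
     (wl # Seq (mv 5 4) ?e # ks, S, qs @ [?v]) (ks, S, qs @ [v @ query w z p])"
    by (rule go_add[OF g3], rule go_Seq, rule go_add[OF g4 g5])
  have "Gs X (Suc (4 * p + 1 + Suc (2 * p + 1 + Suc (Suc (Suc (10 * length w + 1 + Suc (2 * length w + 1 + (6 * length (3 # enc (bin z)) + 1))))))))
     (emit z # ks, S, qs @ [v]) (ks, S, qs @ [v @ query w z p])"
    unfolding emit_def
    by (rule go_Seq, rule go_add[OF g1], rule go_Seq, rule go_add[OF g2], rule go_Seq, rule go_QW, rule go_Seq) (use g35 in simp)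
  then show ?thesis by (rule af_mono) (use length_bin[of z] in \<open>simp add: enc_def\<close>)
qed

lemma go_emitall:
  assumes "S 1 = replicate p 0" "S 2 = []" "S 5 = []" "S 4 = enc w" "\<forall>z \<in> set zs. z \<le> B"
  shows "Gs X (length zs * (6 * p + 12 * length w + 6 * B + 43) + 1) (emitall zs # ks, S, qs)
     (ks, S, qs @ map (\<lambda>z. query w z p) zs)"
  using assms(5)
proof (induction zs arbitrary: qs)
  case Nil
  have "Gs X (Suc 0) (Skip # ks, S, qs) (ks, S, qs)" by (rule go_Skip) simp
  then show ?case by simp
next
  case (Cons z zs)
  let ?E = "6 * p + 12 * length w + 6 * B + 43"
  have g1: "Gs X (6 * p + 12 * length w + 6 * z + 40) (emit z # emitall zs # ks, S, qs @ [[]]) (emitall zs # ks, S, qs @ [[] @ query w z p])"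
    by (rule go_emit[OF assms(1-4)])
  have g2: "Gs X (length zs * ?E + 1) (emitall zs # ks, S, qs @ [[] @ query w z p]) (ks, S, qs @ map (\<lambda>z. query w z p) (z # zs))"
    using Cons.IH[of "qs @ [query w z p]"] Cons.prems by simp
  have "Gs X (Suc (Suc (Suc (6 * p + 12 * length w + 6 * z + 40 + (length zs * ?E + 1))))) (emitall (z # zs) # ks, S, qs)
     (ks, S, qs @ map (\<lambda>z. query w z p) (z # zs))"
    unfolding emitall.simps by (rule go_Seq, rule go_QN, rule go_Seq) (use go_add[OF g1 g2] in simp)
  then show ?case by (rule af_mono) (use Cons.prems in simp)
qed

text \<open>The parity of the positive answers is the parity that the Hausdorff reduction asks for;
  \<open>flip\<close> complements it and so treats the co-class.\<close>

definition prog2 :: "com \<Rightarrow> nat \<Rightarrow> bool \<Rightarrow> com" where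
  "prog2 cl k flip = Seq (mkclock cl) (Seq (mv 0 4) (Seq (emit 1) (Seq (emitall [2..<Suc k])
     (Ask k (\<lambda>bs. Halt (odd (length (filter id bs)) \<noteq> flip))))))"

lemma dec_prog2:
  assumes cl: "unary cl F G" and k: "1 \<le> k"
  shows "dec X (8 * length w + G (length w) + Suc k * (6 * F (length w) + 12 * length w + 6 * k + 60) + 20)
    ([prog2 cl k flip], S0 (enc w), [[]])
    (odd (length (filter id (map (\<lambda>z. query w z (F (length w)) \<in> X) [1..<Suc k]))) \<noteq> flip)"
proof -
  let ?n = "length w" and ?S = "S0 (enc w)"
  let ?p = "F ?n"
  let ?S1 = "?S(1 := replicate ?p 0)"
  let ?S2 = "(\<lambda>_. [])(1 := replicate ?p 0, 4 := enc w) :: store"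
  let ?A = "Ask k (\<lambda>bs. Halt (odd (length (filter id bs)) \<noteq> flip))"
  let ?E = "6 * ?p + 12 * ?n + 6 * k + 43"
  have le: "length (rev (enc w)) = ?n" by (simp add: enc_def)
  have g1: "Gs X (6 * ?n + G ?n + 4) (mkclock cl # Seq (mv 0 4) (Seq (emit 1) (Seq (emitall [2..<Suc k]) ?A)) # [], ?S, [[]])
     (Seq (mv 0 4) (Seq (emit 1) (Seq (emitall [2..<Suc k]) ?A)) # [], ?S1, [[]])"
    using go_mkclock[where c = cl and S = ?S and l = "rev (enc w)", OF cl] le by (simp add: S0_def)
  have "Gs X (2 * length (rev (enc w)) + 1) (mv 0 4 # Seq (emit 1) (Seq (emitall [2..<Suc k]) ?A) # [], ?S1, [[]])
     (Seq (emit 1) (Seq (emitall [2..<Suc k]) ?A) # [], ?S1(0 := [], 4 := rev (rev (enc w)) @ ?S1 4), [[]])"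
    by (rule go_mv) (auto simp: S0_def)
  moreover have "?S1(0 := [], 4 := rev (rev (enc w)) @ ?S1 4) = ?S2" by (auto simp: S0_def fun_eq_iff fun_upd_apply)
  ultimately have g2: "Gs X (2 * ?n + 1) (mv 0 4 # Seq (emit 1) (Seq (emitall [2..<Suc k]) ?A) # [], ?S1, [[]])
     (Seq (emit 1) (Seq (emitall [2..<Suc k]) ?A) # [], ?S2, [[]])" using le by simp
  have g3: "Gs X (6 * ?p + 12 * ?n + 6 * 1 + 40) (emit 1 # Seq (emitall [2..<Suc k]) ?A # [], ?S2, [] @ [[]])
     (Seq (emitall [2..<Suc k]) ?A # [], ?S2, [] @ [[] @ query w 1 ?p])"
    by (rule go_emit) auto
  have g4: "Gs X (length [2..<Suc k] * ?E + 1) (emitall [2..<Suc k] # ?A # [], ?S2, [] @ [[] @ query w 1 ?p])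
     (?A # [], ?S2, ([] @ [[] @ query w 1 ?p]) @ map (\<lambda>z. query w z ?p) [2..<Suc k])"
    by (rule go_emitall) auto
  let ?Q = "map (\<lambda>z. query w z ?p) [1..<Suc k]"
  have u: "[1..<Suc k] = 1 # [2..<Suc k]" using k by (simp add: upt_rec numeral_2_eq_2)
  have Q: "([] @ [[] @ query w 1 ?p]) @ map (\<lambda>z. query w z ?p) [2..<Suc k] = ?Q" unfolding u by simp
  have g5: "Gs X (Suc 0) (?A # [], ?S2, ?Q) (Halt (odd (length (filter id (map (\<lambda>x. x \<in> X) ?Q))) \<noteq> flip) # [], ?S2, [[]])"
    by (rule go_Ask) simp_all
  have g45: "Gs X (length [2..<Suc k] * ?E + 1 + Suc 0) (emitall [2..<Suc k] # ?A # [], ?S2, [] @ [[] @ query w 1 ?p])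
     (Halt (odd (length (filter id (map (\<lambda>x. x \<in> X) ?Q))) \<noteq> flip) # [], ?S2, [[]])"
    by (rule go_add[OF g4]) (unfold Q, rule g5)
  have g: "Gs X (Suc (6 * ?n + G ?n + 4 + Suc (2 * ?n + 1 + Suc (6 * ?p + 12 * ?n + 6 * 1 + 40 + Suc (length [2..<Suc k] * ?E + 1 + Suc 0)))))
     ([prog2 cl k flip], ?S, [[]]) (Halt (odd (length (filter id (map (\<lambda>x. x \<in> X) ?Q))) \<noteq> flip) # [], ?S2, [[]])"
    unfolding prog2_def
    apply (rule go_Seq, rule go_add[OF g1], rule go_Seq, rule go_add[OF g2], rule go_Seq)
    apply (rule go_add[OF g3[unfolded append_Nil]])
    apply (rule go_Seq)
    using g45 by simp
  have m: "map (\<lambda>z. query w z ?p \<in> X) [1..<Suc k] = map (\<lambda>x. x \<in> X) ?Q" by simp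
  have "length [2..<Suc k] * ?E \<le> k * (6 * ?p + 12 * ?n + 6 * k + 60)" by (intro mult_le_mono) auto
  then have b: "Suc (6 * ?n + G ?n + 4 + Suc (2 * ?n + 1 + Suc (6 * ?p + 12 * ?n + 6 * 1 + 40 + Suc (length [2..<Suc k] * ?E + 1 + Suc 0)))) + 0
    \<le> 8 * ?n + G ?n + Suc k * (6 * ?p + 12 * ?n + 6 * k + 60) + 20"
    using k unfolding mult_Suc by linarith
  show ?thesis unfolding m by (rule dec_mono[OF dec_go[OF g dec_Halt] b])
qed

lemma wfc_emits: "wfc A K k d (emits xs)"
  by (induction xs) auto

lemma wfc_prog2:
  assumes "unary cl F G" "1 \<le> k"
  shows "wfc 4 10 k True (prog2 cl k flip)"
proof -
  have e: "wfc 4 10 k True (emit z)" for z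
    by (auto simp: emit_def padl_def wl_def opts_def or0_def wfc_emits intro!: wfc_mv)
  have "wfc 4 10 k True (emitall zs)" for zs by (induction zs) (auto simp: e)
  then show ?thesis using e wfc_mkclock[OF assms(1)] assms(2) by (auto simp: prog2_def intro!: wfc_mv)
qed

lemma card_count: "card {z. 1 \<le> z \<and> z \<le> k \<and> D z} = length (filter id (map D [1..<Suc k]))"
proof -
  have "length (filter id (map D [1..<Suc k])) = length (filter D [1..<Suc k])"
    by (simp add: filter_map comp_def)
  also have "\<dots> = card (set (filter D [1..<Suc k]))" by (intro distinct_card[symmetric]) auto
  also have "set (filter D [1..<Suc k]) = {z. 1 \<le> z \<and> z \<le> k \<and> D z}" by auto
  finally show ?thesis by (rule sym)
qed

text \<open>The padding \<open>F (length w)\<close> dominates the running time of the machine for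
  \<open>D\<close>, so the \<open>k\<close> answers are the values of \<open>D w\<close> at 1 to
  \<open>k\<close>. Since \<open>F\<close> itself obeys a bound of the class, the deterministic
  machine has the time to write such queries.\<close>

lemma hausdorff_in_ExpPar:
  assumes "1 \<le> k" "D \<in> NExpPredClass i c"
  shows "{w. odd (card {z. 1 \<le> z \<and> z \<le> k \<and> D w z}) \<noteq> flip} \<in> ExpPar i c k"
proof -
  obtain Or0 M kk a where M: "Or0 \<in> SigmaP c" "kk \<ge> 1" "wf_otm M" "decides_pred M Or0 (\<lambda>n. a * expi i (n ^ kk) + a) D"
    using assms(2) unfolding NExpPredClass_def by blast
  obtain Y where Y: "Y \<in> SigmaP (Suc c)"
    "\<And>w z p T. halts_within M Or0 T (enc_pair w z) \<Longrightarrow> T \<le> p \<Longrightarrow> (query w z p \<in> Y \<longleftrightarrow> accepts M Or0 (enc_pair w z))"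
    using padded_oracle[OF M(3,1)] by blast
  obtain cl F G where cl: "unary cl F G" "\<And>n. a * expi i (n ^ kk) + a \<le> F n" "bnd i F" "bnd i G"
    using clock_exists[OF bnd_class[OF M(2)], of a i] by blast
  obtain N where N: "wf_otm N" "deterministic N"
    "\<And>X w n b. dec X n ([prog2 cl k flip], S0 (enc w), [[]]) b \<Longrightarrow>
        halts_within N X (2 * length w + 3 + n * (2 * (Suc (length w) + n) + 10)) (enc w) \<and> (accepts N X (enc w) \<longleftrightarrow> b)
        \<and> one_round N X k (enc w)"
    using compile[of 4 10 k True "prog2 cl k flip" 0] wfc_prog2[OF cl(1) assms(1)] by auto
  let ?t = "\<lambda>n. 8 * n + G n + Suc k * (6 * F n + 12 * n + 6 * k + 60) + 20"
  let ?T = "\<lambda>n. 2 * n + 3 + ?t n * (2 * (Suc n + ?t n) + 10)"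
  have "bnd i ?T" by (intro bnd_intros cl)
  then obtain kk' a' where ka: "kk' \<ge> 1" "\<And>n. ?T n \<le> a' * expi i (n ^ kk') + a'"
    using bnd_official by blast
  let ?L = "{w. odd (card {z. 1 \<le> z \<and> z \<le> k \<and> D w z}) \<noteq> flip}"
  have q: "query w z (F (length w)) \<in> Y \<longleftrightarrow> D w z" for w z
    using Y(2)[of "a * expi i (length w ^ kk) + a" w z "F (length w)"] M(4) cl(2) unfolding decides_pred_def by blast
  have NN: "halts_within N Y (?T (length w)) (enc w) \<and> (accepts N Y (enc w) \<longleftrightarrow> w \<in> ?L) \<and> one_round N Y k (enc w)" for w
    using N(3)[OF dec_prog2[OF cl(1) assms(1), of Y w flip]] unfolding q card_count by simp
  have "decides_lang N Y (\<lambda>n. a' * expi i (n ^ kk') + a') ?L"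
    unfolding decides_lang_def using NN halts_mono ka(2) by blast
  then show ?thesis unfolding ExpPar_def using Y(1) N(1,2) ka(1) NN by blast
qed

lemma first_inclusion:
  assumes "1 \<le> k"
  shows "HausdorffH (\<lambda>_. k) (NExpPredClass i c) \<union> coHausdorffH (\<lambda>_. k) (NExpPredClass i c) \<subseteq> ExpPar i c k"
proof
  fix L assume L: "L \<in> HausdorffH (\<lambda>_. k) (NExpPredClass i c) \<union> coHausdorffH (\<lambda>_. k) (NExpPredClass i c)"
  then obtain D flip where D: "D \<in> NExpPredClass i c" "\<And>w. w \<in> L \<longleftrightarrow> (odd (card {z. 1 \<le> z \<and> z \<le> k \<and> D w z}) \<noteq> flip)"
  proof
    assume "L \<in> HausdorffH (\<lambda>_. k) (NExpPredClass i c)"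
    then obtain D where "D \<in> NExpPredClass i c" "\<And>w. w \<in> L \<longleftrightarrow> odd (card {z. 1 \<le> z \<and> z \<le> k \<and> D w z})"
      unfolding HausdorffH_def by blast
    then show thesis using that[of D False] by simp
  next
    assume "L \<in> coHausdorffH (\<lambda>_. k) (NExpPredClass i c)"
    then obtain D where "D \<in> NExpPredClass i c" "\<And>w. w \<in> - L \<longleftrightarrow> odd (card {z. 1 \<le> z \<and> z \<le> k \<and> D w z})"
      unfolding coHausdorffH_def HausdorffH_def by blast
    then show thesis using that[of D True] by simp
  qed
  have "L = {w. odd (card {z. 1 \<le> z \<and> z \<le> k \<and> D w z}) \<noteq> flip}" using D(2) by blast
  then show "L \<in> ExpPar i c k" using hausdorff_in_ExpPar[OF assms D(1), of flip] by simp
qed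

subsection \<open>Runs with prescribed oracle answers\<close>

text \<open>The resting store: checks of chain entries that succeed return to it, so that they can
  be sequenced. It is also what remains of a pair once \<open>z\<close> and the separator have been
  popped.\<close>

definition base :: "bool list \<Rightarrow> store" where
  "base w = (\<lambda>_. [])(0 := rev (enc w))"

definition load :: com where
  "load = Seq (copyloop 0 3 5 id) (mv 3 0)"

text \<open>With \<open>md = False\<close> the simulation freezes at the query state and leaves the
  buffered queries on stack 7 for inspection.\<close>

definition runA :: "com \<Rightarrow> otm \<Rightarrow> com" where
  "runA cl M = Seq load (Seq (mkclock cl) (Seq (Push 6 (start M)) (Seq (Push 7 3) (sim M False))))"

definition cleanup :: com where
  "cleanup = Seq (clear 4) (Seq (clear 5) (Seq (clear 6) (clear 7)))"

definition skipq :: com where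
  "skipq = While 7 (\<lambda>x. x \<noteq> None \<and> x \<noteq> Some 3) (\<lambda>_. Skip)"

definition getq :: com where
  "getq = While 7 (\<lambda>x. x \<noteq> None \<and> x \<noteq> Some 3) (\<lambda>x. Push 5 (or0 x))"

text \<open>Popping and pushing back peeks at stack 7, in order to reject a vector whose length
  differs from the number of queries. The vector is given in reverse because the last query is on
  top.\<close>

primrec appl :: "bool list \<Rightarrow> com" where
  "appl [] = Pop 7 (\<lambda>x. if x = None then Seq (mv 8 2) (Seq (mv 2 5) (Push 7 3)) else Halt False)"
| "appl (b # bs) = Pop 7 (\<lambda>x. if x = None then Halt False else Seq (Push 7 (or0 x)) (Seq skipq
     (Seq (Push 8 (sym_of_bit b)) (Seq (Pop 5 (\<lambda>_. Skip)) (appl bs)))))"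

text \<open>Guessed answers may lead \<open>M\<close> to a second query or into an endless run. The
  second simulation then freezes at \<open>ask M\<close> or is cut off by the clock, and both count
  as not accepting, so every vector of the right length gets a value. A run without queries admits
  only the empty vector.\<close>

definition runS :: "com \<Rightarrow> otm \<Rightarrow> bool list \<Rightarrow> bool \<Rightarrow> com" where
  "runS cl M S v = Seq (runA cl M) (Pop 6 (\<lambda>q. if q = Some (ask M)
      then Seq (appl (rev S)) (Seq (Push 6 (ret M)) (Seq (mkclock cl) (Seq (sim M False)
            (Pop 6 (\<lambda>q. if (q = Some (acc M)) = v then cleanup else Halt False)))))
      else if S = [] \<and> (q = Some (acc M)) = v then cleanup else Halt False))"

text \<open>Only entries \<open>True\<close> are checked, by simulating \<open>N\<close> on the
  corresponding query; negative answers, which nondeterminism could not certify, are never asserted.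
  The remaining queries wait on stack 9 because the simulation occupies stack 7.\<close>

primrec vq :: "com \<Rightarrow> otm \<Rightarrow> bool list \<Rightarrow> com" where
  "vq cl N [] = Pop 7 (\<lambda>x. Halt (x = None))"
| "vq cl N (b # bs) = Pop 7 (\<lambda>x. if x = None then Halt False else Seq (Push 7 (or0 x))
     (if b then Seq getq (Seq (mv 7 9) (Seq (mkclock cl) (Seq (Push 6 (start N)) (Seq (Push 7 3) (Seq (sim N True)
          (Pop 6 (\<lambda>q. if q = Some (acc N) then Seq (clear 4) (Seq (clear 5) (Seq (clear 7) (Seq (mv 9 7) (vq cl N bs)))) else Halt False)))))))
      else Seq skipq (vq cl N bs)))"

definition verify :: "com \<Rightarrow> otm \<Rightarrow> otm \<Rightarrow> bool list \<Rightarrow> com" where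
  "verify cl M N S = Seq (runA cl M) (Pop 6 (\<lambda>q. if q = Some (ask M)
      then Seq (clear 4) (Seq (clear 5) (vq cl N (rev S))) else Halt (S = [])))"

lemma ex_conj3: "(\<exists>x. A x \<and> B x \<and> b) \<longleftrightarrow> (\<exists>x. A x \<and> B x) \<and> b"
  by blast

lemma dec_goE: "dec X m d b \<Longrightarrow> Gs X n c d \<Longrightarrow> n + m \<le> l \<Longrightarrow> dec X l c b"
  using dec_go dec_mono by metis

lemma zx_sz_pow: "zne z \<Longrightarrow> (zx M md X ^^ t) z z' \<Longrightarrow> zne z' \<and> zsz z' \<le> zsz z + 3 * t"
proof (induction t arbitrary: z')
  case (Suc t)
  obtain z1 where z1: "(zx M md X ^^ t) z z1" "zx M md X z1 z'" using relpowp_Suc_E[OF Suc.prems(2)] by metis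
  show ?case using Suc.IH[OF Suc.prems(1) z1(1)] zx_sz[OF _ z1(2)] by force
qed simp

lemma go_load: "Gs X (6 * length w + 3) (load # ks, base w, q) (ks, (base w)(5 := enc w), q)"
proof -
  have le: "length (rev (enc w)) = length w" "length (enc w) = length w" by (simp_all add: enc_def)
  let ?S1 = "(\<lambda>_. [])(3 := enc w, 5 := enc w) :: store"
  have "Gs X (4 * length (rev (enc w)) + 1) (copyloop 0 3 5 id # mv 3 0 # ks, base w, q)
     (mv 3 0 # ks, (base w)(0 := [], 3 := rev (rev (enc w)) @ base w 3, 5 := rev (map id (rev (enc w))) @ base w 5), q)"
    by (rule go_copyloop) (auto simp: base_def)
  moreover have "(base w)(0 := [], 3 := rev (rev (enc w)) @ base w 3, 5 := rev (map id (rev (enc w))) @ base w 5) = ?S1"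
    by (auto simp: base_def fun_eq_iff fun_upd_apply)
  ultimately have g1: "Gs X (4 * length w + 1) (copyloop 0 3 5 id # mv 3 0 # ks, base w, q) (mv 3 0 # ks, ?S1, q)"
    unfolding le by simp
  have "Gs X (2 * length (enc w) + 1) (mv 3 0 # ks, ?S1, q) (ks, ?S1(3 := [], 0 := rev (enc w) @ ?S1 0), q)"
    by (rule go_mv) auto
  moreover have "?S1(3 := [], 0 := rev (enc w) @ ?S1 0) = (base w)(5 := enc w)"
    by (auto simp: base_def fun_eq_iff fun_upd_apply)
  ultimately have g2: "Gs X (2 * length w + 1) (mv 3 0 # ks, ?S1, q) (ks, (base w)(5 := enc w), q)"
    unfolding le by simp
  have "Gs X (Suc (4 * length w + 1 + (2 * length w + 1))) (load # ks, base w, q) (ks, (base w)(5 := enc w), q)"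
    unfolding load_def by (rule go_Seq, rule go_add[OF g1 g2])
  then show ?thesis by (rule af_mono) simp
qed

lemma base_rest: "base w 0 = rev (enc w)" "p \<noteq> 0 \<Longrightarrow> base w p = []"
  by (simp_all add: base_def)

lemma zsz_init: "zsz (q, [], enc w, [[]]) = length w + 1"
  using arg_cong[OF qf_init, of length] by (simp add: enc_def)

definition TA :: "otm \<Rightarrow> nat \<Rightarrow> nat \<Rightarrow> nat \<Rightarrow> nat" where
  "TA M n t g = 12 * n + g + t * (card (delta M) + 14 * (n + 1 + 3 * t) + 21) + 20"

lemma dec_runA:
  assumes cl: "unary cl F G" and wf: "wf_otm M" and t: "t = F (length w)"
    and k: "\<And>z'. (zx M False X ^^ t) (start M, [], enc w, [[]]) z' \<Longrightarrow> zne z' \<Longrightarrow> zsz z' \<le> length w + 1 + 3 * t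
        \<Longrightarrow> dec X m (ks, sto (base w) z', [[]]) (P z')"
  shows "dec X (m + TA M (length w) t (G (length w))) (runA cl M # ks, base w, [[]])
     (\<exists>z'. (zx M False X ^^ t) (start M, [], enc w, [[]]) z' \<and> P z')"
proof -
  let ?z = "(start M, [], enc w, [[]]) :: zcfg" and ?n = "length w"
  let ?S1 = "(base w)(5 := enc w)"
  let ?S2 = "(base w)(5 := enc w, 1 := replicate t 0)"
  let ?S3 = "(base w)(1 := replicate t 0)"
  have le: "length (rev (enc w)) = ?n" by (simp add: enc_def)
  have g2: "Gs X (6 * ?n + G ?n + 4) (mkclock cl # Seq (Push 6 (start M)) (Seq (Push 7 3) (sim M False)) # ks, ?S1, [[]])
     (Seq (Push 6 (start M)) (Seq (Push 7 3) (sim M False)) # ks, ?S2, [[]])"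
    using go_mkclock[where c = cl and S = ?S1 and l = "rev (enc w)", OF cl] le t by (simp add: base_rest)
  have e: "?S2(6 := start M # ?S2 6, 7 := 3 # (?S2(6 := start M # ?S2 6)) 7) = sto ?S3 ?z"
    by (auto simp: fun_eq_iff fun_upd_apply qf_init base_rest)
  have g3: "Gs X (Suc (Suc (Suc (Suc 0)))) (Seq (Push 6 (start M)) (Seq (Push 7 3) (sim M False)) # ks, ?S2, [[]]) (sim M False # ks, sto ?S3 ?z, [[]])"
    by (rule go_Seq, rule go_Push, rule go_Seq, rule go_Push, unfold e) (rule af_now, rule refl)
  have g23: "Gs X (6 * ?n + G ?n + 4 + Suc (Suc (Suc (Suc 0)))) (mkclock cl # Seq (Push 6 (start M)) (Seq (Push 7 3) (sim M False)) # ks, ?S1, [[]]) (sim M False # ks, sto ?S3 ?z, [[]])"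
    by (rule go_add[OF g2 g3])
  have g: "Gs X (Suc (6 * ?n + 3 + Suc (6 * ?n + G ?n + 4 + Suc (Suc (Suc (Suc 0)))))) (runA cl M # ks, base w, [[]]) (sim M False # ks, sto ?S3 ?z, [[]])"
    unfolding runA_def by (rule go_Seq, rule go_add[OF go_load], rule go_Seq, rule g23)
  have "dec X (m + length (replicate t (0::nat)) * (card (delta M) + 14 * (zsz ?z + 3 * length (replicate t (0::nat))) + 21) + 1) (sim M False # ks, sto ?S3 ?z, [[]])
     (\<exists>z'. (zx M False X ^^ length (replicate t (0::nat))) ?z z' \<and> P z')"
  proof (rule dec_sim[OF wf])
    fix z' assume z': "(zx M False X ^^ length (replicate t (0::nat))) ?z z'"
    then have z'': "(zx M False X ^^ t) ?z z'" by simp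
    have "?S3(1 := []) = base w" by (auto simp: fun_eq_iff fun_upd_apply base_rest)
    then show "dec X m (ks, sto (?S3(1 := [])) z', [[]]) (P z')"
      using k[OF z''] zx_sz_pow[OF _ z''] unfolding zsz_init by simp
  qed (auto simp: base_rest)
  then have d: "dec X (m + t * (card (delta M) + 14 * (?n + 1 + 3 * t) + 21) + 1) (sim M False # ks, sto ?S3 ?z, [[]])
     (\<exists>z'. (zx M False X ^^ t) ?z z' \<and> P z')" unfolding zsz_init length_replicate .
  show ?thesis by (rule dec_goE[OF d g]) (simp add: TA_def)
qed

lemma go_cleanup: "Gs X (2 * zsz z + 20) (cleanup # ks, (sto (base w) z)(6 := []), q) (ks, base w, q)"
proof -
  obtain q' L R qs where z: "z = (q', L, R, qs)" by (cases z)
  let ?S0 = "(sto (base w) z)(6 := [])"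
  have g1: "Gs X (2 * length L + 1) (clear 4 # Seq (clear 5) (Seq (clear 6) (clear 7)) # ks, ?S0, q)
    (Seq (clear 5) (Seq (clear 6) (clear 7)) # ks, ?S0(4 := []), q)"
    by (rule go_clear) (simp add: z)
  have g2: "Gs X (2 * length R + 1) (clear 5 # Seq (clear 6) (clear 7) # ks, ?S0(4 := []), q)
    (Seq (clear 6) (clear 7) # ks, ?S0(4 := [], 5 := []), q)"
    by (rule go_clear) (simp add: z)
  have g3: "Gs X (2 * length ([]::nat list) + 1) (clear 6 # clear 7 # ks, ?S0(4 := [], 5 := []), q)
    (clear 7 # ks, ?S0(4 := [], 5 := [], 6 := []), q)"
    by (rule go_clear) (simp add: z)
  have g4: "Gs X (2 * length (rev (qf qs)) + 1) (clear 7 # ks, ?S0(4 := [], 5 := [], 6 := []), q)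
    (ks, ?S0(4 := [], 5 := [], 6 := [], 7 := []), q)"
    by (rule go_clear) (simp add: z)
  have e: "?S0(4 := [], 5 := [], 6 := [], 7 := []) = base w" by (auto simp: z fun_eq_iff fun_upd_apply base_rest)
  have "Gs X (Suc (2 * length L + 1 + Suc (2 * length R + 1 + Suc (2 * length ([]::nat list) + 1 + (2 * length (rev (qf qs)) + 1)))))
     (cleanup # ks, ?S0, q) (ks, base w, q)"
    unfolding cleanup_def
    by (rule go_Seq, rule go_add[OF g1], rule go_Seq, rule go_add[OF g2], rule go_Seq, rule go_add[OF g3]) (use g4 in \<open>simp only: e\<close>)
  then show ?thesis by (rule af_mono) (simp add: z)
qed

lemma go_skipq: "S 7 = l @ 3 # r \<Longrightarrow> 3 \<notin> set l \<Longrightarrow> Gs X (2 * length l + 1) (skipq # ks, S, q) (ks, S(7 := r), q)"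
proof (induction l arbitrary: S)
  case Nil
  have "Gs X (Suc 0) (skipq # ks, S, q) (ks, S(7 := r), q)"
    unfolding skipq_def by (rule go_While) (simp add: Nil)
  then show ?case by simp
next
  case (Cons x l)
  have "Gs X (2 * length l + 1) (skipq # ks, S(7 := l @ 3 # r), q) (ks, S(7 := l @ 3 # r, 7 := r), q)"
    by (rule Cons.IH) (use Cons.prems in auto)
  then have g: "Gs X (2 * length l + 1) (skipq # ks, S(7 := l @ 3 # r), q) (ks, S(7 := r), q)" by simp
  have x: "x \<noteq> 3" using Cons.prems(2) by auto
  have "Gs X (Suc (Suc (2 * length l + 1))) (skipq # ks, S, q) (ks, S(7 := r), q)"
    unfolding skipq_def by (rule go_While) (use g x Cons.prems(1) in \<open>simp add: skipq_def go_Skip\<close>)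
  then show ?case by (rule af_mono) simp
qed

lemma go_getq: "S 7 = l @ 3 # r \<Longrightarrow> 3 \<notin> set l \<Longrightarrow> Gs X (2 * length l + 1) (getq # ks, S, q) (ks, S(7 := r, 5 := rev l @ S 5), q)"
proof (induction l arbitrary: S)
  case Nil
  have "S(7 := r, 5 := S 5) = S(7 := r)" by (auto simp: fun_eq_iff fun_upd_apply)
  then have "Gs X (Suc 0) (getq # ks, S, q) (ks, S(7 := r, 5 := rev [] @ S 5), q)"
    unfolding getq_def by (intro go_While) (simp add: Nil)
  then show ?case by simp
next
  case (Cons x l)
  let ?S = "S(7 := l @ 3 # r, 5 := x # S 5)"
  have "Gs X (2 * length l + 1) (getq # ks, ?S, q) (ks, ?S(7 := r, 5 := rev l @ ?S 5), q)"
    by (rule Cons.IH) (use Cons.prems in auto)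
  moreover have "?S(7 := r, 5 := rev l @ ?S 5) = S(7 := r, 5 := rev (x # l) @ S 5)" by (auto simp: fun_eq_iff fun_upd_apply)
  ultimately have g: "Gs X (2 * length l + 1) (getq # ks, ?S, q) (ks, S(7 := r, 5 := rev (x # l) @ S 5), q)" by simp
  have x: "x \<noteq> 3" using Cons.prems(2) by auto
  have "Gs X (Suc (Suc (2 * length l + 1))) (getq # ks, S, q) (ks, S(7 := r, 5 := rev (x # l) @ S 5), q)"
    unfolding getq_def by (rule go_While) (use g x Cons.prems(1) in \<open>simp add: getq_def go_Push or0_def\<close>)
  then show ?case by (rule af_mono) simp
qed

lemma enc_no3: "3 \<notin> set (rev (enc u))"
  using set_enc[of u] by auto

lemma dec_Pop: "dec X n (f (hdo (S s)) # ks, S(s := tl (S s)), q) b \<Longrightarrow> dec X (Suc n) (Pop s f # ks, S, q) b"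
proof -
  assume d: "dec X n (f (hdo (S s)) # ks, S(s := tl (S s)), q) b"
  have "Gs X (Suc 0) (Pop s f # ks, S, q) (f (hdo (S s)) # ks, S(s := tl (S s)), q)"
    by (rule go_Pop) simp
  from dec_go[OF this d] show ?thesis by simp
qed

lemma qf_rev_cases:
  "hdo (rev (qf qs)) = None \<longleftrightarrow> qs = []"
proof (cases qs rule: rev_cases)
  case (snoc qs' u)
  then show ?thesis by (cases "rev (enc u)") (simp_all add: qf_snoc)
qed (simp add: qf_def)

text \<open>Stack 8 accumulates the answers applied so far, which is why \<open>S 8\<close> appears
  in the resulting tape. A vector of wrong length is rejected before \<open>ks\<close> is reached,
  so \<open>ks\<close> need only be analysed for the right length.\<close>

lemma dec_appl:
  "S 7 = rev (qf qs) \<Longrightarrow> S 2 = [] \<Longrightarrow>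
   (length bs = length qs \<Longrightarrow> dec X m (ks, S(7 := [3], 8 := [], 5 := map sym_of_bit (rev bs) @ S 8 @ drop (length qs) (S 5)), [[]]) P) \<Longrightarrow>
   dec X (m + 4 * length (qf qs) + 12 * length bs + 4 * length (S 8) + 20) (appl bs # ks, S, [[]]) (length bs = length qs \<and> P)"
proof (induction bs arbitrary: S qs)
  case Nil
  show ?case
  proof (cases "qs = []")
    case False
    obtain y where y: "hdo (S 7) = Some y" using qf_rev_cases[of qs] Nil(1) False by auto
    have "dec X 0 (Halt False # ks, S(7 := tl (S 7)), [[]]) False" by (rule dec_Halt)
    then have "dec X (Suc 0) (appl [] # ks, S, [[]]) False"
      unfolding appl.simps by (intro dec_Pop) (simp add: y)
    then have "dec X (m + 4 * length (qf qs) + 12 * length ([]::bool list) + 4 * length (S 8) + 20) (appl [] # ks, S, [[]]) False"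
      by (rule dec_mono) simp
    then show ?thesis using False by simp
  next
    case True
    let ?S1 = "S(7 := [], 8 := [], 2 := rev (S 8))"
    let ?S2 = "S(7 := [], 8 := [], 5 := S 8 @ S 5)"
    let ?S3 = "S(7 := [3], 8 := [], 5 := map sym_of_bit (rev []) @ S 8 @ drop (length qs) (S 5))"
    have d: "dec X m (ks, ?S3, [[]]) P" using Nil(3) True by simp
    have S7: "S 7 = []" using Nil(1) True by (simp add: qf_def)
    have Sid: "S(7 := []) = S" using S7 by (auto simp: fun_eq_iff fun_upd_apply)
    have "Gs X (2 * length (S 8) + 1) (mv 8 2 # Seq (mv 2 5) (Push 7 3) # ks, S, [[]]) (Seq (mv 2 5) (Push 7 3) # ks, S(8 := [], 2 := rev (S 8) @ S 2), [[]])"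
      by (rule go_mv) auto
    moreover have "S(8 := [], 2 := rev (S 8) @ S 2) = ?S1" using S7 Nil(2) by (auto simp: fun_eq_iff fun_upd_apply)
    ultimately have g1: "Gs X (2 * length (S 8) + 1) (mv 8 2 # Seq (mv 2 5) (Push 7 3) # ks, S, [[]]) (Seq (mv 2 5) (Push 7 3) # ks, ?S1, [[]])" by simp
    have "Gs X (2 * length (rev (S 8)) + 1) (mv 2 5 # Push 7 3 # ks, ?S1, [[]]) (Push 7 3 # ks, ?S1(2 := [], 5 := rev (rev (S 8)) @ ?S1 5), [[]])"
      by (rule go_mv) auto
    moreover have "?S1(2 := [], 5 := rev (rev (S 8)) @ ?S1 5) = ?S2" using Nil(2) by (auto simp: fun_eq_iff fun_upd_apply)
    ultimately have g2: "Gs X (2 * length (S 8) + 1) (mv 2 5 # Push 7 3 # ks, ?S1, [[]]) (Push 7 3 # ks, ?S2, [[]])" by simp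
    have e: "?S2(7 := 3 # ?S2 7) = ?S3" using True by (auto simp: fun_eq_iff fun_upd_apply)
    have g3: "Gs X (Suc 0) (Push 7 3 # ks, ?S2, [[]]) (ks, ?S3, [[]])" by (rule go_Push, unfold e) (rule af_now, rule refl)
    have "Gs X (Suc (Suc (2 * length (S 8) + 1 + Suc (2 * length (S 8) + 1 + Suc 0)))) (appl [] # ks, S, [[]]) (ks, ?S3, [[]])"
      unfolding appl.simps
    proof (rule go_Pop, unfold S7 Sid hdo_simps list.sel(2))
      have "Gs X (Suc (2 * length (S 8) + 1 + Suc (2 * length (S 8) + 1 + Suc 0))) (Seq (mv 8 2) (Seq (mv 2 5) (Push 7 3)) # ks, S, [[]]) (ks, ?S3, [[]])"
        by (rule go_Seq, rule go_add[OF g1], rule go_Seq, rule go_add[OF g2 g3])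
      then show "Gs X (Suc (2 * length (S 8) + 1 + Suc (2 * length (S 8) + 1 + Suc 0))) ((if (None::nat option) = None then Seq (mv 8 2) (Seq (mv 2 5) (Push 7 3)) else Halt False) # ks, S, [[]]) (ks, ?S3, [[]])"
        by simp
    qed
    from dec_goE[OF d this] have "dec X (m + 4 * length (qf qs) + 12 * length ([]::bool list) + 4 * length (S 8) + 20) (appl [] # ks, S, [[]]) P"
      by simp
    then show ?thesis using True by simp
  qed
next
  case (Cons b bs)
  show ?case
  proof (cases qs rule: rev_cases)
    case Nil
    have "dec X 0 (Halt False # ks, S(7 := tl (S 7)), [[]]) False" by (rule dec_Halt)
    then have "dec X (Suc 0) (appl (b # bs) # ks, S, [[]]) False"
      unfolding appl.simps by (intro dec_Pop) (use Cons(2) Nil in \<open>simp add: qf_def\<close>)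
    then have "dec X (m + 4 * length (qf qs) + 12 * length (b # bs) + 4 * length (S 8) + 20) (appl (b # bs) # ks, S, [[]]) False"
      by (rule dec_mono) simp
    then show ?thesis using Nil by simp
  next
    case (snoc qs' u)
    let ?r = "rev (qf qs')"
    let ?S1 = "S(7 := ?r, 8 := sym_of_bit b # S 8, 5 := tl (S 5))"
    have S7: "S 7 = rev (enc u) @ 3 # ?r" using Cons(2) snoc by (simp add: qf_snoc)
    have "S 7 \<noteq> []" using S7 by simp
    then obtain y l where y: "S 7 = y # l" unfolding neq_Nil_conv by blast
    have bk: "(S(7 := l))(7 := y # (S(7 := l)) 7) = S" using y by (auto simp: fun_eq_iff fun_upd_apply)
    have d1: "dec X (m + 4 * length (qf qs') + 12 * length bs + 4 * length (?S1 8) + 20) (appl bs # ks, ?S1, [[]]) (length bs = length qs' \<and> P)"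
    proof (rule Cons.IH)
      assume "length bs = length qs'"
      then have "dec X m (ks, S(7 := [3], 8 := [], 5 := map sym_of_bit (rev (b # bs)) @ S 8 @ drop (length qs) (S 5)), [[]]) P"
        using Cons(4) snoc by simp
      moreover have "?S1(7 := [3], 8 := [], 5 := map sym_of_bit (rev bs) @ ?S1 8 @ drop (length qs') (?S1 5))
         = S(7 := [3], 8 := [], 5 := map sym_of_bit (rev (b # bs)) @ S 8 @ drop (length qs) (S 5))"
        using snoc by (auto simp: fun_eq_iff fun_upd_apply drop_Suc)
      ultimately show "dec X m (ks, ?S1(7 := [3], 8 := [], 5 := map sym_of_bit (rev bs) @ ?S1 8 @ drop (length qs') (?S1 5)), [[]]) P" by simp
    qed (use Cons(3) in auto)
    let ?c3 = "Seq (Push 8 (sym_of_bit b)) (Seq (Pop 5 (\<lambda>_. Skip)) (appl bs))"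
    have g2: "Gs X (2 * length (rev (enc u)) + 1) (skipq # ?c3 # ks, S, [[]]) (?c3 # ks, S(7 := ?r), [[]])"
      by (rule go_skipq[OF _ enc_no3]) (rule S7)
    have e3: "(S(7 := ?r, 8 := sym_of_bit b # (S(7 := ?r)) 8))(5 := tl ((S(7 := ?r, 8 := sym_of_bit b # (S(7 := ?r)) 8)) 5)) = ?S1"
      by (auto simp: fun_eq_iff fun_upd_apply)
    have g3: "Gs X (Suc (Suc (Suc (Suc (Suc 0))))) (?c3 # ks, S(7 := ?r), [[]]) (appl bs # ks, ?S1, [[]])"
      by (rule go_Seq, rule go_Push, rule go_Seq, rule go_Pop, unfold e3, rule go_Skip) simp
    have g1: "Gs X (Suc (Suc (Suc (Suc (2 * length (rev (enc u)) + 1 + Suc (Suc (Suc (Suc (Suc 0))))))))) (appl (b # bs) # ks, S, [[]]) (appl bs # ks, ?S1, [[]])"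
      unfolding appl.simps
      apply (rule go_Pop)
      apply (simp add: y or0_def del: fun_upd_upd)
      apply (rule go_Seq, rule go_Push, unfold bk, rule go_Seq)
      using go_add[OF g2 g3] by simp
    have "dec X (m + 4 * length (qf qs) + 12 * length (b # bs) + 4 * length (S 8) + 20) (appl (b # bs) # ks, S, [[]]) (length bs = length qs' \<and> P)"
      by (rule dec_goE[OF d1 g1]) (simp add: snoc qf_snoc)
    then show ?thesis using snoc by simp
  qed
qed

fun CB :: "otm \<Rightarrow> lang \<Rightarrow> nat \<Rightarrow> bool list \<Rightarrow> bool \<Rightarrow> zcfg \<Rightarrow> bool" where
  "CB M X t S v (q, L, R, qs) = (if q = ask M then length S = length qs \<and>
      (\<exists>z2. (zx M False X ^^ t) (ret M, L, map sym_of_bit S @ drop (length qs) R, [[]]) z2 \<and> (fst z2 = acc M) = v)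
    else S = [] \<and> (q = acc M) = v)"

text \<open>Two phases of \<open>t\<close> ticks, each tick adding at most 3 to the simulated
  configuration, give \<open>6 * t\<close>; the 2 in \<open>n + 2\<close> covers the initial buffer
  marker and the one written after the query round.\<close>

definition TS :: "otm \<Rightarrow> nat \<Rightarrow> nat \<Rightarrow> nat \<Rightarrow> nat \<Rightarrow> nat" where
  "TS M n t g l = TA M n t g + 4 * (n + 1 + 3 * t) + 12 * l + 6 * n + g
     + t * (card (delta M) + 14 * (n + 2 + 6 * t) + 21) + 2 * (n + 2 + 6 * t) + 70"

text \<open>The continuation starts from \<open>base w\<close> again whichever run was taken, so its
  verdict \<open>b\<close> factors out of the existential over runs.\<close>

lemma dec_runS:
  assumes cl: "unary cl F G" and wf: "wf_otm M" and t: "t = F (length w)" and k: "dec X m (ks, base w, [[]]) b"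
  shows "dec X (m + TS M (length w) t (G (length w)) (length S)) (runS cl M S v # ks, base w, [[]])
     ((\<exists>z'. (zx M False X ^^ t) (start M, [], enc w, [[]]) z' \<and> CB M X t S v z') \<and> b)"
proof -
  let ?n = "length w"
  let ?g = "G ?n"
  let ?f = "Pop 6 (\<lambda>q. if (q = Some (acc M)) = v then cleanup else Halt False)"
  let ?body = "Seq (appl (rev S)) (Seq (Push 6 (ret M)) (Seq (mkclock cl) (Seq (sim M False) ?f)))"
  let ?pop = "Pop 6 (\<lambda>q. if q = Some (ask M) then ?body else if S = [] \<and> (q = Some (acc M)) = v then cleanup else Halt False)"
  let ?s = "?n + 1 + 3 * t"
  let ?m = "m + 4 * ?s + 12 * length S + 6 * ?n + ?g + t * (card (delta M) + 14 * (?n + 2 + 6 * t) + 21) + 2 * (?n + 2 + 6 * t) + 65"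
  have main: "dec X ?m (?pop # ks, sto (base w) z, [[]]) (CB M X t S v z \<and> b)" if z: "zne z" "zsz z \<le> ?s" for z
  proof -
    obtain q L R qs where zz: "z = (q, L, R, qs)" by (cases z)
    let ?S0 = "(sto (base w) z)(6 := [])"
    have s6: "sto (base w) z 6 = [q]" by (simp add: zz)
    have clean: "dec X (m + 2 * zsz z' + 20) (cleanup # ks, (sto (base w) z')(6 := []), [[]]) b" for z'
      by (rule dec_goE[OF k go_cleanup]) simp
    show ?thesis
    proof (cases "q = ask M")
      case False
      have "dec X (?m - 1) ((if S = [] \<and> (q = acc M) = v then cleanup else Halt False) # ks, ?S0, [[]]) (CB M X t S v z \<and> b)"
      proof (cases "S = [] \<and> (q = acc M) = v")
        case True
        have "dec X (?m - 1) (cleanup # ks, ?S0, [[]]) b" by (rule dec_mono[OF clean]) (use z(2) in simp)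
        then show ?thesis using True False by (simp add: zz)
      next
        case F: False
        have eq: "(CB M X t S v z \<and> b) = False" using False F by (simp add: zz)
        show ?thesis unfolding if_not_P[OF F] eq by (rule dec_Halt)
      qed
      then have "dec X (Suc (?m - 1)) (?pop # ks, sto (base w) z, [[]]) (CB M X t S v z \<and> b)"
        by (intro dec_Pop) (use False s6 in simp)
      then show ?thesis by (rule dec_mono) simp
    next
      case True
      let ?R = "map sym_of_bit S @ drop (length qs) R"
      let ?z2 = "(ret M, L, ?R, [[]]) :: zcfg"
      let ?S1 = "?S0(7 := [3], 8 := [], 5 := map sym_of_bit (rev (rev S)) @ ?S0 8 @ drop (length qs) (?S0 5))"
      let ?C2 = "\<exists>z2. (zx M False X ^^ t) ?z2 z2 \<and> (fst z2 = acc M) = v"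
      let ?c4 = "Seq (Push 6 (ret M)) (Seq (mkclock cl) (Seq (sim M False) ?f))"
      let ?m2 = "m + 6 * ?n + ?g + t * (card (delta M) + 14 * (?n + 2 + 6 * t) + 21) + 2 * (?n + 2 + 6 * t) + 35"
      have d4: "dec X ?m2 (?c4 # ks, ?S1, [[]]) (?C2 \<and> b)" if len: "length (rev S) = length qs"
      proof -
        let ?B = "(base w)(1 := replicate t 0)"
        have sz2: "zsz ?z2 \<le> ?s + 1"
        proof -
          have "length S \<le> length (qf qs)" using length_qf[of qs] len by simp
          moreover have "length (qf [[]]) = 1" by (simp add: qf_def enc_def)
          ultimately show ?thesis using z(2) by (simp add: zz)
        qed
        have e1: "?S1(6 := ret M # ?S1 6) = sto (base w) ?z2"
          by (auto simp: zz fun_eq_iff fun_upd_apply base_rest qf_init)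
        have le: "length (rev (enc w)) = ?n" by (simp add: enc_def)
        have e2: "(sto (base w) ?z2)(1 := replicate (F ?n) 0) = sto ?B ?z2" using t by (auto simp: fun_eq_iff fun_upd_apply)
        have "Gs X (6 * length (rev (enc w)) + G (length (rev (enc w))) + 4) (mkclock cl # Seq (sim M False) ?f # ks, sto (base w) ?z2, [[]])
           (Seq (sim M False) ?f # ks, (sto (base w) ?z2)(1 := replicate (F (length (rev (enc w)))) 0), [[]])"
          by (rule go_mkclock[OF cl]) (auto simp: base_rest)
        then have g1: "Gs X (6 * ?n + ?g + 4) (mkclock cl # Seq (sim M False) ?f # ks, sto (base w) ?z2, [[]]) (Seq (sim M False) ?f # ks, sto ?B ?z2, [[]])"
          unfolding le e2 .
        have "dec X (m + 2 * (?n + 2 + 6 * t) + 21 + length (replicate t (0::nat)) * (card (delta M) + 14 * (zsz ?z2 + 3 * length (replicate t (0::nat))) + 21) + 1) (sim M False # ?f # ks, sto ?B ?z2, [[]])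
           (\<exists>z2. (zx M False X ^^ length (replicate t (0::nat))) ?z2 z2 \<and> ((fst z2 = acc M) = v \<and> b))"
        proof (rule dec_sim[OF wf])
          fix z' assume z': "(zx M False X ^^ length (replicate t (0::nat))) ?z2 z'"
          have zs: "zsz z' \<le> ?n + 2 + 6 * t" using zx_sz_pow[OF _ z'] sz2 by simp
          have Bi: "?B(1 := []) = base w" by (auto simp: fun_eq_iff fun_upd_apply base_rest)
          obtain q' L' R' qs' where zq: "z' = (q', L', R', qs')" by (cases z')
          have s6': "sto (base w) z' 6 = [q']" by (simp add: zq)
          have "dec X (m + 2 * (?n + 2 + 6 * t) + 20) ((if (q' = acc M) = v then cleanup else Halt False) # ks, (sto (base w) z')(6 := []), [[]]) ((q' = acc M) = v \<and> b)"
          proof (cases "(q' = acc M) = v")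
            case True
            have "dec X (m + 2 * (?n + 2 + 6 * t) + 20) (cleanup # ks, (sto (base w) z')(6 := []), [[]]) b"
              by (rule dec_mono[OF clean]) (use zs in simp)
            then show ?thesis using True by simp
          next
            case F: False
            have "dec X (m + 2 * (?n + 2 + 6 * t) + 20) (Halt False # ks, (sto (base w) z')(6 := []), [[]]) False" by (rule dec_Halt)
            then show ?thesis unfolding if_not_P[OF F] using F by simp
          qed
          then have "dec X (Suc (m + 2 * (?n + 2 + 6 * t) + 20)) (?f # ks, sto (base w) z', [[]]) ((fst z' = acc M) = v \<and> b)"
            by (intro dec_Pop) (use s6' zq in simp)
          then show "dec X (m + 2 * (?n + 2 + 6 * t) + 21) (?f # ks, sto (?B(1 := [])) z', [[]]) ((fst z' = acc M) = v \<and> b)"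
            unfolding Bi by simp
        qed (auto simp: base_rest)
        then have d: "dec X (m + 2 * (?n + 2 + 6 * t) + 21 + t * (card (delta M) + 14 * (zsz ?z2 + 3 * t) + 21) + 1) (sim M False # ?f # ks, sto ?B ?z2, [[]])
           (?C2 \<and> b)" unfolding length_replicate ex_conj3 .
        have g: "Gs X (Suc (Suc (Suc (6 * ?n + ?g + 4 + Suc 0)))) (?c4 # ks, ?S1, [[]]) (sim M False # ?f # ks, sto ?B ?z2, [[]])"
          by (rule go_Seq, rule go_Push, unfold e1, rule go_Seq, rule go_add[OF g1], rule go_Seq) simp
        have "t * (card (delta M) + 14 * (zsz ?z2 + 3 * t) + 21) \<le> t * (card (delta M) + 14 * (?n + 2 + 6 * t) + 21)"
          using sz2 by (intro mult_le_mono) auto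
        then show ?thesis by (intro dec_goE[OF d g]) linarith
      qed
      have "dec X (?m2 + 4 * length (qf qs) + 12 * length (rev S) + 4 * length (?S0 8) + 20) (appl (rev S) # ?c4 # ks, ?S0, [[]])
         (length (rev S) = length qs \<and> (?C2 \<and> b))"
        by (rule dec_appl) (use d4 in \<open>simp_all add: zz base_rest\<close>)
      then have d3: "dec X (?m2 + 4 * length (qf qs) + 12 * length S + 20) (appl (rev S) # ?c4 # ks, ?S0, [[]]) (CB M X t S v z \<and> b)"
        using True by (simp add: zz base_rest)
      have "Gs X (Suc (Suc 0)) (?pop # ks, sto (base w) z, [[]]) (appl (rev S) # ?c4 # ks, ?S0, [[]])"
        by (rule go_Pop, unfold s6) (use True in \<open>simp add: go_Seq\<close>)
      then show ?thesis by (rule dec_goE[OF d3]) (use z(2) in \<open>simp add: zz\<close>)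
    qed
  qed
  have "dec X (?m + TA M ?n t ?g) (runA cl M # ?pop # ks, base w, [[]])
     (\<exists>z'. (zx M False X ^^ t) (start M, [], enc w, [[]]) z' \<and> (CB M X t S v z' \<and> b))"
    by (rule dec_runA[OF cl wf t]) (rule main)
  then have d: "dec X (?m + TA M ?n t ?g) (runA cl M # ?pop # ks, base w, [[]])
     ((\<exists>z'. (zx M False X ^^ t) (start M, [], enc w, [[]]) z' \<and> CB M X t S v z') \<and> b)"
    by (simp only: ex_simps conj_assoc[symmetric])
  have "Gs X (Suc 0) (runS cl M S v # ks, base w, [[]]) (runA cl M # ?pop # ks, base w, [[]])"
    unfolding runS_def by (rule go_Seq) simp
  then show ?thesis by (rule dec_goE[OF d]) (simp add: TS_def)
qed


definition VE :: "otm \<Rightarrow> nat \<Rightarrow> nat \<Rightarrow> nat \<Rightarrow> nat" where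
  "VE N n t g = 30 * (n + 1 + 3 * t) + 6 * n + g + t * (card (delta N) + 14 * (n + 1 + 6 * t) + 21) + 6 * t + 80"

lemma vq_arith:
  fixes V :: nat
  assumes "V = 30 * (n + 1 + 3 * t) + 6 * n + g + P' + 6 * t + 80" "P \<le> P'" "u + 1 + q \<le> n + 1 + 3 * t"
  shows "Suc (2 * u + 1 + Suc (2 * q + 1 + Suc (6 * n + g + 4 + Suc (Suc (Suc (Suc (Suc 0))))))) +
     (lV + 5 + 4 * (u + 1 + 3 * t) + 2 * q + 12 + P + 1) \<le> lV + 5 + V - 3"
  using assms by simp

text \<open>The induction consumes the queries in the order of stack 7, last query first; hence the
  buffer is presented as \<open>rev us\<close>.\<close>

lemma dec_vq:
  assumes cl: "unary cl F G" and wf: "wf_otm N" and t: "t = F (length w)"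
    and Y: "\<And>u. u \<in> set us \<Longrightarrow> (\<exists>T \<le> t. halts_within N X T (enc u)) \<and> (u \<in> Y \<longleftrightarrow> accepts N X (enc u))"
    and sz: "length (qf (rev us)) \<le> length w + 1 + 3 * t"
  shows "dec X (length bs * VE N (length w) t (G (length w)) + 5) (vq cl N bs # ks, (base w)(7 := rev (qf (rev us))), [[]])
     (list_all2 (\<lambda>b u. b \<longrightarrow> u \<in> Y) bs us)"
  using Y sz
proof (induction bs arbitrary: us)
  case Nil
  let ?S = "(base w)(7 := rev (qf (rev us)))"
  have eq: "(hdo (?S 7) = None) = list_all2 (\<lambda>b u. b \<longrightarrow> u \<in> Y) [] us" using qf_rev_cases[of "rev us"] by simp
  have "dec X (Suc 0) (vq cl N [] # ks, ?S, [[]]) (list_all2 (\<lambda>b u. b \<longrightarrow> u \<in> Y) [] us)"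
    unfolding vq.simps by (rule dec_Pop, unfold eq, rule dec_Halt)
  then show ?case by (rule dec_mono) simp
next
  case (Cons b bs)
  let ?n = "length w"
  let ?g = "G ?n"
  let ?VE = "VE N ?n t ?g"
  let ?s = "?n + 1 + 3 * t"
  let ?S = "(base w)(7 := rev (qf (rev us)))"
  show ?case
  proof (cases us)
    case Nil
    have h: "hdo (?S 7) = None" using qf_rev_cases[of "rev us"] Nil by simp
    have "dec X (Suc 0) (vq cl N (b # bs) # ks, ?S, [[]]) False"
      unfolding vq.simps by (rule dec_Pop, unfold h) (simp add: dec_Halt)
    then have "dec X (length (b # bs) * ?VE + 5) (vq cl N (b # bs) # ks, ?S, [[]]) False" by (rule dec_mono) simp
    then show ?thesis using Nil by simp
  next
    case us: (Cons u us')
    let ?r = "rev (qf (rev us'))"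
    let ?S1 = "(base w)(7 := ?r)"
    have qfe: "rev (qf (rev us)) = rev (enc u) @ 3 # ?r" by (simp add: us qf_snoc)
    have "?S 7 \<noteq> []" using qfe by simp
    then obtain y l where y: "?S 7 = y # l" unfolding neq_Nil_conv by blast
    have bk: "(?S(7 := l))(7 := y # (?S(7 := l)) 7) = ?S" using y by (auto simp: fun_eq_iff fun_upd_apply)
    have lr: "length (rev (enc u)) = length u" "length (enc u) = length u" by (simp_all add: enc_def)
    have lq: "length u + 1 + length (qf (rev us')) \<le> ?s" using Cons.prems(2) arg_cong[OF qfe, of length] by (simp add: lr)
    have IH: "dec X (length bs * ?VE + 5) (vq cl N bs # ks, ?S1, [[]]) (list_all2 (\<lambda>b u. b \<longrightarrow> u \<in> Y) bs us')"
      by (rule Cons.IH) (use Cons.prems(1) us lq in auto)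
    let ?fin = "Pop 6 (\<lambda>q. if q = Some (acc N) then Seq (clear 4) (Seq (clear 5) (Seq (clear 7) (Seq (mv 9 7) (vq cl N bs)))) else Halt False)"
    let ?c = "Seq getq (Seq (mv 7 9) (Seq (mkclock cl) (Seq (Push 6 (start N)) (Seq (Push 7 3) (Seq (sim N True) ?fin)))))"
    let ?d = "Seq skipq (vq cl N bs)"
    have top: "dec X (m + 3) (vq cl N (b # bs) # ks, ?S, [[]]) Q" if d: "dec X m ((if b then ?c else ?d) # ks, ?S, [[]]) Q" for m Q
    proof -
      have "Gs X (Suc (Suc (Suc 0))) (vq cl N (b # bs) # ks, ?S, [[]]) ((if b then ?c else ?d) # ks, ?S, [[]])"
        unfolding vq.simps
        apply (rule go_Pop, unfold y hdo_simps list.sel(3))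
        apply (subst if_not_P, simp)
        apply (rule go_Seq, rule go_Push)
        unfolding or0_def option.case bk by (rule go_refl)
      then show ?thesis by (rule dec_goE[OF d]) simp
    qed
    show ?thesis
    proof (cases b)
      case False
      have g: "Gs X (2 * length (rev (enc u)) + 1) (skipq # vq cl N bs # ks, ?S, [[]]) (vq cl N bs # ks, ?S(7 := ?r), [[]])"
        by (rule go_skipq[OF _ enc_no3]) (simp add: qfe)
      then have "Gs X (Suc (2 * length (rev (enc u)) + 1)) (?d # ks, ?S, [[]]) (vq cl N bs # ks, ?S1, [[]])"
        by (intro go_Seq) simp
      then have "dec X (2 * length u + 2 + (length bs * ?VE + 5)) ((if b then ?c else ?d) # ks, ?S, [[]]) (list_all2 (\<lambda>b u. b \<longrightarrow> u \<in> Y) bs us')"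
        using False lr by (simp only: if_False) (rule dec_goE[OF IH], assumption, simp)
      from top[OF this] have "dec X (length (b # bs) * ?VE + 5) (vq cl N (b # bs) # ks, ?S, [[]]) (list_all2 (\<lambda>b u. b \<longrightarrow> u \<in> Y) bs us')"
        by (rule dec_mono) (use lq in \<open>simp add: VE_def\<close>)
      then show ?thesis using False us by simp
    next
      case True
      let ?S2 = "(base w)(7 := ?r, 5 := enc u)"
      let ?S3 = "(base w)(9 := qf (rev us'), 5 := enc u)"
      let ?S4 = "(base w)(9 := qf (rev us'), 5 := enc u, 1 := replicate t 0)"
      let ?B = "(base w)(9 := qf (rev us'), 1 := replicate t 0)"
      let ?BB = "(base w)(9 := qf (rev us'))"
      let ?z = "(start N, [], enc u, [[]]) :: zcfg"
      let ?k2 = "Seq (mv 7 9) (Seq (mkclock cl) (Seq (Push 6 (start N)) (Seq (Push 7 3) (Seq (sim N True) ?fin))))"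
      let ?k3 = "Seq (mkclock cl) (Seq (Push 6 (start N)) (Seq (Push 7 3) (Seq (sim N True) ?fin)))"
      let ?k4 = "Seq (Push 6 (start N)) (Seq (Push 7 3) (Seq (sim N True) ?fin))"
      have "Gs X (2 * length (rev (enc u)) + 1) (getq # ?k2 # ks, ?S, [[]]) (?k2 # ks, ?S(7 := ?r, 5 := rev (rev (enc u)) @ ?S 5), [[]])"
        by (rule go_getq[OF _ enc_no3]) (simp add: qfe)
      moreover have "?S(7 := ?r, 5 := rev (rev (enc u)) @ ?S 5) = ?S2" by (auto simp: fun_eq_iff fun_upd_apply base_rest)
      ultimately have g1: "Gs X (2 * length u + 1) (getq # ?k2 # ks, ?S, [[]]) (?k2 # ks, ?S2, [[]])" unfolding lr by simp
      have "Gs X (2 * length ?r + 1) (mv 7 9 # ?k3 # ks, ?S2, [[]]) (?k3 # ks, ?S2(7 := [], 9 := rev ?r @ ?S2 9), [[]])"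
        by (rule go_mv) auto
      moreover have "?S2(7 := [], 9 := rev ?r @ ?S2 9) = ?S3" by (auto simp: fun_eq_iff fun_upd_apply base_rest)
      ultimately have g2: "Gs X (2 * length (qf (rev us')) + 1) (mv 7 9 # ?k3 # ks, ?S2, [[]]) (?k3 # ks, ?S3, [[]])" by simp
      have le: "length (rev (enc w)) = ?n" by (simp add: enc_def)
      have "Gs X (6 * length (rev (enc w)) + G (length (rev (enc w))) + 4) (mkclock cl # ?k4 # ks, ?S3, [[]])
           (?k4 # ks, ?S3(1 := replicate (F (length (rev (enc w)))) 0), [[]])"
        by (rule go_mkclock[OF cl]) (auto simp: base_rest)
      then have g3: "Gs X (6 * ?n + ?g + 4) (mkclock cl # ?k4 # ks, ?S3, [[]]) (?k4 # ks, ?S4, [[]])" unfolding le t .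
      have e: "?S4(6 := start N # ?S4 6, 7 := 3 # (?S4(6 := start N # ?S4 6)) 7) = sto ?B ?z"
        by (auto simp: fun_eq_iff fun_upd_apply qf_init base_rest)
      have g4: "Gs X (Suc (Suc (Suc (Suc (Suc 0))))) (?k4 # ks, ?S4, [[]]) (sim N True # ?fin # ks, sto ?B ?z, [[]])"
        by (rule go_Seq, rule go_Push, rule go_Seq, rule go_Push, unfold e, rule go_Seq, rule af_now, rule refl)
      have g14: "Gs X (Suc (2 * length u + 1 + Suc (2 * length (qf (rev us')) + 1 + Suc (6 * ?n + ?g + 4 + Suc (Suc (Suc (Suc (Suc 0))))))))
         (?c # ks, ?S, [[]]) (sim N True # ?fin # ks, sto ?B ?z, [[]])"
        by (rule go_Seq, rule go_add[OF g1], rule go_Seq, rule go_add[OF g2], rule go_Seq, rule go_add[OF g3 g4])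
      let ?P = "list_all2 (\<lambda>b u. b \<longrightarrow> u \<in> Y) bs us'"
      let ?m = "length bs * ?VE + 5 + 4 * (length u + 1 + 3 * t) + 2 * length (qf (rev us')) + 12"
      have zs: "zsz ?z = length u + 1" by (rule zsz_init)
      have dsim: "dec X (?m + length (replicate t (0::nat)) * (card (delta N) + 14 * (zsz ?z + 3 * length (replicate t (0::nat))) + 21) + 1) (sim N True # ?fin # ks, sto ?B ?z, [[]])
         (\<exists>z'. (zx N True X ^^ length (replicate t (0::nat))) ?z z' \<and> (fst z' = acc N \<and> ?P))"
      proof (rule dec_sim[OF wf])
        fix z' assume z': "(zx N True X ^^ length (replicate t (0::nat))) ?z z'"
        have zs': "zsz z' \<le> length u + 1 + 3 * t" using zx_sz_pow[OF _ z'] zs by simp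
        have Bi: "?B(1 := []) = ?BB" by (auto simp: fun_eq_iff fun_upd_apply base_rest)
        obtain q' L' R' qs' where zq: "z' = (q', L', R', qs')" by (cases z')
        have s6': "sto ?BB z' 6 = [q']" by (simp add: zq)
        let ?T0 = "(sto ?BB z')(6 := [])"
        let ?k = "Seq (clear 4) (Seq (clear 5) (Seq (clear 7) (Seq (mv 9 7) (vq cl N bs))))"
        have "dec X (?m - 1) ((if q' = acc N then ?k else Halt False) # ks, ?T0, [[]]) (q' = acc N \<and> ?P)"
        proof (cases "q' = acc N")
          case F: False
          have eq: "(q' = acc N \<and> ?P) = False" using F by simp
          show ?thesis unfolding if_not_P[OF F] eq by (rule dec_Halt)
        next
          case T: True
          have c1: "Gs X (2 * length L' + 1) (clear 4 # Seq (clear 5) (Seq (clear 7) (Seq (mv 9 7) (vq cl N bs))) # ks, ?T0, [[]])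
             (Seq (clear 5) (Seq (clear 7) (Seq (mv 9 7) (vq cl N bs))) # ks, ?T0(4 := []), [[]])"
            by (rule go_clear) (simp add: zq)
          have c2: "Gs X (2 * length R' + 1) (clear 5 # Seq (clear 7) (Seq (mv 9 7) (vq cl N bs)) # ks, ?T0(4 := []), [[]])
             (Seq (clear 7) (Seq (mv 9 7) (vq cl N bs)) # ks, ?T0(4 := [], 5 := []), [[]])"
            by (rule go_clear) (simp add: zq)
          have c3: "Gs X (2 * length (rev (qf qs')) + 1) (clear 7 # Seq (mv 9 7) (vq cl N bs) # ks, ?T0(4 := [], 5 := []), [[]])
             (Seq (mv 9 7) (vq cl N bs) # ks, ?T0(4 := [], 5 := [], 7 := []), [[]])"
            by (rule go_clear) (simp add: zq)
          have e0: "?T0(4 := [], 5 := [], 7 := []) = ?BB" by (auto simp: zq fun_eq_iff fun_upd_apply base_rest)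
          have "Gs X (2 * length (qf (rev us')) + 1) (mv 9 7 # vq cl N bs # ks, ?BB, [[]]) (vq cl N bs # ks, ?BB(9 := [], 7 := rev (qf (rev us')) @ ?BB 7), [[]])"
            by (rule go_mv) auto
          moreover have "?BB(9 := [], 7 := rev (qf (rev us')) @ ?BB 7) = ?S1" by (auto simp: fun_eq_iff fun_upd_apply base_rest)
          ultimately have c4: "Gs X (2 * length (qf (rev us')) + 1) (mv 9 7 # vq cl N bs # ks, ?BB, [[]]) (vq cl N bs # ks, ?S1, [[]])" by simp
          have "Gs X (Suc (2 * length L' + 1 + Suc (2 * length R' + 1 + Suc (2 * length (rev (qf qs')) + 1 + Suc (2 * length (qf (rev us')) + 1)))))
             (?k # ks, ?T0, [[]]) (vq cl N bs # ks, ?S1, [[]])"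
            by (rule go_Seq, rule go_add[OF c1], rule go_Seq, rule go_add[OF c2], rule go_Seq, rule go_add[OF c3], unfold e0, rule go_Seq, rule c4)
          then have "dec X (?m - 1) (?k # ks, ?T0, [[]]) ?P"
            by (rule dec_goE[OF IH]) (use zs' in \<open>simp add: zq\<close>)
          then show ?thesis using T by simp
        qed
        then have "dec X (Suc (?m - 1)) (?fin # ks, sto ?BB z', [[]]) (fst z' = acc N \<and> ?P)"
          by (intro dec_Pop) (use s6' zq in simp)
        then show "dec X ?m (?fin # ks, sto (?B(1 := [])) z', [[]]) (fst z' = acc N \<and> ?P)"
          unfolding Bi by (rule dec_mono) simp
      qed (auto simp: base_rest)
      obtain T where T: "T \<le> t" "halts_within N X T (enc u)" "u \<in> Y \<longleftrightarrow> accepts N X (enc u)"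
        using Cons.prems(1)[of u] us by auto
      \<comment> \<open>The clock \<open>t\<close> is at least the halting time \<open>T\<close> of
        \<open>N\<close> on \<open>u\<close>, so \<open>t\<close> ticks decide membership in
        \<open>Y\<close>.\<close>
      have eq: "(\<exists>z'. (zx N True X ^^ length (replicate t (0::nat))) ?z z' \<and> (fst z' = acc N \<and> ?P)) = (u \<in> Y \<and> ?P)"
        unfolding T(3) zx_accepts[OF wf T(2,1), symmetric] length_replicate by (simp only: ex_simps conj_assoc[symmetric])
      have bound: "t * (card (delta N) + 14 * (length u + 1 + 3 * t) + 21) \<le> t * (card (delta N) + 14 * (?n + 1 + 6 * t) + 21)"
        using lq by (intro mult_le_mono) auto
      have "dec X (length bs * ?VE + 5 + ?VE - 3) (?c # ks, ?S, [[]]) (u \<in> Y \<and> ?P)"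
        by (rule dec_goE[OF dsim[unfolded eq, unfolded zs length_replicate] g14])
           (rule vq_arith[OF VE_def bound lq])
      then have "dec X (length bs * ?VE + 5 + ?VE - 3) ((if b then ?c else ?d) # ks, ?S, [[]]) (u \<in> Y \<and> ?P)"
        using True by simp
      from top[OF this] have "dec X (length (b # bs) * ?VE + 5) (vq cl N (b # bs) # ks, ?S, [[]]) (u \<in> Y \<and> ?P)"
        by (rule dec_mono) (simp add: VE_def)
      then show ?thesis using True us by simp
    qed
  qed
qed

fun VB :: "otm \<Rightarrow> lang \<Rightarrow> bool list \<Rightarrow> zcfg \<Rightarrow> bool" where
  "VB M Y S (q, L, R, qs) = (if q = ask M then list_all2 (\<lambda>b u. b \<longrightarrow> u \<in> Y) S qs else S = [])"

lemma dec_verify: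
  assumes cl: "unary cl F G" and wf: "wf_otm M" "wf_otm N" and t: "t = F (length w)"
    and Y: "\<And>L R qs u. (zx M False X ^^ t) (start M, [], enc w, [[]]) (ask M, L, R, qs) \<Longrightarrow> u \<in> set qs \<Longrightarrow>
       (\<exists>T \<le> t. halts_within N X T (enc u)) \<and> (u \<in> Y \<longleftrightarrow> accepts N X (enc u))"
  shows "dec X (length S * VE N (length w) t (G (length w)) + 2 * (length w + 1 + 3 * t) + 20 + TA M (length w) t (G (length w)))
     (verify cl M N S # ks, base w, [[]])
     (\<exists>z'. (zx M False X ^^ t) (start M, [], enc w, [[]]) z' \<and> VB M Y S z')"
proof -
  let ?n = "length w"
  let ?VE = "VE N ?n t (G ?n)"
  let ?b = "Seq (clear 4) (Seq (clear 5) (vq cl N (rev S)))"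
  let ?pop = "Pop 6 (\<lambda>q. if q = Some (ask M) then ?b else Halt (S = []))"
  let ?m = "length S * ?VE + 2 * (?n + 1 + 3 * t) + 15"
  have "dec X (?m + TA M ?n t (G ?n)) (runA cl M # ?pop # ks, base w, [[]])
     (\<exists>z'. (zx M False X ^^ t) (start M, [], enc w, [[]]) z' \<and> VB M Y S z')"
  proof (rule dec_runA[OF cl wf(1) t])
    fix z assume z: "(zx M False X ^^ t) (start M, [], enc w, [[]]) z" "zne z" "zsz z \<le> ?n + 1 + 3 * t"
    obtain q L R qs where zz: "z = (q, L, R, qs)" by (cases z)
    let ?S0 = "(sto (base w) z)(6 := [])"
    have s6: "sto (base w) z 6 = [q]" by (simp add: zz)
    have "dec X (?m - 1) ((if q = ask M then ?b else Halt (S = [])) # ks, ?S0, [[]]) (VB M Y S z)"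
    proof (cases "q = ask M")
      case False
      have eq: "VB M Y S z = (S = [])" using False by (simp add: zz)
      show ?thesis unfolding if_not_P[OF False] eq by (rule dec_Halt)
    next
      case True
      have c1: "Gs X (2 * length L + 1) (clear 4 # Seq (clear 5) (vq cl N (rev S)) # ks, ?S0, [[]]) (Seq (clear 5) (vq cl N (rev S)) # ks, ?S0(4 := []), [[]])"
        by (rule go_clear) (simp add: zz)
      have c2: "Gs X (2 * length R + 1) (clear 5 # vq cl N (rev S) # ks, ?S0(4 := []), [[]]) (vq cl N (rev S) # ks, ?S0(4 := [], 5 := []), [[]])"
        by (rule go_clear) (simp add: zz)
      have e: "?S0(4 := [], 5 := []) = (base w)(7 := rev (qf (rev (rev qs))))" by (auto simp: zz fun_eq_iff fun_upd_apply base_rest)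
      have d: "dec X (length (rev S) * ?VE + 5) (vq cl N (rev S) # ks, (base w)(7 := rev (qf (rev (rev qs)))), [[]])
         (list_all2 (\<lambda>b u. b \<longrightarrow> u \<in> Y) (rev S) (rev qs))"
      proof (rule dec_vq[OF cl wf(2) t])
        show "(\<exists>T \<le> t. halts_within N X T (enc u)) \<and> (u \<in> Y \<longleftrightarrow> accepts N X (enc u))" if "u \<in> set (rev qs)" for u
          by (rule Y[of L R qs]) (use z(1) True that in \<open>simp_all add: zz\<close>)
      qed (use z(3) in \<open>simp add: zz\<close>)
      have g: "Gs X (Suc (2 * length L + 1 + Suc (2 * length R + 1))) (?b # ks, ?S0, [[]]) (vq cl N (rev S) # ks, (base w)(7 := rev (qf (rev (rev qs)))), [[]])"
        by (rule go_Seq, rule go_add[OF c1], rule go_Seq) (use c2 in \<open>simp only: e\<close>)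
      have "dec X (?m - 1) (?b # ks, ?S0, [[]]) (list_all2 (\<lambda>b u. b \<longrightarrow> u \<in> Y) (rev S) (rev qs))"
        by (rule dec_goE[OF d g]) (use z(3) in \<open>simp add: zz\<close>)
      then show ?thesis using True by (simp add: zz list_all2_rev)
    qed
    then have "dec X (Suc (?m - 1)) (?pop # ks, sto (base w) z, [[]]) (VB M Y S z)"
      by (intro dec_Pop) (use s6 in simp)
    then show "dec X ?m (?pop # ks, sto (base w) z, [[]]) (VB M Y S z)" by (rule dec_mono) simp
  qed
  moreover have "Gs X (Suc 0) (verify cl M N S # ks, base w, [[]]) (runA cl M # ?pop # ks, base w, [[]])"
    unfolding verify_def by (rule go_Seq) simp
  ultimately show ?thesis by (rule dec_goE) simp
qed

subsection \<open>Chains of answer vectors\<close>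

definition le :: "bool list \<Rightarrow> bool list \<Rightarrow> bool" where
  "le = list_all2 (\<longrightarrow>)"

definition ones :: "bool list \<Rightarrow> nat" where
  "ones S = length (filter id S)"

lemma le_ones: "le S S' \<Longrightarrow> ones S \<le> ones S' \<and> (S \<noteq> S' \<longrightarrow> ones S < ones S')"
  unfolding le_def
proof (induction rule: list_all2_induct)
  case (Cons x xs y ys)
  then show ?case by (cases x; cases y) (auto simp: ones_def)
qed (simp add: ones_def)

lemma le_length: "le S S' \<Longrightarrow> length S = length S'"
  unfolding le_def by (rule list_all2_lengthD)

definition mono_chain :: "bool list list \<Rightarrow> bool" where
  "mono_chain Ss \<longleftrightarrow> (\<forall>j. Suc j < length Ss \<longrightarrow> le (Ss ! j) (Ss ! Suc j))"

definition alternating :: "(bool list \<Rightarrow> bool) \<Rightarrow> bool list list \<Rightarrow> bool" where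
  "alternating f Ss \<longleftrightarrow> (\<forall>j < length Ss. f (Ss ! j) = even j)"

definition has_chain :: "(bool list \<Rightarrow> bool) \<Rightarrow> bool list \<Rightarrow> nat \<Rightarrow> bool" where
  "has_chain f Y z \<longleftrightarrow> (\<exists>Ss. length Ss = z \<and> Ss \<noteq> [] \<and> mono_chain Ss \<and> alternating f Ss \<and> le (last Ss) Y)"

text \<open>Alternation forces consecutive vectors to differ, so the number of ones increases
  strictly along the chain and stays at most \<open>length Y\<close>.\<close>

lemma chain_bound:
  assumes "has_chain f Y z"
  shows "z \<le> Suc (length Y)"
proof -
  obtain Ss where Ss: "length Ss = z" "Ss \<noteq> []" "mono_chain Ss" "alternating f Ss" "le (last Ss) Y"
    using assms unfolding has_chain_def by blast
  have "j < z \<Longrightarrow> j \<le> ones (Ss ! j)" for j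
  proof (induction j)
    case (Suc j)
    have "f (Ss ! j) = even j" "f (Ss ! Suc j) = even (Suc j)" using Ss(1,4) Suc.prems unfolding alternating_def by auto
    then have "Ss ! j \<noteq> Ss ! Suc j" by (metis even_Suc)
    moreover have "le (Ss ! j) (Ss ! Suc j)" using Ss(1,3) Suc.prems unfolding mono_chain_def by blast
    ultimately have "ones (Ss ! j) < ones (Ss ! Suc j)" using le_ones by blast
    then show ?case using Suc by simp
  qed simp
  moreover have "z - 1 < z" using Ss(1,2) by (cases z) auto
  ultimately have "z - 1 \<le> ones (last Ss)" unfolding last_conv_nth[OF Ss(2)] Ss(1) by metis
  also have "\<dots> \<le> ones Y" using le_ones[OF Ss(5)] by blast
  also have "\<dots> \<le> length Y" unfolding ones_def by (rule length_filter_le)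
  finally show ?thesis by simp
qed

lemma le_refl: "le S S"
  unfolding le_def by (rule list_all2_refl) simp

lemma le_trans: "le S S' \<Longrightarrow> le S' S'' \<Longrightarrow> le S S''"
  unfolding le_def by (rule list_all2_trans[of "(\<longrightarrow>)" "(\<longrightarrow>)"]) auto

text \<open>Dropping the last vector leaves a chain that is still below \<open>Y\<close> by
  transitivity; \<open>z \<ge> 1\<close> keeps it nonempty.\<close>

lemma chain_antimono:
  assumes "has_chain f Y (Suc z)" "z \<ge> 1"
  shows "has_chain f Y z"
proof -
  obtain Ss where Ss: "length Ss = Suc z" "mono_chain Ss" "alternating f Ss" "le (last Ss) Y"
    using assms unfolding has_chain_def by blast
  let ?T = "butlast Ss"
  have len: "length ?T = z" using Ss(1) by simp
  have ne: "?T \<noteq> []"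
  proof
    assume "?T = []"
    then have "length ?T = 0" by (simp only: list.size(3))
    then show False using len assms(2) by linarith
  qed
  have nth: "j < z \<Longrightarrow> ?T ! j = Ss ! j" for j using len by (simp add: nth_butlast)
  have "le (last ?T) (last Ss)"
  proof -
    have "last ?T = Ss ! (z - 1)" using ne len nth[of "z - 1"] assms(2) by (simp add: last_conv_nth)
    moreover have "Ss \<noteq> []" using Ss(1) by auto
    then have "last Ss = Ss ! Suc (z - 1)" using Ss(1) assms(2) by (simp add: last_conv_nth)
    moreover have "le (Ss ! (z - 1)) (Ss ! Suc (z - 1))"
    proof -
      have "Suc (z - 1) < length Ss" using Ss(1) assms(2) by simp
      then show ?thesis using Ss(2) unfolding mono_chain_def by metis
    qed
    ultimately show ?thesis by simp
  qed
  then have "le (last ?T) Y" using Ss(4) le_trans by blast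
  moreover have "mono_chain ?T" unfolding mono_chain_def
  proof (intro allI impI)
    fix j assume "Suc j < length ?T"
    then show "le (?T ! j) (?T ! Suc j)" using nth[of j] nth[of "Suc j"] Ss(1,2) len unfolding mono_chain_def by simp
  qed
  moreover have "alternating f ?T" using Ss(1,3) nth len unfolding alternating_def by simp
  ultimately show ?thesis using len ne unfolding has_chain_def by blast
qed

text \<open>A longest alternating chain below \<open>Y\<close> must end with the value \<open>f Y\<close>, as otherwise \<open>Y\<close> itself extends it.\<close>

lemma chain_parity:
  assumes "length Y \<le> k"
  shows "odd (card {z. 1 \<le> z \<and> z \<le> Suc k \<and> has_chain f Y z}) \<longleftrightarrow> f Y"
proof -
  let ?Z = "{z. 1 \<le> z \<and> z \<le> Suc k \<and> has_chain f Y z}"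
  have fin: "finite ?Z" by (rule finite_subset[of _ "{..Suc k}"]) auto
  show ?thesis
  proof (cases "?Z = {}")
    case True
    have "\<not> f Y"
    proof
      assume "f Y"
      then have "has_chain f Y 1" unfolding has_chain_def
        by (intro exI[of _ "[Y]"]) (auto simp: mono_chain_def alternating_def le_refl)
      then show False using True by auto
    qed
    then show ?thesis unfolding True by simp
  next
    case False
    define m where "m = Max ?Z"
    have m: "m \<in> ?Z" unfolding m_def using fin False by (rule Max_in)
    \<comment> \<open>The lengths of chains form an initial segment, so their number equals the
      largest of them.\<close>
    have down: "has_chain f Y z" if "1 \<le> z" "z \<le> m" for z
      using that(2) that(1)
    proof (induction z rule: inc_induct)
      case base
      then show ?case using m by simp
    next
      case (step z)
      then show ?case using chain_antimono by simp
    qed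
    have "?Z = {1..m}"
    proof
      show "?Z \<subseteq> {1..m}" using Max_ge[OF fin] unfolding m_def by auto
      show "{1..m} \<subseteq> ?Z" using down m by auto
    qed
    then have card: "card ?Z = m" by simp
    obtain Ss where Ss: "length Ss = m" "Ss \<noteq> []" "mono_chain Ss" "alternating f Ss" "le (last Ss) Y"
      using m unfolding has_chain_def by blast
    have "f Y = odd m"
    proof (rule ccontr)
      assume ne: "f Y \<noteq> odd m"
      let ?T = "Ss @ [Y]"
      have mono: "mono_chain ?T" unfolding mono_chain_def
      proof (intro allI impI)
        fix j assume j: "Suc j < length ?T"
        show "le (?T ! j) (?T ! Suc j)"
        proof (cases "Suc j < length Ss")
          case True
          then show ?thesis using Ss(3) unfolding mono_chain_def by (simp add: nth_append)
        next
          case False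
          then have jl: "j = length Ss - 1" "j < length Ss" "Suc j = length Ss" using j by simp_all
          have "?T ! j = last Ss" unfolding last_conv_nth[OF Ss(2)] using jl(1,2) by (simp add: nth_append)
          moreover have "?T ! Suc j = Y" using jl(3) by (simp add: nth_append)
          ultimately have "?T ! j = last Ss" "?T ! Suc j = Y" by simp_all
          then show ?thesis using Ss(5) by simp
        qed
      qed
      \<comment> \<open>Positions count from 0: the appended vector has position \<open>m\<close>
        and must have the value \<open>even m\<close>, which is what \<open>ne\<close>
        states.\<close>
      have "alternating f ?T" using Ss(1,4) ne unfolding alternating_def by (auto simp: nth_append less_Suc_eq)
      then have hc: "has_chain f Y (Suc m)" unfolding has_chain_def using mono Ss(1)
        by (intro exI[of _ ?T]) (auto simp: le_refl)
      \<comment> \<open>The cutoff at \<open>Suc k\<close> hides no longer chain, because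
        \<open>chain_bound\<close> keeps every chain below it.\<close>
      then have "Suc m \<in> ?Z" using chain_bound[OF hc] assms by simp
      then have "Suc m \<le> Max ?Z" by (rule Max_ge[OF fin])
      then show False using m_def by linarith
    qed
    then show ?thesis unfolding card by blast
  qed
qed

subsection \<open>Semantics of a deterministic machine with one round of queries\<close>

text \<open>Without query steps the oracle is never consulted. This carries runs of \<open>M\<close>
  over from its own oracle \<open>Y\<close> to the oracle \<open>X\<close> of the simulating
  machine.\<close>

lemma stepm_False: "stepm M False X = stepm M False Y"
  by (intro ext) (auto simp: stepm_def step_def)

lemma tot_ex: "\<exists>c'. tot R c c'"
  unfolding tot_def by blast

lemma tot_pow_ex: "\<exists>c'. (tot R ^^ t) c c'"
proof (induction t)
  case (Suc t)
  then obtain c1 where "(tot R ^^ t) c c1" by blast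
  then show ?case using tot_ex[of R c1] by (meson relpowp_Suc_I)
qed auto

lemma pow_det:
  fixes R :: "'c \<Rightarrow> 'c \<Rightarrow> bool"
  assumes "\<And>x a b. R x a \<Longrightarrow> R x b \<Longrightarrow> a = b"
  shows "(R ^^ t) c a \<Longrightarrow> (R ^^ t) c b \<Longrightarrow> a = b"
proof (induction t arbitrary: a b)
  case (Suc t)
  obtain a1 where a1: "(R ^^ t) c a1" "R a1 a" using relpowp_Suc_E[OF Suc.prems(1)] by metis
  obtain b1 where b1: "(R ^^ t) c b1" "R b1 b" using relpowp_Suc_E[OF Suc.prems(2)] by metis
  show ?case using Suc.IH[OF a1(1) b1(1)] a1(2) b1(2) assms by metis
qed simp

lemma tot_det:
  fixes R :: "'c \<Rightarrow> 'c \<Rightarrow> bool"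
  assumes "\<And>x a b. R x a \<Longrightarrow> R x b \<Longrightarrow> a = b"
  shows "tot R x a \<Longrightarrow> tot R x b \<Longrightarrow> a = b"
  using assms unfolding tot_def by metis

lemma stuck_unique:
  fixes R :: "'c \<Rightarrow> 'c \<Rightarrow> bool"
  assumes det: "\<And>x a b. R x a \<Longrightarrow> R x b \<Longrightarrow> a = b"
    and "(R ^^ n) c a" "(R ^^ m) c b" "\<And>d. \<not> R a d" "\<And>d. \<not> R b d"
  shows "a = b"
proof -
  have "(tot R ^^ max n m) c a" by (rule relpow_tot[OF assms(2)]) (use assms(4) in auto)
  moreover have "(tot R ^^ max n m) c b" by (rule relpow_tot[OF assms(3)]) (use assms(5) in auto)
  moreover have "p = p'" if "tot R x p" "tot R x p'" for x p p'
    by (rule tot_det[of R, OF _ that]) (rule det)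
  ultimately show ?thesis using pow_det[of "tot R"] by metis
qed

lemma step_det:
  assumes "deterministic M" "step M X c a" "step M X c b"
  shows "a = b"
proof -
  obtain q t h qs where c: "c = (q, t, h, qs)" by (cases c)
  obtain q1 t1 h1 qs1 where a: "a = (q1, t1, h1, qs1)" by (cases a)
  obtain q2 t2 h2 qs2 where b: "b = (q2, t2, h2, qs2)" by (cases b)
  show ?thesis
  proof (cases "q = ask M")
    case True
    then show ?thesis using assms(2,3) unfolding c a b step_def by simp
  next
    case False
    obtain s1 d1 x1 where 1: "(q, t h, q1, s1, d1, x1) \<in> delta M" "t1 = t(h := s1)" "h1 = h + d1" "qs1 = qupd x1 qs"
      using assms(2) False unfolding c a step_def by auto
    obtain s2 d2 x2 where 2: "(q, t h, q2, s2, d2, x2) \<in> delta M" "t2 = t(h := s2)" "h2 = h + d2" "qs2 = qupd x2 qs"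
      using assms(3) False unfolding c b step_def by auto
    have "(q, t h, q1, s1, d1, x1) = (q, t h, q2, s2, d2, x2)"
      using assms(1) 1(1) 2(1) unfolding deterministic_def by fastforce
    then show ?thesis using 1 2 unfolding a b by simp
  qed
qed

lemma query_length:
  "(step M X ^^ n) (init_cfg M xs) c \<Longrightarrow> snd (snd (snd c)) \<noteq> [] \<and> (\<forall>u \<in> set (snd (snd (snd c))). length u \<le> n)"
proof (induction n arbitrary: c)
  case 0
  then show ?case by (auto simp: init_cfg_def)
next
  case (Suc n)
  obtain b where b: "(step M X ^^ n) (init_cfg M xs) b" "step M X b c" using relpowp_Suc_E[OF Suc.prems] by metis
  obtain q t h qs where bq: "b = (q, t, h, qs)" by (cases b)
  obtain q' t' h' qs' where cq: "c = (q', t', h', qs')" by (cases c)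
  have ih: "qs \<noteq> []" "\<forall>u \<in> set qs. length u \<le> n" using Suc.IH[OF b(1)] bq by auto
  have "qs' = [[]] \<or> (\<exists>x. qs' = qupd x qs)" using b(2) unfolding bq cq step_def by auto
  then show ?case
  proof
    assume "\<exists>x. qs' = qupd x qs"
    then obtain x where x: "qs' = qupd x qs" by blast
    have "\<forall>u \<in> set (qupd x qs). length u \<le> Suc n"
    proof (cases x)
      case (QWrite y)
      have "length (last qs) \<le> n" using ih by simp
      then show ?thesis using QWrite ih(2) by (auto dest!: in_set_butlastD intro: le_SucI)
    qed (use ih(2) in \<open>auto intro: le_SucI\<close>)
    then show ?thesis using x qupd_ne[OF ih(1)] cq by simp
  qed (simp add: cq)
qed

fun CBc :: "otm \<Rightarrow> lang \<Rightarrow> nat \<Rightarrow> bool list \<Rightarrow> bool \<Rightarrow> cfg \<Rightarrow> bool" where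
  "CBc M X t S v (q, tp, h, qs) = (if q = ask M then length S = length qs \<and>
      (\<exists>c2. (tot (stepm M False X) ^^ t) (ret M, write_answers tp h S, h, [[]]) c2 \<and> (fst c2 = acc M) = v)
    else S = [] \<and> (q = acc M) = v)"

fun VBc :: "otm \<Rightarrow> lang \<Rightarrow> bool list \<Rightarrow> cfg \<Rightarrow> bool" where
  "VBc M Y S (q, tp, h, qs) = (if q = ask M then list_all2 (\<lambda>b u. b \<longrightarrow> u \<in> Y) S qs else S = [])"

lemma CB_CBc:
  assumes wf: "wf_otm M" and rel: "zrel z c"
  shows "CB M X t S v z \<longleftrightarrow> CBc M X t S v c"
proof -
  obtain q L R qs where z: "z = (q, L, R, qs)" by (cases z)
  obtain tp h where c: "c = (q, tp, h, qs)" using rel unfolding z by (cases c) auto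
  have "(\<exists>z2. (zx M False X ^^ t) (ret M, L, map sym_of_bit S @ drop (length qs) R, [[]]) z2 \<and> (fst z2 = acc M) = v)
     \<longleftrightarrow> (\<exists>c2. (tot (stepm M False X) ^^ t) (ret M, write_answers tp h S, h, [[]]) c2 \<and> (fst c2 = acc M) = v)"
    if len: "length S = length qs"
  proof (rule zsim_iff[OF wf])
    show "zrel (ret M, L, map sym_of_bit S @ drop (length qs) R, [[]]) (ret M, write_answers tp h S, h, [[]])"
      using zrel_write[of q L R qs tp h "ret M" S] rel len unfolding z c by simp
    show "(fst z' = acc M) = v \<longleftrightarrow> (fst c' = acc M) = v" if "zrel z' c'" for z' c'
      using that by (cases z'; cases c') auto
  qed
  then show ?thesis unfolding z c CB.simps CBc.simps by argo
qed

lemma VB_VBc: "zrel z c \<Longrightarrow> VB M Y S z \<longleftrightarrow> VBc M Y S c"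
  by (cases z; cases c) auto

text \<open>Determinism makes the configuration at the query state unique, and it is reached before
  any answer is seen. So the queries \<open>us\<close> are fixed by the input, and
  \<open>f S\<close> is the outcome of \<open>t\<close> further ticks after writing \<open>S\<close>
  as answers, for true and false answers alike.\<close>

lemma one_round_semantics:
  assumes wf: "wf_otm M" and det: "deterministic M" and one: "one_round M Y k xs"
    and h: "halts_within M Y T xs" and t: "T \<le> t"
  shows "\<exists>us f. length us \<le> k \<and> (accepts M Y xs \<longleftrightarrow> f (map (\<lambda>u. u \<in> Y) us))
     \<and> (\<forall>S v. (\<exists>z'. (zx M False X ^^ t) (start M, [], xs, [[]]) z' \<and> CB M X t S v z') \<longleftrightarrow> length S = length us \<and> f S = v)
     \<and> (\<forall>S. (\<exists>z'. (zx M False X ^^ t) (start M, [], xs, [[]]) z' \<and> VB M Y S z') \<longleftrightarrow> le S (map (\<lambda>u. u \<in> Y) us))"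
proof -
  let ?R = "stepm M False X"
  let ?c0 = "init_cfg M xs"
  have RY: "?R = stepm M False Y" by (rule stepm_False)
  have Rstep: "step M Y c c'" if "?R c c'" for c c' using that unfolding RY stepm_def by blast
  have Rpow: "(step M Y ^^ n) c c'" if "(?R ^^ n) c c'" for n c c'
    using that
  proof (induction n arbitrary: c')
    case (Suc n)
    obtain b where "(?R ^^ n) c b" "?R b c'" using relpowp_Suc_E[OF Suc.prems] by metis
    then show ?case using Suc.IH Rstep by (meson relpowp_Suc_I)
  qed simp
  have sdet: "step M Y c a \<Longrightarrow> step M Y c b \<Longrightarrow> a = b" for c a b by (rule step_det[OF det])
  have Rdet: "?R c a \<Longrightarrow> ?R c b \<Longrightarrow> a = b" for c a b using Rstep sdet by metis
  have tdet: "(tot ?R ^^ t) c a \<Longrightarrow> (tot ?R ^^ t) c b \<Longrightarrow> a = b" for c a b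
  proof (rule pow_det[of "tot ?R"])
    show "p = p'" if "tot ?R x p" "tot ?R x p'" for x p p'
      by (rule tot_det[of ?R, OF _ that]) (rule Rdet)
  qed
  obtain c1 where c1: "(tot ?R ^^ t) ?c0 c1" using tot_pow_ex[where R = ?R and t = t and c = ?c0] by metis
  obtain n1 where n1: "(?R ^^ n1) ?c0 c1" "n1 = t \<or> (\<forall>d. \<not> ?R c1 d)" using tot_relpow[OF c1] by metis
  have n1T: "n1 \<le> T" by (rule halts_length[OF h Rpow[OF n1(1)]])
  have st1: "\<not> ?R c1 d" for d
  proof
    assume d: "?R c1 d"
    then have "n1 = t" using n1(2) by metis
    moreover have "Suc n1 \<le> T" by (rule halts_length[OF h relpowp_Suc_I[OF Rpow[OF n1(1)] Rstep[OF d]]])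
    ultimately show False using t by simp
  qed
  have acc_iff: "accepts M Y xs \<longleftrightarrow> fst c = acc M" if c: "(step M Y ^^ n) ?c0 c" "\<And>d. \<not> step M Y c d" for n c
  proof
    assume "accepts M Y xs"
    then obtain m c' where c': "(step M Y ^^ m) ?c0 c'" "fst c' = acc M" unfolding accepts_def by metis
    have "c' = c" by (rule stuck_unique[of "step M Y", OF sdet c'(1) c(1) acc_stuck[OF wf c'(2)] c(2)])
    then show "fst c = acc M" using c'(2) by simp
  next
    assume "fst c = acc M"
    then show "accepts M Y xs" using c(1) unfolding accepts_def by metis
  qed
  have noask: "\<not> step M Y c d" if "\<And>d. \<not> ?R c d" "fst c \<noteq> ask M" for c d
    using that unfolding RY stepm_def by metis
  have CC: "(\<exists>z'. (zx M False X ^^ t) (start M, [], xs, [[]]) z' \<and> CB M X t S v z') \<longleftrightarrow> CBc M X t S v c1" for S v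
  proof -
    have "(\<exists>z'. (zx M False X ^^ t) (start M, [], xs, [[]]) z' \<and> CB M X t S v z') \<longleftrightarrow> (\<exists>c. (tot ?R ^^ t) ?c0 c \<and> CBc M X t S v c)"
      by (rule zsim_iff[OF wf zrel_init]) (rule CB_CBc[OF wf])
    also have "\<dots> \<longleftrightarrow> CBc M X t S v c1" using c1 tdet by metis
    finally show ?thesis .
  qed
  have VV: "(\<exists>z'. (zx M False X ^^ t) (start M, [], xs, [[]]) z' \<and> VB M Y S z') \<longleftrightarrow> VBc M Y S c1" for S
  proof -
    have "(\<exists>z'. (zx M False X ^^ t) (start M, [], xs, [[]]) z' \<and> VB M Y S z') \<longleftrightarrow> (\<exists>c. (tot ?R ^^ t) ?c0 c \<and> VBc M Y S c)"
      by (rule zsim_iff[OF wf zrel_init]) (rule VB_VBc)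
    also have "\<dots> \<longleftrightarrow> VBc M Y S c1" using c1 tdet by metis
    finally show ?thesis .
  qed
  obtain q tp hp qs where c1q: "c1 = (q, tp, hp, qs)" by (cases c1)
  show ?thesis
  proof (cases "q = ask M")
    case False
    have a: "accepts M Y xs \<longleftrightarrow> q = acc M"
      using acc_iff[OF Rpow[OF n1(1)] noask[OF st1]] False unfolding c1q by simp
    \<comment> \<open>Without a query the only answer vector is the empty one, and \<open>f\<close>
      is constant.\<close>
    show ?thesis
    proof (intro exI[of _ "[]"] exI[of _ "\<lambda>_. q = acc M"] conjI allI)
      show "(\<exists>z'. (zx M False X ^^ t) (start M, [], xs, [[]]) z' \<and> CB M X t S v z') \<longleftrightarrow> length S = length [] \<and> (q = acc M) = v" for S v
        unfolding CC c1q using False by simp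
      show "(\<exists>z'. (zx M False X ^^ t) (start M, [], xs, [[]]) z' \<and> VB M Y S z') \<longleftrightarrow> le S (map (\<lambda>u. u \<in> Y) [])" for S
        unfolding VV c1q using False by (simp add: le_def)
    qed (use a in simp_all)
  next
    case True
    let ?f = "\<lambda>S. \<exists>c2. (tot ?R ^^ t) (ret M, write_answers tp hp S, hp, [[]]) c2 \<and> fst c2 = acc M"
    let ?Y = "map (\<lambda>u. u \<in> Y) qs"
    let ?c2 = "(ret M, write_answers tp hp ?Y, hp, [[]]) :: cfg"
    have f: "(\<exists>c2. (tot ?R ^^ t) (ret M, write_answers tp hp S, hp, [[]]) c2 \<and> (fst c2 = acc M) = v) \<longleftrightarrow> ?f S = v" for S v
    proof -
      obtain c2 where c2: "(tot ?R ^^ t) (ret M, write_answers tp hp S, hp, [[]]) c2"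
        using tot_pow_ex[where R = ?R and t = t and c = "(ret M, write_answers tp hp S, hp, [[]])"] by metis
      then show ?thesis using tdet[OF c2] by metis
    qed
    have ar: "length (snd (snd (snd c1))) \<le> k \<and> (\<forall>m c'. m > 0 \<and> (step M Y ^^ m) c1 c' \<longrightarrow> fst c' \<noteq> ask M)"
      using one Rpow[OF n1(1)] True unfolding one_round_def c1q by (metis fst_conv)
    have s12: "step M Y c1 ?c2" using True unfolding c1q step_def by simp
    obtain c3 where c3: "(tot ?R ^^ t) ?c2 c3" using tot_pow_ex[where R = ?R and t = t and c = ?c2] by metis
    obtain n3 where n3: "(?R ^^ n3) ?c2 c3" "n3 = t \<or> (\<forall>d. \<not> ?R c3 d)" using tot_relpow[OF c3] by metis
    have p13: "(step M Y ^^ Suc n3) c1 c3" by (rule relpowp_Suc_I2[OF s12 Rpow[OF n3(1)]])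
    have p03: "(step M Y ^^ (n1 + Suc n3)) ?c0 c3"
      using Rpow[OF n1(1)] p13 unfolding relpowp_add by (rule relcomppI)
    have "n1 + Suc n3 \<le> T" by (rule halts_length[OF h p03])
    \<comment> \<open>The query step itself takes one of at most \<open>T\<close> steps, so fewer
      than \<open>t\<close> are left for the second phase and \<open>c3\<close> is stuck rather than
      cut off.\<close>
    then have "n3 \<noteq> t" using t by simp
    then have st3: "\<not> ?R c3 d" for d using n3(2) by metis
    \<comment> \<open>A configuration that is stuck only for lack of query steps would be a second
      query state, which \<open>one_round\<close> excludes.\<close>
    have "fst c3 \<noteq> ask M" using ar p13 by (metis zero_less_Suc)
    then have "accepts M Y xs \<longleftrightarrow> fst c3 = acc M" using acc_iff[OF p03 noask[OF st3]] by simp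
    also have "\<dots> \<longleftrightarrow> ?f ?Y" using c3 tdet by metis
    finally have a: "accepts M Y xs \<longleftrightarrow> ?f ?Y" .
    show ?thesis
    proof (intro exI[of _ qs] exI[of _ ?f] conjI allI)
      show "length qs \<le> k" using ar unfolding c1q by simp
      show "accepts M Y xs \<longleftrightarrow> ?f ?Y" by (rule a)
      show "(\<exists>z'. (zx M False X ^^ t) (start M, [], xs, [[]]) z' \<and> CB M X t S v z') \<longleftrightarrow> length S = length qs \<and> ?f S = v" for S v
        unfolding CC c1q CBc.simps f if_P[OF True] by (rule refl)
      show "(\<exists>z'. (zx M False X ^^ t) (start M, [], xs, [[]]) z' \<and> VB M Y S z') \<longleftrightarrow> le S ?Y" for S
        unfolding VV c1q VBc.simps if_P[OF True] le_def list_all2_map2 by (rule refl)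
    qed
  qed
qed

text \<open>A query is written one symbol per step, so its length is bounded by the halting time.
  This keeps the polynomial running time of \<open>N\<close> on it within the class.\<close>

lemma zx_query_length:
  assumes wf: "wf_otm M" and h: "halts_within M Y T xs"
    and z: "(zx M False X ^^ t) (start M, [], xs, [[]]) (q, L, R, qs)" and u: "u \<in> set qs"
  shows "length u \<le> T"
proof -
  let ?Q = "\<lambda>c :: cfg. u \<in> set (snd (snd (snd c)))"
  have "(\<exists>z'. (zx M False X ^^ t) (start M, [], xs, [[]]) z' \<and> u \<in> set (snd (snd (snd z'))))
     \<longleftrightarrow> (\<exists>c'. (tot (stepm M False X) ^^ t) (init_cfg M xs) c' \<and> ?Q c')"
  proof (rule zsim_iff[OF wf zrel_init])
    show "u \<in> set (snd (snd (snd z'))) \<longleftrightarrow> ?Q c'" if "zrel z' c'" for z' c'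
      using that by (cases z'; cases c') auto
  qed
  moreover have "\<exists>z'. (zx M False X ^^ t) (start M, [], xs, [[]]) z' \<and> u \<in> set (snd (snd (snd z')))"
    by (rule exI[of _ "(q, L, R, qs)"]) (use z u in simp)
  ultimately obtain c where c: "(tot (stepm M False Y) ^^ t) (init_cfg M xs) c" "?Q c"
    unfolding stepm_False[of M X Y] by metis
  obtain n where n: "(stepm M False Y ^^ n) (init_cfg M xs) c" using tot_relpow[OF c(1)] by metis
  have "(step M Y ^^ n) (init_cfg M xs) c"
    using n
  proof (induction n arbitrary: c)
    case (Suc n)
    obtain b where "(stepm M False Y ^^ n) (init_cfg M xs) b" "stepm M False Y b c" using relpowp_Suc_E[OF Suc.prems] by metis
    then show ?case using Suc.IH unfolding stepm_def by (meson relpowp_Suc_I)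
  qed simp
  then show ?thesis using query_length halts_length[OF h] c(2) by (meson order_trans)
qed


subsection \<open>Guessing a chain\<close>

text \<open>With \<open>k\<close> constant there are finitely many monotone chains, so guessing one
  is a choice among constants of the program. The vectors have length at most \<open>k\<close>, not
  exactly \<open>k\<close>, because the number of queries depends on the input.\<close>

definition chains :: "nat \<Rightarrow> nat \<Rightarrow> bool list list list" where
  "chains k z = (SOME xs. set xs = {Ss. length Ss = z \<and> set Ss \<subseteq> {S. length S \<le> k} \<and> mono_chain Ss})"

lemma set_chains: "set (chains k z) = {Ss. length Ss = z \<and> set Ss \<subseteq> {S. length S \<le> k} \<and> mono_chain Ss}"
proof -
  have f: "finite {S :: bool list. length S \<le> k}" using finite_lists_length_le[of "UNIV :: bool set" k] by simp
  have "finite {Ss. length Ss = z \<and> set Ss \<subseteq> {S :: bool list. length S \<le> k} \<and> mono_chain Ss}"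
    by (rule finite_subset[OF _ finite_lists_length_eq[OF f, of z]]) auto
  then show ?thesis unfolding chains_def by (rule someI_ex[OF finite_list])
qed

context
  fixes cl :: com and M N :: otm and flip :: bool and k :: nat
begin

text \<open>\<open>r\<close> is the position in the chain, whose parity prescribes the value of the
  function there; \<open>flip\<close> asks for chains of the negated function instead.\<close>

fun chainc :: "nat \<Rightarrow> bool list list \<Rightarrow> bool list \<Rightarrow> com" where
  "chainc r [] l = verify cl M N l"
| "chainc r (S # Ss) l = Seq (runS cl M S (even r \<noteq> flip)) (chainc (Suc r) Ss l)"

definition guess :: "nat \<Rightarrow> com" where
  "guess z = Ors (map (\<lambda>Ss. chainc 0 Ss (last Ss)) (chains k z))"

text \<open>The digits of \<open>z\<close> are collected in the finite control, which is possible
  because longer codes are already rejected while loading. They come last digit first, so consing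
  restores their order, and after \<open>j\<close> digits the next symbol is the separator.\<close>

primrec readz :: "(bool list \<Rightarrow> com) \<Rightarrow> nat \<Rightarrow> bool list \<Rightarrow> com" where
  "readz P 0 bs = Pop 0 (\<lambda>_. P bs)"
| "readz P (Suc j) bs = Pop 0 (\<lambda>x. if x = Some 3 then P bs else readz P j ((x = Some 2) # bs))"

definition pz :: "bool list \<Rightarrow> com" where
  "pz bs = (case find (\<lambda>z. bin z = bs) [1..<Suc (Suc k)] of None \<Rightarrow> Halt False | Some z \<Rightarrow> guess z)"

definition prog4 :: com where
  "prog4 = readz pz (Suc (Suc k)) []"

lemma go_readz: "S 0 = rev (enc v) @ 3 # r \<Longrightarrow> length v \<le> j \<Longrightarrow>
   Gs X (length v + 1) (readz P j bs # ks, S, q) (P (v @ bs) # ks, S(0 := r), q)"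
proof (induction v arbitrary: S j bs rule: rev_induct)
  case Nil
  have "Gs X (Suc 0) (readz P j bs # ks, S, q) (P ([] @ bs) # ks, S(0 := r), q)"
    by (cases j) (use Nil in \<open>auto intro!: go_Pop simp: enc_def\<close>)
  then show ?case by simp
next
  case (snoc b v)
  obtain i where j: "j = Suc i" "length v \<le> i" using snoc.prems(2) by (cases j) auto
  have S0: "S 0 = sym_of_bit b # rev (enc v) @ 3 # r" using snoc.prems(1) by (simp add: enc_def)
  have b: "Some (sym_of_bit b) \<noteq> Some 3" "(Some (sym_of_bit b) = Some 2) = b" by (simp_all add: sym_of_bit_def)
  have "Gs X (length v + 1) (readz P i (b # bs) # ks, S(0 := rev (enc v) @ 3 # r), q) (P (v @ b # bs) # ks, S(0 := rev (enc v) @ 3 # r, 0 := r), q)"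
    by (rule snoc.IH) (use j in simp_all)
  then have g: "Gs X (length v + 1) (readz P i (b # bs) # ks, S(0 := rev (enc v) @ 3 # r), q) (P ((v @ [b]) @ bs) # ks, S(0 := r), q)"
    by simp
  have "Gs X (Suc (length v + 1)) (readz P j bs # ks, S, q) (P ((v @ [b]) @ bs) # ks, S(0 := r), q)"
    unfolding j readz.simps by (rule go_Pop, unfold S0 hdo_simps list.sel(3) if_not_P[OF b(1)] b(2)) (rule g)
  then show ?case by (rule af_mono) simp
qed

text \<open>Evaluating the digits inverts \<open>bin\<close>, whence its injectivity;
  \<open>pz\<close> relies on this to recognise \<open>z\<close> from its code.\<close>

lemma bin_value: "foldl (\<lambda>a b. 2 * a + of_bool b) 0 (bin z) = z"
proof (induction z rule: bin.induct)
  case (1 z)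
  show ?case
  proof (cases "z < 2")
    case True
    then show ?thesis by (auto simp: bin.simps[of z])
  next
    case False
    then have "bin z = bin (z div 2) @ [odd z]" by (simp add: bin.simps[of z])
    moreover have "2 * (z div 2) + of_bool (odd z) = z" using mult_div_mod_eq[of 2 z] unfolding mod_2_eq_odd .
    ultimately show ?thesis using 1[OF False] by (simp only: foldl_append foldl_Cons foldl_Nil)
  qed
qed

lemma bin_inj: "bin z = bin z' \<longleftrightarrow> z = z'"
  using bin_value by metis

lemma pz_bin: "pz (bin z) = (if 1 \<le> z \<and> z \<le> Suc k then guess z else Halt False)"
proof (cases "find (\<lambda>z'. bin z' = bin z) [1..<Suc (Suc k)]")
  case None
  then have "z \<notin> set [1..<Suc (Suc k)]" unfolding find_None_iff by blast
  then have "\<not> (1 \<le> z \<and> z \<le> Suc k)" by auto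
  then show ?thesis using None unfolding pz_def by auto
next
  case (Some z')
  then obtain i where i: "i < length [1..<Suc (Suc k)]" "bin ([1..<Suc (Suc k)] ! i) = bin z" "z' = [1..<Suc (Suc k)] ! i"
    unfolding find_Some_iff by metis
  then have "z' = z" using bin_inj by metis
  moreover have "z' \<in> set [1..<Suc (Suc k)]" using i by (metis nth_mem)
  ultimately show ?thesis using Some unfolding pz_def by auto
qed

lemma TS_mono: "l \<le> l' \<Longrightarrow> TS M n t g l \<le> TS M n t g l'"
  by (simp add: TS_def)

definition TG :: "nat \<Rightarrow> nat \<Rightarrow> nat \<Rightarrow> nat" where
  "TG n t g = Suc k * (TS M n t g k + 1) + k * VE N n t g + 2 * (n + 1 + 3 * t) + 20 + TA M n t g"

lemma dec_chainc:
  assumes cl: "unary cl F G" and wf: "wf_otm M" "wf_otm N" and t: "t = F (length w)"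
    and CC: "\<And>S v. (\<exists>z'. (zx M False X ^^ t) (start M, [], enc w, [[]]) z' \<and> CB M X t S v z') \<longleftrightarrow> C S v"
    and VV: "dec X m (verify cl M N l # ks, base w, [[]]) V"
    and len: "\<forall>S \<in> set Ss. length S \<le> k"
  shows "dec X (m + length Ss * (TS M (length w) t (G (length w)) k + 1)) (chainc r Ss l # ks, base w, [[]])
     ((\<forall>j < length Ss. C (Ss ! j) (even (r + j) \<noteq> flip)) \<and> V)"
  using len
proof (induction Ss arbitrary: r)
  case Nil
  then show ?case using VV by simp
next
  case (Cons S Ss)
  let ?T = "TS M (length w) t (G (length w))"
  have ih: "dec X (m + length Ss * (?T k + 1)) (chainc (Suc r) Ss l # ks, base w, [[]])
     ((\<forall>j < length Ss. C (Ss ! j) (even (Suc r + j) \<noteq> flip)) \<and> V)"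
    by (rule Cons.IH) (use Cons.prems in simp)
  have d: "dec X (m + length Ss * (?T k + 1) + ?T (length S)) (runS cl M S (even r \<noteq> flip) # chainc (Suc r) Ss l # ks, base w, [[]])
     (C S (even r \<noteq> flip) \<and> ((\<forall>j < length Ss. C (Ss ! j) (even (Suc r + j) \<noteq> flip)) \<and> V))"
    using dec_runS[OF cl wf(1) t ih, of S "even r \<noteq> flip"] unfolding CC .
  have g: "Gs X (Suc 0) (chainc r (S # Ss) l # ks, base w, [[]]) (runS cl M S (even r \<noteq> flip) # chainc (Suc r) Ss l # ks, base w, [[]])"
    unfolding chainc.simps by (rule go_Seq, rule go_refl)
  have eq: "(C S (even r \<noteq> flip) \<and> ((\<forall>j < length Ss. C (Ss ! j) (even (Suc r + j) \<noteq> flip)) \<and> V))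
     = ((\<forall>j < length (S # Ss). C ((S # Ss) ! j) (even (r + j) \<noteq> flip)) \<and> V)"
    by (auto simp: less_Suc_eq_0_disj)
  have "?T (length S) \<le> ?T k" by (rule TS_mono) (use Cons.prems in simp)
  then show ?case by (intro dec_goE[OF d[unfolded eq] g]) simp
qed

lemma dec_prog4:
  assumes cl: "unary cl F G" and wf: "wf_otm M" "wf_otm N" and t: "t = F (length w)"
    and CC: "\<And>S v. (\<exists>z'. (zx M False X ^^ t) (start M, [], enc w, [[]]) z' \<and> CB M X t S v z') \<longleftrightarrow> length S = length us \<and> f S = v"
    and VV: "\<And>S. (\<exists>z'. (zx M False X ^^ t) (start M, [], enc w, [[]]) z' \<and> VB M Y S z') \<longleftrightarrow> le S (map (\<lambda>u. u \<in> Y) us)"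
    and Y: "\<And>L R qs u. (zx M False X ^^ t) (start M, [], enc w, [[]]) (ask M, L, R, qs) \<Longrightarrow> u \<in> set qs \<Longrightarrow>
       (\<exists>T \<le> t. halts_within N X T (enc u)) \<and> (u \<in> Y \<longleftrightarrow> accepts N X (enc u))"
    and us: "length us \<le> k" and z: "length (bin z) \<le> Suc (Suc k)"
  shows "dec X (TG (length w) t (G (length w)) + (\<Sum>z \<le> Suc k. length (chains k z)) + k + 10) ([prog4], S0 (enc_pair w z), [[]])
     (1 \<le> z \<and> z \<le> Suc k \<and> has_chain (\<lambda>S. f S \<noteq> flip) (map (\<lambda>u. u \<in> Y) us) z)"
proof -
  let ?n = "length w" and ?Y = "map (\<lambda>u. u \<in> Y) us"
  let ?g = "G ?n"
  let ?TG = "TG ?n t ?g"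
  let ?h = "\<lambda>S. f S \<noteq> flip"
  have S0: "S0 (enc_pair w z) 0 = rev (enc (bin z)) @ 3 # rev (enc w)" by (simp add: S0_def enc_pair_def)
  have e: "(S0 (enc_pair w z))(0 := rev (enc w)) = base w" by (auto simp: S0_def base_def fun_eq_iff fun_upd_apply)
  have g: "Gs X (length (bin z) + 1) ([prog4], S0 (enc_pair w z), [[]]) (pz (bin z) # [], base w, [[]])"
    using go_readz[where S = "S0 (enc_pair w z)" and v = "bin z" and r = "rev (enc w)" and j = "Suc (Suc k)" and P = pz and bs = "[]"
       and X = X and ks = "[]" and q = "[[]]"] S0 z unfolding e prog4_def by simp
  have d: "dec X (?TG + (\<Sum>z \<le> Suc k. length (chains k z))) (pz (bin z) # [], base w, [[]])
     (1 \<le> z \<and> z \<le> Suc k \<and> has_chain ?h ?Y z)"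
  proof (cases "1 \<le> z \<and> z \<le> Suc k")
    case False
    have pzH: "pz (bin z) = Halt False" unfolding pz_bin if_not_P[OF False] by (intro refl)
    have eq: "(1 \<le> z \<and> z \<le> Suc k \<and> has_chain ?h ?Y z) = False" using False by blast
    show ?thesis unfolding pzH eq by (rule dec_Halt)
  next
    case True
    let ?B = "\<lambda>Ss. (\<forall>j < length Ss. length (Ss ! j) = length us \<and> f (Ss ! j) = (even (0 + j) \<noteq> flip)) \<and> le (last Ss) ?Y"
    have dc: "dec X ?TG (chainc 0 Ss (last Ss) # [], base w, [[]]) (?B Ss)" if Ss: "Ss \<in> set (chains k z)" for Ss
    proof -
      have s: "length Ss = z" "\<forall>S \<in> set Ss. length S \<le> k" using Ss unfolding set_chains by auto
      then have ll: "length (last Ss) \<le> k" using True by (metis last_in_set list.size(3) not_one_le_zero)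
      have "dec X (length (last Ss) * VE N ?n t ?g + 2 * (?n + 1 + 3 * t) + 20 + TA M ?n t ?g) (verify cl M N (last Ss) # [], base w, [[]]) (le (last Ss) ?Y)"
        using dec_verify[OF cl wf t, where S = "last Ss" and ks = "[]" and X = X and Y = Y] Y unfolding VV by metis
      then have d: "dec X (length (last Ss) * VE N ?n t ?g + 2 * (?n + 1 + 3 * t) + 20 + TA M ?n t ?g + length Ss * (TS M ?n t ?g k + 1)) (chainc 0 Ss (last Ss) # [], base w, [[]]) (?B Ss)"
        by (rule dec_chainc[OF cl wf t CC _ s(2)])
      have "length (last Ss) * VE N ?n t ?g \<le> k * VE N ?n t ?g" "length Ss * (TS M ?n t ?g k + 1) \<le> Suc k * (TS M ?n t ?g k + 1)"
        using ll s(1) True by (intro mult_le_mono; simp)+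
      then show ?thesis by (intro dec_mono[OF d]) (unfold TG_def, linarith)
    qed
    have ex: "(\<exists>Ss \<in> set (chains k z). ?B Ss) \<longleftrightarrow> has_chain ?h ?Y z"
    proof
      assume "\<exists>Ss \<in> set (chains k z). ?B Ss"
      then obtain Ss where Ss: "Ss \<in> set (chains k z)" "?B Ss" by blast
      then have "length Ss = z" "mono_chain Ss" unfolding set_chains by auto
      moreover have "alternating ?h Ss" using Ss(2) unfolding alternating_def by auto
      moreover have "Ss \<noteq> []" using \<open>length Ss = z\<close> True by auto
      ultimately show "has_chain ?h ?Y z" using Ss(2) unfolding has_chain_def by blast
    next
      assume "has_chain ?h ?Y z"
      then obtain Ss where Ss: "length Ss = z" "Ss \<noteq> []" "mono_chain Ss" "alternating ?h Ss" "le (last Ss) ?Y"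
        unfolding has_chain_def by blast
      \<comment> \<open>Comparable vectors have equal length, so going back from the last one all
        entries have the length of \<open>?Y\<close>. This is the length that \<open>runS\<close>
        tests, and it places the chain in the enumeration.\<close>
      have l: "length (Ss ! j) = length us" if "j < length Ss" for j
      proof -
        have "j \<le> length Ss - 1" using that by simp
        then show ?thesis
        proof (induction j rule: inc_induct)
          case base
          then show ?case using le_length[OF Ss(5)] Ss(2) by (simp add: last_conv_nth)
        next
          case (step i)
          then have "Suc i < length Ss" by simp
          then have "le (Ss ! i) (Ss ! Suc i)" using Ss(3) unfolding mono_chain_def by blast
          then show ?case using le_length step.IH by metis
        qed
      qed
      have "Ss \<in> set (chains k z)" unfolding set_chains using Ss(1,3) l us by (auto simp: in_set_conv_nth)
      moreover have "?B Ss" using l Ss(4,5) unfolding alternating_def by auto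
      ultimately show "\<exists>Ss \<in> set (chains k z). ?B Ss" by blast
    qed
    have "dec X (?TG + length (map (\<lambda>Ss. chainc 0 Ss (last Ss)) (chains k z))) (Ors (map (\<lambda>Ss. chainc 0 Ss (last Ss)) (chains k z)) # [], base w, [[]])
       (\<exists>c \<in> set (map (\<lambda>Ss. chainc 0 Ss (last Ss)) (chains k z)). \<exists>d. (astep X)\<^sup>*\<^sup>* (c # [], base w, [[]]) d \<and> accf d)"
    proof (rule dec_Ors)
      fix c assume "c \<in> set (map (\<lambda>Ss. chainc 0 Ss (last Ss)) (chains k z))"
      then obtain Ss where Ss: "Ss \<in> set (chains k z)" "c = chainc 0 Ss (last Ss)" by auto
      show "dec X ?TG (c # [], base w, [[]]) (\<exists>d. (astep X)\<^sup>*\<^sup>* (c # [], base w, [[]]) d \<and> accf d)"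
        using dc[OF Ss(1)] unfolding dec_def Ss(2) by (intro conjI refl) (elim conjE)
    qed
    moreover have "(\<exists>c \<in> set (map (\<lambda>Ss. chainc 0 Ss (last Ss)) (chains k z)). \<exists>d. (astep X)\<^sup>*\<^sup>* (c # [], base w, [[]]) d \<and> accf d)
       \<longleftrightarrow> (\<exists>Ss \<in> set (chains k z). ?B Ss)"
    proof -
      have "(\<exists>d. (astep X)\<^sup>*\<^sup>* (chainc 0 Ss (last Ss) # [], base w, [[]]) d \<and> accf d) \<longleftrightarrow> ?B Ss" if "Ss \<in> set (chains k z)" for Ss
        using dc[OF that] unfolding dec_def by argo
      then show ?thesis unfolding set_map bex_simps by (rule bex_cong[OF refl])
    qed
    ultimately have dg: "dec X (?TG + length (chains k z)) (guess z # [], base w, [[]]) (has_chain ?h ?Y z)"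
      unfolding guess_def ex by simp
    \<comment> \<open>The number of alternatives is bounded uniformly in \<open>z\<close>, since the
      time bound must not depend on \<open>z\<close>.\<close>
    have "length (chains k z) \<le> (\<Sum>z \<le> Suc k. length (chains k z))" using True by (intro member_le_sum) auto
    then have "dec X (?TG + (\<Sum>z \<le> Suc k. length (chains k z))) (guess z # [], base w, [[]]) (has_chain ?h ?Y z)"
      by (intro dec_mono[OF dg]) simp
    then show ?thesis using True unfolding pz_bin by simp
  qed
  show ?thesis by (rule dec_goE[OF d g]) (use z in simp)
qed

lemma wfc_prog4:
  assumes cl: "unary cl F G" and wf: "wf_otm M" "wf_otm N" and A: "symbound M A" "symbound N A" "10 \<le> K"
  shows "wfc A K j False prog4"
proof -
  have a: "4 \<le> A" "0 < A" "start M < A" "ret M < A" "start N < A" using A unfolding symbound_def by auto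
  have opt: "or0 x < A" if "x \<in> opts A" for x using that a(2) unfolding opts_def or0_def by auto
  have sb: "sym_of_bit b < A" for b using a(1) by (simp add: sym_of_bit_def)
  have mk: "wfc A K j False (mkclock cl)" by (rule wfc_mkclock[OF cl a(1) A(3)])
  have sM: "wfc A K j False (sim M False)" and sN: "wfc A K j False (sim N True)"
    by (rule wfc_sim[OF A(1,3) wf(1)], rule wfc_sim[OF A(2,3) wf(2)])
  have rA: "wfc A K j False (runA cl M)"
    using A(3) a mk sM by (auto simp: runA_def load_def intro!: wfc_copyloop wfc_mv)
  have cu: "wfc A K j False cleanup" using A(3) by (auto simp: cleanup_def intro!: wfc_clear)
  have sk: "wfc A K j False skipq" "wfc A K j False getq" using A(3) opt by (auto simp: skipq_def getq_def)
  have ap: "wfc A K j False (appl bs)" for bs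
    by (induction bs) (use A(3) a opt sb sk in \<open>auto intro!: wfc_mv\<close>)
  have rS: "wfc A K j False (runS cl M S v)" for S v
    using A(3) a rA ap mk sM cu by (auto simp: runS_def)
  have v: "wfc A K j False (vq cl N bs)" for bs
    by (induction bs) (use A(3) a opt sk mk sN in \<open>auto intro!: wfc_mv wfc_clear\<close>)
  have ve: "wfc A K j False (verify cl M N S)" for S
    using A(3) rA v by (auto simp: verify_def intro!: wfc_clear)
  have ch: "wfc A K j False (chainc r Ss l)" for r Ss l
    by (induction r Ss l rule: chainc.induct) (use ve rS in auto)
  have gu: "wfc A K j False (guess z)" for z unfolding guess_def by (rule wfc_Ors) (use ch in auto)
  have p: "wfc A K j False (pz bs)" for bs unfolding pz_def using gu by (auto split: option.split)
  have "wfc A K j False (readz pz i bs)" for i bs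
    by (induction i arbitrary: bs) (use p A(3) in auto)
  then show ?thesis unfolding prog4_def .
qed

end

text \<open>Chains of the negated function show the complement of \<open>L\<close> to be on the same
  level, so \<open>flip\<close> covers the class and its co-class by one construction.\<close>

lemma ExpPar_in_hausdorff:
  assumes L: "L \<in> ExpPar i c k"
  shows "{w. w \<in> L \<longleftrightarrow> \<not> flip} \<in> HausdorffH (\<lambda>_. Suc k) (NExpPredClass i c)"
proof -
  obtain Y M kk a where M: "Y \<in> SigmaP (Suc c)" "kk \<ge> 1" "wf_otm M" "deterministic M" "\<And>w. one_round M Y k (enc w)"
      "decides_lang M Y (\<lambda>n. a * expi i (n ^ kk) + a) L"
    using L unfolding ExpPar_def by blast
  obtain X N ll b where N: "X \<in> SigmaP c" "ll \<ge> 1" "wf_otm N" "decides_lang N X (\<lambda>n. b * n ^ ll + b) Y"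
    using M(1) unfolding SigmaP.simps by blast
  let ?T = "\<lambda>n. a * expi i (n ^ kk) + a"
  have bT: "bnd i ?T" by (rule bnd_class[OF M(2)])
  \<comment> \<open>One clock serves both simulations: \<open>M\<close> runs for at most
    \<open>?T n\<close> steps, and \<open>N\<close> runs on queries of length at most
    \<open>?T n\<close>.\<close>
  have "bnd i (\<lambda>n. ?T n + (b * ?T n ^ ll + b))" by (intro bnd_add[OF bT] bnd_add bnd_mult bnd_pow bnd_const bT)
  then obtain cl F G where cl: "unary cl F G" "\<And>n. ?T n + (b * ?T n ^ ll + b) \<le> F n" "bnd i F" "bnd i G"
    using clock_exists by blast
  obtain A1 A2 where A12: "symbound M A1" "symbound N A2" using symbound_ex M(3) N(3) by meson
  let ?A = "max A1 A2"
  have A: "symbound M ?A" "symbound N ?A" using A12 by (auto intro: symbound_mono)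
  have A4: "4 \<le> ?A" using A(1) unfolding symbound_def by blast
  let ?P = "prog4 cl M N flip k"
  \<comment> \<open>By \<open>length_bin\<close> every \<open>z \<le> Suc k\<close> has a code of at
    most this length, so a longer code belongs to a number at which the predicate is false
    anyway.\<close>
  let ?B = "Suc (Suc k)"
  obtain H where H: "wf_otm H"
    "\<And>X w z n b. length (bin z) \<le> ?B \<Longrightarrow> dec X n ([?P], S0 (enc_pair w z), [[]]) b \<Longrightarrow>
          halts_within H X (2 * (length w + ?B + 1) + 3 + n * (2 * (Suc (length w + ?B + 1) + n) + 10)) (enc_pair w z)
          \<and> (accepts H X (enc_pair w z) \<longleftrightarrow> b)"
    "\<And>X w z. ?B < length (bin z) \<Longrightarrow> halts_within H X (length w + ?B + 2) (enc_pair w z) \<and> \<not> accepts H X (enc_pair w z)"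
    using compile[OF A4 _ wfc_prog4[OF cl(1) M(3) N(3) A, where K = 10 and flip = flip and k = k and j = 0], where B = ?B] by auto
  define Q where "Q = (\<lambda>w us f. length us \<le> k \<and> (accepts M Y (enc w) \<longleftrightarrow> f (map (\<lambda>u. u \<in> Y) us))
     \<and> (\<forall>S v. (\<exists>z'. (zx M False X ^^ F (length w)) (start M, [], enc w, [[]]) z' \<and> CB M X (F (length w)) S v z') \<longleftrightarrow> length S = length us \<and> f S = v)
     \<and> (\<forall>S. (\<exists>z'. (zx M False X ^^ F (length w)) (start M, [], enc w, [[]]) z' \<and> VB M Y S z') \<longleftrightarrow> le S (map (\<lambda>u. u \<in> Y) us)))"
  have sem: "\<exists>us f. Q w us f" for w
    unfolding Q_def
    by (rule one_round_semantics[OF M(3,4,5), of "?T (length w)"])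
       (use M(6) cl(2)[of "length w"] in \<open>auto simp: decides_lang_def\<close>)
  define us where "us = (\<lambda>w. SOME us. \<exists>f. Q w us f)"
  define f where "f = (\<lambda>w. SOME f. Q w (us w) f)"
  have exf: "\<exists>f. Q w (us w) f" for w
    using someI_ex[OF sem[of w]] unfolding us_def .
  have Q: "Q w (us w) (f w)" for w
    using someI_ex[OF exf[of w]] unfolding f_def .
  note Q' = Q[unfolded Q_def]
  note sm1 = Q'[THEN conjunct1] and sm2 = Q'[THEN conjunct2, THEN conjunct1]
    and sm3 = Q'[THEN conjunct2, THEN conjunct2, THEN conjunct1, rule_format]
    and sm4 = Q'[THEN conjunct2, THEN conjunct2, THEN conjunct2, rule_format]
  have hM: "halts_within M Y (?T (length w)) (enc w)" for w using M(6) unfolding decides_lang_def by blast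
  have qY: "(\<exists>T \<le> F (length w). halts_within N X T (enc u)) \<and> (u \<in> Y \<longleftrightarrow> accepts N X (enc u))"
    if zz: "(zx M False X ^^ F (length w)) (start M, [], enc w, [[]]) (ask M, L, R, qs)" "u \<in> set qs" for w L R qs u
  proof -
    have u: "length u \<le> ?T (length w)" by (rule zx_query_length[OF M(3) hM zz])
    have hN: "halts_within N X (b * length u ^ ll + b) (enc u) \<and> (u \<in> Y \<longleftrightarrow> accepts N X (enc u))"
      using N(4) unfolding decides_lang_def by blast
    have "b * length u ^ ll + b \<le> b * ?T (length w) ^ ll + b" using u by (intro add_mono mult_le_mono power_mono) auto
    also have "\<dots> \<le> F (length w)" using cl(2)[of "length w"] by linarith
    finally show ?thesis using hN by blast
  qed
  let ?h = "\<lambda>w S. f w S \<noteq> flip"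
  let ?Y = "\<lambda>w. map (\<lambda>u. u \<in> Y) (us w)"
  \<comment> \<open>The cutoff at \<open>Suc k\<close> makes the rejection of long codes correct,
    and it preserves downward closure above 0.\<close>
  let ?D = "\<lambda>w z. 1 \<le> z \<and> z \<le> Suc k \<and> has_chain (?h w) (?Y w) z"
  let ?t = "\<lambda>n. TG M N k n (F n) (G n) + (\<Sum>z \<le> Suc k. length (chains k z)) + k + 10"
  let ?Z = "\<lambda>n. 2 * (n + ?B + 1) + 3 + ?t n * (2 * (Suc (n + ?B + 1) + ?t n) + 10)"
  have "bnd i ?Z" unfolding TG_def TS_def TA_def VE_def by (intro bnd_intros cl(3,4))
  then obtain kk' a' where ka: "kk' \<ge> 1" "\<And>n. ?Z n \<le> a' * expi i (n ^ kk') + a'" using bnd_official by blast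
  have dd: "halts_within H X (?Z (length w)) (enc_pair w z) \<and> (?D w z \<longleftrightarrow> accepts H X (enc_pair w z))" for w z
  proof (cases "length (bin z) \<le> ?B")
    case True
    have "dec X (?t (length w)) ([?P], S0 (enc_pair w z), [[]]) (?D w z)"
      by (rule dec_prog4[OF cl(1) M(3) N(3) refl sm3 sm4 qY sm1 True])
    from H(2)[OF True this] show ?thesis by simp
  next
    case False
    then have l: "?B < length (bin z)" by simp
    have "\<not> z \<le> Suc k" using length_bin[of z] l by simp
    moreover have "halts_within H X (?Z (length w)) (enc_pair w z)"
      by (rule halts_mono[OF conjunct1[OF H(3)[OF l]]]) simp
    ultimately show ?thesis using H(3)[OF l] by blast
  qed
  have "decides_pred H X (\<lambda>n. a' * expi i (n ^ kk') + a') ?D"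
    unfolding decides_pred_def using dd halts_mono[OF _ ka(2)] by blast
  then have D: "?D \<in> NExpPredClass i c" unfolding NExpPredClass_def using N(1) ka(1) H(1) by blast
  have hd: "hausdorff_pred ?D" unfolding hausdorff_pred_def using chain_antimono by auto
  have "w \<in> {w. w \<in> L \<longleftrightarrow> \<not> flip} \<longleftrightarrow> odd (card {z. 1 \<le> z \<and> z \<le> Suc k \<and> ?D w z})" for w
  proof -
    have "{z. 1 \<le> z \<and> z \<le> Suc k \<and> ?D w z} = {z. 1 \<le> z \<and> z \<le> Suc k \<and> has_chain (?h w) (?Y w) z}" by blast
    moreover have "odd (card {z. 1 \<le> z \<and> z \<le> Suc k \<and> has_chain (?h w) (?Y w) z}) \<longleftrightarrow> ?h w (?Y w)"
      by (rule chain_parity) (use sm1 in simp)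
    moreover have "w \<in> L \<longleftrightarrow> f w (?Y w)" using M(6) sm2 unfolding decides_lang_def by blast
    ultimately show ?thesis by auto
  qed
  then show ?thesis unfolding HausdorffH_def using D hd by blast
qed

theorem mainTheorem8:
  fixes i k c :: nat
  assumes "k \<ge> 1"
  shows "HausdorffH (\<lambda>_. k) (NExpPredClass i c) \<union> coHausdorffH (\<lambda>_. k) (NExpPredClass i c)
           \<subseteq> ExpPar i c k
       \<and> ExpPar i c k
           \<subseteq> HausdorffH (\<lambda>_. Suc k) (NExpPredClass i c) \<inter> coHausdorffH (\<lambda>_. Suc k) (NExpPredClass i c)"
proof
  show "HausdorffH (\<lambda>_. k) (NExpPredClass i c) \<union> coHausdorffH (\<lambda>_. k) (NExpPredClass i c) \<subseteq> ExpPar i c k"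
    by (rule first_inclusion[OF assms])
  show "ExpPar i c k \<subseteq> HausdorffH (\<lambda>_. Suc k) (NExpPredClass i c) \<inter> coHausdorffH (\<lambda>_. Suc k) (NExpPredClass i c)"
  proof
    fix L assume L: "L \<in> ExpPar i c k"
    have "{w. w \<in> L \<longleftrightarrow> \<not> False} = L" "{w. w \<in> L \<longleftrightarrow> \<not> True} = - L" by auto
    then show "L \<in> HausdorffH (\<lambda>_. Suc k) (NExpPredClass i c) \<inter> coHausdorffH (\<lambda>_. Suc k) (NExpPredClass i c)"
      using ExpPar_in_hausdorff[OF L, of False] ExpPar_in_hausdorff[OF L, of True] unfolding coHausdorffH_def by simp
  qed
qed

end
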